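(* Let $\mathbb R\overline{\mathcal M}_{0,3}$ denote $\overline{\mathcal M}_{0,3}^{\tau}$, $\overline{\mathcal M}_{0,3}^{\eta}$, or $\overline{\mathcal M}_{0,3}^{\mathbb R}$. The (oriented) submanifolds $\Gamma_1,\Gamma_{\bar1},\Gamma_2,\Gamma_{\bar2}$ of $\mathbb R\overline{\mathcal M}_{0,3}$ determine relative cycles in $(\mathbb R\overline{\mathcal M}_{0,3},\partial\mathbb R\overline{\mathcal M}_{0,3})$ and $$[\Gamma_1]+[\Gamma_{\bar1}]=[\Gamma_2]+[\Gamma_{\bar2}]\in H_1\big(\mathbb R\overline{\mathcal M}_{0,3},\partial\mathbb R\overline{\mathcal M}_{0,3};\mathbb Q\big).$$
   Context: **Moduli spaces of real curves.** On $\mathbb P^1$ let $\tau(z)=1/\bar z$, $\eta(z)=-1/\bar z$. For $c=\tau,\eta$ and $k\in\mathbb Z^+$, $\overline{\mathcal M}_{0,k+1}^c$ is the Deligne–Mumford moduli space of stable $c$-real genus $0$ curves with $k+1$ conjugate pairs of marked points $(z_i^+,z_i^-)$ indexed by $i=0,1,\ldots,k$; its main stratum is the quotient of $\{((z_0^+,z_0^-),\ldots,(z_k^+,z_k^-)): z_i^\pm\in\mathbb P^1,\ z_i^+=c(z_i^-),\ z_i^+\ne z_i^-,\ z_i^+\ne z_j^\pm\ \forall i\ne j\}$ by the automorphisms of $\mathbb P^1$ commuting with $c$. It is a $(2k-1)$-dimensional manifold; $\overline{\mathcal M}_{0,k+1}^\tau$ and $\overline{\mathcal M}_{0,k+1}^\eta$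 have the same boundary, consisting of the curves with no irreducible component fixed by the involution. $\overline{\mathcal M}_{0,k+1}^{\mathbb R}$ is obtained by gluing the two along the common boundary; it has no boundary. $\mathbb R\overline{\mathcal M}_{0,k+1}$ denotes any one of the three. **Orientations of $\mathbb R\overline{\mathcal M}_{0,2}$.** $\overline{\mathcal M}_{0,2}^c$ is an interval, oriented so that the diffeomorphism to $[0,\infty]$ given by $[(z_0^+,z_0^-),(z_1^+,z_1^-)]\mapsto(-1)^c\frac{z_1^+-z_0^+}{z_1^--z_0^+}:\frac{z_1^+-z_0^-}{z_1^--z_0^-}$, with $(-1)^\tau=1$, $(-1)^\eta=-1$, is orientation-preserving. $\overline{\mathcal M}_{0,2}^{\mathbb R}$ (a circle) is oriented by the orientation of $\overline{\mathcal M}_{0,2}^\tau$ and the reverse of the orientation of $\overline{\mathcal M}_{0,2}^\eta$. **The submanifolds.** For $i=1,2$, $\Gamma_i\subset\mathbb R\overline{\mathcal M}_{0,3}$ (resp. $\Gamma_{\bar i}$) is the closure of the set of three-component real curves $(\mathcal C,c)$ such that $z_i^+$ (resp. $z_i^-$) lies on the same component as $z_0^+$. Such a curve has a component $\mathcal C^{\mathbb R}$ preserved by the involution, containing the pair $(z_{3-i}^+,z_{3-i}^-)$ and a conjugate pair of nodes $(z_\bullet^+,z_\bullet^-)$, and a pair of conjugate components, of which $\mathcal C^{\mathbb C}$ contains $z_0^+$ and $z_i^+$ (resp. $z_i^-$) and is attached at $z_\bullet^+$. Recording $\mathcal C^{\mathbb R}$ with the pairs $(z_\bullet^+,z_\bullet^-)$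 and $(z_{3-i}^+,z_{3-i}^-)$ (as pairs number $0$ and $1$) gives an isomorphism of $\Gamma_i$ and of $\Gamma_{\bar i}$ with $\mathbb R\overline{\mathcal M}_{0,2}$. $\Gamma_i$ is oriented by this isomorphism, and $\Gamma_{\bar i}$ is given the opposite of the orientation induced by this isomorphism. *)

theory Defs
  imports "HOL-Analysis.Analysis" "HOL-Homology.Homology"
begin

section \<open>The Riemann sphere\<close>

type_synonym csphere = "complex option"  \<comment> \<open>\<^term>\<open>None\<close> is the point at infinity\<close>

abbreviation csphere_top :: "csphere topology" where
  "csphere_top \<equiv> Alexandroff_compactification euclidean"

text \<open>The point with homogeneous coordinates \<open>[x : y]\<close>, that is, \<open>x / y\<close>.\<close>
definition proj_pt :: "complex \<Rightarrow> complex \<Rightarrow> csphere" where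
  "proj_pt x y = (if y = 0 then None else Some (x / y))"

definition mobius_map :: "complex \<Rightarrow> complex \<Rightarrow> complex \<Rightarrow> complex \<Rightarrow> csphere \<Rightarrow> csphere" where
  "mobius_map a b c d p =
     (case p of None \<Rightarrow> proj_pt a c | Some z \<Rightarrow> proj_pt (a * z + b) (c * z + d))"

definition mobius :: "(csphere \<Rightarrow> csphere) \<Rightarrow> bool" where
  "mobius g \<longleftrightarrow> (\<exists>a b c d. a * d - b * c \<noteq> 0 \<and> g = mobius_map a b c d)"

definition antimobius :: "(csphere \<Rightarrow> csphere) \<Rightarrow> bool" where
  "antimobius g \<longleftrightarrow> (\<exists>h. mobius h \<and> g = h \<circ> map_option cnj)"

datatype invol = Tau | Eta

text \<open>\<open>(-1)\<^sup>c\<close>; the two involutions are \<open>z \<mapsto> (-1)\<^sup>c / cnj z\<close>.\<close>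
fun inv_sign :: "invol \<Rightarrow> complex" where
  "inv_sign Tau = 1"
| "inv_sign Eta = - 1"

definition std_inv :: "invol \<Rightarrow> csphere \<Rightarrow> csphere" where
  "std_inv c p = (case p of None \<Rightarrow> Some 0 | Some z \<Rightarrow> proj_pt (inv_sign c) (cnj z))"

fun hom_coords :: "csphere \<Rightarrow> complex \<times> complex" where
  "hom_coords None = (1, 0)"
| "hom_coords (Some z) = (z, 1)"

definition hdiff :: "csphere \<Rightarrow> csphere \<Rightarrow> complex" where
  "hdiff p q = fst (hom_coords p) * snd (hom_coords q) - fst (hom_coords q) * snd (hom_coords p)"

text \<open>
  The cross-ratio \<open>(x - y) / (z - y) : (x - w) / (z - w)\<close>. It makes sense as long as no three of
  the four points coincide.
\<close>
definition cross_ratio :: "csphere \<Rightarrow> csphere \<Rightarrow> csphere \<Rightarrow> csphere \<Rightarrow> csphere" where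
  "cross_ratio x y z w = proj_pt (hdiff x y * hdiff z w) (hdiff z y * hdiff x w)"

section \<open>Stable real curves of genus 0\<close>

text \<open>
  The label \<open>(i, True)\<close> stands for the marked point \<open>z\<^sub>i\<^sup>+\<close> and \<open>(i, False)\<close> for \<open>z\<^sub>i\<^sup>-\<close>.
\<close>
type_synonym label = "nat \<times> bool"

definition labels :: "nat \<Rightarrow> label set" where
  "labels k = {..k} \<times> UNIV"

text \<open>
  A nodal curve of genus 0 is a tree of spheres: \<open>node C \<alpha> \<beta>\<close> is the point of the component \<open>\<alpha>\<close>
  at which the adjacent component \<open>\<beta>\<close> is attached. The marked point \<open>l\<close> is the point \<open>mpt C l\<close> of
  the component \<open>mcomp C l\<close>. The involution sends the point \<open>z\<close> of the component \<open>\<alpha>\<close> to the point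
  \<open>imap C \<alpha> z\<close> of the component \<open>icomp C \<alpha>\<close>.
\<close>
record rcurve =
  comps :: "nat set"
  adj :: "(nat \<times> nat) set"
  node :: "nat \<Rightarrow> nat \<Rightarrow> csphere"
  mcomp :: "label \<Rightarrow> nat"
  mpt :: "label \<Rightarrow> csphere"
  icomp :: "nat \<Rightarrow> nat"
  imap :: "nat \<Rightarrow> csphere \<Rightarrow> csphere"

definition tree_path :: "rcurve \<Rightarrow> nat \<Rightarrow> nat list \<Rightarrow> nat \<Rightarrow> bool" where
  "tree_path C \<alpha> xs \<beta> \<longleftrightarrow>
     xs \<noteq> [] \<and> hd xs = \<alpha> \<and> last xs = \<beta> \<and> distinct xs \<and> set xs \<subseteq> comps C \<and>
     successively (\<lambda>x y. (x, y) \<in> adj C) xs"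

definition is_tree :: "rcurve \<Rightarrow> bool" where
  "is_tree C \<longleftrightarrow>
     finite (comps C) \<and> comps C \<noteq> {} \<and> adj C \<subseteq> comps C \<times> comps C \<and>
     sym (adj C) \<and> irrefl (adj C) \<and>
     (\<forall>\<alpha>\<in>comps C. \<forall>\<beta>\<in>comps C. \<exists>!xs. tree_path C \<alpha> xs \<beta>)"

definition marks_on :: "nat \<Rightarrow> rcurve \<Rightarrow> nat \<Rightarrow> label set" where
  "marks_on k C \<alpha> = {l \<in> labels k. mcomp C l = \<alpha>}"

definition stable_curve :: "nat \<Rightarrow> rcurve \<Rightarrow> bool" where
  "stable_curve k C \<longleftrightarrow>
     is_tree C \<and> mcomp C ` labels k \<subseteq> comps C \<and>
     (\<forall>\<alpha>\<in>comps C.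
        inj_on (node C \<alpha>) (adj C `` {\<alpha>}) \<and>
        inj_on (mpt C) (marks_on k C \<alpha>) \<and>
        node C \<alpha> ` (adj C `` {\<alpha>}) \<inter> mpt C ` marks_on k C \<alpha> = {} \<and>
        3 \<le> card (node C \<alpha> ` (adj C `` {\<alpha>}) \<union> mpt C ` marks_on k C \<alpha>))"

definition real_involution :: "nat \<Rightarrow> rcurve \<Rightarrow> bool" where
  "real_involution k C \<longleftrightarrow>
     (\<forall>\<alpha>\<in>comps C. icomp C \<alpha> \<in> comps C \<and> icomp C (icomp C \<alpha>) = \<alpha> \<and>
        antimobius (imap C \<alpha>) \<and> (\<forall>z. imap C (icomp C \<alpha>) (imap C \<alpha> z) = z)) \<and>
     (\<forall>(\<alpha>, \<beta>)\<in>adj C. (icomp C \<alpha>, icomp C \<beta>) \<in> adj C \<and>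
        imap C \<alpha> (node C \<alpha> \<beta>) = node C (icomp C \<alpha>) (icomp C \<beta>)) \<and>
     (\<forall>(i, s)\<in>labels k. icomp C (mcomp C (i, s)) = mcomp C (i, \<not> s) \<and>
        imap C (mcomp C (i, s)) (mpt C (i, s)) = mpt C (i, \<not> s))"

text \<open>Stable real curves with the \<open>k + 1\<close> conjugate pairs of marked points \<open>0, \<dots>, k\<close>.\<close>
definition real_curve :: "nat \<Rightarrow> rcurve \<Rightarrow> bool" where
  "real_curve k C \<longleftrightarrow> stable_curve k C \<and> real_involution k C"

definition no_fixed_comp :: "rcurve \<Rightarrow> bool" where
  "no_fixed_comp C \<longleftrightarrow> (\<forall>\<alpha>\<in>comps C. icomp C \<alpha> \<noteq> \<alpha>)"

text \<open>
  A real curve is \<open>c\<close>-real if the involution is of type \<open>c\<close> on all components it preserves. The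
  curves without such components are thus both \<open>\<tau>\<close>-real and \<open>\<eta>\<close>-real.
\<close>
definition c_real :: "invol \<Rightarrow> rcurve \<Rightarrow> bool" where
  "c_real c C \<longleftrightarrow>
     (\<forall>\<alpha>\<in>comps C. icomp C \<alpha> = \<alpha> \<longrightarrow> (\<exists>g. mobius g \<and> g \<circ> imap C \<alpha> = std_inv c \<circ> g))"

definition real_iso :: "nat \<Rightarrow> (rcurve \<times> rcurve) set" where
  "real_iso k = {(C, D). real_curve k C \<and> real_curve k D \<and>
     (\<exists>f \<phi>. bij_betw f (comps C) (comps D) \<and> (\<forall>\<alpha>\<in>comps C. mobius (\<phi> \<alpha>)) \<and>
        (\<forall>\<alpha>\<in>comps C. \<forall>\<beta>\<in>comps C. (\<alpha>, \<beta>) \<in> adj C \<longleftrightarrow> (f \<alpha>, f \<beta>) \<in> adj D) \<and>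
        (\<forall>(\<alpha>, \<beta>)\<in>adj C. \<phi> \<alpha> (node C \<alpha> \<beta>) = node D (f \<alpha>) (f \<beta>)) \<and>
        (\<forall>l\<in>labels k. f (mcomp C l) = mcomp D l \<and> \<phi> (mcomp C l) (mpt C l) = mpt D l) \<and>
        (\<forall>\<alpha>\<in>comps C. f (icomp C \<alpha>) = icomp D (f \<alpha>) \<and>
           (\<forall>z. \<phi> (icomp C \<alpha>) (imap C \<alpha> z) = imap D (f \<alpha>) (\<phi> \<alpha> z))))}"

section \<open>The moduli spaces\<close>

text \<open>
  The point of the component \<open>\<alpha>\<close> in the direction of the marked point \<open>l\<close>: the marked point itself
  if it lies on \<open>\<alpha>\<close>, and otherwise the node of \<open>\<alpha>\<close> through which it is reached.
\<close>
definition dir_pt :: "rcurve \<Rightarrow> nat \<Rightarrow> label \<Rightarrow> csphere" where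
  "dir_pt C \<alpha> l =
     (if mcomp C l = \<alpha> then mpt C l
      else node C \<alpha> ((THE xs. tree_path C \<alpha> xs (mcomp C l)) ! 1))"

text \<open>
  The cross-ratio of four marked points of a stable curve, computed on any component on which at
  least three of the four directions are distinct. On irreducible curves this is the usual
  cross-ratio of the marked points, and it is the continuous extension of the latter.
\<close>
definition curve_cross_ratio :: "rcurve set \<Rightarrow> label \<Rightarrow> label \<Rightarrow> label \<Rightarrow> label \<Rightarrow> csphere" where
  "curve_cross_ratio X l1 l2 l3 l4 =
     (THE w. \<exists>C\<in>X. \<exists>\<alpha>\<in>comps C. 3 \<le> card (dir_pt C \<alpha> ` {l1, l2, l3, l4}) \<and>
        w = cross_ratio (dir_pt C \<alpha> l1) (dir_pt C \<alpha> l2) (dir_pt C \<alpha> l3) (dir_pt C \<alpha> l4))"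

definition quadruples :: "nat \<Rightarrow> (label \<times> label \<times> label \<times> label) set" where
  "quadruples k = {(l1, l2, l3, l4). {l1, l2, l3, l4} \<subseteq> labels k \<and> distinct [l1, l2, l3, l4]}"

text \<open>
  The Deligne--Mumford topology in genus 0 is the one for which the cross-ratios embed the moduli
  space into a product of spheres (see McDuff and Salamon, J-holomorphic Curves and Symplectic
  Topology, Appendix D).
\<close>
definition real_curve_space :: "nat \<Rightarrow> rcurve set topology" where
  "real_curve_space k =
     pullback_topology (Collect (real_curve k) // real_iso k)
       (\<lambda>X. \<lambda>(l1, l2, l3, l4)\<in>quadruples k. curve_cross_ratio X l1 l2 l3 l4)
       (product_topology (\<lambda>_. csphere_top) (quadruples k))"

definition c_moduli_set :: "invol \<Rightarrow> nat \<Rightarrow> rcurve set set" where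
  "c_moduli_set c k = {C. real_curve k C \<and> c_real c C} // real_iso k"

text \<open>
  The three spaces in question. The sets for \<open>\<tau>\<close> and \<open>\<eta>\<close> meet exactly in their common boundary,
  so their union is the space obtained by gluing them along it.
\<close>
datatype rmoduli = Of invol | Glued

fun RM_set :: "rmoduli \<Rightarrow> nat \<Rightarrow> rcurve set set" where
  "RM_set (Of c) k = c_moduli_set c k"
| "RM_set Glued k = c_moduli_set Tau k \<union> c_moduli_set Eta k"

text \<open>\<open>RM R k\<close> is the moduli space of curves with \<open>k + 1\<close> conjugate pairs of marked points.\<close>
definition RM :: "rmoduli \<Rightarrow> nat \<Rightarrow> rcurve set topology" where
  "RM R k = subtopology (real_curve_space k) (RM_set R k)"

fun RM_boundary :: "rmoduli \<Rightarrow> nat \<Rightarrow> rcurve set set" where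
  "RM_boundary (Of c) k = {C. real_curve k C \<and> no_fixed_comp C} // real_iso k"
| "RM_boundary Glued k = {}"

section \<open>Singular homology with rational coefficients\<close>

text \<open>As in \<^theory>\<open>HOL-Homology.Homology_Groups\<close>, with rational instead of integer chains.\<close>

type_synonym 'a qchain = "((nat \<Rightarrow> real) \<Rightarrow> 'a) \<Rightarrow>\<^sub>0 rat"

definition qchain :: "nat \<Rightarrow> 'a topology \<Rightarrow> 'a qchain \<Rightarrow> bool" where
  "qchain p X c \<longleftrightarrow> Poly_Mapping.keys c \<subseteq> singular_simplex_set p X"

definition qboundary :: "nat \<Rightarrow> 'a qchain \<Rightarrow> 'a qchain" where
  "qboundary p c =
     (if p = 0 then 0 else
      (\<Sum>f\<in>Poly_Mapping.keys c. \<Sum>k\<le>p.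
         Poly_Mapping.single (singular_face p k f) ((- 1) ^ k * Poly_Mapping.lookup c f)))"

definition qrelcycle :: "nat \<Rightarrow> 'a topology \<Rightarrow> 'a set \<Rightarrow> 'a qchain \<Rightarrow> bool" where
  "qrelcycle p X S c \<longleftrightarrow> qchain p X c \<and> qchain (p - 1) (subtopology X S) (qboundary p c)"

definition qrelboundary :: "nat \<Rightarrow> 'a topology \<Rightarrow> 'a set \<Rightarrow> 'a qchain \<Rightarrow> bool" where
  "qrelboundary p X S c \<longleftrightarrow>
     (\<exists>d. qchain (Suc p) X d \<and> qchain p (subtopology X S) (qboundary (Suc p) d - c))"

definition qrelcycle_group :: "nat \<Rightarrow> 'a topology \<Rightarrow> 'a set \<Rightarrow> 'a qchain monoid" where
  "qrelcycle_group p X S = \<lparr>carrier = Collect (qrelcycle p X S), mult = (+), one = 0\<rparr>"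

definition qhomology_group :: "nat \<Rightarrow> 'a topology \<Rightarrow> 'a set \<Rightarrow> 'a qchain set monoid" where
  "qhomology_group p X S = qrelcycle_group p X S Mod Collect (qrelboundary p X S)"

definition qhomology_class :: "nat \<Rightarrow> 'a topology \<Rightarrow> 'a set \<Rightarrow> 'a qchain \<Rightarrow> 'a qchain set" where
  "qhomology_class p X S c = Collect (qrelboundary p X S) #>\<^bsub>qrelcycle_group p X S\<^esub> c"

definition qchain_map :: "nat \<Rightarrow> ('a \<Rightarrow> 'b) \<Rightarrow> 'a qchain \<Rightarrow> 'b qchain" where
  "qchain_map p g c =
     (\<Sum>f\<in>Poly_Mapping.keys c. Poly_Mapping.single (simplex_map p g f) (Poly_Mapping.lookup c f))"

section \<open>Orientations of the one-dimensional moduli spaces\<close>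

text \<open>The homeomorphism onto \<open>[0, \<infinity>]\<close> that defines the orientation for \<open>\<tau>\<close> and for \<open>\<eta>\<close>.\<close>
definition chart2 :: "invol \<Rightarrow> rcurve set \<Rightarrow> csphere" where
  "chart2 c X = map_option ((*) (inv_sign c))
     (curve_cross_ratio X (1, True) (0, True) (1, False) (0, False))"

text \<open>
  The singular 1-simplex that traverses the interval once in the positive direction: the point
  of the simplex with barycentric coordinates \<open>(x 0, x 1)\<close> is sent to the curve with coordinate
  \<open>x 1 / x 0\<close>, which goes from \<open>0\<close> at the initial vertex to \<open>\<infinity>\<close> at the final one.
\<close>
definition fund_simplex :: "invol \<Rightarrow> (nat \<Rightarrow> real) \<Rightarrow> rcurve set" where
  "fund_simplex c =
     (\<lambda>x\<in>standard_simplex 1.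
        inv_into (c_moduli_set c 1) (chart2 c) (proj_pt (of_real (x 1)) (of_real (x 0))))"

text \<open>
  The fundamental cycle. The glued space is a circle, oriented as the interval for \<open>\<tau>\<close> and
  oppositely to the interval for \<open>\<eta>\<close>.
\<close>
fun fund_chain :: "rmoduli \<Rightarrow> rcurve set qchain" where
  "fund_chain (Of c) = Poly_Mapping.single (fund_simplex c) 1"
| "fund_chain Glued =
     Poly_Mapping.single (fund_simplex Tau) 1 - Poly_Mapping.single (fund_simplex Eta) 1"

section \<open>The submanifolds\<close>

text \<open>\<open>Gam R i True\<close> is \<open>\<Gamma>\<^sub>i\<close> and \<open>Gam R i False\<close> is \<open>\<Gamma>\<close> with the index \<open>i\<close> barred.\<close>
definition Gam :: "rmoduli \<Rightarrow> nat \<Rightarrow> bool \<Rightarrow> rcurve set set" where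
  "Gam R i s = RM R 2 closure_of
     {X \<in> RM_set R 2. \<exists>C\<in>X. card (comps C) = 3 \<and> mcomp C (i, s) = mcomp C (0, True)}"

text \<open>
  Applied to curves in \<^term>\<open>Gam R i s\<close>, on which the component \<open>\<gamma>\<close> that carries \<open>z\<^sub>0\<^sup>+\<close> has a single
  node: \<open>\<gamma>\<close> and its conjugate are removed, the point where \<open>\<gamma>\<close> was attached and the conjugate of
  this point become pair number 0, and the pair \<open>3 - i\<close> becomes pair number 1. What remains is the
  component preserved by the involution, or a degeneration of it.
\<close>
definition cut_curve :: "nat \<Rightarrow> rcurve \<Rightarrow> rcurve" where
  "cut_curve i C =
     (let \<gamma> = mcomp C (0, True);
          \<beta> = (THE \<beta>. (\<gamma>, \<beta>) \<in> adj C);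
          V = comps C - {\<gamma>, icomp C \<gamma>}
      in C\<lparr>comps := V,
           adj := adj C \<inter> V \<times> V,
           mcomp := (\<lambda>(j, t). if j = 0 then (if t then \<beta> else icomp C \<beta>) else mcomp C (3 - i, t)),
           mpt := (\<lambda>(j, t). if j = 0
                     then (if t then node C \<beta> \<gamma> else node C (icomp C \<beta>) (icomp C \<gamma>))
                     else mpt C (3 - i, t))\<rparr>)"

text \<open>The isomorphism from \<open>\<Gamma>\<close> onto \<open>RM R 1\<close>, on isomorphism classes.\<close>
definition record_real :: "nat \<Rightarrow> rcurve set \<Rightarrow> rcurve set" where
  "record_real i X = (\<Union>C\<in>X. real_iso 1 `` {cut_curve i C})"

text \<open>
  The fundamental cycle of \<open>\<Gamma>\<close>, transported from \<open>RM R 1\<close>, with the orientation reversed for the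
  barred indices.
\<close>
definition Gam_cycle :: "rmoduli \<Rightarrow> nat \<Rightarrow> bool \<Rightarrow> rcurve set qchain" where
  "Gam_cycle R i s =
     (let c = qchain_map 1 (inv_into (Gam R i s) (record_real i)) (fund_chain R)
      in if s then c else - c)"

definition Gam_class :: "rmoduli \<Rightarrow> nat \<Rightarrow> bool \<Rightarrow> rcurve set qchain set" where
  "Gam_class R i s = qhomology_class 1 (RM R 2) (RM_boundary R 2) (Gam_cycle R i s)"

end

theory Submission
  imports Defs
begin

text \<open>
  The cross-ratios determine a stable real curve up to isomorphism, since components correspond to
  the triples of marked points of which they are the median. Place \<open>z\<^sub>0\<^sup>+\<close> at \<open>0\<close> and \<open>z\<^sub>0\<^sup>-\<close> at infinity and
  consider the curves on which \<open>z\<^sub>1\<^sup>+ = p\<close> and \<open>z\<^sub>2\<^sup>+ = \<omega> q\<close> with \<open>p, q \<in> [0, \<infinity>]\<close> and a phase \<open>\<omega>\<close>. Blowing up the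
  corners of the square turns this family into a continuous map from an octagon to the moduli space.
  The four axis-parallel sides parametrize \<open>\<Gamma>\<^sub>1\<close>, \<open>\<Gamma>\<close> with index \<open>1\<close> barred, \<open>\<Gamma>\<^sub>2\<close> and \<open>\<Gamma>\<close> with index \<open>2\<close> barred, and the
  four oblique sides consist of curves without a component preserved by the involution, that is, of
  boundary points. With a suitable phase for \<open>\<eta>\<close> the maps for \<open>\<tau>\<close> and \<open>\<eta>\<close> agree on the oblique
  sides, so these cancel in the glued space. The boundary of the octagon is the claimed relation.
\<close>

section \<open>Cross-ratios and Moebius transformations\<close>

text \<open>Once z0+ and z0- are fixed, only rotations are left, and they make z1+ = p real. A
  generic curve thus has coordinates p, q and a phase, and prescribing \<omega> cuts a surface out
  of a three-dimensional space. At a corner such as p = q = 0 the limit still depends on q / p,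
  hence the blow-up; the 17 faces of the octagon match the 17 cells of the line arrangement a = 0, b
  = 0, a = b, a = -b, where a and b are the orders of growth of p and q. The surface must avoid z2+
  = z1+ and z2+ = z1-, for only then are all its curves chains of spheres. For \<open>Tau\<close>
  the phase -1 does this. For \<open>Eta\<close> the phase 1 fails at q = p and -1 fails at p q = 1,
  so \<omega> varies: it is 1 only where q / p is 0 or infinite, and -1 only where p q is. The same
  choice matches the signs of the two types on the oblique sides. The collision z_i+ = z_i- does
  occur for \<open>Tau\<close>; real bubbles are there for it. Since the topology and the
  isomorphism classes are both governed by cross-ratios, continuity and gluing are checked on ratios
  of coordinates.\<close>

lemma hom_coords_nonzero: "fst (hom_coords p) \<noteq> 0 \<or> snd (hom_coords p) \<noteq> 0"
  by (cases p) auto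

lemma proj_pt_hom_coords [simp]: "proj_pt (fst (hom_coords p)) (snd (hom_coords p)) = p"
  by (cases p) (auto simp: proj_pt_def)

lemma proj_pt_scale: "k \<noteq> 0 \<Longrightarrow> proj_pt (k * x) (k * y) = proj_pt x y"
  by (simp add: proj_pt_def)

lemma proj_pt_eq_iff:
  assumes "x \<noteq> 0 \<or> y \<noteq> 0" "x' \<noteq> 0 \<or> y' \<noteq> 0"
  shows "proj_pt x y = proj_pt x' y' \<longleftrightarrow> x * y' = x' * y"
  using assms by (auto simp: proj_pt_def field_simps)

lemma hom_coords_proj_pt:
  assumes "x \<noteq> 0 \<or> y \<noteq> 0"
  obtains k where "k \<noteq> 0" "fst (hom_coords (proj_pt x y)) = k * x"
    "snd (hom_coords (proj_pt x y)) = k * y"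
proof (cases "y = 0")
  case True
  with assms that[of "1 / x"] show ?thesis by (auto simp: proj_pt_def)
next
  case False
  with that[of "1 / y"] show ?thesis by (auto simp: proj_pt_def)
qed

lemma hdiff_swap: "hdiff q p = - hdiff p q"
  by (simp add: hdiff_def)

lemma hdiff_self [simp]: "hdiff p p = 0"
  by (simp add: hdiff_def)

lemma hdiff_eq_0_iff [simp]: "hdiff p q = 0 \<longleftrightarrow> p = q"
  by (cases p; cases q) (auto simp: hdiff_def)

lemma hdiff_pluecker:
  "hdiff x z * hdiff y w = hdiff x y * hdiff z w - hdiff z y * hdiff x w"
  by (simp add: hdiff_def algebra_simps)

text \<open>No three of the points coincide, which is exactly when the cross-ratio is not 0 : 0.
  This is weaker than having three distinct points, because the points may coincide in pairs, and it
  is an open condition. Both facts matter: the first for spheres that carry a real bubble, the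
  second for continuity.\<close>

definition nondeg4 :: "csphere \<Rightarrow> csphere \<Rightarrow> csphere \<Rightarrow> csphere \<Rightarrow> bool" where
  "nondeg4 x y z w \<longleftrightarrow>
     \<not> (x = y \<and> z = y) \<and> \<not> (x = y \<and> x = w) \<and> \<not> (z = w \<and> z = y) \<and> \<not> (z = w \<and> x = w)"

lemma nondeg4_iff:
  "nondeg4 x y z w \<longleftrightarrow> hdiff x y * hdiff z w \<noteq> 0 \<or> hdiff z y * hdiff x w \<noteq> 0"
  by (auto simp: nondeg4_def)

lemma card_ge_3_imp_nondeg4:
  assumes "3 \<le> card {x, y, z, w}"
  shows "nondeg4 x y z w"
proof (rule ccontr)
  assume "\<not> nondeg4 x y z w"
  then obtain a b where "{x, y, z, w} \<subseteq> {a, b}"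
    by (auto simp: nondeg4_def)
  then have "card {x, y, z, w} \<le> card {a, b}" by (intro card_mono) auto
  also have "\<dots> \<le> 2" by (simp add: card_insert_if)
  finally show False using assms by simp
qed

lemma cross_ratio_proj_pt:
  assumes "x1 \<noteq> 0 \<or> x2 \<noteq> 0" "y1 \<noteq> 0 \<or> y2 \<noteq> 0" "z1 \<noteq> 0 \<or> z2 \<noteq> 0" "w1 \<noteq> 0 \<or> w2 \<noteq> 0"
  shows "cross_ratio (proj_pt x1 x2) (proj_pt y1 y2) (proj_pt z1 z2) (proj_pt w1 w2) =
    proj_pt ((x1 * y2 - y1 * x2) * (z1 * w2 - w1 * z2)) ((z1 * y2 - y1 * z2) * (x1 * w2 - w1 * x2))"
proof -
  obtain a where a: "a \<noteq> 0" "fst (hom_coords (proj_pt x1 x2)) = a * x1"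
    "snd (hom_coords (proj_pt x1 x2)) = a * x2" using hom_coords_proj_pt[OF assms(1)] .
  obtain b where b: "b \<noteq> 0" "fst (hom_coords (proj_pt y1 y2)) = b * y1"
    "snd (hom_coords (proj_pt y1 y2)) = b * y2" using hom_coords_proj_pt[OF assms(2)] .
  obtain c where c: "c \<noteq> 0" "fst (hom_coords (proj_pt z1 z2)) = c * z1"
    "snd (hom_coords (proj_pt z1 z2)) = c * z2" using hom_coords_proj_pt[OF assms(3)] .
  obtain d where d: "d \<noteq> 0" "fst (hom_coords (proj_pt w1 w2)) = d * w1"
    "snd (hom_coords (proj_pt w1 w2)) = d * w2" using hom_coords_proj_pt[OF assms(4)] .
  have "a * b * c * d \<noteq> 0" using a b c d by simp
  from proj_pt_scale[OF this, of "(x1 * y2 - y1 * x2) * (z1 * w2 - w1 * z2)"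
      "(z1 * y2 - y1 * z2) * (x1 * w2 - w1 * x2)"] show ?thesis
    unfolding cross_ratio_def hdiff_def a(2,3) b(2,3) c(2,3) d(2,3)
    by (simp add: algebra_simps)
qed

lemma nondeg4_proj_pt:
  assumes "x1 \<noteq> 0 \<or> x2 \<noteq> 0" "y1 \<noteq> 0 \<or> y2 \<noteq> 0" "z1 \<noteq> 0 \<or> z2 \<noteq> 0" "w1 \<noteq> 0 \<or> w2 \<noteq> 0"
  shows "nondeg4 (proj_pt x1 x2) (proj_pt y1 y2) (proj_pt z1 z2) (proj_pt w1 w2) \<longleftrightarrow>
    (x1 * y2 - y1 * x2) * (z1 * w2 - w1 * z2) \<noteq> 0 \<or> (z1 * y2 - y1 * z2) * (x1 * w2 - w1 * x2) \<noteq> 0"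
proof -
  have "x1 * y2 - y1 * x2 = 0 \<longleftrightarrow> proj_pt x1 x2 = proj_pt y1 y2"
    "z1 * w2 - w1 * z2 = 0 \<longleftrightarrow> proj_pt z1 z2 = proj_pt w1 w2"
    "z1 * y2 - y1 * z2 = 0 \<longleftrightarrow> proj_pt z1 z2 = proj_pt y1 y2"
    "x1 * w2 - w1 * x2 = 0 \<longleftrightarrow> proj_pt x1 x2 = proj_pt w1 w2"
    using assms by (simp_all only: proj_pt_eq_iff right_minus_eq)
  then show ?thesis unfolding nondeg4_def mult_eq_0_iff by blast
qed

lemma cross_ratio_right_eq_iff:
  assumes "x \<noteq> y" "x \<noteq> z" "y \<noteq> z"
  shows "cross_ratio x y z w = cross_ratio x y z w' \<longleftrightarrow> w = w'"
proof
  assume eq: "cross_ratio x y z w = cross_ratio x y z w'"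
  have n: "hdiff x y \<noteq> 0" "hdiff z y \<noteq> 0" "hdiff x z \<noteq> 0" using assms by auto
  have "hdiff x y * hdiff z w \<noteq> 0 \<or> hdiff z y * hdiff x w \<noteq> 0"
    "hdiff x y * hdiff z w' \<noteq> 0 \<or> hdiff z y * hdiff x w' \<noteq> 0" using assms by auto
  from proj_pt_eq_iff[OF this] eq
  have "(hdiff x y * hdiff z w) * (hdiff z y * hdiff x w') =
        (hdiff x y * hdiff z w') * (hdiff z y * hdiff x w)"
    by (simp add: cross_ratio_def)
  then have "hdiff z w * hdiff x w' = hdiff z w' * hdiff x w" using n by (simp add: field_simps)
  \<comment> \<open>A Pluecker relation; as x \<noteq> z, it leaves
    \<open>hdiff w w' = 0\<close>.\<close>
  moreover have "hdiff z w * hdiff x w' - hdiff z w' * hdiff x w = hdiff x z * - hdiff w w'"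
    by (simp add: hdiff_def algebra_simps)
  ultimately show "w = w'" using n by auto
qed simp

lemma cross_ratio_special:
  assumes "x \<noteq> y" "x \<noteq> z" "y \<noteq> z"
  shows "cross_ratio x y z x = None" "cross_ratio x y z y = Some 1" "cross_ratio x y z z = Some 0"
  using assms by (auto simp: cross_ratio_def proj_pt_def mult_eq_0_iff)

section \<open>Moebius and anti-Moebius transformations\<close>

lemma mobius_map_hom_coords:
  "mobius_map a b c d p =
    proj_pt (a * fst (hom_coords p) + b * snd (hom_coords p)) (c * fst (hom_coords p) + d * snd (hom_coords p))"
  by (cases p) (auto simp: mobius_map_def)

lemma mobius_coords_nonzero:
  fixes a b c d x y :: complex
  assumes "a * d - b * c \<noteq> 0" "x \<noteq> 0 \<or> y \<noteq> 0"
  shows "a * x + b * y \<noteq> 0 \<or> c * x + d * y \<noteq> 0"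
proof (rule ccontr)
  assume "\<not> ?thesis"
  then have *: "a * x + b * y = 0" "c * x + d * y = 0" by auto
  have "(a * d - b * c) * x = d * (a * x + b * y) - b * (c * x + d * y)"
    "(a * d - b * c) * y = a * (c * x + d * y) - c * (a * x + b * y)"
    by (simp_all add: algebra_simps)
  then show False using * assms by auto
qed

lemma mobius_map_proj_pt:
  assumes "x \<noteq> 0 \<or> y \<noteq> 0"
  shows "mobius_map a b c d (proj_pt x y) = proj_pt (a * x + b * y) (c * x + d * y)"
proof -
  obtain k where k: "k \<noteq> 0" "fst (hom_coords (proj_pt x y)) = k * x"
    "snd (hom_coords (proj_pt x y)) = k * y" using hom_coords_proj_pt[OF assms] .
  show ?thesis
    unfolding mobius_map_hom_coords k(2,3)
    by (subst proj_pt_scale[OF k(1), symmetric]) (simp add: algebra_simps)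
qed

lemma mobius_map_comp:
  assumes "a * d - b * c \<noteq> 0"
  shows "mobius_map a' b' c' d' \<circ> mobius_map a b c d =
    mobius_map (a' * a + b' * c) (a' * b + b' * d) (c' * a + d' * c) (c' * b + d' * d)"
proof
  fix p
  show "(mobius_map a' b' c' d' \<circ> mobius_map a b c d) p =
    mobius_map (a' * a + b' * c) (a' * b + b' * d) (c' * a + d' * c) (c' * b + d' * d) p"
    unfolding comp_def mobius_map_hom_coords[of a b c d p]
      mobius_map_proj_pt[OF mobius_coords_nonzero[OF assms hom_coords_nonzero]]
    by (simp add: mobius_map_hom_coords algebra_simps)
qed

lemma mobius_comp:
  assumes "mobius g" "mobius h"
  shows "mobius (g \<circ> h)"
proof -
  obtain a b c d where h: "a * d - b * c \<noteq> 0" "h = mobius_map a b c d"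
    using assms(2) by (auto simp: mobius_def)
  obtain a' b' c' d' where g: "a' * d' - b' * c' \<noteq> 0" "g = mobius_map a' b' c' d'"
    using assms(1) by (auto simp: mobius_def)
  have "(a' * a + b' * c) * (c' * b + d' * d) - (a' * b + b' * d) * (c' * a + d' * c) =
    (a' * d' - b' * c') * (a * d - b * c)" by (simp add: algebra_simps)
  then show ?thesis
    unfolding g(2) h(2) mobius_map_comp[OF h(1)] mobius_def using g(1) h(1)
    by (metis mult_eq_0_iff)
qed

lemma mobius_map_scalar: "k \<noteq> 0 \<Longrightarrow> mobius_map k 0 0 k = id"
  by (rule ext) (simp add: mobius_map_hom_coords proj_pt_scale)

lemma mobius_id: "mobius id"
  unfolding mobius_def using mobius_map_scalar[of 1]
  by (intro exI[of _ 1] exI[of _ 0]) auto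

lemma mobius_inverse:
  assumes "mobius g"
  obtains h where "mobius h" "h \<circ> g = id" "g \<circ> h = id"
proof -
  obtain a b c d where g: "a * d - b * c \<noteq> 0" "g = mobius_map a b c d"
    using assms by (auto simp: mobius_def)
  have *: "d * a - (- b) * (- c) \<noteq> 0" using g(1) by (simp add: algebra_simps)
  let ?h = "mobius_map d (- b) (- c) a"
  have "?h \<circ> g = mobius_map (a * d - b * c) 0 0 (a * d - b * c)"
    unfolding g(2) mobius_map_comp[OF g(1)] by (simp add: algebra_simps)
  moreover have "g \<circ> ?h = mobius_map (a * d - b * c) 0 0 (a * d - b * c)"
    unfolding g(2) mobius_map_comp[OF *] by (simp add: algebra_simps)
  ultimately show ?thesis
    using that[of ?h] * g(1) by (simp add: mobius_map_scalar) (metis mobius_def *)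
qed

lemma mobius_bij: "mobius g \<Longrightarrow> bij g"
  by (metis mobius_inverse o_bij)

lemma mobius_eq_iff: "mobius g \<Longrightarrow> g p = g q \<longleftrightarrow> p = q"
  using mobius_bij[of g] by (auto simp: bij_def inj_def)

text \<open>Homogeneous coordinates are normalized, so a linear map changes \<open>hdiff\<close> by
  its determinant and by one rescaling factor for each point. In a cross-ratio every point occurs
  equally often in both products, so all factors cancel.\<close>

lemma mobius_hdiff:
  assumes "mobius g"
  obtains \<delta> \<kappa> where "\<delta> \<noteq> 0" "\<And>p. \<kappa> p \<noteq> 0" "\<And>p q. hdiff (g p) (g q) = \<delta> * \<kappa> p * \<kappa> q * hdiff p q"
proof -
  obtain a b c d where g: "a * d - b * c \<noteq> 0" "g = mobius_map a b c d"
    using assms by (auto simp: mobius_def)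
  have "\<exists>k. k \<noteq> 0 \<and> fst (hom_coords (g p)) = k * (a * fst (hom_coords p) + b * snd (hom_coords p)) \<and>
    snd (hom_coords (g p)) = k * (c * fst (hom_coords p) + d * snd (hom_coords p))" for p
    using hom_coords_proj_pt[OF mobius_coords_nonzero[OF g(1) hom_coords_nonzero[of p]]]
    unfolding g(2) mobius_map_hom_coords by metis
  then obtain \<kappa> where \<kappa>: "\<And>p. \<kappa> p \<noteq> 0"
    "\<And>p. fst (hom_coords (g p)) = \<kappa> p * (a * fst (hom_coords p) + b * snd (hom_coords p))"
    "\<And>p. snd (hom_coords (g p)) = \<kappa> p * (c * fst (hom_coords p) + d * snd (hom_coords p))"
    by metis
  show ?thesis
  proof (rule that[OF g(1) \<kappa>(1)])
    show "hdiff (g p) (g q) = (a * d - b * c) * \<kappa> p * \<kappa> q * hdiff p q" for p q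
      by (simp add: hdiff_def \<kappa>(2,3) algebra_simps)
  qed
qed

lemma cross_ratio_mobius:
  assumes "mobius g"
  shows "cross_ratio (g x) (g y) (g z) (g w) = cross_ratio x y z w"
proof -
  obtain \<delta> \<kappa> where d: "\<delta> \<noteq> 0" "\<And>p. \<kappa> p \<noteq> 0"
    and h: "\<And>p q. hdiff (g p) (g q) = \<delta> * \<kappa> p * \<kappa> q * hdiff p q"
    using mobius_hdiff[OF assms] by metis
  have "\<delta>\<^sup>2 * \<kappa> x * \<kappa> y * \<kappa> z * \<kappa> w \<noteq> 0" using d by simp
  from proj_pt_scale[OF this, of "hdiff x y * hdiff z w" "hdiff z y * hdiff x w"] show ?thesis
    unfolding cross_ratio_def h by (simp add: algebra_simps power2_eq_square)
qed

lemma nondeg4_mobius: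
  "mobius g \<Longrightarrow> nondeg4 (g x) (g y) (g z) (g w) \<longleftrightarrow> nondeg4 x y z w"
  by (simp add: nondeg4_def mobius_eq_iff)

lemma cross_ratio_is_mobius:
  assumes "x \<noteq> y" "x \<noteq> z" "y \<noteq> z"
  shows "mobius (cross_ratio x y z)"
proof -
  let ?f = "\<lambda>p. fst (hom_coords p)" and ?s = "\<lambda>p. snd (hom_coords p)"
  let ?a = "- hdiff x y * ?s z" and ?b = "hdiff x y * ?f z"
  let ?c = "- hdiff z y * ?s x" and ?d = "hdiff z y * ?f x"
  have "cross_ratio x y z = mobius_map ?a ?b ?c ?d"
    by (rule ext) (simp add: cross_ratio_def mobius_map_hom_coords hdiff_def algebra_simps)
  moreover have "?a * ?d - ?b * ?c = hdiff x y * hdiff z y * hdiff z x"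
    by (simp add: hdiff_def algebra_simps)
  ultimately show ?thesis
    using assms unfolding mobius_def
    by (intro exI[of _ ?a] exI[of _ ?b] exI[of _ ?c] exI[of _ ?d]) simp
qed

text \<open>The cross-ratio with a fixed triple is the coordinate that normalizes this triple.
  Composing one normalization with the inverse of the other moves every further point to the one
  with the same cross-ratio; isomorphisms of components are produced in this way.\<close>

lemma mobius_transport:
  assumes "x \<noteq> y" "x \<noteq> z" "y \<noteq> z" "x' \<noteq> y'" "x' \<noteq> z'" "y' \<noteq> z'"
  obtains g where "mobius g" "g x = x'" "g y = y'" "g z = z'"
    "\<And>w w'. cross_ratio x y z w = cross_ratio x' y' z' w' \<Longrightarrow> g w = w'"
proof -
  obtain h where h: "mobius h" "h \<circ> cross_ratio x' y' z' = id"
    using mobius_inverse[OF cross_ratio_is_mobius[OF assms(4-6)]] by metis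
  let ?g = "h \<circ> cross_ratio x y z"
  have *: "?g w = w'" if "cross_ratio x y z w = cross_ratio x' y' z' w'" for w w'
    using that h(2) by (simp add: fun_eq_iff)
  show ?thesis
    using assms by (intro that[of ?g] mobius_comp h cross_ratio_is_mobius *) (simp_all add: cross_ratio_special)
qed

lemma mobius_eqI:
  assumes "mobius g" "mobius h" "x \<noteq> y" "x \<noteq> z" "y \<noteq> z" "g x = h x" "g y = h y" "g z = h z"
  shows "g = h"
proof
  fix w
  have "cross_ratio (g x) (g y) (g z) (g w) = cross_ratio (g x) (g y) (g z) (h w)"
    using cross_ratio_mobius[OF assms(1)] cross_ratio_mobius[OF assms(2)] assms(6-8) by metis
  then show "g w = h w"
    using assms by (subst (asm) cross_ratio_right_eq_iff) (auto simp: mobius_eq_iff)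
qed

lemma mobius_cnj:
  assumes "mobius g"
  shows "\<exists>h. mobius h \<and> map_option cnj \<circ> g = h \<circ> map_option cnj"
proof -
  obtain a b c d where g: "a * d - b * c \<noteq> 0" "g = mobius_map a b c d"
    using assms by (auto simp: mobius_def)
  have "cnj (a * d - b * c) \<noteq> cnj 0" using g(1) by (subst complex_cnj_cancel_iff)
  then have "mobius (mobius_map (cnj a) (cnj b) (cnj c) (cnj d))"
    unfolding mobius_def by (intro exI conjI) (auto)
  moreover have "map_option cnj \<circ> g = mobius_map (cnj a) (cnj b) (cnj c) (cnj d) \<circ> map_option cnj"
  proof
    fix p
    have "cnj u = 0 \<longleftrightarrow> u = 0" for u by simp
    from this[of "c * the p + d"] show "(map_option cnj \<circ> g) p = (mobius_map (cnj a) (cnj b) (cnj c) (cnj d) \<circ> map_option cnj) p"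
      by (cases p) (auto simp: g(2) mobius_map_def proj_pt_def)
  qed
  ultimately show ?thesis by blast
qed

lemma antimobius_comp:
  assumes "antimobius f" "mobius g"
  shows "antimobius (g \<circ> f)" "antimobius (f \<circ> g)"
proof -
  obtain h where h: "mobius h" "f = h \<circ> map_option cnj" using assms(1) by (auto simp: antimobius_def)
  show "antimobius (g \<circ> f)"
    unfolding antimobius_def h(2) using mobius_comp[OF assms(2) h(1)] by (metis comp_assoc)
  obtain k where k: "mobius k" "map_option cnj \<circ> g = k \<circ> map_option cnj"
    using mobius_cnj[OF assms(2)] by blast
  show "antimobius (f \<circ> g)"
    unfolding antimobius_def h(2) using mobius_comp[OF h(1) k(1)] k(2) by (metis comp_assoc)
qed

text \<open>Compatibility with the involutions therefore needs to be checked at three directions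
  only.\<close>

lemma antimobius_eqI:
  assumes "antimobius g" "antimobius h" "x \<noteq> y" "x \<noteq> z" "y \<noteq> z" "g x = h x" "g y = h y" "g z = h z"
  shows "g = h"
proof -
  obtain g' where g: "mobius g'" "g = g' \<circ> map_option cnj" using assms(1) by (auto simp: antimobius_def)
  obtain h' where h: "mobius h'" "h = h' \<circ> map_option cnj" using assms(2) by (auto simp: antimobius_def)
  have inj: "map_option cnj p = map_option cnj q \<longleftrightarrow> p = q" for p q
    by (cases p; cases q) auto
  have "g' = h'"
    by (rule mobius_eqI[OF g(1) h(1), of "map_option cnj x" "map_option cnj y" "map_option cnj z"])
      (use assms g(2) h(2) in \<open>auto simp: inj\<close>)
  then show ?thesis using g h by simp
qed

lemma antimobius_eq_iff:
  assumes "antimobius f"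
  shows "f p = f q \<longleftrightarrow> p = q"
proof -
  obtain h where h: "mobius h" "f = h \<circ> map_option cnj" using assms by (auto simp: antimobius_def)
  show ?thesis by (cases p; cases q) (auto simp: h(2) mobius_eq_iff[OF h(1)])
qed

lemma antimobius_cnj: "antimobius (map_option cnj)"
  unfolding antimobius_def by (intro exI[of _ id]) (simp add: mobius_id)

lemma inv_sign_simps [simp]: "inv_sign c \<noteq> 0" "inv_sign c * inv_sign c = 1" "cnj (inv_sign c) = inv_sign c"
  "1 / inv_sign c = inv_sign c" "inv_sign c / inv_sign c = 1" "norm (inv_sign c) = 1"
  by (cases c; simp)+

lemma std_inv_antimobius: "antimobius (std_inv c)"
proof -
  have "std_inv c = mobius_map 0 (inv_sign c) 1 0 \<circ> map_option cnj"
    by (rule ext) (auto simp: std_inv_def mobius_map_def proj_pt_def split: option.split)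
  moreover have "mobius (mobius_map 0 (inv_sign c) 1 0)"
    unfolding mobius_def by (intro exI conjI) (auto simp del: mult_eq_0_iff)
  ultimately show ?thesis unfolding antimobius_def by blast
qed

lemma std_inv_std_inv [simp]: "std_inv c (std_inv c p) = p"
  by (cases c; cases p) (auto simp: std_inv_def proj_pt_def)

lemma std_inv_simps [simp]: "std_inv c None = Some 0" "std_inv c (Some 0) = None"
  "z \<noteq> 0 \<Longrightarrow> std_inv c (Some z) = Some (inv_sign c / cnj z)"
  by (auto simp: std_inv_def proj_pt_def)

section \<open>Topology of the Riemann sphere\<close>

lemma topspace_csphere [simp]: "topspace csphere_top = UNIV"
  by (auto simp: UNIV_option_conv)

lemma Hausdorff_csphere: "Hausdorff_space csphere_top"
  unfolding Hausdorff_space_Alexandroff_compactification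
  by (intro conjI Hausdorff_space_euclidean locally_compact_space_euclidean)

lemma continuous_map_proj_pt:
  fixes f g :: "'a::topological_space \<Rightarrow> complex"
  assumes f: "continuous_on S f" and g: "continuous_on S g"
    and nz: "\<And>x. x \<in> S \<Longrightarrow> f x \<noteq> 0 \<or> g x \<noteq> 0"
  shows "continuous_map (top_of_set S) csphere_top (\<lambda>x. proj_pt (f x) (g x))"
  unfolding continuous_map_def
proof (intro conjI allI impI)
  fix U assume "openin csphere_top U"
  then consider V where "open V" "U = Some ` V"
    | K where "compact K" "U = insert None (Some ` (UNIV - K))"
    by (auto simp: openin_Alexandroff_compactification)
  then show "openin (top_of_set S) {x \<in> topspace (top_of_set S). proj_pt (f x) (g x) \<in> U}"
  proof cases
    case 1
    let ?S = "S \<inter> g -` (- {0})"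
    have oS: "openin (top_of_set S) ?S"
      using g by (auto intro: continuous_openin_preimage_gen)
    have "continuous_on ?S (\<lambda>x. f x / g x)"
      by (intro continuous_intros continuous_on_subset[OF f] continuous_on_subset[OF g]) auto
    then have "openin (top_of_set ?S) (?S \<inter> (\<lambda>x. f x / g x) -` V)"
      using 1(1) by (intro continuous_openin_preimage_gen)
    then have "openin (top_of_set S) (?S \<inter> (\<lambda>x. f x / g x) -` V)"
      using oS openin_trans by blast
    moreover have "{x \<in> topspace (top_of_set S). proj_pt (f x) (g x) \<in> U} = ?S \<inter> (\<lambda>x. f x / g x) -` V"
      unfolding 1(2) by (auto simp: proj_pt_def split: if_splits)
    ultimately show ?thesis by simp
  next
    case 2
    obtain B where B: "B > 0" "\<And>z. z \<in> K \<Longrightarrow> norm z \<le> B"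
      using compact_imp_bounded[OF 2(1)] by (auto simp: bounded_pos)
    let ?S1 = "S \<inter> g -` (- {0})" and ?S2 = "S \<inter> (\<lambda>x. norm (f x) - B * norm (g x)) -` {0<..}"
    have oS: "openin (top_of_set S) ?S1"
      using g by (auto intro: continuous_openin_preimage_gen)
    have "continuous_on ?S1 (\<lambda>x. f x / g x)"
      by (intro continuous_intros continuous_on_subset[OF f] continuous_on_subset[OF g]) auto
    then have "openin (top_of_set ?S1) (?S1 \<inter> (\<lambda>x. f x / g x) -` (UNIV - K))"
      using 2(1) by (intro continuous_openin_preimage_gen) (auto simp: compact_imp_closed open_Diff)
    then have o1: "openin (top_of_set S) (?S1 \<inter> (\<lambda>x. f x / g x) -` (UNIV - K))"
      using oS openin_trans by blast
    have "continuous_on S (\<lambda>x. norm (f x) - B * norm (g x))"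
      by (intro continuous_intros f g)
    then have o2: "openin (top_of_set S) ?S2"
      by (intro continuous_openin_preimage_gen) auto
    have "{x \<in> topspace (top_of_set S). proj_pt (f x) (g x) \<in> U} =
      (?S1 \<inter> (\<lambda>x. f x / g x) -` (UNIV - K)) \<union> ?S2" (is "?L = ?R")
    proof (rule Set.set_eqI)
      fix x
      have K: "f x / g x \<notin> K" if "norm (f x) > B * norm (g x)" "g x \<noteq> 0"
        using B(2)[of "f x / g x"] that by (auto simp: norm_divide field_simps)
      have U: "p \<in> U \<longleftrightarrow> p = None \<or> (\<exists>z. p = Some z \<and> z \<notin> K)" for p unfolding 2(2) by auto
      show "x \<in> ?L \<longleftrightarrow> x \<in> ?R"
      proof (cases "x \<in> S")
        case True
        show ?thesis
        proof (cases "g x = 0")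
          case g0: True
          then have "proj_pt (f x) (g x) \<in> U" by (simp add: U proj_pt_def)
          moreover have "norm (f x) - B * norm (g x) \<in> {0<..}" using g0 nz[OF True] by simp
          ultimately show ?thesis using True by simp
        next
          case False
          then have "proj_pt (f x) (g x) \<in> U \<longleftrightarrow> f x / g x \<notin> K" by (simp add: U proj_pt_def)
          moreover have "f x / g x \<notin> K" if "norm (f x) - B * norm (g x) \<in> {0<..}"
            using that K False by simp
          ultimately show ?thesis using True False by simp blast
        qed
      qed auto
    qed
    then show ?thesis using openin_Un[OF o1 o2] by (rule ssubst)
  qed
next
  show "(\<lambda>x. proj_pt (f x) (g x)) \<in> topspace (top_of_set S) \<rightarrow> topspace csphere_top"
    unfolding topspace_csphere by (rule funcsetI) (rule UNIV_I)
qed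

section \<open>Paths in trees\<close>

definition path_to :: "rcurve \<Rightarrow> nat \<Rightarrow> nat \<Rightarrow> nat list" where
  "path_to C \<alpha> \<beta> = (THE xs. tree_path C \<alpha> xs \<beta>)"

text \<open>Entry 0 of the path is \<alpha> itself, so this is meaningful for \<alpha> \<noteq>
  \<beta> only.\<close>

definition first_step :: "rcurve \<Rightarrow> nat \<Rightarrow> nat \<Rightarrow> nat" where
  "first_step C \<alpha> \<beta> = path_to C \<alpha> \<beta> ! 1"

lemma tree_path_ex1:
  assumes "is_tree C" "\<alpha> \<in> comps C" "\<beta> \<in> comps C"
  shows "\<exists>!xs. tree_path C \<alpha> xs \<beta>"
  using assms unfolding is_tree_def by blast

lemma tree_path_path_to:
  assumes "is_tree C" "\<alpha> \<in> comps C" "\<beta> \<in> comps C"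
  shows "tree_path C \<alpha> (path_to C \<alpha> \<beta>) \<beta>"
  unfolding path_to_def by (rule theI'[OF tree_path_ex1[OF assms]])

lemma tree_path_in_comps: "tree_path C \<alpha> xs \<beta> \<Longrightarrow> \<alpha> \<in> comps C \<and> \<beta> \<in> comps C"
  by (auto simp: tree_path_def)

lemma path_to_eqI:
  assumes "is_tree C" "tree_path C \<alpha> xs \<beta>"
  shows "path_to C \<alpha> \<beta> = xs"
proof -
  have "\<exists>!xs. tree_path C \<alpha> xs \<beta>"
    using tree_path_ex1[OF assms(1)] tree_path_in_comps[OF assms(2)] by blast
  then show ?thesis using tree_path_path_to[OF assms(1)] tree_path_in_comps[OF assms(2)] assms(2) by blast
qed

lemma tree_path_Cons:
  assumes "\<alpha> \<noteq> \<beta>"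
  shows "tree_path C \<alpha> xs \<beta> \<longleftrightarrow>
    (\<exists>\<gamma> ys. xs = \<alpha> # ys \<and> \<alpha> \<in> comps C \<and> \<alpha> \<notin> set ys \<and> (\<alpha>, \<gamma>) \<in> adj C \<and> tree_path C \<gamma> ys \<beta>)"
    (is "?l \<longleftrightarrow> ?r")
proof
  assume l: ?l
  then obtain ys where xs: "xs = \<alpha> # ys" by (cases xs) (auto simp: tree_path_def)
  with l assms have "ys \<noteq> []" by (auto simp: tree_path_def)
  then obtain \<gamma> zs where ys: "ys = \<gamma> # zs" by (cases ys) auto
  show ?r using l xs ys by (auto simp: tree_path_def)
next
  assume ?r
  then obtain \<gamma> ys where "xs = \<alpha> # ys" "\<alpha> \<in> comps C" "\<alpha> \<notin> set ys" "(\<alpha>, \<gamma>) \<in> adj C" "tree_path C \<gamma> ys \<beta>"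
    by auto
  then show ?l by (cases ys) (auto simp: tree_path_def)
qed

lemma tree_path_refl: "\<alpha> \<in> comps C \<Longrightarrow> tree_path C \<alpha> [\<alpha>] \<alpha>"
  by (auto simp: tree_path_def)

lemma tree_path_rev:
  assumes "is_tree C" "tree_path C \<alpha> xs \<beta>"
  shows "tree_path C \<beta> (rev xs) \<alpha>"
proof -
  have "(y, x) \<in> adj C \<longleftrightarrow> (x, y) \<in> adj C" for x y
    using assms(1) by (auto simp: is_tree_def sym_def)
  then show ?thesis
    using assms(2) by (auto simp: tree_path_def hd_rev last_rev)
qed

lemma tree_path_append:
  assumes "tree_path C \<alpha> xs \<beta>" "tree_path C \<beta> (\<beta> # ys) \<gamma>" "set xs \<inter> set ys = {}"
  shows "tree_path C \<alpha> (xs @ ys) \<gamma>"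
  using assms by (cases ys) (auto simp: tree_path_def successively_append_iff)

lemma tree_path_prefix:
  assumes "tree_path C \<alpha> (xs @ \<gamma> # ys) \<beta>"
  shows "tree_path C \<alpha> (xs @ [\<gamma>]) \<gamma>" "tree_path C \<gamma> (\<gamma> # ys) \<beta>"
  using assms
  by (simp_all add: tree_path_def successively_append_iff) (cases xs; simp)

lemma adj_in_comps: "is_tree C \<Longrightarrow> (\<alpha>, \<beta>) \<in> adj C \<Longrightarrow> \<alpha> \<in> comps C \<and> \<beta> \<in> comps C \<and> \<alpha> \<noteq> \<beta>"
  by (auto simp: is_tree_def irrefl_def)

lemma adj_sym: "is_tree C \<Longrightarrow> (\<alpha>, \<beta>) \<in> adj C \<Longrightarrow> (\<beta>, \<alpha>) \<in> adj C"
  by (auto simp: is_tree_def sym_def)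

lemma path_to_first_step:
  assumes "is_tree C" "\<alpha> \<in> comps C" "\<beta> \<in> comps C" "\<alpha> \<noteq> \<beta>"
  shows "(\<alpha>, first_step C \<alpha> \<beta>) \<in> adj C"
    and "path_to C \<alpha> \<beta> = \<alpha> # path_to C (first_step C \<alpha> \<beta>) \<beta>"
    and "\<alpha> \<notin> set (path_to C (first_step C \<alpha> \<beta>) \<beta>)"
proof -
  obtain \<gamma> ys where *: "path_to C \<alpha> \<beta> = \<alpha> # ys" "\<alpha> \<notin> set ys" "(\<alpha>, \<gamma>) \<in> adj C" "tree_path C \<gamma> ys \<beta>"
    using tree_path_path_to[OF assms(1-3)] tree_path_Cons[OF assms(4)] by auto
  then have "first_step C \<alpha> \<beta> = \<gamma>"
    by (cases ys) (auto simp: first_step_def tree_path_def)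
  with * path_to_eqI[OF assms(1) *(4)]
  show "(\<alpha>, first_step C \<alpha> \<beta>) \<in> adj C" "path_to C \<alpha> \<beta> = \<alpha> # path_to C (first_step C \<alpha> \<beta>) \<beta>"
    "\<alpha> \<notin> set (path_to C (first_step C \<alpha> \<beta>) \<beta>)" by auto
qed

lemma first_step_eqI:
  assumes "is_tree C" "(\<alpha>, \<gamma>) \<in> adj C" "tree_path C \<gamma> ys \<beta>" "\<alpha> \<notin> set ys"
  shows "first_step C \<alpha> \<beta> = \<gamma>"
proof -
  have "ys \<noteq> []" "hd ys = \<gamma>" "\<beta> \<in> set ys" using assms(3) by (auto simp: tree_path_def)
  moreover from this have "\<alpha> \<noteq> \<beta>" using assms(4) by auto
  then have "tree_path C \<alpha> (\<alpha> # ys) \<beta>"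
    using assms adj_in_comps[OF assms(1,2)] by (auto simp: tree_path_Cons)
  then have "path_to C \<alpha> \<beta> = \<alpha> # ys" by (rule path_to_eqI[OF assms(1)])
  ultimately show ?thesis by (cases ys) (auto simp: first_step_def)
qed

lemma first_step_adj:
  assumes "is_tree C" "(\<alpha>, \<beta>) \<in> adj C"
  shows "first_step C \<alpha> \<beta> = \<beta>"
  using first_step_eqI[OF assms tree_path_refl] adj_in_comps[OF assms] by auto

text \<open>The path from the first step on is a tail of the path from \<alpha>, which does not
  return to \<alpha>.\<close>

lemma first_step_back:
  assumes "is_tree C" "\<alpha> \<in> comps C" "\<gamma> \<in> comps C" "\<alpha> \<noteq> \<gamma>" "first_step C \<alpha> \<gamma> \<noteq> \<gamma>"
  shows "first_step C (first_step C \<alpha> \<gamma>) \<gamma> \<noteq> \<alpha>"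
proof
  let ?\<beta> = "first_step C \<alpha> \<gamma>"
  assume *: "first_step C ?\<beta> \<gamma> = \<alpha>"
  have b: "?\<beta> \<in> comps C" using path_to_first_step(1)[OF assms(1-4)] adj_in_comps[OF assms(1)] by blast
  have "path_to C ?\<beta> \<gamma> = ?\<beta> # path_to C \<alpha> \<gamma>"
    using path_to_first_step(2)[OF assms(1) b assms(3,5)] * by simp
  then show False
    using path_to_first_step(2)[OF assms(1-4)] path_to_first_step(3)[OF assms(1-4)] by auto
qed

text \<open>If \<gamma> is not reached from \<alpha> in the direction of \<beta>, the paths from
  \<alpha> to \<beta> and to \<gamma> share only \<alpha>. The first one reversed, followed by the
  second, is then the path from \<beta> to \<gamma>, and it starts toward \<alpha>.\<close>

lemma first_step_toward:
  assumes C: "is_tree C" "\<alpha> \<in> comps C" "\<beta> \<in> comps C" "\<gamma> \<in> comps C" "\<alpha> \<noteq> \<beta>"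
  shows "(\<gamma> \<noteq> \<alpha> \<and> first_step C \<alpha> \<gamma> = first_step C \<alpha> \<beta>) \<or> (\<gamma> \<noteq> \<beta> \<and> first_step C \<beta> \<gamma> = first_step C \<beta> \<alpha>)"
proof (cases "\<gamma> \<noteq> \<alpha> \<and> first_step C \<alpha> \<gamma> = first_step C \<alpha> \<beta>")
  case False
  let ?p = "path_to C \<alpha> \<beta>" and ?r = "path_to C \<alpha> \<gamma>"
  have p: "tree_path C \<alpha> ?p \<beta>" and r: "tree_path C \<alpha> ?r \<gamma>"
    using tree_path_path_to[OF C(1,2)] C by auto
  have hd: "?r = \<alpha> # tl ?r" using r by (cases ?r) (auto simp: tree_path_def)
  \<comment> \<open>A common vertex x \<noteq> \<alpha> would cut the same initial segment off both
    paths, because the path from \<alpha> to x is unique; their first steps would then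
    agree.\<close>
  have disj: "set ?p \<inter> set (tl ?r) = {}"
  proof (rule ccontr)
    assume "set ?p \<inter> set (tl ?r) \<noteq> {}"
    then obtain x where x: "x \<in> set ?p" "x \<in> set (tl ?r)" by auto
    have "x \<noteq> \<alpha>" using x(2) r hd by (metis distinct.simps(2) tree_path_def)
    from x obtain a b c d where ab: "?p = a @ x # b" and cd: "?r = c @ x # d"
      using hd by (metis in_set_conv_decomp list.set_intros(2))
    have pa: "path_to C \<alpha> x = a @ [x]" "path_to C \<alpha> x = c @ [x]"
      using tree_path_prefix(1)[of C \<alpha> a x b \<beta>] tree_path_prefix(1)[of C \<alpha> c x d \<gamma>] p r ab cd
        path_to_eqI[OF C(1)] by metis+
    then have "a = c" by simp
    moreover have "a \<noteq> []" using p ab \<open>x \<noteq> \<alpha>\<close> by (auto simp: tree_path_def)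
    ultimately have "?p ! 1 = ?r ! 1" using ab cd by (cases a) (auto simp: nth_append nth_Cons')
    moreover have "\<gamma> \<noteq> \<alpha>"
    proof
      assume "\<gamma> = \<alpha>"
      then have "?r = [\<alpha>]" using path_to_eqI[OF C(1) tree_path_refl[OF C(2)]] by simp
      with x show False by simp
    qed
    ultimately show False using False by (simp add: first_step_def)
  qed
  have rev: "tree_path C \<beta> (rev ?p) \<alpha>" by (rule tree_path_rev[OF C(1) p])
  have "tree_path C \<beta> (rev ?p @ tl ?r) \<gamma>"
    by (rule tree_path_append[OF rev]) (use r hd disj in auto)
  then have 1: "path_to C \<beta> \<gamma> = rev ?p @ tl ?r" by (rule path_to_eqI[OF C(1)])
  have 2: "path_to C \<beta> \<alpha> = rev ?p" by (rule path_to_eqI[OF C(1) rev])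
  have len: "length (rev ?p) > 1"
    using p C(5) by (cases ?p; cases "tl ?p") (auto simp: tree_path_def)
  then have "first_step C \<beta> \<gamma> = first_step C \<beta> \<alpha>"
    unfolding first_step_def 1 2 using len by (simp add: nth_append)
  moreover have "\<gamma> \<noteq> \<beta>"
  proof
    assume "\<gamma> = \<beta>"
    then have "rev ?p @ tl ?r = [\<beta>]" using 1 path_to_eqI[OF C(1) tree_path_refl[OF C(3)]] by simp
    then have "length (rev ?p @ tl ?r) = 1" by simp
    with len show False by simp
  qed
  ultimately show ?thesis by blast
qed auto

text \<open>Removing an edge splits the tree in two, and \<gamma> lies on exactly one side.\<close>

lemma first_step_adj_iff:
  assumes C: "is_tree C" "(\<alpha>, \<beta>) \<in> adj C" "\<gamma> \<in> comps C"
  shows "(\<gamma> \<noteq> \<alpha> \<and> first_step C \<alpha> \<gamma> = \<beta>) \<longleftrightarrow> \<not> (\<gamma> \<noteq> \<beta> \<and> first_step C \<beta> \<gamma> = \<alpha>)"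
proof -
  have a: "\<alpha> \<in> comps C" "\<beta> \<in> comps C" "\<alpha> \<noteq> \<beta>" using adj_in_comps[OF C(1,2)] by auto
  have s: "first_step C \<alpha> \<beta> = \<beta>" "first_step C \<beta> \<alpha> = \<alpha>"
    using first_step_adj[OF C(1)] C(2) adj_sym[OF C(1,2)] by auto
  show ?thesis
    using first_step_toward[OF C(1) a(1,2) C(3) a(3)] first_step_back[OF C(1) a(1) C(3)] s by auto
qed

lemma path_to_length_less:
  assumes "is_tree C" "\<alpha> \<in> comps C" "\<beta> \<in> comps C" "\<alpha> \<noteq> \<beta>"
  shows "length (path_to C (first_step C \<alpha> \<beta>) \<beta>) < length (path_to C \<alpha> \<beta>)"
  using path_to_first_step(2)[OF assms] by simp

text \<open>The branch S can be entered only through the edge from \<alpha> to \<beta>. Computing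
  first steps thus reduces to naming the branch, without writing down any path.\<close>

lemma first_step_branch:
  assumes C: "is_tree C" "\<alpha> \<in> comps C" "\<gamma> \<in> comps C" "\<gamma> \<in> S" "\<alpha> \<notin> S"
    and S: "\<And>x y. (x, y) \<in> adj C \<Longrightarrow> x \<notin> S \<Longrightarrow> y \<in> S \<Longrightarrow> x = \<alpha> \<and> y = \<beta>"
  shows "first_step C \<alpha> \<gamma> = \<beta>"
proof -
  have *: "\<alpha> \<in> set ys \<or> x \<in> S" if "tree_path C x ys \<gamma>" for x ys
    using that
  proof (induction ys arbitrary: x)
    case (Cons z zs)
    show ?case
    proof (cases "x = \<gamma>")
      case False
      then obtain y where "x = z" "(x, y) \<in> adj C" "tree_path C y zs \<gamma>"
        using Cons.prems by (auto simp: tree_path_Cons)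
      with Cons.IH[of y] S[of x y] show ?thesis by auto
    qed (use C in auto)
  qed (auto simp: tree_path_def)
  have "\<alpha> \<noteq> \<gamma>" using C by auto
  note p = path_to_first_step[OF C(1-3) this]
  have "tree_path C (first_step C \<alpha> \<gamma>) (path_to C (first_step C \<alpha> \<gamma>) \<gamma>) \<gamma>"
    using tree_path_path_to[OF C(1)] adj_in_comps[OF C(1) p(1)] C(3) by blast
  from *[OF this] p(3) have "first_step C \<alpha> \<gamma> \<in> S" by auto
  with S[OF p(1)] C show ?thesis by auto
qed

lemma is_tree_singleton: "comps C = {\<alpha>} \<Longrightarrow> adj C = {} \<Longrightarrow> is_tree C"
proof -
  assume C: "comps C = {\<alpha>}" "adj C = {}"
  have "tree_path C \<alpha> xs \<alpha> \<longleftrightarrow> xs = [\<alpha>]" for xs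
    by (cases xs; cases "tl xs") (auto simp: tree_path_def C)
  then show ?thesis by (auto simp: is_tree_def C sym_def irrefl_def)
qed

lemma tree_path_subtree:
  assumes "comps C \<subseteq> comps D" "adj C = adj D \<inter> comps C \<times> comps C"
  shows "tree_path C \<alpha> xs \<beta> \<longleftrightarrow> tree_path D \<alpha> xs \<beta> \<and> set xs \<subseteq> comps C"
proof -
  have "set xs \<subseteq> comps C \<Longrightarrow> successively (\<lambda>x y. (x, y) \<in> adj C) xs \<longleftrightarrow> successively (\<lambda>x y. (x, y) \<in> adj D) xs" for xs
    unfolding assms(2) by (induction "\<lambda>x y. (x, y) \<in> adj D" xs rule: successively.induct) auto
  then show ?thesis using assms(1) by (auto simp: tree_path_def)
qed

text \<open>A path through \<gamma> would enter and leave it by way of the same neighbour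
  \<delta>.\<close>

lemma tree_path_avoids_leaf:
  assumes "tree_path D \<alpha> xs \<beta>" "\<gamma> \<noteq> \<alpha>" "\<gamma> \<noteq> \<beta>"
    and "\<And>x. (\<gamma>, x) \<in> adj D \<Longrightarrow> x = \<delta>" "\<And>x. (x, \<gamma>) \<in> adj D \<Longrightarrow> x = \<delta>"
  shows "\<gamma> \<notin> set xs"
proof
  assume "\<gamma> \<in> set xs"
  then obtain ys zs where xs: "xs = ys @ \<gamma> # zs" by (auto simp: in_set_conv_decomp)
  have "ys \<noteq> []" "zs \<noteq> []" using assms(1-3) xs by (auto simp: tree_path_def)
  then have "(last ys, \<gamma>) \<in> adj D" "(\<gamma>, hd zs) \<in> adj D"
    using assms(1) xs by (auto simp: tree_path_def successively_append_iff successively_Cons)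
  with assms(4,5) have "last ys = hd zs" by blast
  moreover have "last ys \<in> set ys" "hd zs \<in> set zs" using \<open>ys \<noteq> []\<close> \<open>zs \<noteq> []\<close> by auto
  ultimately show False using assms(1) xs by (auto simp: tree_path_def)
qed

text \<open>Paths between old vertices cannot visit the leaf, and paths from the leaf are paths from
  \<beta> with \<gamma> put in front. This is the induction step both for the chain of levels and
  for attaching the bubbles.\<close>

lemma is_tree_insert_leaf:
  assumes C: "is_tree C" "\<beta> \<in> comps C" "\<gamma> \<notin> comps C"
    and D: "comps D = insert \<gamma> (comps C)" "adj D = adj C \<union> {(\<beta>, \<gamma>), (\<gamma>, \<beta>)}"
  shows "is_tree D"
proof -
  have aC: "adj C \<subseteq> comps C \<times> comps C" using C(1) by (auto simp: is_tree_def)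
  have sub: "tree_path C \<alpha> xs \<delta> \<longleftrightarrow> tree_path D \<alpha> xs \<delta> \<and> set xs \<subseteq> comps C" for \<alpha> xs \<delta>
    by (rule tree_path_subtree) (use D aC C(3) in auto)
  have leaf: "x = \<beta>" if "(\<gamma>, x) \<in> adj D \<or> (x, \<gamma>) \<in> adj D" for x
    using that D aC C(3) by auto
  have D_in: "tree_path D \<alpha> xs \<delta> \<longleftrightarrow> tree_path C \<alpha> xs \<delta>" if "\<alpha> \<in> comps C" "\<delta> \<in> comps C" for \<alpha> xs \<delta>
  proof
    assume *: "tree_path D \<alpha> xs \<delta>"
    have "\<gamma> \<notin> set xs"
      by (rule tree_path_avoids_leaf[OF *, of _ \<beta>]) (use that C(3) leaf in auto)
    then show "tree_path C \<alpha> xs \<delta>" using * D by (auto simp: sub) (auto simp: tree_path_def)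
  qed (simp add: sub)
  have from_leaf: "tree_path D \<gamma> xs \<delta> \<longleftrightarrow> (\<exists>ys. xs = \<gamma> # ys \<and> tree_path C \<beta> ys \<delta>)" if "\<delta> \<in> comps C" for xs \<delta>
  proof -
    have "\<gamma> \<noteq> \<delta>" using that C(3) by auto
    have notin: "\<gamma> \<notin> set ys" if "tree_path C \<beta> ys \<delta>" for ys using that C(3) by (auto simp: tree_path_def)
    have "\<gamma> \<in> comps D" "(\<gamma>, \<beta>) \<in> adj D" using D by auto
    with leaf show ?thesis
      unfolding tree_path_Cons[OF \<open>\<gamma> \<noteq> \<delta>\<close>] using D_in[OF C(2) that] notin by blast
  qed
  have symD: "sym (adj D)" using C(1) unfolding D(2) is_tree_def sym_def by auto
  have rev: "tree_path D \<delta> xs \<alpha> \<longleftrightarrow> tree_path D \<alpha> (rev xs) \<delta>" for xs \<alpha> \<delta>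
  proof -
    have "(y, x) \<in> adj D \<longleftrightarrow> (x, y) \<in> adj D" for x y using symD by (auto simp: sym_def)
    then show ?thesis by (auto simp: tree_path_def hd_rev last_rev)
  qed
  note ex1 = tree_path_ex1[OF C(1)]
  have ex1_leaf: "\<exists>!xs. tree_path D \<gamma> xs \<delta>" if "\<delta> \<in> comps C" for \<delta>
    using ex1[OF C(2) that] from_leaf[OF that] by (metis list.inject)
  have ex1_rev: "\<exists>!xs. tree_path D \<delta> xs \<gamma>" if "\<delta> \<in> comps C" for \<delta>
    using ex1_leaf[OF that] rev by (metis rev_rev_ident)
  have self: "tree_path D \<gamma> xs \<gamma> \<longleftrightarrow> xs = [\<gamma>]" for xs
  proof
    assume *: "tree_path D \<gamma> xs \<gamma>"
    then obtain ys where "xs = \<gamma> # ys" by (cases xs) (auto simp: tree_path_def)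
    with * show "xs = [\<gamma>]" by (cases ys rule: rev_cases) (auto simp: tree_path_def)
  qed (auto simp: D intro: tree_path_refl)
  have "\<exists>!xs. tree_path D \<alpha> xs \<delta>" if "\<alpha> \<in> comps D" "\<delta> \<in> comps D" for \<alpha> \<delta>
    using that ex1 ex1_leaf ex1_rev self D_in unfolding D(1)
    by (cases "\<alpha> = \<gamma>"; cases "\<delta> = \<gamma>") auto
  moreover have "finite (comps D)" "comps D \<noteq> {}" "adj D \<subseteq> comps D \<times> comps D" "irrefl (adj D)"
    using C unfolding D is_tree_def irrefl_def by auto
  ultimately show ?thesis using symD unfolding is_tree_def by blast
qed

section \<open>Stable curves seen from their components\<close>

lemma ex_three_distinct:
  assumes "3 \<le> card (f ` A)"
  obtains a b c where "a \<in> A" "b \<in> A" "c \<in> A" "f a \<noteq> f b" "f a \<noteq> f c" "f b \<noteq> f c"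
proof -
  obtain S where S: "S \<subseteq> f ` A" "card S = 3"
    using obtain_subset_with_card_n[OF assms] by metis
  then obtain x y z where "S = {x, y, z}" "x \<noteq> y" "y \<noteq> z" "x \<noteq> z"
    unfolding card_3_iff by blast
  with S(1) that show ?thesis by blast
qed

lemma finite_labels [simp]: "finite (labels k)"
  by (simp add: labels_def)

lemma dir_pt_eq:
  "dir_pt C \<alpha> l = (if mcomp C l = \<alpha> then mpt C l else node C \<alpha> (first_step C \<alpha> (mcomp C l)))"
  by (simp add: dir_pt_def first_step_def path_to_def)

lemma stable_curve_tree: "stable_curve k C \<Longrightarrow> is_tree C"
  by (simp add: stable_curve_def)

lemma stable_curve_mcomp: "stable_curve k C \<Longrightarrow> l \<in> labels k \<Longrightarrow> mcomp C l \<in> comps C"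
  unfolding stable_curve_def by blast

lemma stable_curve_node_inj:
  assumes "stable_curve k C" "(\<alpha>, \<beta>) \<in> adj C" "(\<alpha>, \<gamma>) \<in> adj C"
  shows "node C \<alpha> \<beta> = node C \<alpha> \<gamma> \<longleftrightarrow> \<beta> = \<gamma>"
proof -
  have "\<alpha> \<in> comps C" using adj_in_comps[OF stable_curve_tree[OF assms(1)] assms(2)] by blast
  then have "inj_on (node C \<alpha>) (adj C `` {\<alpha>})" using assms(1) unfolding stable_curve_def by blast
  from inj_on_eq_iff[OF this] show ?thesis using assms(2,3) by simp
qed

lemma stable_curve_mpt_inj:
  assumes "stable_curve k C" "l \<in> labels k" "m \<in> labels k" "mcomp C l = mcomp C m"
  shows "mpt C l = mpt C m \<longleftrightarrow> l = m"
proof -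
  have "inj_on (mpt C) (marks_on k C (mcomp C l))"
    using assms(1) stable_curve_mcomp[OF assms(1,2)] unfolding stable_curve_def by blast
  from inj_on_eq_iff[OF this] show ?thesis using assms(2-4) by (simp add: marks_on_def)
qed

lemma stable_curve_mpt_node:
  assumes "stable_curve k C" "l \<in> labels k" "(mcomp C l, \<beta>) \<in> adj C"
  shows "mpt C l \<noteq> node C (mcomp C l) \<beta>"
proof -
  have "node C (mcomp C l) ` (adj C `` {mcomp C l}) \<inter> mpt C ` marks_on k C (mcomp C l) = {}"
    using assms(1) stable_curve_mcomp[OF assms(1,2)] unfolding stable_curve_def by blast
  moreover have "l \<in> marks_on k C (mcomp C l)" "\<beta> \<in> adj C `` {mcomp C l}"
    using assms by (auto simp: marks_on_def)
  ultimately show ?thesis by (metis disjoint_iff imageI)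
qed

lemma stable_curve_card:
  "stable_curve k C \<Longrightarrow> \<alpha> \<in> comps C \<Longrightarrow>
    3 \<le> card (node C \<alpha> ` (adj C `` {\<alpha>}) \<union> mpt C ` marks_on k C \<alpha>)"
  unfolding stable_curve_def by blast

definition beyond :: "rcurve \<Rightarrow> nat \<Rightarrow> nat \<Rightarrow> label \<Rightarrow> bool" where
  "beyond C \<alpha> \<beta> l \<longleftrightarrow> mcomp C l \<noteq> \<alpha> \<and> first_step C \<alpha> (mcomp C l) = \<beta>"

lemma beyond_adj:
  assumes "stable_curve k C" "\<alpha> \<in> comps C" "l \<in> labels k" "mcomp C l \<noteq> \<alpha>"
  shows "(\<alpha>, first_step C \<alpha> (mcomp C l)) \<in> adj C"
  using path_to_first_step(1)[OF stable_curve_tree[OF assms(1)] assms(2) stable_curve_mcomp[OF assms(1,3)]]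
    assms(4) by metis

lemma beyond_swap:
  assumes "stable_curve k C" "(\<alpha>, \<beta>) \<in> adj C" "l \<in> labels k"
  shows "beyond C \<alpha> \<beta> l \<longleftrightarrow> \<not> beyond C \<beta> \<alpha> l"
  unfolding beyond_def
  by (rule first_step_adj_iff[OF stable_curve_tree[OF assms(1)] assms(2) stable_curve_mcomp[OF assms(1,3)]])

lemma dir_pt_eq_node_iff:
  assumes "stable_curve k C" "(\<alpha>, \<beta>) \<in> adj C" "l \<in> labels k"
  shows "dir_pt C \<alpha> l = node C \<alpha> \<beta> \<longleftrightarrow> beyond C \<alpha> \<beta> l"
proof (cases "mcomp C l = \<alpha>")
  case True
  then show ?thesis using stable_curve_mpt_node[OF assms(1,3)] assms(2) by (auto simp: dir_pt_eq beyond_def)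
next
  case False
  have "\<alpha> \<in> comps C" using adj_in_comps[OF stable_curve_tree[OF assms(1)] assms(2)] by blast
  from stable_curve_node_inj[OF assms(1) beyond_adj[OF assms(1) this assms(3) False] assms(2)]
  show ?thesis using False by (simp add: dir_pt_eq beyond_def)
qed

lemma dir_pt_eq_iff:
  assumes "stable_curve k C" "\<alpha> \<in> comps C" "l \<in> labels k" "m \<in> labels k" "l \<noteq> m"
  shows "dir_pt C \<alpha> l = dir_pt C \<alpha> m \<longleftrightarrow> (\<exists>\<beta>. (\<alpha>, \<beta>) \<in> adj C \<and> beyond C \<alpha> \<beta> l \<and> beyond C \<alpha> \<beta> m)"
proof (cases "mcomp C l = \<alpha>")
  case l: True
  show ?thesis
  proof (cases "mcomp C m = \<alpha>")
    case True
    then show ?thesis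
      using stable_curve_mpt_inj[OF assms(1,3,4)] l assms(5) by (auto simp: dir_pt_eq beyond_def)
  next
    case False
    have "mpt C l \<noteq> node C \<alpha> (first_step C \<alpha> (mcomp C m))"
      using stable_curve_mpt_node[OF assms(1,3)] beyond_adj[OF assms(1,2,4) False] l by metis
    with l False show ?thesis by (auto simp: dir_pt_eq beyond_def)
  qed
next
  case False
  note a = beyond_adj[OF assms(1,2,3) False]
  have "dir_pt C \<alpha> l = node C \<alpha> (first_step C \<alpha> (mcomp C l))" using False by (simp add: dir_pt_eq)
  with dir_pt_eq_node_iff[OF assms(1) a assms(4)] a False show ?thesis
    by (auto simp: beyond_def)
qed

text \<open>A component of the branch at maximal distance from \<alpha> has a single node, so
  stability puts at least two marked points on it.\<close>

lemma two_labels_beyond: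
  assumes C: "stable_curve k C" and ab: "(\<alpha>, \<beta>) \<in> adj C"
  obtains l m where "l \<in> labels k" "m \<in> labels k" "l \<noteq> m" "beyond C \<alpha> \<beta> l" "beyond C \<alpha> \<beta> m"
proof -
  note T = stable_curve_tree[OF C]
  have in_c: "\<alpha> \<in> comps C" "\<beta> \<in> comps C" "\<alpha> \<noteq> \<beta>" using adj_in_comps[OF T ab] by auto
  define B where "B = {\<gamma> \<in> comps C. \<gamma> \<noteq> \<alpha> \<and> first_step C \<alpha> \<gamma> = \<beta>}"
  let ?d = "\<lambda>\<gamma>. length (path_to C \<alpha> \<gamma>)"
  have "finite B" "B \<noteq> {}"
    using T in_c first_step_adj[OF T ab] by (auto simp: B_def is_tree_def)
  then have "Max (?d ` B) \<in> ?d ` B" by (intro Max_in) auto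
  then obtain \<gamma> where g: "\<gamma> \<in> B" "?d \<gamma> = Max (?d ` B)" by auto
  have max: "?d \<delta> \<le> ?d \<gamma>" if "\<delta> \<in> B" for \<delta>
    using that \<open>finite B\<close> g(2) by simp
  have gc: "\<gamma> \<in> comps C" "\<gamma> \<noteq> \<alpha>" "first_step C \<alpha> \<gamma> = \<beta>" using g(1) by (auto simp: B_def)
  have rev: "path_to C \<delta> \<epsilon> = rev (path_to C \<epsilon> \<delta>)" if "\<delta> \<in> comps C" "\<epsilon> \<in> comps C" for \<delta> \<epsilon>
    by (rule path_to_eqI[OF T tree_path_rev[OF T tree_path_path_to[OF T]]]) (use that in auto)
  \<comment> \<open>Any other neighbour would belong to the same branch and be farther away from
    \<alpha>.\<close>
  have leaf: "\<delta> = first_step C \<gamma> \<alpha>" if "(\<gamma>, \<delta>) \<in> adj C" for \<delta>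
  proof (rule ccontr)
    assume ne: "\<delta> \<noteq> first_step C \<gamma> \<alpha>"
    have dc: "\<delta> \<in> comps C" using adj_in_comps[OF T that] by blast
    have d: "\<alpha> \<noteq> \<delta>" "first_step C \<delta> \<alpha> = \<gamma>"
      using first_step_adj_iff[OF T that in_c(1)] ne gc(2) by auto
    have "path_to C \<delta> \<alpha> = \<delta> # path_to C \<gamma> \<alpha>"
      using path_to_first_step(2)[OF T dc in_c(1)] d by auto
    then have p: "path_to C \<alpha> \<delta> = path_to C \<alpha> \<gamma> @ [\<delta>]"
      using rev[OF dc in_c(1)] rev[OF gc(1) in_c(1)] by simp
    have "path_to C \<alpha> \<gamma> = \<alpha> # path_to C \<beta> \<gamma>" "path_to C \<beta> \<gamma> \<noteq> []"
      using path_to_first_step(2)[OF T in_c(1) gc(1)] gc tree_path_path_to[OF T in_c(2) gc(1)]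
      by (auto simp: tree_path_def)
    then have "first_step C \<alpha> \<delta> = first_step C \<alpha> \<gamma>"
      unfolding first_step_def p by (simp add: nth_append)
    then have "\<delta> \<in> B" using dc d gc by (simp add: B_def)
    from max[OF this] p show False by simp
  qed
  let ?M = "marks_on k C \<gamma>"
  have fin: "finite ?M" by (simp add: marks_on_def)
  have "node C \<gamma> ` (adj C `` {\<gamma>}) \<union> mpt C ` ?M \<subseteq> insert (node C \<gamma> (first_step C \<gamma> \<alpha>)) (mpt C ` ?M)"
    using leaf by auto
  from card_mono[OF _ this] fin have "3 \<le> card (insert (node C \<gamma> (first_step C \<gamma> \<alpha>)) (mpt C ` ?M))"
    using stable_curve_card[OF C gc(1)] by simp
  also have "\<dots> \<le> Suc (card (mpt C ` ?M))" by (rule card_insert_le_m1) simp_all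
  also have "\<dots> \<le> Suc (card ?M)" using card_image_le[OF fin] by simp
  finally have "\<not> card ?M \<le> Suc 0" by simp
  then obtain l m where "l \<in> ?M" "m \<in> ?M" "l \<noteq> m"
    using card_le_Suc0_iff_eq[OF fin] by blast
  then show ?thesis using gc by (intro that[of l m]) (simp_all add: marks_on_def beyond_def)
qed

text \<open>Every node is the direction of some marked point, by \<open>two_labels_beyond\<close>.
  Stability, which counts special points, so becomes a statement about directions of labels.\<close>

lemma three_directions:
  assumes C: "stable_curve k C" and a: "\<alpha> \<in> comps C"
  obtains l m n where "l \<in> labels k" "m \<in> labels k" "n \<in> labels k"
    "dir_pt C \<alpha> l \<noteq> dir_pt C \<alpha> m" "dir_pt C \<alpha> l \<noteq> dir_pt C \<alpha> n" "dir_pt C \<alpha> m \<noteq> dir_pt C \<alpha> n"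
proof -
  have "node C \<alpha> ` (adj C `` {\<alpha>}) \<union> mpt C ` marks_on k C \<alpha> \<subseteq> dir_pt C \<alpha> ` labels k"
  proof
    fix p assume "p \<in> node C \<alpha> ` (adj C `` {\<alpha>}) \<union> mpt C ` marks_on k C \<alpha>"
    then consider \<beta> where "(\<alpha>, \<beta>) \<in> adj C" "p = node C \<alpha> \<beta>"
      | l where "l \<in> labels k" "mcomp C l = \<alpha>" "p = mpt C l"
      by (auto simp: marks_on_def)
    then show "p \<in> dir_pt C \<alpha> ` labels k"
    proof cases
      case 1
      obtain l where "l \<in> labels k" "beyond C \<alpha> \<beta> l" using two_labels_beyond[OF C 1(1)] by metis
      then show ?thesis using dir_pt_eq_node_iff[OF C 1(1)] 1(2) by (metis imageI)
    next
      case 2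
      then show ?thesis by (intro image_eqI[of _ _ l]) (auto simp: dir_pt_eq)
    qed
  qed
  from card_mono[OF _ this] have "3 \<le> card (dir_pt C \<alpha> ` labels k)"
    using stable_curve_card[OF C a] by simp
  from ex_three_distinct[OF this] that show ?thesis by metis
qed

lemma dir_pt_toward:
  assumes C: "stable_curve k C" and a: "\<alpha> \<in> comps C" "\<beta> \<in> comps C" "\<alpha> \<noteq> \<beta>" and l: "l \<in> labels k"
  shows "dir_pt C \<alpha> l = node C \<alpha> (first_step C \<alpha> \<beta>) \<or> dir_pt C \<beta> l = node C \<beta> (first_step C \<beta> \<alpha>)"
  using first_step_toward[OF stable_curve_tree[OF C] a(1,2) stable_curve_mcomp[OF C l] a(3)]
  by (auto simp: dir_pt_eq)

text \<open>For \<alpha> \<noteq> \<beta> each of the three labels is seen from \<alpha> toward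
  \<beta> or from \<beta> toward \<alpha>. Two of the three fall into the same case and are not
  separated there.\<close>

lemma median_unique:
  assumes C: "stable_curve k C" and a: "\<alpha> \<in> comps C" "\<beta> \<in> comps C"
    and l: "l \<in> labels k" "m \<in> labels k" "n \<in> labels k"
    and "dir_pt C \<alpha> l \<noteq> dir_pt C \<alpha> m" "dir_pt C \<alpha> l \<noteq> dir_pt C \<alpha> n" "dir_pt C \<alpha> m \<noteq> dir_pt C \<alpha> n"
    and "dir_pt C \<beta> l \<noteq> dir_pt C \<beta> m" "dir_pt C \<beta> l \<noteq> dir_pt C \<beta> n" "dir_pt C \<beta> m \<noteq> dir_pt C \<beta> n"
  shows "\<alpha> = \<beta>"
  using dir_pt_toward[OF C a _ l(1)] dir_pt_toward[OF C a _ l(2)] dir_pt_toward[OF C a _ l(3)] assms(7-12)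
  by metis

text \<open>
  Among the components that separate \<open>l\<close> from \<open>m\<close>, the median is the one closest to \<open>n\<close>.
\<close>
lemma median_exists:
  assumes C: "stable_curve k C" and l: "l \<in> labels k" "m \<in> labels k" "n \<in> labels k"
    and ne: "l \<noteq> m" "l \<noteq> n" "m \<noteq> n"
  obtains \<alpha> where "\<alpha> \<in> comps C"
    "dir_pt C \<alpha> l \<noteq> dir_pt C \<alpha> m" "dir_pt C \<alpha> l \<noteq> dir_pt C \<alpha> n" "dir_pt C \<alpha> m \<noteq> dir_pt C \<alpha> n"
proof -
  note T = stable_curve_tree[OF C]
  let ?S = "\<lambda>\<alpha>. \<alpha> \<in> comps C \<and> dir_pt C \<alpha> l \<noteq> dir_pt C \<alpha> m"
  let ?d = "\<lambda>\<alpha>. length (path_to C \<alpha> (mcomp C n))"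
  have "?S (mcomp C l)"
    using stable_curve_mcomp[OF C] dir_pt_eq_iff[OF C _ l(1,2) ne(1)] l by (auto simp: beyond_def)
  then obtain \<alpha> where a: "?S \<alpha>" and min: "\<And>\<beta>. ?S \<beta> \<Longrightarrow> ?d \<alpha> \<le> ?d \<beta>"
    using ex_has_least_nat[of ?S "mcomp C l" ?d] by auto
  have *: "dir_pt C \<alpha> x \<noteq> dir_pt C \<alpha> n"
    if x: "x \<in> labels k" "y \<in> labels k" "x \<noteq> y" "x \<noteq> n" "dir_pt C \<alpha> x \<noteq> dir_pt C \<alpha> y" "{x, y} = {l, m}" for x y
  proof
    assume "dir_pt C \<alpha> x = dir_pt C \<alpha> n"
    then obtain \<beta> where b: "(\<alpha>, \<beta>) \<in> adj C" "beyond C \<alpha> \<beta> x" "beyond C \<alpha> \<beta> n"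
      using dir_pt_eq_iff[OF C _ x(1) l(3) x(4)] a by blast
    have bc: "\<beta> \<in> comps C" using adj_in_comps[OF T b(1)] by blast
    have "dir_pt C \<alpha> x = node C \<alpha> \<beta>" using dir_pt_eq_node_iff[OF C b(1) x(1)] b(2) by blast
    then have "\<not> beyond C \<alpha> \<beta> y" using dir_pt_eq_node_iff[OF C b(1) x(2)] x(5) by auto
    then have "beyond C \<beta> \<alpha> y" "\<not> beyond C \<beta> \<alpha> x"
      using beyond_swap[OF C b(1)] x(1,2) b(2) by blast+
    then have "dir_pt C \<beta> y = node C \<beta> \<alpha>" "dir_pt C \<beta> x \<noteq> node C \<beta> \<alpha>"
      using dir_pt_eq_node_iff[OF C adj_sym[OF T b(1)]] x(1,2) by blast+
    then have "dir_pt C \<beta> x \<noteq> dir_pt C \<beta> y" by simp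
    then have "?S \<beta>" using bc x(6) by (metis doubleton_eq_iff)
    moreover have "?d \<beta> < ?d \<alpha>"
      using path_to_length_less[OF T, of \<alpha> "mcomp C n"] a b(3) stable_curve_mcomp[OF C l(3)]
      by (auto simp: beyond_def)
    ultimately show False using min[of \<beta>] by simp
  qed
  show ?thesis
    using that[of \<alpha>] a *[of l m] *[of m l] l ne by (metis insert_commute)
qed

text \<open>A marked point that lies elsewhere is seen through a node, and by
  \<open>two_labels_beyond\<close> some other label is seen through the same node. The component of
  a label is thus expressed by directions alone.\<close>

lemma mcomp_iff:
  assumes C: "stable_curve k C" and a: "\<alpha> \<in> comps C" and l: "l \<in> labels k"
  shows "mcomp C l = \<alpha> \<longleftrightarrow> (\<forall>m\<in>labels k. m \<noteq> l \<longrightarrow> dir_pt C \<alpha> m \<noteq> dir_pt C \<alpha> l)"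
proof
  assume "mcomp C l = \<alpha>"
  then show "\<forall>m\<in>labels k. m \<noteq> l \<longrightarrow> dir_pt C \<alpha> m \<noteq> dir_pt C \<alpha> l"
    using dir_pt_eq_iff[OF C a _ l] by (auto simp: beyond_def)
next
  assume *: "\<forall>m\<in>labels k. m \<noteq> l \<longrightarrow> dir_pt C \<alpha> m \<noteq> dir_pt C \<alpha> l"
  show "mcomp C l = \<alpha>"
  proof (rule ccontr)
    assume ne: "mcomp C l \<noteq> \<alpha>"
    let ?\<beta> = "first_step C \<alpha> (mcomp C l)"
    note ab = beyond_adj[OF C a l ne]
    obtain m where m: "m \<in> labels k" "m \<noteq> l" "beyond C \<alpha> ?\<beta> m"
      using two_labels_beyond[OF C ab] by metis
    have "beyond C \<alpha> ?\<beta> l" using ne by (simp add: beyond_def)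
    then have "dir_pt C \<alpha> m = dir_pt C \<alpha> l" using dir_pt_eq_iff[OF C a m(1) l m(2)] ab m(3) by blast
    with * m show False by blast
  qed
qed

text \<open>An edge splits the labels into those seen through it from one end and those seen through
  it from the other. Conversely, such a splitting pins down both nodes and rules out anything
  between \<alpha> and \<beta>, so adjacency can be read off from directions as well.\<close>

lemma adj_iff:
  assumes C: "stable_curve k C" and a: "\<alpha> \<in> comps C" "\<beta> \<in> comps C" "\<alpha> \<noteq> \<beta>"
  shows "(\<forall>l\<in>labels k. (dir_pt C \<alpha> l = x) \<noteq> (dir_pt C \<beta> l = y)) \<longleftrightarrow>
    (\<alpha>, \<beta>) \<in> adj C \<and> x = node C \<alpha> \<beta> \<and> y = node C \<beta> \<alpha>" (is "?l \<longleftrightarrow> ?r")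
proof
  note T = stable_curve_tree[OF C]
  assume r: ?r
  show ?l
    using dir_pt_eq_node_iff[OF C] adj_sym[OF T] beyond_swap[OF C] r by metis
next
  note T = stable_curve_tree[OF C]
  assume l: ?l
  let ?a = "first_step C \<alpha> \<beta>" and ?b = "first_step C \<beta> \<alpha>"
  \<comment> \<open>If x' were not the node toward \<beta>', a label seen from \<alpha>' neither at
    x' nor toward \<beta>' would force y' to be the node toward \<alpha>'. A label that \<beta>'
    does not see at y' then appears from \<alpha>' at x' and also toward \<beta>', a
    contradiction.\<close>
  have *: "x' = node C \<alpha>' (first_step C \<alpha>' \<beta>')"
    if a': "\<alpha>' \<in> comps C" "\<beta>' \<in> comps C" "\<alpha>' \<noteq> \<beta>'"
      and l': "\<forall>l\<in>labels k. (dir_pt C \<alpha>' l = x') \<noteq> (dir_pt C \<beta>' l = y')" for \<alpha>' \<beta>' x' y'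
  proof (rule ccontr)
    let ?X = "node C \<alpha>' (first_step C \<alpha>' \<beta>')" and ?Y = "node C \<beta>' (first_step C \<beta>' \<alpha>')"
    assume ne: "x' \<noteq> ?X"
    note tw = dir_pt_toward[OF C a']
    obtain u where u: "u \<in> labels k" "dir_pt C \<alpha>' u \<noteq> x'" "dir_pt C \<alpha>' u \<noteq> ?X"
      using three_directions[OF C a'(1)] by metis
    then have y': "y' = ?Y" using tw[OF u(1)] l' by metis
    obtain v where v: "v \<in> labels k" "dir_pt C \<beta>' v \<noteq> y'"
      using three_directions[OF C a'(2)] by metis
    then have "dir_pt C \<alpha>' v = x'" using l' by metis
    with tw[OF v(1)] ne v(2) y' show False by auto
  qed
  have xy: "x = node C \<alpha> ?a" "y = node C \<beta> ?b"
    using *[OF a l] *[OF a(2,1) a(3)[symmetric], of y x] l by auto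
  have aa: "(\<alpha>, ?a) \<in> adj C" and ac: "?a \<in> comps C" "\<alpha> \<noteq> ?a"
    using path_to_first_step(1)[OF T a] adj_in_comps[OF T] by blast+
  \<comment> \<open>A component strictly between \<alpha> and \<beta> has a third direction, and a
    label in it is seen from both ends through the nodes that face each other.\<close>
  have "?a = \<beta>"
  proof (rule ccontr)
    assume ne: "?a \<noteq> \<beta>"
    obtain u where u: "u \<in> labels k" "dir_pt C ?a u \<noteq> node C ?a (first_step C ?a \<alpha>)"
      "dir_pt C ?a u \<noteq> node C ?a (first_step C ?a \<beta>)"
      using three_directions[OF C ac(1)] by metis
    have "dir_pt C \<alpha> u = node C \<alpha> ?a"
      using dir_pt_toward[OF C a(1) ac u(1)] u(2) first_step_adj[OF T aa] by auto
    moreover have "first_step C \<beta> ?a = ?b"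
      using first_step_toward[OF T ac(1) a(2,1) ne] first_step_back[OF T a(1,2,3) ne]
        first_step_adj[OF T adj_sym[OF T aa]] by auto
    then have "dir_pt C \<beta> u = node C \<beta> ?b"
      using dir_pt_toward[OF C ac(1) a(2) ne u(1)] u(3) by auto
    ultimately show False using l u(1) xy by auto
  qed
  then show ?r using xy aa first_step_adj[OF T adj_sym[OF T aa]] by simp
qed

text \<open>Each label is seen at x from the first component or at y from the second. As no three
  may coincide in either view, the labels split two and two, and both cross-ratios take the same
  value among 0, 1 and infinity.\<close>

lemma cross_ratio_two_views:
  assumes "d1 = x \<or> e1 = y" "d2 = x \<or> e2 = y" "d3 = x \<or> e3 = y" "d4 = x \<or> e4 = y"
    and "nondeg4 d1 d2 d3 d4" "nondeg4 e1 e2 e3 e4"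
  shows "cross_ratio d1 d2 d3 d4 = cross_ratio e1 e2 e3 e4"
proof -
  consider "d1 = x" "d2 = x" "e3 = y" "e4 = y" | "d3 = x" "d4 = x" "e1 = y" "e2 = y"
    | "d1 = x" "d4 = x" "e2 = y" "e3 = y" | "d2 = x" "d3 = x" "e1 = y" "e4 = y"
    | "d1 = x" "d3 = x" "e2 = y" "e4 = y" | "d2 = x" "d4 = x" "e1 = y" "e3 = y"
    using assms unfolding nondeg4_def by metis
  then show ?thesis
    using assms(5,6) by cases (auto simp: nondeg4_iff cross_ratio_def proj_pt_def)
qed

lemma cross_ratio_comp_indep:
  assumes C: "stable_curve k C" and a: "\<alpha> \<in> comps C" "\<beta> \<in> comps C" and l: "{l1, l2, l3, l4} \<subseteq> labels k"
    and n: "nondeg4 (dir_pt C \<alpha> l1) (dir_pt C \<alpha> l2) (dir_pt C \<alpha> l3) (dir_pt C \<alpha> l4)"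
      "nondeg4 (dir_pt C \<beta> l1) (dir_pt C \<beta> l2) (dir_pt C \<beta> l3) (dir_pt C \<beta> l4)"
  shows "cross_ratio (dir_pt C \<alpha> l1) (dir_pt C \<alpha> l2) (dir_pt C \<alpha> l3) (dir_pt C \<alpha> l4) =
    cross_ratio (dir_pt C \<beta> l1) (dir_pt C \<beta> l2) (dir_pt C \<beta> l3) (dir_pt C \<beta> l4)"
proof (cases "\<alpha> = \<beta>")
  case False
  note t = dir_pt_toward[OF C a False]
  show ?thesis by (rule cross_ratio_two_views[OF t t t t n]) (use l in auto)
qed simp

section \<open>Isomorphism classes and cross-ratios\<close>

abbreviation cr :: "rcurve \<Rightarrow> label \<Rightarrow> label \<Rightarrow> label \<Rightarrow> label \<Rightarrow> csphere" where
  "cr C \<equiv> curve_cross_ratio {C}"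

lemma quadruples_iff:
  "(l1, l2, l3, l4) \<in> quadruples k \<longleftrightarrow> {l1, l2, l3, l4} \<subseteq> labels k \<and> distinct [l1, l2, l3, l4]"
  by (simp add: quadruples_def)

lemma quadruple_comp:
  assumes "stable_curve k C" "(l1, l2, l3, l4) \<in> quadruples k"
  obtains \<alpha> where "\<alpha> \<in> comps C" "3 \<le> card (dir_pt C \<alpha> ` {l1, l2, l3, l4})"
    "nondeg4 (dir_pt C \<alpha> l1) (dir_pt C \<alpha> l2) (dir_pt C \<alpha> l3) (dir_pt C \<alpha> l4)"
proof -
  have "l1 \<in> labels k" "l2 \<in> labels k" "l3 \<in> labels k" "l1 \<noteq> l2" "l1 \<noteq> l3" "l2 \<noteq> l3"
    using assms(2) by (auto simp: quadruples_iff)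
  from median_exists[OF assms(1) this] obtain \<alpha> where a: "\<alpha> \<in> comps C"
    "dir_pt C \<alpha> l1 \<noteq> dir_pt C \<alpha> l2" "dir_pt C \<alpha> l1 \<noteq> dir_pt C \<alpha> l3" "dir_pt C \<alpha> l2 \<noteq> dir_pt C \<alpha> l3"
    by metis
  have "3 = card {dir_pt C \<alpha> l1, dir_pt C \<alpha> l2, dir_pt C \<alpha> l3}" using a by auto
  also have "\<dots> \<le> card (dir_pt C \<alpha> ` {l1, l2, l3, l4})" by (rule card_mono) auto
  finally have 3: "3 \<le> card (dir_pt C \<alpha> ` {l1, l2, l3, l4})" .
  then show ?thesis using that a(1) card_ge_3_imp_nondeg4 by simp
qed

lemma cr_eqI:
  assumes C: "stable_curve k C" and q: "(l1, l2, l3, l4) \<in> quadruples k" and a: "\<alpha> \<in> comps C"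
    and n: "nondeg4 (dir_pt C \<alpha> l1) (dir_pt C \<alpha> l2) (dir_pt C \<alpha> l3) (dir_pt C \<alpha> l4)"
  shows "cr C l1 l2 l3 l4 = cross_ratio (dir_pt C \<alpha> l1) (dir_pt C \<alpha> l2) (dir_pt C \<alpha> l3) (dir_pt C \<alpha> l4)"
proof -
  have l: "{l1, l2, l3, l4} \<subseteq> labels k" using q by (simp add: quadruples_iff)
  obtain \<beta> where b: "\<beta> \<in> comps C" "3 \<le> card (dir_pt C \<beta> ` {l1, l2, l3, l4})"
    "nondeg4 (dir_pt C \<beta> l1) (dir_pt C \<beta> l2) (dir_pt C \<beta> l3) (dir_pt C \<beta> l4)"
    using quadruple_comp[OF C q] .
  show ?thesis
    unfolding curve_cross_ratio_def
  proof (rule the_equality)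
    show "\<exists>E\<in>{C}. \<exists>\<alpha>'\<in>comps E. 3 \<le> card (dir_pt E \<alpha>' ` {l1, l2, l3, l4}) \<and>
        cross_ratio (dir_pt C \<alpha> l1) (dir_pt C \<alpha> l2) (dir_pt C \<alpha> l3) (dir_pt C \<alpha> l4) =
        cross_ratio (dir_pt E \<alpha>' l1) (dir_pt E \<alpha>' l2) (dir_pt E \<alpha>' l3) (dir_pt E \<alpha>' l4)"
      using b cross_ratio_comp_indep[OF C a b(1) l n b(3)] by blast
  next
    fix w
    assume "\<exists>C\<in>{C}. \<exists>\<alpha>\<in>comps C. 3 \<le> card (dir_pt C \<alpha> ` {l1, l2, l3, l4}) \<and>
        w = cross_ratio (dir_pt C \<alpha> l1) (dir_pt C \<alpha> l2) (dir_pt C \<alpha> l3) (dir_pt C \<alpha> l4)"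
    then obtain \<gamma> where g: "\<gamma> \<in> comps C" "3 \<le> card (dir_pt C \<gamma> ` {l1, l2, l3, l4})"
      "w = cross_ratio (dir_pt C \<gamma> l1) (dir_pt C \<gamma> l2) (dir_pt C \<gamma> l3) (dir_pt C \<gamma> l4)" by blast
    have "nondeg4 (dir_pt C \<gamma> l1) (dir_pt C \<gamma> l2) (dir_pt C \<gamma> l3) (dir_pt C \<gamma> l4)"
      using g(2) by (intro card_ge_3_imp_nondeg4) simp
    from cross_ratio_comp_indep[OF C g(1) a l this n] g(3)
    show "w = cross_ratio (dir_pt C \<alpha> l1) (dir_pt C \<alpha> l2) (dir_pt C \<alpha> l3) (dir_pt C \<alpha> l4)" by simp
  qed
qed

lemma cr_eq_of_views:
  assumes C: "stable_curve k C" and D: "stable_curve k D"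
    and v: "\<And>\<alpha>. \<alpha> \<in> comps C \<Longrightarrow> \<exists>\<beta>\<in>comps D. \<exists>g. mobius g \<and> (\<forall>l\<in>labels k. dir_pt D \<beta> l = g (dir_pt C \<alpha> l))"
    and q: "(l1, l2, l3, l4) \<in> quadruples k"
  shows "cr C l1 l2 l3 l4 = cr D l1 l2 l3 l4"
proof -
  obtain \<alpha> where a: "\<alpha> \<in> comps C"
    "nondeg4 (dir_pt C \<alpha> l1) (dir_pt C \<alpha> l2) (dir_pt C \<alpha> l3) (dir_pt C \<alpha> l4)"
    using quadruple_comp[OF C q] by metis
  obtain \<beta> g where b: "\<beta> \<in> comps D" "mobius g" "\<And>l. l \<in> labels k \<Longrightarrow> dir_pt D \<beta> l = g (dir_pt C \<alpha> l)"
    using v[OF a(1)] by blast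
  have l: "dir_pt D \<beta> l1 = g (dir_pt C \<alpha> l1)" "dir_pt D \<beta> l2 = g (dir_pt C \<alpha> l2)"
    "dir_pt D \<beta> l3 = g (dir_pt C \<alpha> l3)" "dir_pt D \<beta> l4 = g (dir_pt C \<alpha> l4)"
    using q b(3) by (auto simp: quadruples_iff)
  have "nondeg4 (dir_pt D \<beta> l1) (dir_pt D \<beta> l2) (dir_pt D \<beta> l3) (dir_pt D \<beta> l4)"
    unfolding l nondeg4_mobius[OF b(2)] by (rule a(2))
  from cr_eqI[OF D q b(1) this] cr_eqI[OF C q a] show ?thesis
    unfolding l cross_ratio_mobius[OF b(2)] by simp
qed

lemma real_iso_dir_pt:
  assumes C: "stable_curve k C" and D: "stable_curve k D"
    and f: "bij_betw f (comps C) (comps D)"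
      "\<And>\<alpha> \<beta>. \<alpha> \<in> comps C \<Longrightarrow> \<beta> \<in> comps C \<Longrightarrow> (\<alpha>, \<beta>) \<in> adj C \<longleftrightarrow> (f \<alpha>, f \<beta>) \<in> adj D"
    and g: "\<And>\<alpha> \<beta>. (\<alpha>, \<beta>) \<in> adj C \<Longrightarrow> \<phi> \<alpha> (node C \<alpha> \<beta>) = node D (f \<alpha>) (f \<beta>)"
    and m: "\<And>l. l \<in> labels k \<Longrightarrow> f (mcomp C l) = mcomp D l \<and> \<phi> (mcomp C l) (mpt C l) = mpt D l"
    and a: "\<alpha> \<in> comps C" and l: "l \<in> labels k"
  shows "dir_pt D (f \<alpha>) l = \<phi> \<alpha> (dir_pt C \<alpha> l)"
proof (cases "mcomp C l = \<alpha>")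
  case True
  then show ?thesis using m[OF l] by (auto simp: dir_pt_eq)
next
  case False
  have inj: "inj_on f (comps C)" and im: "f ` comps C = comps D" using f(1) by (auto simp: bij_betw_def)
  note mc = stable_curve_mcomp[OF C l]
  have ne: "mcomp D l \<noteq> f \<alpha>" using m[OF l] False inj_onD[OF inj _ mc a] by metis
  have path: "tree_path D (f \<alpha>) (map f xs) (f \<beta>)" if "tree_path C \<alpha> xs \<beta>" for xs \<beta>
  proof -
    have sub: "set xs \<subseteq> comps C" and suc: "successively (\<lambda>x y. (x, y) \<in> adj C) xs"
      and "distinct xs" "xs \<noteq> []" "hd xs = \<alpha>" "last xs = \<beta>"
      using that by (auto simp: tree_path_def)
    moreover have "successively (\<lambda>x y. (f x, f y) \<in> adj D) xs"
      using suc by (rule successively_mono) (use sub f(2) in auto)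
    ultimately show ?thesis
      using inj im by (auto simp: tree_path_def distinct_map hd_map last_map successively_map inj_on_subset)
  qed
  let ?p = "path_to C \<alpha> (mcomp C l)"
  have p: "tree_path C \<alpha> ?p (mcomp C l)" by (rule tree_path_path_to[OF stable_curve_tree[OF C] a mc])
  have "length ?p > 1" using p False by (cases ?p; cases "tl ?p") (auto simp: tree_path_def)
  moreover have "path_to D (f \<alpha>) (mcomp D l) = map f ?p"
    using path_to_eqI[OF stable_curve_tree[OF D] path[OF p]] m[OF l] by simp
  ultimately have "first_step D (f \<alpha>) (mcomp D l) = f (first_step C \<alpha> (mcomp C l))"
    by (simp add: first_step_def)
  with g[OF beyond_adj[OF C a l False]] False ne show ?thesis by (simp add: dir_pt_eq)
qed

lemma real_curve_stable: "real_curve k C \<Longrightarrow> stable_curve k C"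
  by (simp add: real_curve_def)

lemma real_curve_icomp:
  assumes "real_curve k C" "\<alpha> \<in> comps C"
  shows "icomp C \<alpha> \<in> comps C" "icomp C (icomp C \<alpha>) = \<alpha>" "antimobius (imap C \<alpha>)"
    "imap C (icomp C \<alpha>) (imap C \<alpha> z) = z"
  using assms unfolding real_curve_def real_involution_def by blast+

lemma real_curve_adj:
  assumes "real_curve k C" "(\<alpha>, \<beta>) \<in> adj C"
  shows "(icomp C \<alpha>, icomp C \<beta>) \<in> adj C" "imap C \<alpha> (node C \<alpha> \<beta>) = node C (icomp C \<alpha>) (icomp C \<beta>)"
  using assms unfolding real_curve_def real_involution_def by blast+

lemma real_curve_mark:
  assumes "real_curve k C" "(i, s) \<in> labels k"
  shows "icomp C (mcomp C (i, s)) = mcomp C (i, \<not> s)"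
    "imap C (mcomp C (i, s)) (mpt C (i, s)) = mpt C (i, \<not> s)"
  using assms unfolding real_curve_def real_involution_def by blast+

lemma labels_conj [simp]: "(i, \<not> s) \<in> labels k \<longleftrightarrow> (i, s) \<in> labels k"
  by (auto simp: labels_def)

text \<open>The involution is an automorphism of the tree, so it maps the path to a marked point to
  the path to its conjugate.\<close>

lemma real_curve_dir_pt_conj:
  assumes C: "real_curve k C" and a: "\<alpha> \<in> comps C" and l: "(i, s) \<in> labels k"
  shows "dir_pt C (icomp C \<alpha>) (i, \<not> s) = imap C \<alpha> (dir_pt C \<alpha> (i, s))"
proof -
  note S = real_curve_stable[OF C]
  note T = stable_curve_tree[OF S]
  have bij: "icomp C x = icomp C y \<longleftrightarrow> x = y" if "x \<in> comps C" "y \<in> comps C" for x y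
    using real_curve_icomp(2)[OF C] that by metis
  note mc = stable_curve_mcomp[OF S l]
  note mk = real_curve_mark[OF C l]
  show ?thesis
  proof (cases "mcomp C (i, s) = \<alpha>")
    case True
    then show ?thesis using mk by (auto simp: dir_pt_eq)
  next
    case False
    have path: "tree_path C (icomp C \<alpha>) (map (icomp C) xs) (icomp C \<beta>)" if "tree_path C \<alpha> xs \<beta>" for xs \<beta>
    proof -
      have sub: "set xs \<subseteq> comps C" and suc: "successively (\<lambda>x y. (x, y) \<in> adj C) xs"
        and "distinct xs" "xs \<noteq> []" "hd xs = \<alpha>" "last xs = \<beta>"
        using that by (auto simp: tree_path_def)
      moreover have "successively (\<lambda>x y. (icomp C x, icomp C y) \<in> adj C) xs"
        using suc by (rule successively_mono) (use real_curve_adj(1)[OF C] in auto)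
      moreover have "inj_on (icomp C) (set xs)" using bij sub by (auto simp: inj_on_def)
      moreover have "icomp C ` set xs \<subseteq> comps C" using real_curve_icomp(1)[OF C] sub by auto
      ultimately show ?thesis
        by (auto simp: tree_path_def distinct_map hd_map last_map successively_map)
    qed
    let ?p = "path_to C \<alpha> (mcomp C (i, s))"
    have p: "tree_path C \<alpha> ?p (mcomp C (i, s))" by (rule tree_path_path_to[OF T a mc])
    have "length ?p > 1" using p False by (cases ?p; cases "tl ?p") (auto simp: tree_path_def)
    moreover have "path_to C (icomp C \<alpha>) (mcomp C (i, \<not> s)) = map (icomp C) ?p"
      using path_to_eqI[OF T path[OF p]] mk by simp
    ultimately have "first_step C (icomp C \<alpha>) (mcomp C (i, \<not> s)) = icomp C (first_step C \<alpha> (mcomp C (i, s)))"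
      by (simp add: first_step_def)
    moreover have "mcomp C (i, \<not> s) \<noteq> icomp C \<alpha>" using bij[OF mc a] mk False by metis
    ultimately show ?thesis
      using real_curve_adj(2)[OF C beyond_adj[OF S a l False]] False by (simp add: dir_pt_eq)
  qed
qed

text \<open>The Moebius map that matches one separated triple matches every fourth label, since its
  position is given by a cross-ratio with the triple.\<close>

lemma cr_triple:
  assumes C: "stable_curve k C" "\<alpha> \<in> comps C" and D: "stable_curve k D" "\<beta> \<in> comps D"
    and same: "\<And>l1 l2 l3 l4. (l1, l2, l3, l4) \<in> quadruples k \<Longrightarrow> cr C l1 l2 l3 l4 = cr D l1 l2 l3 l4"
    and l: "a \<in> labels k" "b \<in> labels k" "c \<in> labels k"
    and dC: "dir_pt C \<alpha> a \<noteq> dir_pt C \<alpha> b" "dir_pt C \<alpha> a \<noteq> dir_pt C \<alpha> c" "dir_pt C \<alpha> b \<noteq> dir_pt C \<alpha> c"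
    and dD: "dir_pt D \<beta> a \<noteq> dir_pt D \<beta> b" "dir_pt D \<beta> a \<noteq> dir_pt D \<beta> c" "dir_pt D \<beta> b \<noteq> dir_pt D \<beta> c"
  obtains g where "mobius g" "\<And>l. l \<in> labels k \<Longrightarrow> dir_pt D \<beta> l = g (dir_pt C \<alpha> l)"
proof -
  obtain g where g: "mobius g" "g (dir_pt C \<alpha> a) = dir_pt D \<beta> a" "g (dir_pt C \<alpha> b) = dir_pt D \<beta> b"
    "g (dir_pt C \<alpha> c) = dir_pt D \<beta> c"
    "\<And>w w'. cross_ratio (dir_pt C \<alpha> a) (dir_pt C \<alpha> b) (dir_pt C \<alpha> c) w =
      cross_ratio (dir_pt D \<beta> a) (dir_pt D \<beta> b) (dir_pt D \<beta> c) w' \<Longrightarrow> g w = w'"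
    using mobius_transport[OF dC dD] by metis
  have "dir_pt D \<beta> l = g (dir_pt C \<alpha> l)" if "l \<in> labels k" for l
  proof (cases "l \<in> {a, b, c}")
    case False
    have q: "(a, b, c, l) \<in> quadruples k" using False that l dC by (auto simp: quadruples_iff)
    have "cr C a b c l = cross_ratio (dir_pt C \<alpha> a) (dir_pt C \<alpha> b) (dir_pt C \<alpha> c) (dir_pt C \<alpha> l)"
      by (rule cr_eqI[OF C(1) q C(2)]) (use dC in \<open>auto simp: nondeg4_def\<close>)
    moreover have "cr D a b c l = cross_ratio (dir_pt D \<beta> a) (dir_pt D \<beta> b) (dir_pt D \<beta> c) (dir_pt D \<beta> l)"
      by (rule cr_eqI[OF D(1) q D(2)]) (use dD in \<open>auto simp: nondeg4_def\<close>)
    ultimately show ?thesis using g(5) same[OF q] by metis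
  qed (use g in auto)
  with g(1) that show ?thesis by metis
qed

text \<open>
  A component corresponds to the triples of marked points of which it is the median, so both the
  components and the positions of the special points on them can be recovered from the cross-ratios.
\<close>
theorem real_iso_iff:
  "(C, D) \<in> real_iso k \<longleftrightarrow> real_curve k C \<and> real_curve k D \<and>
    (\<forall>l1 l2 l3 l4. (l1, l2, l3, l4) \<in> quadruples k \<longrightarrow> cr C l1 l2 l3 l4 = cr D l1 l2 l3 l4)" (is "?l \<longleftrightarrow> ?r")
proof
  assume ?l
  then obtain f \<phi> where R: "real_curve k C" "real_curve k D"
    and f: "bij_betw f (comps C) (comps D)" "\<forall>\<alpha>\<in>comps C. mobius (\<phi> \<alpha>)"
      "\<forall>\<alpha>\<in>comps C. \<forall>\<beta>\<in>comps C. (\<alpha>, \<beta>) \<in> adj C \<longleftrightarrow> (f \<alpha>, f \<beta>) \<in> adj D"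
      "\<forall>(\<alpha>, \<beta>)\<in>adj C. \<phi> \<alpha> (node C \<alpha> \<beta>) = node D (f \<alpha>) (f \<beta>)"
      "\<forall>l\<in>labels k. f (mcomp C l) = mcomp D l \<and> \<phi> (mcomp C l) (mpt C l) = mpt D l"
    unfolding real_iso_def by auto
  note S = real_curve_stable[OF R(1)] real_curve_stable[OF R(2)]
  have "dir_pt D (f \<alpha>) l = \<phi> \<alpha> (dir_pt C \<alpha> l)" if "\<alpha> \<in> comps C" "l \<in> labels k" for \<alpha> l
    by (rule real_iso_dir_pt[OF S f(1)]) (use f that in auto)
  moreover have "f \<alpha> \<in> comps D" if "\<alpha> \<in> comps C" for \<alpha> using f(1) that by (auto simp: bij_betw_def)
  ultimately have "\<exists>\<beta>\<in>comps D. \<exists>g. mobius g \<and> (\<forall>l\<in>labels k. dir_pt D \<beta> l = g (dir_pt C \<alpha> l))"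
    if "\<alpha> \<in> comps C" for \<alpha> using f(2) that by blast
  from cr_eq_of_views[OF S this] R show ?r by auto
next
  assume r: ?r
  then have R: "real_curve k C" "real_curve k D"
    and same: "\<And>l1 l2 l3 l4. (l1, l2, l3, l4) \<in> quadruples k \<Longrightarrow> cr C l1 l2 l3 l4 = cr D l1 l2 l3 l4"
    by auto
  note S = real_curve_stable[OF R(1)] real_curve_stable[OF R(2)]
  define sep where "sep = (\<lambda>E \<alpha> a b c. dir_pt E \<alpha> a \<noteq> dir_pt E \<alpha> b \<and> dir_pt E \<alpha> a \<noteq> dir_pt E \<alpha> c \<and>
    dir_pt E \<alpha> b \<noteq> dir_pt E \<alpha> c)"
  have match: "\<exists>\<beta>\<in>comps E'. \<exists>g. mobius g \<and> (\<forall>l\<in>labels k. dir_pt E' \<beta> l = g (dir_pt E \<alpha> l))"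
    if E: "stable_curve k E" "stable_curve k E'" "\<alpha> \<in> comps E"
      and same': "\<And>l1 l2 l3 l4. (l1, l2, l3, l4) \<in> quadruples k \<Longrightarrow> cr E l1 l2 l3 l4 = cr E' l1 l2 l3 l4"
    for E E' \<alpha>
  proof -
    obtain a b c where l: "a \<in> labels k" "b \<in> labels k" "c \<in> labels k"
      and s: "dir_pt E \<alpha> a \<noteq> dir_pt E \<alpha> b" "dir_pt E \<alpha> a \<noteq> dir_pt E \<alpha> c" "dir_pt E \<alpha> b \<noteq> dir_pt E \<alpha> c"
      using three_directions[OF E(1,3)] by metis
    have "a \<noteq> b" "a \<noteq> c" "b \<noteq> c" using s by auto
    from median_exists[OF E(2) l this] obtain \<beta> where b: "\<beta> \<in> comps E'"
      "dir_pt E' \<beta> a \<noteq> dir_pt E' \<beta> b" "dir_pt E' \<beta> a \<noteq> dir_pt E' \<beta> c" "dir_pt E' \<beta> b \<noteq> dir_pt E' \<beta> c"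
      by metis
    show ?thesis
    proof (rule cr_triple[OF E(1,3,2) b(1) same' l s b(2-4)])
      fix g assume "mobius g" "\<And>l. l \<in> labels k \<Longrightarrow> dir_pt E' \<beta> l = g (dir_pt E \<alpha> l)"
      with b(1) show ?thesis by (intro bexI[of _ \<beta>] exI[of _ g]) simp_all
    qed
  qed
  from match[OF S _ same] obtain f \<phi> where f: "\<And>\<alpha>. \<alpha> \<in> comps C \<Longrightarrow> f \<alpha> \<in> comps D"
    and \<phi>: "\<And>\<alpha>. \<alpha> \<in> comps C \<Longrightarrow> mobius (\<phi> \<alpha>)"
    and fd: "\<And>\<alpha> l. \<alpha> \<in> comps C \<Longrightarrow> l \<in> labels k \<Longrightarrow> dir_pt D (f \<alpha>) l = \<phi> \<alpha> (dir_pt C \<alpha> l)"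
    by metis
  \<comment> \<open>A component is determined by which labels it sees in the same direction: a
    triple separated at \<alpha> is then separated at \<beta>, and medians are unique.\<close>
  have uniq: "\<alpha> = \<beta>"
    if E: "stable_curve k E" "\<alpha> \<in> comps E" "\<beta> \<in> comps E"
      and eq: "\<And>l m. l \<in> labels k \<Longrightarrow> m \<in> labels k \<Longrightarrow>
        dir_pt E \<alpha> l = dir_pt E \<alpha> m \<longleftrightarrow> dir_pt E \<beta> l = dir_pt E \<beta> m" for E \<alpha> \<beta>
  proof -
    obtain a b c where l: "a \<in> labels k" "b \<in> labels k" "c \<in> labels k"
      and s: "dir_pt E \<alpha> a \<noteq> dir_pt E \<alpha> b" "dir_pt E \<alpha> a \<noteq> dir_pt E \<alpha> c" "dir_pt E \<alpha> b \<noteq> dir_pt E \<alpha> c"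
      using three_directions[OF E(1,2)] by metis
    show ?thesis by (rule median_unique[OF E l s]) (use eq l s in auto)
  qed
  have inj: "inj_on f (comps C)"
  proof (rule inj_onI)
    fix \<alpha> \<beta> assume ab: "\<alpha> \<in> comps C" "\<beta> \<in> comps C" "f \<alpha> = f \<beta>"
    show "\<alpha> = \<beta>"
      by (rule uniq[OF S(1) ab(1,2)]) (use ab fd \<phi> in \<open>metis mobius_eq_iff\<close>)
  qed
  have im: "f ` comps C = comps D"
  proof (intro equalityI subsetI)
    fix \<beta> assume b: "\<beta> \<in> comps D"
    obtain \<alpha> g where a: "\<alpha> \<in> comps C" "mobius g" "\<And>l. l \<in> labels k \<Longrightarrow> dir_pt C \<alpha> l = g (dir_pt D \<beta> l)"
      using match[OF S(2,1) b same[symmetric]] by blast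
    have "f \<alpha> = \<beta>"
      by (rule uniq[OF S(2) f[OF a(1)] b]) (use a fd[OF a(1)] \<phi>[OF a(1)] in \<open>simp add: mobius_eq_iff\<close>)
    with a(1) show "\<beta> \<in> f ` comps C" by blast
  qed (use f in auto)
  have feq: "f \<alpha> = f \<beta> \<longleftrightarrow> \<alpha> = \<beta>" if "\<alpha> \<in> comps C" "\<beta> \<in> comps C" for \<alpha> \<beta>
    using inj that by (auto simp: inj_on_def)
  have marks: "f (mcomp C l) = mcomp D l" if l: "l \<in> labels k" for l
  proof -
    note mc = stable_curve_mcomp[OF S(1) l]
    have "\<forall>m\<in>labels k. m \<noteq> l \<longrightarrow> dir_pt C (mcomp C l) m \<noteq> dir_pt C (mcomp C l) l"
      using mcomp_iff[OF S(1) mc l] by simp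
    then have "\<forall>m\<in>labels k. m \<noteq> l \<longrightarrow> dir_pt D (f (mcomp C l)) m \<noteq> dir_pt D (f (mcomp C l)) l"
      using fd[OF mc] \<phi>[OF mc] l by (simp add: mobius_eq_iff)
    then show ?thesis using mcomp_iff[OF S(2) f[OF mc] l] by simp
  qed
  have mpts: "\<phi> (mcomp C l) (mpt C l) = mpt D l" if l: "l \<in> labels k" for l
    using fd[OF stable_curve_mcomp[OF S(1) l] l] marks[OF l] by (simp add: dir_pt_eq)
  have sur: "\<exists>x'. \<phi> \<alpha> x' = x" if "\<alpha> \<in> comps C" for \<alpha> x
    using mobius_bij[OF \<phi>[OF that]] by (metis bij_pointE)
  have adj1: "(f \<alpha>, f \<beta>) \<in> adj D \<and> \<phi> \<alpha> (node C \<alpha> \<beta>) = node D (f \<alpha>) (f \<beta>)" if "(\<alpha>, \<beta>) \<in> adj C" for \<alpha> \<beta>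
  proof -
    have ab: "\<alpha> \<in> comps C" "\<beta> \<in> comps C" "\<alpha> \<noteq> \<beta>"
      using adj_in_comps[OF stable_curve_tree[OF S(1)] that] by auto
    then have fab: "f \<alpha> \<noteq> f \<beta>" using feq by auto
    have "\<forall>l\<in>labels k. (dir_pt C \<alpha> l = node C \<alpha> \<beta>) \<noteq> (dir_pt C \<beta> l = node C \<beta> \<alpha>)"
      using adj_iff[OF S(1) ab] that by blast
    then have "\<forall>l\<in>labels k. (dir_pt D (f \<alpha>) l = \<phi> \<alpha> (node C \<alpha> \<beta>)) \<noteq> (dir_pt D (f \<beta>) l = \<phi> \<beta> (node C \<beta> \<alpha>))"
      using fd ab \<phi> by (simp add: mobius_eq_iff)
    then show ?thesis using adj_iff[OF S(2) f[OF ab(1)] f[OF ab(2)] fab] by blast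
  qed
  have adj2: "(\<alpha>, \<beta>) \<in> adj C" if ab: "\<alpha> \<in> comps C" "\<beta> \<in> comps C" and fab: "(f \<alpha>, f \<beta>) \<in> adj D" for \<alpha> \<beta>
  proof -
    have ne: "f \<alpha> \<noteq> f \<beta>" "\<alpha> \<noteq> \<beta>"
      using adj_in_comps[OF stable_curve_tree[OF S(2)] fab] by auto
    obtain x y where xy: "\<phi> \<alpha> x = node D (f \<alpha>) (f \<beta>)" "\<phi> \<beta> y = node D (f \<beta>) (f \<alpha>)"
      using sur ab by metis
    have "\<forall>l\<in>labels k. (dir_pt D (f \<alpha>) l = \<phi> \<alpha> x) \<noteq> (dir_pt D (f \<beta>) l = \<phi> \<beta> y)"
      using adj_iff[OF S(2) f[OF ab(1)] f[OF ab(2)] ne(1)] fab xy by simp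
    then have "\<forall>l\<in>labels k. (dir_pt C \<alpha> l = x) \<noteq> (dir_pt C \<beta> l = y)"
      using fd ab \<phi> by (simp add: mobius_eq_iff)
    then show ?thesis using adj_iff[OF S(1) ab ne(2)] by blast
  qed
  have inv: "f (icomp C \<alpha>) = icomp D (f \<alpha>) \<and> (\<forall>z. \<phi> (icomp C \<alpha>) (imap C \<alpha> z) = imap D (f \<alpha>) (\<phi> \<alpha> z))"
    if a: "\<alpha> \<in> comps C" for \<alpha>
  proof -
    note ia = real_curve_icomp[OF R(1) a] and ifa = real_curve_icomp[OF R(2) f[OF a]]
    have d: "dir_pt D (f (icomp C \<alpha>)) (i, s) = \<phi> (icomp C \<alpha>) (imap C \<alpha> (dir_pt C \<alpha> (i, \<not> s)))"
      "dir_pt D (icomp D (f \<alpha>)) (i, s) = imap D (f \<alpha>) (\<phi> \<alpha> (dir_pt C \<alpha> (i, \<not> s)))"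
      if "(i, s) \<in> labels k" for i s
      using fd[OF ia(1) that] real_curve_dir_pt_conj[OF R(1) a, of i "\<not> s"]
        real_curve_dir_pt_conj[OF R(2) f[OF a], of i "\<not> s"] fd[OF a, of "(i, \<not> s)"] that by auto
    have c: "f (icomp C \<alpha>) = icomp D (f \<alpha>)"
    proof (rule uniq[OF S(2) f[OF ia(1)] ifa(1)])
      fix l m :: label assume lm: "l \<in> labels k" "m \<in> labels k"
      obtain i s j t where "l = (i, s)" "m = (j, t)" by (cases l; cases m)
      with lm show "dir_pt D (f (icomp C \<alpha>)) l = dir_pt D (f (icomp C \<alpha>)) m \<longleftrightarrow>
          dir_pt D (icomp D (f \<alpha>)) l = dir_pt D (icomp D (f \<alpha>)) m"
        by (simp add: d mobius_eq_iff[OF \<phi>[OF ia(1)]] mobius_eq_iff[OF \<phi>[OF a]]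
            antimobius_eq_iff[OF ia(3)] antimobius_eq_iff[OF ifa(3)])
    qed
    obtain a1 a2 a3 where l: "a1 \<in> labels k" "a2 \<in> labels k" "a3 \<in> labels k"
      and s: "dir_pt C \<alpha> a1 \<noteq> dir_pt C \<alpha> a2" "dir_pt C \<alpha> a1 \<noteq> dir_pt C \<alpha> a3" "dir_pt C \<alpha> a2 \<noteq> dir_pt C \<alpha> a3"
      using three_directions[OF S(1) a] by metis
    have e: "(\<phi> (icomp C \<alpha>) \<circ> imap C \<alpha>) (dir_pt C \<alpha> l) = (imap D (f \<alpha>) \<circ> \<phi> \<alpha>) (dir_pt C \<alpha> l)"
      if "l \<in> labels k" for l
      using d[of "fst l" "\<not> snd l"] c that by simp
    \<comment> \<open>Both sides are anti-Moebius, and they agree at the three separated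
      directions.\<close>
    have "\<phi> (icomp C \<alpha>) \<circ> imap C \<alpha> = imap D (f \<alpha>) \<circ> \<phi> \<alpha>"
      by (rule antimobius_eqI[OF _ _ s e[OF l(1)] e[OF l(2)] e[OF l(3)]])
        (intro antimobius_comp \<phi> a ia ifa)+
    with c show ?thesis by (auto simp: fun_eq_iff)
  qed
  have "bij_betw f (comps C) (comps D)" using inj im by (simp add: bij_betw_def)
  then show ?l
    unfolding real_iso_def using R \<phi> adj1 adj2 marks mpts inv
    by (intro CollectI case_prodI conjI exI[of _ f] exI[of _ \<phi>]) auto
qed

lemma equiv_real_iso: "equiv (Collect (real_curve k)) (real_iso k)"
proof (rule equivI)
  show "trans (real_iso k)" unfolding real_iso_iff trans_def by metis
  show "sym (real_iso k)" unfolding real_iso_iff sym_def by metis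
  show "refl_on (Collect (real_curve k)) (real_iso k)" unfolding real_iso_iff refl_on_def by simp
  show "real_iso k \<subseteq> Collect (real_curve k) \<times> Collect (real_curve k)"
    by (auto simp: real_iso_def)
qed

lemma curve_cross_ratio_class:
  assumes C: "C \<in> X" "stable_curve k C" and q: "(l1, l2, l3, l4) \<in> quadruples k"
    and X: "\<And>D. D \<in> X \<Longrightarrow> (C, D) \<in> real_iso k"
  shows "curve_cross_ratio X l1 l2 l3 l4 = cr C l1 l2 l3 l4"
proof -
  have D: "cross_ratio (dir_pt D \<alpha> l1) (dir_pt D \<alpha> l2) (dir_pt D \<alpha> l3) (dir_pt D \<alpha> l4) = cr C l1 l2 l3 l4"
    if "D \<in> X" "\<alpha> \<in> comps D" "3 \<le> card (dir_pt D \<alpha> ` {l1, l2, l3, l4})" for D \<alpha>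
  proof -
    have "cr C l1 l2 l3 l4 = cr D l1 l2 l3 l4" "stable_curve k D"
      using X[OF that(1)] q unfolding real_iso_iff by (blast intro: real_curve_stable)+
    moreover have "nondeg4 (dir_pt D \<alpha> l1) (dir_pt D \<alpha> l2) (dir_pt D \<alpha> l3) (dir_pt D \<alpha> l4)"
      using that(3) by (intro card_ge_3_imp_nondeg4) simp
    ultimately show ?thesis using cr_eqI[OF _ q that(2)] by simp
  qed
  obtain \<alpha> where "\<alpha> \<in> comps C" "3 \<le> card (dir_pt C \<alpha> ` {l1, l2, l3, l4})"
    using quadruple_comp[OF C(2) q] by metis
  with D[OF C(1)] have "\<exists>D\<in>X. \<exists>\<alpha>\<in>comps D. 3 \<le> card (dir_pt D \<alpha> ` {l1, l2, l3, l4}) \<and>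
    cr C l1 l2 l3 l4 = cross_ratio (dir_pt D \<alpha> l1) (dir_pt D \<alpha> l2) (dir_pt D \<alpha> l3) (dir_pt D \<alpha> l4)"
    using C(1) by (intro bexI[of _ C] bexI[of _ \<alpha>] conjI) simp_all
  then show ?thesis
    unfolding curve_cross_ratio_def[of X] by (rule the_equality) (use D in blast)
qed

definition iso_class :: "nat \<Rightarrow> rcurve \<Rightarrow> rcurve set" where
  "iso_class k C = real_iso k `` {C}"

lemma iso_class_eq_iff:
  assumes "real_curve k C" "real_curve k D"
  shows "iso_class k C = iso_class k D \<longleftrightarrow>
    (\<forall>l1 l2 l3 l4. (l1, l2, l3, l4) \<in> quadruples k \<longrightarrow> cr C l1 l2 l3 l4 = cr D l1 l2 l3 l4)"
proof -
  have "iso_class k C = iso_class k D \<longleftrightarrow> (C, D) \<in> real_iso k"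
    unfolding iso_class_def by (rule eq_equiv_class_iff[OF equiv_real_iso]) (simp_all add: assms)
  then show ?thesis by (simp add: real_iso_iff assms)
qed

lemma self_in_iso_class: "real_curve k C \<Longrightarrow> C \<in> iso_class k C"
  by (simp add: iso_class_def real_iso_iff)

lemma curve_cross_ratio_iso_class:
  assumes "real_curve k C" "(l1, l2, l3, l4) \<in> quadruples k"
  shows "curve_cross_ratio (iso_class k C) l1 l2 l3 l4 = cr C l1 l2 l3 l4"
  by (rule curve_cross_ratio_class[OF self_in_iso_class[OF assms(1)] real_curve_stable[OF assms(1)] assms(2)])
    (simp add: iso_class_def)

section \<open>Chains of spheres\<close>

text \<open>
  The curve \<open>chain_curve c N \<kappa> z k\<close> consists of spheres indexed by a set of numbers symmetric about
  \<open>N / 2\<close>, in which infinity on a sphere is glued to \<open>0\<close> on the next one. The point \<open>z\<^sub>0\<^sup>+\<close> is \<open>0\<close> on the first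
  sphere, \<open>z\<^sub>0\<^sup>-\<close> is infinity on the last one and \<open>z\<^sub>i\<^sup>+\<close> is \<open>z i\<close> on sphere \<open>\<kappa> i\<close>. If \<open>z\<^sub>i\<^sup>+\<close> and \<open>z\<^sub>i\<^sup>-\<close>
  would coincide, they are moved to a real bubble with index \<open>N + i\<close>.
\<close>
definition chain_levels :: "nat \<Rightarrow> (nat \<Rightarrow> nat) \<Rightarrow> nat \<Rightarrow> nat set" where
  "chain_levels N \<kappa> k = \<kappa> ` {1..k} \<union> (\<lambda>i. N - \<kappa> i) ` {1..k}"

definition chain_pos :: "nat \<Rightarrow> (nat \<Rightarrow> nat) \<Rightarrow> nat \<Rightarrow> label \<Rightarrow> nat" where
  "chain_pos N \<kappa> k = (\<lambda>(i, s). if i = 0 then (if s then Min (chain_levels N \<kappa> k) else Max (chain_levels N \<kappa> k))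
     else if s then \<kappa> i else N - \<kappa> i)"

definition chain_num :: "invol \<Rightarrow> (nat \<Rightarrow> complex) \<Rightarrow> label \<Rightarrow> complex" where
  "chain_num c z = (\<lambda>(i, s). if s then z i else inv_sign c / cnj (z i))"

definition chain_val :: "invol \<Rightarrow> (nat \<Rightarrow> complex) \<Rightarrow> label \<Rightarrow> csphere" where
  "chain_val c z = (\<lambda>(i, s). if i = 0 then (if s then Some 0 else None) else Some (chain_num c z (i, s)))"

definition chain_bubble :: "invol \<Rightarrow> nat \<Rightarrow> (nat \<Rightarrow> nat) \<Rightarrow> (nat \<Rightarrow> complex) \<Rightarrow> nat \<Rightarrow> nat \<Rightarrow> bool" where
  "chain_bubble c N \<kappa> z k i \<longleftrightarrow> i \<in> {1..k} \<and> \<kappa> i = N - \<kappa> i \<and> z i = inv_sign c / cnj (z i)"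

definition consecutive :: "nat set \<Rightarrow> (nat \<times> nat) set" where
  "consecutive K = {(a, b). a \<in> K \<and> b \<in> K \<and> a \<noteq> b \<and> (\<forall>m\<in>K. \<not> (a < m \<and> m < b) \<and> \<not> (b < m \<and> m < a))}"

definition chain_curve :: "invol \<Rightarrow> nat \<Rightarrow> (nat \<Rightarrow> nat) \<Rightarrow> (nat \<Rightarrow> complex) \<Rightarrow> nat \<Rightarrow> rcurve" where
  "chain_curve c N \<kappa> z k =
    \<lparr>comps = chain_levels N \<kappa> k \<union> (+) N ` Collect (chain_bubble c N \<kappa> z k),
     adj = consecutive (chain_levels N \<kappa> k) \<union> (\<Union>i\<in>Collect (chain_bubble c N \<kappa> z k). {(\<kappa> i, N + i), (N + i, \<kappa> i)}),
     node = (\<lambda>\<alpha> \<beta>. if \<alpha> > N then None else if \<beta> > N then Some (z (\<beta> - N)) else if \<alpha> < \<beta> then None else Some 0),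
     mcomp = (\<lambda>l. if chain_bubble c N \<kappa> z k (fst l) then N + fst l else chain_pos N \<kappa> k l),
     mpt = (\<lambda>l. if chain_bubble c N \<kappa> z k (fst l) then Some (if snd l then \<i> else - \<i>) else chain_val c z l),
     icomp = (\<lambda>\<alpha>. if \<alpha> > N then \<alpha> else N - \<alpha>),
     imap = (\<lambda>\<alpha>. if \<alpha> > N then map_option cnj else std_inv c)\<rparr>"

text \<open>The position of l as seen from the level of m, in the coordinate with z0+ toward 0, z0-
  toward infinity and m at 1. The normalization removes the free scaling of the spheres: lower
  levels appear at 0 and higher ones at infinity.\<close>

definition chain_ratio :: "invol \<Rightarrow> nat \<Rightarrow> (nat \<Rightarrow> nat) \<Rightarrow> (nat \<Rightarrow> complex) \<Rightarrow> nat \<Rightarrow> label \<Rightarrow> label \<Rightarrow> csphere" where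
  "chain_ratio c N \<kappa> z k l m =
    (if fst l = 0 then chain_val c z l
     else if chain_pos N \<kappa> k l = chain_pos N \<kappa> k m then Some (chain_num c z l / chain_num c z m)
     else if chain_pos N \<kappa> k l < chain_pos N \<kappa> k m then Some 0 else None)"

lemma consecutiveD:
  assumes "(x, y) \<in> consecutive K" "m \<in> K"
  shows "\<not> (x < m \<and> m < y)" "\<not> (y < m \<and> m < x)"
  using assms by (auto simp: consecutive_def)

lemma consecutive_insert:
  assumes "M \<in> A" "\<And>x. x \<in> A \<Longrightarrow> x \<le> M" "M < b"
  shows "consecutive (insert b A) = consecutive A \<union> {(M, b), (b, M)}"
proof (rule Set.set_eqI, clarify)
  fix x y
  have lt: "x < b" if "x \<in> A" for x using assms(2)[OF that] assms(3) by simp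
  then have "b \<notin> A" by blast
  have top: "(\<forall>m\<in>insert b A. \<not> (u < m \<and> m < b) \<and> \<not> (b < m \<and> m < u)) \<longleftrightarrow> u = M" if "u \<in> A" for u
  proof
    assume "\<forall>m\<in>insert b A. \<not> (u < m \<and> m < b) \<and> \<not> (b < m \<and> m < u)"
    then have "\<not> u < M" using assms by blast
    then show "u = M" using assms(2)[OF that] by simp
  next
    assume "u = M"
    then show "\<forall>m\<in>insert b A. \<not> (u < m \<and> m < b) \<and> \<not> (b < m \<and> m < u)"
      using assms(2,3) by force
  qed
  have inner: "\<not> (u < b \<and> b < v)" if "u \<in> A" "v \<in> A" for u v using lt[OF that(2)] by simp
  show "(x, y) \<in> consecutive (insert b A) \<longleftrightarrow> (x, y) \<in> consecutive A \<union> {(M, b), (b, M)}"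
  proof (cases "x = b"; cases "y = b")
    assume "x = b" "y \<noteq> b"
    then show ?thesis using top[of y] assms(1) \<open>b \<notin> A\<close> unfolding consecutive_def by blast
  next
    assume "x \<noteq> b" "y = b"
    then show ?thesis using top[of x] assms(1) \<open>b \<notin> A\<close> unfolding consecutive_def by blast
  next
    assume "x \<noteq> b" "y \<noteq> b"
    then show ?thesis using inner unfolding consecutive_def by blast
  next
    assume "x = b" "y = b"
    then show ?thesis using \<open>b \<notin> A\<close> assms(3) by (simp add: consecutive_def)
  qed
qed

lemma is_tree_consecutive:
  assumes "finite K" "K \<noteq> {}"
  shows "comps C = K \<Longrightarrow> adj C = consecutive K \<Longrightarrow> is_tree C"
  using assms
proof (induction K arbitrary: C rule: finite_linorder_max_induct)
  case (insert b A)
  show ?case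
  proof (cases "A = {}")
    case True
    then show ?thesis using insert.prems by (intro is_tree_singleton[of _ b]) (auto simp: consecutive_def)
  next
    case False
    define D where "D = C\<lparr>comps := A, adj := consecutive A\<rparr>"
    have D: "comps D = A" "adj D = consecutive A" by (simp_all add: D_def)
    have M: "Max A \<in> A" "\<And>x. x \<in> A \<Longrightarrow> x \<le> Max A" using insert.hyps(1) False by auto
    have b: "Max A < b" "b \<notin> A" using insert.hyps(2) M(1) by blast+
    have "adj C = adj D \<union> {(Max A, b), (b, Max A)}"
      unfolding insert.prems(2) D(2) by (rule consecutive_insert[OF M b(1)])
    from is_tree_insert_leaf[OF insert.IH[OF D False] _ _ _ this] show ?thesis
      using M(1) b(2) insert.prems(1) D(1) by simp
  qed
qed simp

text \<open>Both distinctness conditions are for i \<noteq> j, so a point may coincide with its own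
  conjugate; this is the case of a bubble. By \<open>level_le\<close> the truncated subtraction
  \<open>N - \<kappa> i\<close> is a true reflection of the levels.\<close>

locale chain =
  fixes c :: invol and N :: nat and \<kappa> :: "nat \<Rightarrow> nat" and z :: "nat \<Rightarrow> complex" and k :: nat
  assumes k: "1 \<le> k"
    and level_le: "\<And>i. i \<in> {1..k} \<Longrightarrow> \<kappa> i \<le> N"
    and nonzero: "\<And>i. i \<in> {1..k} \<Longrightarrow> z i \<noteq> 0"
    and distinct: "\<And>i j. i \<in> {1..k} \<Longrightarrow> j \<in> {1..k} \<Longrightarrow> i \<noteq> j \<Longrightarrow> \<kappa> i = \<kappa> j \<Longrightarrow> z i \<noteq> z j"
    and distinct_conj: "\<And>i j. i \<in> {1..k} \<Longrightarrow> j \<in> {1..k} \<Longrightarrow> i \<noteq> j \<Longrightarrow> \<kappa> i = N - \<kappa> j \<Longrightarrow> z i \<noteq> inv_sign c / cnj (z j)"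
begin

abbreviation "K \<equiv> chain_levels N \<kappa> k"
abbreviation "bub \<equiv> chain_bubble c N \<kappa> z k"
abbreviation "pos \<equiv> chain_pos N \<kappa> k"
abbreviation "val \<equiv> chain_val c z"
abbreviation "num \<equiv> chain_num c z"
abbreviation "C \<equiv> chain_curve c N \<kappa> z k"
abbreviation "ratio \<equiv> chain_ratio c N \<kappa> z k"

lemma C_simps [simp]:
  "comps C = K \<union> (+) N ` Collect bub"
  "adj C = consecutive K \<union> (\<Union>i\<in>Collect bub. {(\<kappa> i, N + i), (N + i, \<kappa> i)})"
  "node C \<alpha> \<beta> = (if \<alpha> > N then None else if \<beta> > N then Some (z (\<beta> - N)) else if \<alpha> < \<beta> then None else Some 0)"
  "mcomp C l = (if bub (fst l) then N + fst l else pos l)"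
  "mpt C l = (if bub (fst l) then Some (if snd l then \<i> else - \<i>) else val l)"
  "icomp C \<alpha> = (if \<alpha> > N then \<alpha> else N - \<alpha>)"
  "imap C \<alpha> = (if \<alpha> > N then map_option cnj else std_inv c)"
  by (simp_all add: chain_curve_def)

lemma finite_K: "finite K" by (simp add: chain_levels_def)
lemma K_nonempty: "K \<noteq> {}" using k by (auto simp: chain_levels_def)
lemma K_le: "\<alpha> \<in> K \<Longrightarrow> \<alpha> \<le> N" using level_le by (auto simp: chain_levels_def)
lemma bubD: "bub i \<Longrightarrow> i \<in> {1..k} \<and> \<kappa> i = N - \<kappa> i \<and> z i = inv_sign c / cnj (z i)"
  by (simp add: chain_bubble_def)
lemma bub_level: "bub i \<Longrightarrow> \<kappa> i \<in> K \<and> \<kappa> i \<le> N \<and> i > 0"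
  using level_le by (auto simp: chain_bubble_def chain_levels_def)
lemma not_bub_0 [simp]: "\<not> bub 0" by (simp add: chain_bubble_def)
lemma finite_bub: "finite (Collect bub)"
  by (rule finite_subset[of _ "{1..k}"]) (auto simp: chain_bubble_def)

lemma K_conj: "\<alpha> \<in> K \<Longrightarrow> N - \<alpha> \<in> K"
  using level_le by (auto simp: chain_levels_def image_iff)

lemma labels_cases:
  assumes "l \<in> labels k"
  obtains "l = (0, True)" | "l = (0, False)" | "fst l \<in> {1..k}"
  using assms by (cases l; cases "fst l = 0"; cases "snd l") (auto simp: labels_def)

lemma pos_in_K: "l \<in> labels k \<Longrightarrow> pos l \<in> K"
  using Min_in[OF finite_K K_nonempty] Max_in[OF finite_K K_nonempty]
  by (auto simp: chain_pos_def labels_def chain_levels_def split: prod.splits)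

lemma val_num: "fst l \<in> {1..k} \<Longrightarrow> val l = Some (num l)"
  by (cases l) (simp add: chain_val_def)

lemma num_nonzero: "fst l \<in> {1..k} \<Longrightarrow> num l \<noteq> 0"
  using nonzero[of "fst l"] by (auto simp: chain_num_def split: prod.splits)

text \<open>The only coincidence of numbers on a level is that of a conjugate pair, which the bubble
  resolves.\<close>

lemma pos_num_eq:
  assumes l: "fst l \<in> {1..k}" "fst m \<in> {1..k}" and eq: "pos l = pos m" "num l = num m"
  shows "l = m \<or> (fst l = fst m \<and> bub (fst l))"
proof -
  obtain i s j t where lm: "l = (i, s)" "m = (j, t)" by (cases l; cases m)
  have n: "\<kappa> i \<le> N" "\<kappa> j \<le> N" "z i \<noteq> 0" "z j \<noteq> 0" "i \<noteq> 0" "j \<noteq> 0" using l lm level_le nonzero by auto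
  have cnj_eq: "inv_sign c / cnj u = inv_sign c / cnj v \<longleftrightarrow> u = v" if "u \<noteq> 0" "v \<noteq> 0" for u v
    using that by (simp add: field_simps)
  show ?thesis
  proof (cases "i = j")
    case True
    then show ?thesis using l eq n lm
      by (cases s; cases t) (auto simp: chain_pos_def chain_num_def chain_bubble_def)
  next
    case False
    have "N - \<kappa> i = N - \<kappa> j \<longleftrightarrow> \<kappa> i = \<kappa> j" using n by auto
    then show ?thesis using l eq n lm False distinct[of i j] distinct_conj[of i j] distinct_conj[of j i]
      by (cases s; cases t) (auto simp: chain_pos_def chain_num_def cnj_eq)
  qed
qed

lemma tree: "is_tree C"
proof -
  \<comment> \<open>Induction over the set of bubbles that are already attached; D is arbitrary
    because only its vertices and edges matter.\<close>
  have *: "is_tree D" if "finite B" "B \<subseteq> Collect bub"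
    "comps D = K \<union> (+) N ` B" "adj D = consecutive K \<union> (\<Union>i\<in>B. {(\<kappa> i, N + i), (N + i, \<kappa> i)})" for D B
    using that
  proof (induction B arbitrary: D rule: finite_induct)
    case empty
    then show ?case using is_tree_consecutive[OF finite_K K_nonempty] by simp
  next
    case (insert i B)
    define E where "E = D\<lparr>comps := K \<union> (+) N ` B, adj := consecutive K \<union> (\<Union>i\<in>B. {(\<kappa> i, N + i), (N + i, \<kappa> i)})\<rparr>"
    have E: "comps E = K \<union> (+) N ` B" "adj E = consecutive K \<union> (\<Union>i\<in>B. {(\<kappa> i, N + i), (N + i, \<kappa> i)})"
      by (simp_all add: E_def)
    have T: "is_tree E" using insert.prems(1) E by (intro insert.IH) auto
    have "N + i \<notin> K" "\<kappa> i \<in> K" using insert.prems(1) bub_level[of i] K_le[of "N + i"] by auto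
    then have "N + i \<notin> comps E" "\<kappa> i \<in> comps E" using insert.hyps(2) E(1) by auto
    moreover have "comps D = insert (N + i) (comps E)" using insert.prems(2) E(1) by simp
    moreover have "adj D = adj E \<union> {(\<kappa> i, N + i), (N + i, \<kappa> i)}"
      unfolding insert.prems(3) UN_insert E(2) by blast
    ultimately show ?case using is_tree_insert_leaf[OF T] by blast
  qed
  show ?thesis by (rule *[OF finite_bub subset_refl]) simp_all
qed

lemma consecutive_le: "(\<alpha>, \<beta>) \<in> consecutive K \<Longrightarrow> \<alpha> \<in> K \<and> \<beta> \<in> K \<and> \<alpha> \<le> N \<and> \<beta> \<le> N \<and> \<alpha> \<noteq> \<beta>"
  using K_le by (auto simp: consecutive_def)

lemma successor:
  assumes "\<alpha> \<in> K" "\<gamma> \<in> K" "\<alpha> < \<gamma>"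
  obtains \<beta> where "(\<alpha>, \<beta>) \<in> consecutive K" "\<alpha> < \<beta>" "\<And>\<delta>. \<delta> \<in> K \<Longrightarrow> \<alpha> < \<delta> \<Longrightarrow> \<beta> \<le> \<delta>"
proof -
  let ?S = "{\<delta> \<in> K. \<alpha> < \<delta>}"
  have S: "finite ?S" "?S \<noteq> {}" using assms finite_K by auto
  have min: "Min ?S \<in> K" "\<alpha> < Min ?S" using Min_in[OF S] by auto
  have le: "Min ?S \<le> \<delta>" if "\<delta> \<in> K" "\<alpha> < \<delta>" for \<delta> using Min_le[OF S(1)] that by simp
  have "\<forall>m\<in>K. \<not> (\<alpha> < m \<and> m < Min ?S)" using le leD by blast
  then have "(\<alpha>, Min ?S) \<in> consecutive K" unfolding consecutive_def using min assms(1) by force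
  from that[OF this min(2) le] show ?thesis .
qed

lemma predecessor:
  assumes "\<alpha> \<in> K" "\<gamma> \<in> K" "\<gamma> < \<alpha>"
  obtains \<beta> where "(\<alpha>, \<beta>) \<in> consecutive K" "\<beta> < \<alpha>" "\<And>\<delta>. \<delta> \<in> K \<Longrightarrow> \<delta> < \<alpha> \<Longrightarrow> \<delta> \<le> \<beta>"
proof -
  let ?S = "{\<delta> \<in> K. \<delta> < \<alpha>}"
  have S: "finite ?S" "?S \<noteq> {}" using assms finite_K by auto
  have max: "Max ?S \<in> K" "Max ?S < \<alpha>" using Max_in[OF S] by auto
  have le: "\<delta> \<le> Max ?S" if "\<delta> \<in> K" "\<delta> < \<alpha>" for \<delta> using Max_ge[OF S(1)] that by simp
  have "\<forall>m\<in>K. \<not> (Max ?S < m \<and> m < \<alpha>)" using le leD by blast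
  then have "(\<alpha>, Max ?S) \<in> consecutive K"
    using max assms(1) unfolding consecutive_def by (simp del: Max_less_iff Max_gr_iff)
  from that[OF this max(2) le] show ?thesis .
qed

text \<open>The target \<gamma>' is either the level \<gamma> or a bubble attached to it. As
  \<gamma> \<noteq> \<alpha>, a bubble on \<alpha> itself is excluded; its direction is its own
  node.\<close>

lemma node_first_step:
  assumes a: "\<alpha> \<in> K" and g: "\<gamma> = \<gamma>' \<and> \<gamma> \<in> K \<or> (\<exists>i. \<gamma>' = N + i \<and> bub i \<and> \<gamma> = \<kappa> i)" and ne: "\<gamma> \<noteq> \<alpha>"
  shows "node C \<alpha> (first_step C \<alpha> \<gamma>') = (if \<gamma> < \<alpha> then Some 0 else None)"
proof -
  have gK: "\<gamma> \<in> K" using g bub_level by auto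
  have gc: "\<gamma>' \<in> comps C" using g by auto
  have ac: "\<alpha> \<in> comps C" using a by simp
  have aN: "\<alpha> \<le> N" by (rule K_le[OF a])
  show ?thesis
  proof (cases "\<gamma> < \<alpha>")
    case True
    obtain \<beta> where b: "(\<alpha>, \<beta>) \<in> consecutive K" "\<beta> < \<alpha>" "\<And>\<delta>. \<delta> \<in> K \<Longrightarrow> \<delta> < \<alpha> \<Longrightarrow> \<delta> \<le> \<beta>"
      using predecessor[OF a gK True] by blast
    \<comment> \<open>The branch below \<alpha>: all lower levels together with their bubbles. It is
      entered only from \<alpha> through its predecessor.\<close>
    let ?S = "{\<delta> \<in> K. \<delta> < \<alpha>} \<union> {N + i |i. bub i \<and> \<kappa> i < \<alpha>}"
    have "first_step C \<alpha> \<gamma>' = \<beta>"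
    proof (rule first_step_branch[OF tree ac gc, of ?S])
      show "\<gamma>' \<in> ?S" using g True by auto
      show "\<alpha> \<notin> ?S" using aN bub_level by fastforce
      fix x y assume xy: "(x, y) \<in> adj C" "x \<notin> ?S" "y \<in> ?S"
      from xy(1) consider "(x, y) \<in> consecutive K" | i where "bub i" "x = \<kappa> i" "y = N + i" | i where "bub i" "x = N + i" "y = \<kappa> i"
        by auto
      then show "x = \<alpha> \<and> y = \<beta>"
      proof cases
        case 1
        then have "x \<in> K" "y \<in> K" "y \<le> N" using consecutive_le by auto
        then have "y < \<alpha>" "\<not> x < \<alpha>" using xy(2,3) bub_level by auto
        moreover have bK: "\<beta> \<in> K" using b(1) consecutive_le by blast
        ultimately have x: "x = \<alpha>" using consecutiveD(2)[OF 1 a] by linarith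
        moreover have "y \<le> \<beta>" using b(3)[OF \<open>y \<in> K\<close> \<open>y < \<alpha>\<close>] .
        ultimately show ?thesis using consecutiveD(2)[OF 1 bK] b(2) by linarith
      next
        case 2
        then show ?thesis using xy(2,3) bub_level[of i] K_le[of "N + i"] by auto
      next
        case 3
        then show ?thesis using xy(2,3) bub_level[of i] by auto
      qed
    qed
    with b aN True show ?thesis by auto
  next
    case False
    then have lt: "\<alpha> < \<gamma>" using ne by simp
    obtain \<beta> where b: "(\<alpha>, \<beta>) \<in> consecutive K" "\<alpha> < \<beta>" "\<And>\<delta>. \<delta> \<in> K \<Longrightarrow> \<alpha> < \<delta> \<Longrightarrow> \<beta> \<le> \<delta>"
      using successor[OF a gK lt] by blast
    let ?S = "{\<delta> \<in> K. \<alpha> < \<delta>} \<union> {N + i |i. bub i \<and> \<alpha> < \<kappa> i}"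
    have "first_step C \<alpha> \<gamma>' = \<beta>"
    proof (rule first_step_branch[OF tree ac gc, of ?S])
      show "\<gamma>' \<in> ?S" using g lt by auto
      show "\<alpha> \<notin> ?S" using aN bub_level by fastforce
      fix x y assume xy: "(x, y) \<in> adj C" "x \<notin> ?S" "y \<in> ?S"
      from xy(1) consider "(x, y) \<in> consecutive K" | i where "bub i" "x = \<kappa> i" "y = N + i" | i where "bub i" "x = N + i" "y = \<kappa> i"
        by auto
      then show "x = \<alpha> \<and> y = \<beta>"
      proof cases
        case 1
        then have "x \<in> K" "y \<in> K" "y \<le> N" using consecutive_le by auto
        then have "\<alpha> < y" "\<not> \<alpha> < x" using xy(2,3) bub_level by auto
        moreover have bK: "\<beta> \<in> K" using b(1) consecutive_le by blast
        ultimately have x: "x = \<alpha>" using consecutiveD(1)[OF 1 a] by linarith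
        moreover have "\<beta> \<le> y" using b(3)[OF \<open>y \<in> K\<close> \<open>\<alpha> < y\<close>] .
        ultimately show ?thesis using consecutiveD(1)[OF 1 bK] b(2) by linarith
      next
        case 2
        then show ?thesis using xy(2,3) bub_level[of i] K_le[of "N + i"] by auto
      next
        case 3
        then show ?thesis using xy(2,3) bub_level[of i] by auto
      qed
    qed
    moreover have "\<beta> \<le> N" using b(1) consecutive_le by blast
    ultimately show ?thesis using b aN False by auto
  qed
qed

lemma dir_pt_level:
  assumes a: "\<alpha> \<in> K" and l: "l \<in> labels k"
  shows "dir_pt C \<alpha> l = (if pos l = \<alpha> then val l else if pos l < \<alpha> then Some 0 else None)"
proof (cases "bub (fst l)")
  case False
  then show ?thesis using node_first_step[OF a, of "pos l" "pos l"] pos_in_K[OF l]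
    by (auto simp: dir_pt_eq simp del: C_simps(3))
next
  case True
  let ?i = "fst l"
  have i: "?i > 0" "z ?i = inv_sign c / cnj (z ?i)" "\<kappa> ?i = N - \<kappa> ?i"
    using bubD[OF True] by auto
  have pos: "pos l = \<kappa> ?i" "val l = Some (z ?i)"
    using i by (auto simp: chain_pos_def chain_val_def chain_num_def split: prod.splits)
  have aN: "\<alpha> \<le> N" by (rule K_le[OF a])
  have ne: "N + ?i \<noteq> \<alpha>" using aN i(1) by simp
  show ?thesis
  proof (cases "\<kappa> ?i = \<alpha>")
    case eq: True
    have "(\<alpha>, N + ?i) \<in> adj C" using True eq by auto
    then have "first_step C \<alpha> (N + ?i) = N + ?i" by (rule first_step_adj[OF tree])
    then show ?thesis using True pos eq ne aN i(1) by (simp add: dir_pt_eq)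
  next
    case False
    then show ?thesis
      using node_first_step[OF a, of "\<kappa> ?i" "N + ?i"] True pos ne
      by (simp add: dir_pt_eq del: C_simps(3))
  qed
qed

lemma dir_pt_bubble:
  assumes "bub i" "l \<in> labels k"
  shows "dir_pt C (N + i) l = (if fst l = i then Some (if snd l then \<i> else - \<i>) else None)"
proof -
  have "pos l \<noteq> N + i" using pos_in_K[OF assms(2)] K_le[of "N + i"] bub_level[OF assms(1)] by auto
  then show ?thesis using assms bub_level[OF assms(1)] by (auto simp: dir_pt_eq)
qed

end

lemma std_inv_proj_pt:
  assumes "x \<noteq> 0 \<or> y \<noteq> 0"
  shows "std_inv c (proj_pt x y) = proj_pt (inv_sign c * cnj y) (cnj x)"
  using assms by (auto simp: proj_pt_def std_inv_def)

section \<open>Stability and real structure of chains of spheres\<close>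

context chain
begin

lemma conj_level: "\<alpha> \<in> K \<Longrightarrow> N - (N - \<alpha>) = \<alpha>"
  using K_le by simp

lemma ex_label_at:
  assumes "\<alpha> \<in> K"
  obtains l where "fst l \<in> {1..k}" "pos l = \<alpha>"
proof -
  obtain i where "i \<in> {1..k}" "\<alpha> = \<kappa> i \<or> \<alpha> = N - \<kappa> i" using assms by (auto simp: chain_levels_def)
  then show ?thesis using that[of "(i, True)"] that[of "(i, False)"] by (auto simp: chain_pos_def)
qed

lemma neighbour_cases:
  assumes "(\<alpha>, \<beta>) \<in> adj C" "\<alpha> \<in> K"
  obtains "(\<alpha>, \<beta>) \<in> consecutive K" "\<beta> \<le> N" "\<beta> \<in> K" "\<alpha> \<noteq> \<beta>" "node C \<alpha> \<beta> = (if \<alpha> < \<beta> then None else Some 0)"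
    | i where "bub i" "\<alpha> = \<kappa> i" "\<beta> = N + i" "node C \<alpha> \<beta> = Some (z i)" "i \<in> {1..k}"
proof -
  have aN: "\<alpha> \<le> N" by (rule K_le[OF assms(2)])
  from assms(1) consider "(\<alpha>, \<beta>) \<in> consecutive K" | i where "bub i" "\<alpha> = \<kappa> i" "\<beta> = N + i" | i where "bub i" "\<alpha> = N + i"
    by auto
  then show ?thesis
  proof cases
    case 1
    then show ?thesis using that(1) consecutive_le[OF 1] aN by simp
  next
    case 2
    then show ?thesis using that(2) bub_level[OF 2(1)] bubD[OF 2(1)] aN by simp
  next
    case 3
    then show ?thesis using bub_level[OF 3(1)] aN by simp
  qed
qed

lemma marks_cases:
  assumes "l \<in> marks_on k C \<alpha>" "\<alpha> \<in> K"
  obtains "l = (0, True)" "\<alpha> = Min K" "mpt C l = Some 0" | "l = (0, False)" "\<alpha> = Max K" "mpt C l = None"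
    | "fst l \<in> {1..k}" "pos l = \<alpha>" "\<not> bub (fst l)" "mpt C l = Some (num l)" "num l \<noteq> 0"
proof -
  have l: "l \<in> labels k" "mcomp C l = \<alpha>" using assms(1) by (auto simp: marks_on_def)
  have nb: "\<not> bub (fst l)" using l(2) K_le[OF assms(2)] bub_level[of "fst l"] by auto
  then have pos: "pos l = \<alpha>" using l(2) by simp
  from l(1) show ?thesis
  proof (cases rule: labels_cases)
    case 1
    then show ?thesis using that(1) pos nb by (simp add: chain_pos_def chain_val_def)
  next
    case 2
    then show ?thesis using that(2) pos nb by (simp add: chain_pos_def chain_val_def)
  next
    case 3
    then show ?thesis using that(3) pos nb num_nonzero[OF 3] val_num[OF 3] by simp
  qed
qed

lemma level_node_inj:
  assumes "\<alpha> \<in> K" shows "inj_on (node C \<alpha>) (adj C `` {\<alpha>})"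
proof (rule inj_onI)
  fix \<beta> \<gamma> assume "\<beta> \<in> adj C `` {\<alpha>}" "\<gamma> \<in> adj C `` {\<alpha>}" and eq: "node C \<alpha> \<beta> = node C \<alpha> \<gamma>"
  then have b: "(\<alpha>, \<beta>) \<in> adj C" and g: "(\<alpha>, \<gamma>) \<in> adj C" by (simp_all del: C_simps)
  from b assms show "\<beta> = \<gamma>"
  proof (cases rule: neighbour_cases)
    case b: 1
    from g assms show ?thesis
    proof (cases rule: neighbour_cases)
      case 1
      then have "\<alpha> < \<beta> \<longleftrightarrow> \<alpha> < \<gamma>" using eq b(5) by (simp split: if_splits del: C_simps)
      then show ?thesis
        using consecutiveD[OF b(1) 1(3)] consecutiveD[OF 1(1) b(3)] b(4) 1(4) by linarith
    next
      case (2 i)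
      then show ?thesis using eq b(5) nonzero[OF 2(5)] by (simp split: if_splits del: C_simps)
    qed
  next
    case b: (2 i)
    from g assms show ?thesis
    proof (cases rule: neighbour_cases)
      case 1
      then show ?thesis using eq b nonzero[OF b(5)] by (simp split: if_splits del: C_simps)
    next
      case (2 j)
      then show ?thesis using eq b distinct[of i j] by (auto simp del: C_simps)
    qed
  qed
qed

lemma level_mpt_inj:
  assumes "\<alpha> \<in> K" shows "inj_on (mpt C) (marks_on k C \<alpha>)"
proof (rule inj_onI)
  fix l m assume l: "l \<in> marks_on k C \<alpha>" and m: "m \<in> marks_on k C \<alpha>" and eq: "mpt C l = mpt C m"
  from l assms show "l = m"
  proof (cases rule: marks_cases)
    case l: 1
    from m assms show ?thesis by (cases rule: marks_cases) (use l eq in \<open>simp_all del: C_simps\<close>)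
  next
    case l: 2
    from m assms show ?thesis by (cases rule: marks_cases) (use l eq in \<open>simp_all del: C_simps\<close>)
  next
    case l: 3
    from m assms show ?thesis
    proof (cases rule: marks_cases)
      case 3
      have "num l = num m" using eq l(4) 3(4) by (simp del: C_simps)
      then show ?thesis using pos_num_eq[OF l(1) 3(1)] l(2,3) 3(2) by auto
    qed (use l eq in \<open>simp_all del: C_simps\<close>)
  qed
qed

lemma level_disjoint:
  assumes "\<alpha> \<in> K" shows "node C \<alpha> ` (adj C `` {\<alpha>}) \<inter> mpt C ` marks_on k C \<alpha> = {}"
proof (rule ccontr)
  assume "\<not> ?thesis"
  then obtain \<beta> l where b: "(\<alpha>, \<beta>) \<in> adj C" and l: "l \<in> marks_on k C \<alpha>" and eq: "node C \<alpha> \<beta> = mpt C l"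
    by (auto simp del: C_simps)
  from b assms show False
  proof (cases rule: neighbour_cases)
    case b: 1
    have "Min K \<le> \<beta>" "\<beta> \<le> Max K" using b(3) finite_K by simp_all
    with l assms show False
      by (cases rule: marks_cases) (use b eq in \<open>simp_all split: if_splits del: C_simps\<close>)
  next
    case b: (2 i)
    from l assms show False
    proof (cases rule: marks_cases)
      case 3
      have "num l = num (i, True)" "pos l = pos (i, True)"
        using eq b 3 by (simp_all add: chain_num_def chain_pos_def del: C_simps)
      from pos_num_eq[OF 3(1) _ this(2,1)] b 3 show False by auto
    qed (use b eq nonzero[OF b(5)] in \<open>simp_all del: C_simps\<close>)
  qed
qed

text \<open>On each level 0 and infinity are special, being nodes or, at the two ends of the chain,
  z0+ and z0-. A level exists only because some z_i+ or z_i- is placed on it, and this point, or the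
  node of its bubble, is the third.\<close>

lemma level_card:
  assumes "\<alpha> \<in> K" shows "3 \<le> card (node C \<alpha> ` (adj C `` {\<alpha>}) \<union> mpt C ` marks_on k C \<alpha>)"
proof -
  define S where "S = node C \<alpha> ` (adj C `` {\<alpha>}) \<union> mpt C ` marks_on k C \<alpha>"
  have aN: "\<alpha> \<le> N" by (rule K_le[OF assms])
  have mk: "x \<in> S" if "l \<in> labels k" "mcomp C l = \<alpha>" "mpt C l = x" for l x
    unfolding S_def that(3)[symmetric] using that(1,2) by (intro UnI2 imageI) (simp add: marks_on_def del: C_simps)
  have nd: "x \<in> S" if "(\<alpha>, \<beta>) \<in> adj C" "node C \<alpha> \<beta> = x" for \<beta> x
    unfolding S_def that(2)[symmetric] using that(1) by (intro UnI1 imageI) (simp del: C_simps)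
  have l0: "(0, s) \<in> labels k" for s by (simp add: labels_def)
  have m0: "mpt C (0, False) = None" "mpt C (0, True) = Some 0"
    "mcomp C (0, False) = Max K" "mcomp C (0, True) = Min K"
    by (simp_all add: chain_pos_def chain_val_def)
  have None: "None \<in> S"
  proof (cases "\<alpha> = Max K")
    case True
    then show ?thesis using mk[OF l0 _ m0(1)] m0(3) by metis
  next
    case False
    then have "\<alpha> < Max K" using Max_ge[OF finite_K assms] by simp
    then obtain \<beta> where b: "(\<alpha>, \<beta>) \<in> consecutive K" "\<alpha> < \<beta>"
      using successor[OF assms Max_in[OF finite_K K_nonempty]] by metis
    then have "(\<alpha>, \<beta>) \<in> adj C" "node C \<alpha> \<beta> = None"
      using aN consecutive_le[OF b(1)] by (simp_all add: chain_curve_def)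
    then show ?thesis by (rule nd)
  qed
  have Zero: "Some 0 \<in> S"
  proof (cases "\<alpha> = Min K")
    case True
    then show ?thesis using mk[OF l0 _ m0(2)] m0(4) by metis
  next
    case False
    then have "Min K < \<alpha>" using Min_le[OF finite_K assms] by simp
    then obtain \<beta> where b: "(\<alpha>, \<beta>) \<in> consecutive K" "\<beta> < \<alpha>"
      using predecessor[OF assms Min_in[OF finite_K K_nonempty]] by metis
    then have "(\<alpha>, \<beta>) \<in> adj C" "node C \<alpha> \<beta> = Some 0"
      using aN consecutive_le[OF b(1)] by (simp_all add: chain_curve_def)
    then show ?thesis by (rule nd)
  qed
  obtain l where l: "fst l \<in> {1..k}" "pos l = \<alpha>" using ex_label_at[OF assms] by blast
  have "\<exists>w. w \<noteq> 0 \<and> Some w \<in> S"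
  proof (cases "bub (fst l)")
    case True
    have "\<kappa> (fst l) = \<alpha>" using l bubD[OF True] by (auto simp: chain_pos_def split: prod.splits if_splits)
    then have "(\<alpha>, N + fst l) \<in> adj C" "node C \<alpha> (N + fst l) = Some (z (fst l))"
      using True aN l(1) by auto
    then show ?thesis using nd nonzero[OF l(1)] by metis
  next
    case False
    have "l \<in> labels k" using l by (cases l) (simp add: labels_def)
    moreover have "mcomp C l = \<alpha>" "mpt C l = Some (num l)"
      using False l val_num[OF l(1)] by simp_all
    ultimately show ?thesis using mk num_nonzero[OF l(1)] by metis
  qed
  then obtain w where w: "w \<noteq> 0" "Some w \<in> S" by blast
  have sub: "{None, Some 0, Some w} \<subseteq> S" using None Zero w(2) by blast
  have "adj C `` {\<alpha>} \<subseteq> comps C" "finite (comps C)" using tree unfolding is_tree_def by blast+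
  then have "finite (adj C `` {\<alpha>})" by (rule finite_subset)
  moreover have "finite (marks_on k C \<alpha>)" by (simp add: marks_on_def del: C_simps)
  ultimately have "finite S" unfolding S_def by (intro finite_UnI finite_imageI)
  from card_mono[OF this sub] w(1) have "3 \<le> card S" by simp
  then show ?thesis unfolding S_def .
qed

lemma bubble_adj: "bub i \<Longrightarrow> adj C `` {N + i} = {\<kappa> i}"
proof (rule Set.set_eqI)
  fix x
  assume b: "bub i"
  have "(N + i, x) \<notin> consecutive K" using consecutive_le[of "N + i" x] bub_level[OF b] by auto
  moreover have "N + i \<noteq> \<kappa> j" if "bub j" for j using bub_level[OF that] bub_level[OF b] by auto
  ultimately show "x \<in> adj C `` {N + i} \<longleftrightarrow> x \<in> {\<kappa> i}" using b by auto
qed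

lemma bubble_marks: "bub i \<Longrightarrow> marks_on k C (N + i) = {(i, True), (i, False)}"
proof -
  assume b: "bub i"
  have "pos l \<noteq> N + i" if "l \<in> labels k" for l
    using pos_in_K[OF that] K_le[of "N + i"] bub_level[OF b] by auto
  then show ?thesis using b bubD[OF b] by (auto simp: marks_on_def labels_def split: if_splits)
qed

lemma stable: "stable_curve k C"
  unfolding stable_curve_def
proof (intro conjI ballI tree)
  show "mcomp C ` labels k \<subseteq> comps C" using pos_in_K by auto
  fix \<alpha> assume "\<alpha> \<in> comps C"
  then consider "\<alpha> \<in> K" | i where "bub i" "\<alpha> = N + i" by auto
  then have "inj_on (node C \<alpha>) (adj C `` {\<alpha>}) \<and> inj_on (mpt C) (marks_on k C \<alpha>) \<and>
    node C \<alpha> ` (adj C `` {\<alpha>}) \<inter> mpt C ` marks_on k C \<alpha> = {} \<and>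
    3 \<le> card (node C \<alpha> ` (adj C `` {\<alpha>}) \<union> mpt C ` marks_on k C \<alpha>)"
  proof cases
    case 1
    then show ?thesis using level_node_inj level_mpt_inj level_disjoint level_card by blast
  next
    case 2
    show ?thesis
      unfolding 2(2) bubble_adj[OF 2(1)] bubble_marks[OF 2(1)]
      using 2(1) bub_level[OF 2(1)] by (simp add: card_insert_if)
  qed
  then show "inj_on (node C \<alpha>) (adj C `` {\<alpha>})" "inj_on (mpt C) (marks_on k C \<alpha>)"
    "node C \<alpha> ` (adj C `` {\<alpha>}) \<inter> mpt C ` marks_on k C \<alpha> = {}"
    "3 \<le> card (node C \<alpha> ` (adj C `` {\<alpha>}) \<union> mpt C ` marks_on k C \<alpha>)" by blast+
qed

lemma consecutive_conj:
  assumes "(\<alpha>, \<beta>) \<in> consecutive K"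
  shows "(N - \<alpha>, N - \<beta>) \<in> consecutive K" "N - \<alpha> < N - \<beta> \<longleftrightarrow> \<beta> < \<alpha>"
proof -
  have le: "\<alpha> \<in> K" "\<beta> \<in> K" "\<alpha> \<le> N" "\<beta> \<le> N" "\<alpha> \<noteq> \<beta>" using consecutive_le[OF assms] by auto
  have "\<not> (N - \<alpha> < m \<and> m < N - \<beta>) \<and> \<not> (N - \<beta> < m \<and> m < N - \<alpha>)" if m: "m \<in> K" for m
    using consecutiveD[OF assms K_conj[OF m]] K_le[OF m] le by linarith
  then show "(N - \<alpha>, N - \<beta>) \<in> consecutive K"
    unfolding consecutive_def using K_conj le by auto
  show "N - \<alpha> < N - \<beta> \<longleftrightarrow> \<beta> < \<alpha>" using le by linarith
qed

lemma pos_conj: "l \<in> labels k \<Longrightarrow> pos (fst l, \<not> snd l) = N - pos l"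
proof -
  assume "l \<in> labels k"
  have min: "Min K \<in> K" "\<And>x. x \<in> K \<Longrightarrow> Min K \<le> x" and max: "Max K \<in> K" "\<And>x. x \<in> K \<Longrightarrow> x \<le> Max K"
    using finite_K K_nonempty by auto
  have "Max K = N - Min K"
    using min(2)[OF K_conj[OF max(1)]] max(2)[OF K_conj[OF min(1)]] K_le[OF max(1)] K_le[OF min(1)] by linarith
  note mm = this
  from \<open>l \<in> labels k\<close> show ?thesis
  proof (cases rule: labels_cases)
    case 3
    then show ?thesis using level_le[OF 3] by (cases l) (auto simp: chain_pos_def)
  qed (simp_all add: chain_pos_def mm(1) conj_level[OF min(1)])
qed

lemma num_conj: "fst l \<in> {1..k} \<Longrightarrow> num (fst l, \<not> snd l) = inv_sign c / cnj (num l)"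
  using nonzero[of "fst l"] by (cases l; cases "snd l") (auto simp: chain_num_def)

lemma val_conj: "l \<in> labels k \<Longrightarrow> val (fst l, \<not> snd l) = std_inv c (val l)"
proof -
  assume "l \<in> labels k"
  then show ?thesis
  proof (cases rule: labels_cases)
    case 3
    then show ?thesis using val_num[OF 3] val_num[of "(fst l, \<not> snd l)"] num_conj[OF 3] num_nonzero[OF 3] by simp
  qed (simp_all add: chain_val_def)
qed

lemma real: "real_curve k C"
proof -
  have "icomp C \<alpha> \<in> comps C \<and> icomp C (icomp C \<alpha>) = \<alpha> \<and> antimobius (imap C \<alpha>) \<and>
      (\<forall>w. imap C (icomp C \<alpha>) (imap C \<alpha> w) = w)" if "\<alpha> \<in> comps C" for \<alpha>
  proof -
    have cc: "map_option cnj (map_option cnj w) = w" for w by (cases w) auto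
    from that consider "\<alpha> \<in> K" | i where "bub i" "\<alpha> = N + i" by auto
    then show ?thesis
    proof cases
      case 1
      then show ?thesis using K_le[OF 1] K_conj[OF 1] conj_level[OF 1] std_inv_antimobius by simp
    next
      case 2
      then show ?thesis using bub_level[OF 2(1)] antimobius_cnj cc by simp
    qed
  qed
  moreover have "(icomp C \<alpha>, icomp C \<beta>) \<in> adj C \<and> imap C \<alpha> (node C \<alpha> \<beta>) = node C (icomp C \<alpha>) (icomp C \<beta>)"
    if "(\<alpha>, \<beta>) \<in> adj C" for \<alpha> \<beta>
  proof -
    from that consider "(\<alpha>, \<beta>) \<in> consecutive K" | i where "bub i" "\<alpha> = \<kappa> i" "\<beta> = N + i" | i where "bub i" "\<alpha> = N + i" "\<beta> = \<kappa> i"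
      by auto
    then show ?thesis
    proof cases
      case 1
      then show ?thesis using consecutive_conj[OF 1] consecutive_le[OF 1] by auto
    next
      case 2
      have "std_inv c (Some (z i)) = Some (z i)" using bubD[OF 2(1)] nonzero by auto
      then show ?thesis using 2 bubD[OF 2(1)] bub_level[OF 2(1)] by auto
    next
      case 3
      then show ?thesis using bubD[OF 3(1)] bub_level[OF 3(1)] by auto
    qed
  qed
  moreover have "icomp C (mcomp C (i, s)) = mcomp C (i, \<not> s) \<and>
      imap C (mcomp C (i, s)) (mpt C (i, s)) = mpt C (i, \<not> s)" if l: "(i, s) \<in> labels k" for i s
  proof (cases "bub i")
    case True
    then show ?thesis using bub_level[OF True] by simp
  next
    case False
    then show ?thesis using pos_conj[OF l] val_conj[OF l] K_le[OF pos_in_K[OF l]] by simp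
  qed
  ultimately have "real_involution k C" unfolding real_involution_def by (simp del: C_simps split_paired_All) blast
  then show ?thesis using stable by (simp add: real_curve_def)
qed

text \<open>A self-conjugate point has |z|^2 = 1 for \<open>Tau\<close>, but would need |z|^2 = -1
  for \<open>Eta\<close>.\<close>

lemma bubble_Tau: "bub i \<Longrightarrow> c = Tau"
proof (cases c)
  case Eta
  assume b: "bub i"
  then have "z i * cnj (z i) = - 1" using bubD[OF b] nonzero[of i] Eta by (auto simp: field_simps)
  then have "Re (z i * cnj (z i)) = - 1" by simp
  moreover have "Re (z i * cnj (z i)) = (Re (z i))\<^sup>2 + (Im (z i))\<^sup>2" by (simp add: power2_eq_square)
  ultimately have "(Re (z i))\<^sup>2 + (Im (z i))\<^sup>2 = - 1" by simp
  moreover have "(Re (z i))\<^sup>2 + (Im (z i))\<^sup>2 \<ge> 0" by (rule sum_power2_ge_zero)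
  ultimately show ?thesis by linarith
qed simp

lemma c_real: "c_real c C"
  unfolding c_real_def
proof (intro ballI impI)
  fix \<alpha> assume "\<alpha> \<in> comps C" "icomp C \<alpha> = \<alpha>"
  then consider "\<alpha> \<in> K" | i where "bub i" "\<alpha> = N + i" by auto
  then show "\<exists>g. mobius g \<and> g \<circ> imap C \<alpha> = std_inv c \<circ> g"
  proof cases
    case 1
    then show ?thesis using K_le[OF 1] mobius_id by (intro exI[of _ id]) simp
  next
    case 2
    have c: "c = Tau" by (rule bubble_Tau[OF 2(1)])
    \<comment> \<open>The Cayley transform, which carries complex conjugation on the bubble to the
      reflection in the unit circle.\<close>
    let ?g = "mobius_map 1 (- \<i>) 1 \<i>"
    have "mobius ?g" unfolding mobius_def by (intro exI conjI) (auto simp: complex_eq_iff)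
    moreover have "?g (map_option cnj w) = std_inv Tau (?g w)" for w
    proof (cases w)
      case (Some u)
      have "u - \<i> \<noteq> 0 \<or> u + \<i> \<noteq> 0" by (auto simp: complex_eq_iff)
      from std_inv_proj_pt[OF this, of Tau] show ?thesis using Some
        by (simp add: mobius_map_def)
    qed (simp add: mobius_map_def proj_pt_def std_inv_def)
    ultimately show ?thesis
      using 2 bub_level[OF 2(1)] c by (intro exI[of _ ?g]) (auto simp: fun_eq_iff chain_curve_def)
  qed
qed

lemma no_fixed_comp:
  assumes "\<And>i. i \<in> {1..k} \<Longrightarrow> 2 * \<kappa> i \<noteq> N"
  shows "no_fixed_comp C"
proof -
  have "\<not> bub i" for i using assms[of i] bubD[of i] by auto
  moreover have "N - \<alpha> \<noteq> \<alpha>" if "\<alpha> \<in> K" for \<alpha>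
    using that assms level_le by (fastforce simp: chain_levels_def)
  ultimately show ?thesis by (auto simp: no_fixed_comp_def dest: K_le)
qed

section \<open>Cross-ratios of chains in terms of coordinate ratios\<close>

lemma dir_pt_ratio:
  assumes l: "l \<in> labels k" and m: "fst m \<in> {1..k}"
  shows "dir_pt C (pos m) l = mobius_map (num m) 0 0 1 (ratio l m)"
proof -
  have "m \<in> labels k" using m by (cases m) (simp add: labels_def)
  note mK = pos_in_K[OF this] and n = num_nonzero[OF m]
  have "Min K \<le> pos m" "pos m \<le> Max K" using mK finite_K by simp_all
  note mm = this
  from l show ?thesis
  proof (cases rule: labels_cases)
    case 1
    then show ?thesis using mm(1) dir_pt_level[OF mK l]
      by (auto simp: chain_ratio_def chain_val_def chain_pos_def[of N \<kappa> k] mobius_map_def proj_pt_def)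
  next
    case 2
    then show ?thesis using mm(2) dir_pt_level[OF mK l]
      by (auto simp: chain_ratio_def chain_val_def chain_pos_def[of N \<kappa> k] mobius_map_def proj_pt_def)
  next
    case 3
    then show ?thesis using n dir_pt_level[OF mK l] val_num[OF 3]
      by (auto simp: chain_ratio_def mobius_map_def proj_pt_def)
  qed
qed

lemma mobius_num: "fst m \<in> {1..k} \<Longrightarrow> mobius (mobius_map (num m) 0 0 1)"
  unfolding mobius_def using num_nonzero[of m]
  by (intro exI[of _ "num m"] exI[of _ 0] exI[of _ 0] exI[of _ 1]) auto

lemma cr_ratio:
  assumes q: "(l1, l2, l3, l4) \<in> quadruples k" and m: "fst m \<in> {1..k}"
    and n: "nondeg4 (ratio l1 m) (ratio l2 m) (ratio l3 m) (ratio l4 m)"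
  shows "cr C l1 l2 l3 l4 = cross_ratio (ratio l1 m) (ratio l2 m) (ratio l3 m) (ratio l4 m)"
proof -
  have l: "l1 \<in> labels k" "l2 \<in> labels k" "l3 \<in> labels k" "l4 \<in> labels k" using q by (auto simp: quadruples_iff)
  have "m \<in> labels k" using m by (cases m) (simp add: labels_def)
  then have "pos m \<in> comps C" using pos_in_K by simp
  from cr_eqI[OF stable q this] show ?thesis
    using n unfolding l[THEN dir_pt_ratio[OF _ m]] nondeg4_mobius[OF mobius_num[OF m]]
      cross_ratio_mobius[OF mobius_num[OF m]] by simp
qed

text \<open>
  A component that separates the four points may be a real bubble, which has no ratio view; the
  level it is attached to then shows two coincident points, but not three.
\<close>
lemma ex_ratio:
  assumes q: "(l1, l2, l3, l4) \<in> quadruples k"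
  obtains m where "fst m \<in> {1..k}" "nondeg4 (ratio l1 m) (ratio l2 m) (ratio l3 m) (ratio l4 m)"
proof -
  have l: "l1 \<in> labels k" "l2 \<in> labels k" "l3 \<in> labels k" "l4 \<in> labels k" "distinct [l1, l2, l3, l4]"
    using q by (auto simp: quadruples_iff)
  have *: "nondeg4 (ratio l1 m) (ratio l2 m) (ratio l3 m) (ratio l4 m)"
    if "fst m \<in> {1..k}" "nondeg4 (dir_pt C (pos m) l1) (dir_pt C (pos m) l2) (dir_pt C (pos m) l3) (dir_pt C (pos m) l4)" for m
    using that(2) unfolding l(1-4)[THEN dir_pt_ratio[OF _ that(1)]] nondeg4_mobius[OF mobius_num[OF that(1)]] .
  obtain \<alpha> where a: "\<alpha> \<in> comps C" "3 \<le> card (dir_pt C \<alpha> ` {l1, l2, l3, l4})"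
    "nondeg4 (dir_pt C \<alpha> l1) (dir_pt C \<alpha> l2) (dir_pt C \<alpha> l3) (dir_pt C \<alpha> l4)"
    using quadruple_comp[OF stable q] .
  from a(1) consider "\<alpha> \<in> K" | i where "bub i" "\<alpha> = N + i" by auto
  then show ?thesis
  proof cases
    case 1
    then obtain m where "fst m \<in> {1..k}" "pos m = \<alpha>" by (rule ex_label_at)
    then show ?thesis using that * a(3) by metis
  next
    case 2
    have i: "i \<in> {1..k}" using bubD[OF 2(1)] by blast
    \<comment> \<open>Apart from its two marked points the bubble shows only its node, so three
      distinct directions require both of them.\<close>
    have both: "(i, True) \<in> {l1, l2, l3, l4} \<and> (i, False) \<in> {l1, l2, l3, l4}"
    proof (rule ccontr)
      assume "\<not> ?thesis"
      then obtain s where s: "(i, s) \<notin> {l1, l2, l3, l4}" by blast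
      have "dir_pt C \<alpha> l \<in> {None, Some (if s then - \<i> else \<i>)}" if lq: "l \<in> {l1, l2, l3, l4}" for l
      proof -
        have "l \<in> labels k" using lq l(1-4) by blast
        moreover have "\<not> (fst l = i \<and> snd l = s)" using lq s by (cases l) auto
        ultimately show ?thesis using dir_pt_bubble[OF 2(1), of l] unfolding 2(2) by (cases s) auto
      qed
      then have "dir_pt C \<alpha> ` {l1, l2, l3, l4} \<subseteq> {None, Some (if s then - \<i> else \<i>)}" by (rule image_subsetI)
      from card_mono[OF _ this] a(2) show False by simp
    qed
    have at: "dir_pt C (\<kappa> i) l = Some (z i) \<longleftrightarrow> fst l = i" if "l \<in> labels k" for l
    proof -
      have iT: "pos (i, True) = \<kappa> i" "num (i, True) = z i" "pos (i, False) = \<kappa> i" "num (i, False) = z i"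
        using bubD[OF 2(1)] i by (auto simp: chain_pos_def chain_num_def)
      note d = dir_pt_level[OF bub_level[OF 2(1), THEN conjunct1] that]
      show ?thesis
      proof (cases "fst l = i")
        case True
        then show ?thesis using d iT i by (cases l; cases "snd l") (auto simp: chain_val_def)
      next
        case False
        have "\<not> (fst l \<in> {1..k} \<and> pos l = \<kappa> i \<and> num l = z i)"
          using pos_num_eq[of l "(i, True)"] iT i False by auto
        then show ?thesis using d False nonzero[OF i] that
          by (cases rule: labels_cases[OF that]) (auto simp: val_num, auto simp: chain_val_def)
      qed
    qed
    have eq: "fst l = i \<longleftrightarrow> fst l' = i" if "dir_pt C (\<kappa> i) l = dir_pt C (\<kappa> i) l'" "l \<in> labels k" "l' \<in> labels k" for l l'
      using at[OF that(2)] at[OF that(3)] that(1) by simp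
    \<comment> \<open>The level below the bubble shows its pair at \<open>z i\<close> and the other
      two labels elsewhere. These two may coincide, but three labels never do.\<close>
    have three: "\<not> ((fst p = i \<longleftrightarrow> fst q = i) \<and> (fst r = i \<longleftrightarrow> fst q = i))"
      if pqr: "{p, q, r, t} = {l1, l2, l3, l4}" "distinct [p, q, r]" for p q r t
    proof
      assume *: "(fst p = i \<longleftrightarrow> fst q = i) \<and> (fst r = i \<longleftrightarrow> fst q = i)"
      show False
      proof (cases "fst q = i")
        case True
        then show ?thesis using * pqr(2) by (cases p; cases q; cases r) auto
      next
        case False
        then have "(i, s) \<notin> {p, q, r}" for s using * by auto
        then have "(i, True) = t" "(i, False) = t" using both pqr(1) by blast+
        then show ?thesis by auto
      qed
    qed
    have "{l1, l2, l3, l4} = {l1, l2, l3, l4}" "{l1, l2, l4, l3} = {l1, l2, l3, l4}"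
      "{l3, l2, l4, l1} = {l1, l2, l3, l4}" "{l1, l4, l3, l2} = {l1, l2, l3, l4}" by auto
    note three = three[OF this(1)] three[OF this(2)] three[OF this(3)] three[OF this(4)]
    have "nondeg4 (dir_pt C (\<kappa> i) l1) (dir_pt C (\<kappa> i) l2) (dir_pt C (\<kappa> i) l3) (dir_pt C (\<kappa> i) l4)"
      unfolding nondeg4_def using eq[OF _ l(1,2)] eq[OF _ l(3,2)] eq[OF _ l(1,4)] eq[OF _ l(3,4)] l(5) three
      by (simp only: distinct.simps list.set insert_iff empty_iff) metis
    then show ?thesis using that[of "(i, True)"] *[of "(i, True)"] i by (simp add: chain_pos_def)
  qed
qed

end

section \<open>Continuous families of curves\<close>

declare topspace_Alexandroff_compactification [simp del]

definition invols :: "rmoduli \<Rightarrow> invol set" where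
  "invols R = (case R of Of c \<Rightarrow> {c} | Glued \<Rightarrow> UNIV)"

lemma RM_set_eq: "RM_set R k = (\<Union>c\<in>invols R. c_moduli_set c k)"
proof (cases R)
  case Glued
  have "(UNIV :: invol set) = {Tau, Eta}" using invol.exhaust by auto
  then have "(\<Union>c. c_moduli_set c k) = c_moduli_set Tau k \<union> c_moduli_set Eta k"
    by (auto, metis invol.exhaust)
  with Glued show ?thesis by (simp add: invols_def)
qed (simp add: invols_def)

lemma c_moduli_set_subset: "c_moduli_set c k \<subseteq> Collect (real_curve k) // real_iso k"
  by (auto simp: c_moduli_set_def quotient_def)

lemma c_moduli_set_iff:
  "X \<in> c_moduli_set c k \<longleftrightarrow> (\<exists>C. real_curve k C \<and> c_real c C \<and> X = iso_class k C)"
  by (auto simp: c_moduli_set_def quotient_def iso_class_def)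

lemma topspace_RM [simp]: "topspace (RM R k) = RM_set R k"
proof -
  have "topspace (real_curve_space k) = Collect (real_curve k) // real_iso k"
    by (auto simp: real_curve_space_def topspace_pullback_topology)
  moreover have "RM_set R k \<subseteq> Collect (real_curve k) // real_iso k"
    unfolding RM_set_eq using c_moduli_set_subset by blast
  ultimately show ?thesis by (auto simp: RM_def)
qed

definition cr_map :: "nat \<Rightarrow> rcurve set \<Rightarrow> label \<times> label \<times> label \<times> label \<Rightarrow> csphere" where
  "cr_map k X = (\<lambda>(l1, l2, l3, l4)\<in>quadruples k. curve_cross_ratio X l1 l2 l3 l4)"

lemma continuous_map_RM:
  assumes F: "\<And>x. x \<in> topspace T \<Longrightarrow> F x \<in> RM_set R k"
    and c: "\<And>l1 l2 l3 l4. (l1, l2, l3, l4) \<in> quadruples k \<Longrightarrow>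
      continuous_map T csphere_top (\<lambda>x. curve_cross_ratio (F x) l1 l2 l3 l4)"
  shows "continuous_map T (RM R k) F"
proof -
  have "continuous_map T (product_topology (\<lambda>_. csphere_top) (quadruples k)) (cr_map k \<circ> F)"
    unfolding continuous_map_componentwise
  proof (intro conjI ballI)
    show "(cr_map k \<circ> F) ` topspace T \<subseteq> extensional (quadruples k)"
      by (auto simp: cr_map_def)
    fix q assume q: "q \<in> quadruples k"
    obtain l1 l2 l3 l4 where "q = (l1, l2, l3, l4)" by (cases q)
    with c[of l1 l2 l3 l4] q show "continuous_map T csphere_top (\<lambda>x. (cr_map k \<circ> F) x q)"
      by (simp add: cr_map_def)
  qed
  moreover have "topspace T \<subseteq> F -` (Collect (real_curve k) // real_iso k)"
    using F c_moduli_set_subset unfolding RM_set_eq by blast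
  ultimately have "continuous_map T (real_curve_space k) F"
    unfolding real_curve_space_def cr_map_def[symmetric, abs_def] by (rule continuous_map_pullback')
  then show ?thesis using F by (auto simp: RM_def continuous_map_in_subtopology)
qed

lemma continuous_map_cr_map:
  "continuous_map (RM R k) (product_topology (\<lambda>_. csphere_top) (quadruples k)) (cr_map k)"
proof -
  have "continuous_map (real_curve_space k) (product_topology (\<lambda>_. csphere_top) (quadruples k)) (id \<circ> cr_map k)"
    unfolding real_curve_space_def cr_map_def[symmetric, abs_def]
    by (rule continuous_map_pullback) (rule continuous_map_id)
  then show ?thesis by (simp add: RM_def continuous_map_from_subtopology)
qed

text \<open>Levels and numbers jump, but the ratios vary continuously as points of the projective
  line. For a fixed view m the cross-ratio is a quotient of continuous functions on the open set
  where the view is nondegenerate, and by \<open>chain.ex_ratio\<close> these sets cover S.\<close>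

lemma continuous_chain_family:
  fixes S :: "'a::topological_space set"
  assumes ch: "\<And>x. x \<in> S \<Longrightarrow> chain c N (\<kappa> x) (z x) k"
    and cont: "\<And>l m. l \<in> labels k \<Longrightarrow> fst m \<in> {1..k} \<Longrightarrow> continuous_on S (n l m) \<and> continuous_on S (d l m)"
    and ratio: "\<And>x l m. x \<in> S \<Longrightarrow> l \<in> labels k \<Longrightarrow> fst m \<in> {1..k} \<Longrightarrow>
      (n l m x \<noteq> 0 \<or> d l m x \<noteq> 0) \<and> chain_ratio c N (\<kappa> x) (z x) k l m = proj_pt (n l m x) (d l m x)"
    and q: "(l1, l2, l3, l4) \<in> quadruples k"
  shows "continuous_map (top_of_set S) csphere_top (\<lambda>x. cr (chain_curve c N (\<kappa> x) (z x) k) l1 l2 l3 l4)"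
proof -
  let ?g = "\<lambda>x. cr (chain_curve c N (\<kappa> x) (z x) k) l1 l2 l3 l4"
  let ?A = "\<lambda>m x. (n l1 m x * d l2 m x - n l2 m x * d l1 m x) * (n l3 m x * d l4 m x - n l4 m x * d l3 m x)"
  let ?B = "\<lambda>m x. (n l3 m x * d l2 m x - n l2 m x * d l3 m x) * (n l1 m x * d l4 m x - n l4 m x * d l1 m x)"
  let ?W = "\<lambda>m. {x \<in> S. ?A m x \<noteq> 0 \<or> ?B m x \<noteq> 0}"
  let ?I = "{m::label. fst m \<in> {1..k}}"
  have l: "l1 \<in> labels k" "l2 \<in> labels k" "l3 \<in> labels k" "l4 \<in> labels k" using q by (auto simp: quadruples_iff)
  have nz: "n l m x \<noteq> 0 \<or> d l m x \<noteq> 0" and r: "chain_ratio c N (\<kappa> x) (z x) k l m = proj_pt (n l m x) (d l m x)"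
    if "m \<in> ?I" "x \<in> S" "l \<in> labels k" for l m x using ratio that by auto
  have nd: "nondeg4 (chain_ratio c N (\<kappa> x) (z x) k l1 m) (chain_ratio c N (\<kappa> x) (z x) k l2 m)
      (chain_ratio c N (\<kappa> x) (z x) k l3 m) (chain_ratio c N (\<kappa> x) (z x) k l4 m) \<longleftrightarrow> x \<in> ?W m"
    if "m \<in> ?I" "x \<in> S" for m x
    unfolding r[OF that l(1)] r[OF that l(2)] r[OF that l(3)] r[OF that l(4)]
      nondeg4_proj_pt[OF nz[OF that l(1)] nz[OF that l(2)] nz[OF that l(3)] nz[OF that l(4)]] using that(2) by simp
  have eq: "?g x = proj_pt (?A m x) (?B m x)" if "m \<in> ?I" "x \<in> ?W m" for m x
  proof -
    have x: "x \<in> S" using that(2) by simp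
    have m: "fst m \<in> {1..k}" using that(1) by simp
    have "nondeg4 (chain_ratio c N (\<kappa> x) (z x) k l1 m) (chain_ratio c N (\<kappa> x) (z x) k l2 m)
      (chain_ratio c N (\<kappa> x) (z x) k l3 m) (chain_ratio c N (\<kappa> x) (z x) k l4 m)"
      using nd[OF that(1) x] that(2) by blast
    from chain.cr_ratio[OF ch[OF x] q m this] show ?thesis
      unfolding r[OF that(1) x l(1)] r[OF that(1) x l(2)] r[OF that(1) x l(3)] r[OF that(1) x l(4)]
        cross_ratio_proj_pt[OF nz[OF that(1) x l(1)] nz[OF that(1) x l(2)] nz[OF that(1) x l(3)] nz[OF that(1) x l(4)]] .
  qed
  have cA: "continuous_on S (?A m)" "continuous_on S (?B m)" if "m \<in> ?I" for m
    using cont[OF l(1), of m] cont[OF l(2), of m] cont[OF l(3), of m] cont[OF l(4), of m] that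
    by (auto intro!: continuous_intros)
  show ?thesis
  proof (rule pasting_lemma[where I = ?I and T = ?W and f = "\<lambda>_. ?g"])
    fix m assume m: "m \<in> ?I"
    have o0: "open (- {0::complex})" by (rule open_Compl) simp
    from openin_Un[OF continuous_openin_preimage_gen[OF cA(1)[OF m] o0]
        continuous_openin_preimage_gen[OF cA(2)[OF m] o0]] have "openin (top_of_set S) (S \<inter> ?A m -` (- {0}) \<union> S \<inter> ?B m -` (- {0}))" .
    moreover have "?W m = S \<inter> ?A m -` (- {0}) \<union> S \<inter> ?B m -` (- {0})" by blast
    ultimately show "openin (top_of_set S) (?W m)" by (simp only:)
    have "continuous_map (top_of_set (?W m)) csphere_top (\<lambda>x. proj_pt (?A m x) (?B m x))"
      by (rule continuous_map_proj_pt) (use cA[OF m] in \<open>auto intro: continuous_on_subset\<close>)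
    then have "continuous_map (top_of_set (?W m)) csphere_top ?g"
      by (rule continuous_map_eq) (use eq[OF m] in simp)
    moreover have "subtopology (top_of_set S) (?W m) = top_of_set (?W m)"
      unfolding subtopology_subtopology by (rule arg_cong) blast
    ultimately show "continuous_map (subtopology (top_of_set S) (?W m)) csphere_top ?g" by (simp only:)
  next
    fix x assume "x \<in> topspace (top_of_set S)"
    then have x: "x \<in> S" by simp
    obtain m where m: "fst m \<in> {1..k}" "nondeg4 (chain_ratio c N (\<kappa> x) (z x) k l1 m)
      (chain_ratio c N (\<kappa> x) (z x) k l2 m) (chain_ratio c N (\<kappa> x) (z x) k l3 m) (chain_ratio c N (\<kappa> x) (z x) k l4 m)"
      using chain.ex_ratio[OF ch[OF x] q] by metis
    have "m \<in> ?I" using m(1) by simp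
    with nd[OF this x] m(2) show "\<exists>j. j \<in> ?I \<and> x \<in> ?W j \<and> ?g x = ?g x" by blast
  qed simp
qed

text \<open>The types c and c' may differ; this is what identifies \<open>Tau\<close> and
  \<open>Eta\<close> curves on the common boundary.\<close>

lemma chain_cr_eqI:
  assumes "chain c N \<kappa> z k" "chain c' N' \<kappa>' z' k"
    and "\<And>l m. l \<in> labels k \<Longrightarrow> fst m \<in> {1..k} \<Longrightarrow> chain_ratio c N \<kappa> z k l m = chain_ratio c' N' \<kappa>' z' k l m"
  shows "iso_class k (chain_curve c N \<kappa> z k) = iso_class k (chain_curve c' N' \<kappa>' z' k)"
proof -
  have "cr (chain_curve c N \<kappa> z k) l1 l2 l3 l4 = cr (chain_curve c' N' \<kappa>' z' k) l1 l2 l3 l4"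
    if q: "(l1, l2, l3, l4) \<in> quadruples k" for l1 l2 l3 l4
  proof -
    obtain m where m: "fst m \<in> {1..k}" "nondeg4 (chain_ratio c N \<kappa> z k l1 m)
      (chain_ratio c N \<kappa> z k l2 m) (chain_ratio c N \<kappa> z k l3 m) (chain_ratio c N \<kappa> z k l4 m)"
      using chain.ex_ratio[OF assms(1) q] by metis
    have "l1 \<in> labels k" "l2 \<in> labels k" "l3 \<in> labels k" "l4 \<in> labels k" using q by (auto simp: quadruples_iff)
    note eq = this[THEN assms(3)[OF _ m(1)]]
    show ?thesis
      using chain.cr_ratio[OF assms(1) q m] chain.cr_ratio[OF assms(2) q m(1)] m(2) unfolding eq by simp
  qed
  then show ?thesis
    using iso_class_eq_iff[OF chain.real[OF assms(1)] chain.real[OF assms(2)]] by blast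
qed

section \<open>Two pairs of points on a chain\<close>

text \<open>
  Homogeneous coordinates \<open>p1 : p2\<close>, \<open>q1 : q2\<close>, \<open>u1 : u2\<close> and \<open>w1 : w2\<close> stand for points \<open>p\<close>, \<open>q\<close>, \<open>u = q / p\<close>
  and \<open>w = p q\<close> of \<open>[0, \<infinity>]\<close>. The points \<open>z\<^sub>1\<^sup>+ = p\<close> and \<open>z\<^sub>2\<^sup>+ = \<omega> q\<close> degenerate to a chain when some of these
  are \<open>0\<close> or \<open>\<infinity>\<close>, and \<open>dir_sign\<close> records the direction.
\<close>
definition dir_sign :: "real \<Rightarrow> real \<Rightarrow> int" where
  "dir_sign n d = (if d = 0 then 1 else 0) - (if n = 0 then 1 else 0)"

text \<open>Let a and b be the orders of growth of p and q, so P, Q, U, W are the signs of a, b, b -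
  a and a + b. The points z1+, z1-, z2+, z2- have heights a, -a, b, -b, and P + W - U = sgn (a + a)
  + sgn (a + b) + sgn (a - b) compares z1+ with the other three. Heights are so replaced by ranks
  between -3 and 3, which the shift by 3 makes natural numbers; the centre is 3 and conjugation is
  reflection in it.\<close>

definition pair_levels :: "int \<Rightarrow> int \<Rightarrow> int \<Rightarrow> int \<Rightarrow> nat \<Rightarrow> nat" where
  "pair_levels P Q U W i = nat (3 + (if i = 1 then P + W - U else Q + W + U))"

text \<open>The hypotheses leave exactly the 17 sign vectors that arise from real heights a and b.
  For each of them the ranks compare as the heights do.\<close>

lemma sgn_sum_aux:
  fixes P Q U W :: int
  assumes "P \<in> {-1, 0, 1}" "Q \<in> {-1, 0, 1}" "U \<in> {-1, 0, 1}" "W \<in> {-1, 0, 1}"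
    and "P = Q \<longrightarrow> W = P" "P = - Q \<longrightarrow> U = Q" "P = 0 \<longrightarrow> U = Q \<and> W = Q" "Q = 0 \<longrightarrow> U = - P \<and> W = P"
      "U = 0 \<longrightarrow> P = Q" "W = 0 \<longrightarrow> P = - Q"
  shows "sgn (P + W - U) = P \<and> sgn (Q + W + U) = Q \<and> sgn ((Q + W + U) - (P + W - U)) = U \<and>
    sgn ((P + W - U) + (Q + W + U)) = W \<and> \<bar>P + W - U\<bar> \<le> 3 \<and> \<bar>Q + W + U\<bar> \<le> 3"
  using assms by (elim insertE emptyE) simp_all

text \<open>The last two conditions exclude z2+ = z1+ and z1+ = z2-. Relations among the weights are
  imposed for P = Q = 0 only, when pairs 1 and 2 both sit on the central level; in all other cases a
  finite u or w is a ratio on another sphere, which has its own scale.\<close>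

locale pair_weights =
  fixes c :: invol and p1 p2 q1 q2 u1 u2 w1 w2 :: real and \<omega> :: complex
  fixes P Q U W :: int
  defines "P \<equiv> dir_sign p1 p2" and "Q \<equiv> dir_sign q1 q2" and "U \<equiv> dir_sign u1 u2" and "W \<equiv> dir_sign w1 w2"
  assumes nz: "p1 \<noteq> 0 \<or> p2 \<noteq> 0" "q1 \<noteq> 0 \<or> q2 \<noteq> 0" "u1 \<noteq> 0 \<or> u2 \<noteq> 0" "w1 \<noteq> 0 \<or> w2 \<noteq> 0"
    and signs: "P = Q \<Longrightarrow> W = P" "P = - Q \<Longrightarrow> U = Q" "P = 0 \<Longrightarrow> U = Q \<and> W = Q" "Q = 0 \<Longrightarrow> U = - P \<and> W = P"
      "U = 0 \<Longrightarrow> P = Q" "W = 0 \<Longrightarrow> P = - Q"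
    and vals: "P = 0 \<Longrightarrow> Q = 0 \<Longrightarrow> q1 * p2 * u2 = q2 * p1 * u1" "P = 0 \<Longrightarrow> Q = 0 \<Longrightarrow> q1 * p1 * w2 = q2 * p2 * w1"
    and \<omega>: "norm \<omega> = 1" "\<omega> * u1 \<noteq> u2" "w1 \<noteq> inv_sign c * \<omega> * w2"
begin

text \<open>The involution fixes the scale of the central sphere, so p and q are kept there. Off the
  centre a sphere can be rescaled: the first point is put at 1, and the second carries u if it
  shares a sphere with z1+, or w if it shares one with z1-.\<close>

definition pnum :: "nat \<Rightarrow> complex" where
  "pnum i = (if i = 1 then (if P = 0 then p1 / p2 else 1)
     else \<omega> * (if Q = 0 then q1 / q2 else if U = 0 then u1 / u2 else if W = 0 then w1 / w2 else 1))"

abbreviation "levels \<equiv> pair_levels P Q U W"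

lemma sign_zero:
  "P = 0 \<longleftrightarrow> p1 \<noteq> 0 \<and> p2 \<noteq> 0" "Q = 0 \<longleftrightarrow> q1 \<noteq> 0 \<and> q2 \<noteq> 0" "U = 0 \<longleftrightarrow> u1 \<noteq> 0 \<and> u2 \<noteq> 0" "W = 0 \<longleftrightarrow> w1 \<noteq> 0 \<and> w2 \<noteq> 0"
  using nz unfolding P_def Q_def U_def W_def dir_sign_def by auto

lemma sign_cases: "P \<in> {-1, 0, 1}" "Q \<in> {-1, 0, 1}" "U \<in> {-1, 0, 1}" "W \<in> {-1, 0, 1}"
  unfolding P_def Q_def U_def W_def dir_sign_def by auto

lemma level_signs:
  "sgn (P + W - U) = P" "sgn (Q + W + U) = Q" "sgn ((Q + W + U) - (P + W - U)) = U"
  "sgn ((P + W - U) + (Q + W + U)) = W" "\<bar>P + W - U\<bar> \<le> 3" "\<bar>Q + W + U\<bar> \<le> 3"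
proof -
  have "P = Q \<longrightarrow> W = P" "P = - Q \<longrightarrow> U = Q" "P = 0 \<longrightarrow> U = Q \<and> W = Q" "Q = 0 \<longrightarrow> U = - P \<and> W = P"
    "U = 0 \<longrightarrow> P = Q" "W = 0 \<longrightarrow> P = - Q"
    using signs by blast+
  from sgn_sum_aux[OF sign_cases this]
  show "sgn (P + W - U) = P" "sgn (Q + W + U) = Q" "sgn ((Q + W + U) - (P + W - U)) = U"
    "sgn ((P + W - U) + (Q + W + U)) = W" "\<bar>P + W - U\<bar> \<le> 3" "\<bar>Q + W + U\<bar> \<le> 3"
    by blast+
qed

lemma levels_le: "levels i \<le> 6" "int (levels i) = 3 + (if i = 1 then P + W - U else Q + W + U)"
  "int (6 - levels i) = 3 - (if i = 1 then P + W - U else Q + W + U)"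
proof -
  have "\<bar>if i = 1 then P + W - U else Q + W + U\<bar> \<le> 3" using level_signs by simp
  then show "levels i \<le> 6" "int (levels i) = 3 + (if i = 1 then P + W - U else Q + W + U)"
    "int (6 - levels i) = 3 - (if i = 1 then P + W - U else Q + W + U)"
    unfolding pair_levels_def by linarith+
qed

lemma omega_cnj: "cnj \<omega> * \<omega> = 1" "\<omega> * cnj \<omega> = 1" "\<omega> \<noteq> 0" "cnj \<omega> = 1 / \<omega>"
proof -
  show *: "\<omega> * cnj \<omega> = 1" using \<omega>(1) by (simp add: complex_norm_square[symmetric])
  show "cnj \<omega> * \<omega> = 1" using * by (simp add: mult.commute)
  show 0: "\<omega> \<noteq> 0" using \<omega>(1) by auto
  show "cnj \<omega> = 1 / \<omega>" using * 0 by (simp add: field_simps)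
qed

lemma pnum_nonzero: "pnum i \<noteq> 0"
  using sign_zero omega_cnj(3) by (auto simp: pnum_def)

lemma pnum_products:
  "P = 0 \<Longrightarrow> pnum 1 * cnj (pnum 1) = complex_of_real ((p1 / p2)\<^sup>2)"
  "Q = 0 \<Longrightarrow> pnum 2 * cnj (pnum 2) = complex_of_real ((q1 / q2)\<^sup>2)"
  "U = 0 \<Longrightarrow> pnum 2 / pnum 1 = \<omega> * complex_of_real (u1 / u2)"
  "W = 0 \<Longrightarrow> pnum 1 * cnj (pnum 2) = cnj \<omega> * complex_of_real (w1 / w2)"
  "W = 0 \<Longrightarrow> pnum 2 * cnj (pnum 1) = \<omega> * complex_of_real (w1 / w2)"
proof -
  show "P = 0 \<Longrightarrow> pnum 1 * cnj (pnum 1) = complex_of_real ((p1 / p2)\<^sup>2)"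
    by (simp add: pnum_def power2_eq_square)
  show "Q = 0 \<Longrightarrow> pnum 2 * cnj (pnum 2) = complex_of_real ((q1 / q2)\<^sup>2)"
    using omega_cnj(2) by (simp add: pnum_def power2_eq_square field_simps)
  show "U = 0 \<Longrightarrow> pnum 2 / pnum 1 = \<omega> * complex_of_real (u1 / u2)"
  proof -
    assume U: "U = 0"
    show ?thesis
    proof (cases "P = 0")
      case True
      then have Q: "Q = 0" using signs(5)[OF U] by simp
      have "(q1 / q2) / (p1 / p2) = u1 / u2" using vals(1)[OF True Q] sign_zero True Q U by (simp add: field_simps)
      moreover have "pnum 2 / pnum 1 = \<omega> * complex_of_real ((q1 / q2) / (p1 / p2))"
        using True Q by (simp add: pnum_def)
      ultimately show ?thesis by (simp only:)
    qed (use signs(5)[OF U] U in \<open>simp add: pnum_def\<close>)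
  qed
  have *: "pnum 2 * pnum 1 = \<omega> * complex_of_real (w1 / w2) \<and> cnj (pnum 1) = pnum 1" if W: "W = 0"
  proof (cases "P = 0")
    case True
    then have Q: "Q = 0" using signs(6)[OF W] by simp
    have "(q1 / q2) * (p1 / p2) = w1 / w2" using vals(2)[OF True Q] sign_zero True Q W by (simp add: field_simps)
    moreover have "pnum 2 * pnum 1 = \<omega> * complex_of_real ((q1 / q2) * (p1 / p2)) \<and> cnj (pnum 1) = pnum 1"
      using True Q by (simp add: pnum_def)
    ultimately show ?thesis by (simp only:)
  next
    case False
    then have "Q \<noteq> 0" "U \<noteq> 0" using signs(6)[OF W] signs(2) by auto
    then show ?thesis using False W by (simp add: pnum_def)
  qed
  then show W5: "W = 0 \<Longrightarrow> pnum 2 * cnj (pnum 1) = \<omega> * complex_of_real (w1 / w2)" by simp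
  show "W = 0 \<Longrightarrow> pnum 1 * cnj (pnum 2) = cnj \<omega> * complex_of_real (w1 / w2)"
    using arg_cong[OF W5, of cnj] by (simp add: mult.commute)
qed

lemma levels_eq_iff: "levels 1 = levels 2 \<longleftrightarrow> U = 0" "levels 1 = 6 - levels 2 \<longleftrightarrow> W = 0" "levels 2 = 6 - levels 1 \<longleftrightarrow> W = 0"
  using levels_le(2)[of 1] levels_le(2)[of 2] levels_le(3)[of 1] levels_le(3)[of 2] level_signs(3,4)
  by (auto simp: sgn_if split: if_splits)

lemma chain: "chain c 6 levels pnum 2"
proof
  have i12: "i \<in> {1..2} \<longleftrightarrow> i = 1 \<or> i = 2" for i :: nat by auto
  have ne: "pnum 1 \<noteq> pnum 2" if "U = 0"
  proof
    assume "pnum 1 = pnum 2"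
    then have "\<omega> * complex_of_real (u1 / u2) = 1" using pnum_products(3)[OF that] pnum_nonzero by simp
    then show False using \<omega>(2) sign_zero(3) that by (simp add: field_simps)
  qed
  have ne': "pnum 1 * cnj (pnum 2) \<noteq> inv_sign c" if "W = 0"
  proof
    assume "pnum 1 * cnj (pnum 2) = inv_sign c"
    then have "complex_of_real (w1 / w2) = inv_sign c * \<omega>"
      using pnum_products(4)[OF that] omega_cnj by (simp add: field_simps)
    then show False using \<omega>(3) sign_zero(4) that by (simp add: field_simps)
  qed
  have ne'': "pnum 2 * cnj (pnum 1) \<noteq> inv_sign c" if "W = 0"
  proof
    assume "pnum 2 * cnj (pnum 1) = inv_sign c"
    from arg_cong[OF this, of cnj] ne'[OF that] show False by (simp add: mult.commute)
  qed
  show "pnum i \<noteq> pnum j" if "i \<in> {1..2}" "j \<in> {1..2}" "i \<noteq> j" "levels i = levels j" for i j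
    using that ne levels_eq_iff(1) unfolding i12 by metis
  show "pnum i \<noteq> inv_sign c / cnj (pnum j)" if "i \<in> {1..2}" "j \<in> {1..2}" "i \<noteq> j" "levels i = 6 - levels j" for i j
  proof -
    have "cnj (pnum j) \<noteq> 0" using pnum_nonzero by simp
    then have "pnum i = inv_sign c / cnj (pnum j) \<longleftrightarrow> pnum i * cnj (pnum j) = inv_sign c"
      by (simp add: field_simps)
    then show ?thesis using that ne' ne'' levels_eq_iff(2,3) unfolding i12 by metis
  qed
qed (simp_all add: levels_le(1) pnum_nonzero)

lemma ratio_pair:
  assumes "fst l \<noteq> 0" "fst m \<noteq> 0" and "n \<noteq> 0 \<or> d \<noteq> 0"
    and "n = 0 \<Longrightarrow> chain_pos 6 levels 2 l < chain_pos 6 levels 2 m"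
    and "d = 0 \<Longrightarrow> chain_pos 6 levels 2 m < chain_pos 6 levels 2 l"
    and pos: "n \<noteq> 0 \<Longrightarrow> d \<noteq> 0 \<Longrightarrow> chain_pos 6 levels 2 l = chain_pos 6 levels 2 m"
    and num: "n \<noteq> 0 \<Longrightarrow> d \<noteq> 0 \<Longrightarrow> chain_num c pnum l / chain_num c pnum m = n / d"
  shows "chain_ratio c 6 levels pnum 2 l m = proj_pt n d" "chain_ratio c 6 levels pnum 2 m l = proj_pt d n"
proof -
  have num': "chain_num c pnum m / chain_num c pnum l = d / n" if "n \<noteq> 0" "d \<noteq> 0"
    using arg_cong[OF num[OF that], of inverse] by simp
  show "chain_ratio c 6 levels pnum 2 l m = proj_pt n d"
    using assms(1-5) pos num unfolding chain_ratio_def proj_pt_def by (cases "n = 0"; cases "d = 0") simp_all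
  show "chain_ratio c 6 levels pnum 2 m l = proj_pt d n"
    using assms(1-5) pos num' unfolding chain_ratio_def proj_pt_def by (cases "n = 0"; cases "d = 0") simp_all
qed

lemma level_pos:
  "int (chain_pos 6 levels 2 (1, True)) = 3 + (P + W - U)" "int (chain_pos 6 levels 2 (1, False)) = 3 - (P + W - U)"
  "int (chain_pos 6 levels 2 (2, True)) = 3 + (Q + W + U)" "int (chain_pos 6 levels 2 (2, False)) = 3 - (Q + W + U)"
  using levels_le(2,3) by (simp_all add: chain_pos_def)

lemma level_less:
  "p1 = 0 \<Longrightarrow> P + W - U < 0" "p2 = 0 \<Longrightarrow> P + W - U > 0" "P = 0 \<Longrightarrow> P + W - U = 0"
  "q1 = 0 \<Longrightarrow> Q + W + U < 0" "q2 = 0 \<Longrightarrow> Q + W + U > 0" "Q = 0 \<Longrightarrow> Q + W + U = 0"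
  "u1 = 0 \<Longrightarrow> Q + W + U < P + W - U" "u2 = 0 \<Longrightarrow> Q + W + U > P + W - U" "U = 0 \<Longrightarrow> Q + W + U = P + W - U"
  "w1 = 0 \<Longrightarrow> (P + W - U) + (Q + W + U) < 0" "w2 = 0 \<Longrightarrow> (P + W - U) + (Q + W + U) > 0"
  "W = 0 \<Longrightarrow> (P + W - U) + (Q + W + U) = 0"
proof -
  have z: "p1 = 0 \<Longrightarrow> P = - 1" "p2 = 0 \<Longrightarrow> P = 1" "q1 = 0 \<Longrightarrow> Q = - 1" "q2 = 0 \<Longrightarrow> Q = 1"
    "u1 = 0 \<Longrightarrow> U = - 1" "u2 = 0 \<Longrightarrow> U = 1" "w1 = 0 \<Longrightarrow> W = - 1" "w2 = 0 \<Longrightarrow> W = 1"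
    using nz unfolding P_def Q_def U_def W_def dir_sign_def by simp_all
  have s: "sgn x = - 1 \<Longrightarrow> x < 0" "sgn x = 1 \<Longrightarrow> x > 0" "sgn x = 0 \<Longrightarrow> x = 0" for x :: int
    by (simp_all add: sgn_if split: if_splits)
  show "p1 = 0 \<Longrightarrow> P + W - U < 0" "p2 = 0 \<Longrightarrow> P + W - U > 0" "P = 0 \<Longrightarrow> P + W - U = 0"
    using s[OF level_signs(1)[THEN trans]] z by blast+
  show "q1 = 0 \<Longrightarrow> Q + W + U < 0" "q2 = 0 \<Longrightarrow> Q + W + U > 0" "Q = 0 \<Longrightarrow> Q + W + U = 0"
    using s[OF level_signs(2)[THEN trans]] z by blast+
  have "u1 = 0 \<Longrightarrow> (Q + W + U) - (P + W - U) < 0" "u2 = 0 \<Longrightarrow> (Q + W + U) - (P + W - U) > 0"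
    "U = 0 \<Longrightarrow> (Q + W + U) - (P + W - U) = 0"
    using s[OF level_signs(3)[THEN trans]] z by blast+
  then show "u1 = 0 \<Longrightarrow> Q + W + U < P + W - U" "u2 = 0 \<Longrightarrow> Q + W + U > P + W - U" "U = 0 \<Longrightarrow> Q + W + U = P + W - U"
    by simp_all
  show "w1 = 0 \<Longrightarrow> (P + W - U) + (Q + W + U) < 0" "w2 = 0 \<Longrightarrow> (P + W - U) + (Q + W + U) > 0"
    "W = 0 \<Longrightarrow> (P + W - U) + (Q + W + U) = 0"
    using s[OF level_signs(4)[THEN trans]] z by blast+
qed

abbreviation "cratio \<equiv> chain_ratio c 6 levels pnum 2"

lemma chain_num_simps: "chain_num c pnum (i, True) = pnum i" "chain_num c pnum (i, False) = inv_sign c / cnj (pnum i)"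
  by (simp_all add: chain_num_def)

lemma div_inv_sign: "x / (inv_sign c / y) = inv_sign c * (x * y)"
  by (cases c) simp_all

lemma inv_sign_div: "inv_sign c / y / (inv_sign c / x) = x / y"
  by (cases c) simp_all

lemma ratio_1:
  "cratio (1, True) (1, False) = proj_pt (of_real (p1\<^sup>2)) (inv_sign c * of_real (p2\<^sup>2))"
  "cratio (1, False) (1, True) = proj_pt (inv_sign c * of_real (p2\<^sup>2)) (of_real (p1\<^sup>2))"
proof -
  have n: "chain_num c pnum (1, True) / chain_num c pnum (1, False) = of_real (p1\<^sup>2) / (inv_sign c * of_real (p2\<^sup>2))" if "P = 0"
    unfolding chain_num_simps div_inv_sign pnum_products(1)[OF that] by (cases c) (simp_all add: power_divide)
  show "cratio (1, True) (1, False) = proj_pt (of_real (p1\<^sup>2)) (inv_sign c * of_real (p2\<^sup>2))"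
    "cratio (1, False) (1, True) = proj_pt (inv_sign c * of_real (p2\<^sup>2)) (of_real (p1\<^sup>2))"
    by (rule ratio_pair; use nz(1) sign_zero(1) level_pos(1,2) level_less(1-3) n in \<open>force\<close>)+
qed

lemma ratio_2:
  "cratio (2, True) (2, False) = proj_pt (of_real (q1\<^sup>2)) (inv_sign c * of_real (q2\<^sup>2))"
  "cratio (2, False) (2, True) = proj_pt (inv_sign c * of_real (q2\<^sup>2)) (of_real (q1\<^sup>2))"
proof -
  have n: "chain_num c pnum (2, True) / chain_num c pnum (2, False) = of_real (q1\<^sup>2) / (inv_sign c * of_real (q2\<^sup>2))" if "Q = 0"
    unfolding chain_num_simps div_inv_sign pnum_products(2)[OF that] by (cases c) (simp_all add: power_divide)
  show "cratio (2, True) (2, False) = proj_pt (of_real (q1\<^sup>2)) (inv_sign c * of_real (q2\<^sup>2))"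
    "cratio (2, False) (2, True) = proj_pt (inv_sign c * of_real (q2\<^sup>2)) (of_real (q1\<^sup>2))"
    by (rule ratio_pair; use nz(2) sign_zero(2) level_pos(3,4) level_less(4-6) n in \<open>force\<close>)+
qed

lemma ratio_u:
  "cratio (2, True) (1, True) = proj_pt (\<omega> * of_real u1) (of_real u2)"
  "cratio (1, True) (2, True) = proj_pt (of_real u2) (\<omega> * of_real u1)"
  "cratio (1, False) (2, False) = proj_pt (of_real u1) (\<omega> * of_real u2)"
  "cratio (2, False) (1, False) = proj_pt (\<omega> * of_real u2) (of_real u1)"
proof -
  have n: "chain_num c pnum (2, True) / chain_num c pnum (1, True) = (\<omega> * of_real u1) / of_real u2" if "U = 0"
    unfolding chain_num_simps pnum_products(3)[OF that] by simp
  have n': "chain_num c pnum (1, False) / chain_num c pnum (2, False) = of_real u1 / (\<omega> * of_real u2)" if "U = 0"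
  proof -
    have "cnj (pnum 2 / pnum 1) = cnj \<omega> * of_real (u1 / u2)" unfolding pnum_products(3)[OF that] by simp
    then show ?thesis unfolding chain_num_simps inv_sign_div omega_cnj(4) by simp
  qed
  show "cratio (2, True) (1, True) = proj_pt (\<omega> * of_real u1) (of_real u2)"
    "cratio (1, True) (2, True) = proj_pt (of_real u2) (\<omega> * of_real u1)"
    by (rule ratio_pair; use nz(3) omega_cnj(3) sign_zero(3) level_pos(1,3) level_less(7-9) n in \<open>force\<close>)+
  show "cratio (1, False) (2, False) = proj_pt (of_real u1) (\<omega> * of_real u2)"
    "cratio (2, False) (1, False) = proj_pt (\<omega> * of_real u2) (of_real u1)"
    by (rule ratio_pair; use nz(3) omega_cnj(3) sign_zero(3) level_pos(2,4) level_less(7-9) n' in \<open>force\<close>)+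
qed

lemma ratio_w:
  "cratio (1, True) (2, False) = proj_pt (of_real w1) (inv_sign c * \<omega> * of_real w2)"
  "cratio (2, False) (1, True) = proj_pt (inv_sign c * \<omega> * of_real w2) (of_real w1)"
  "cratio (2, True) (1, False) = proj_pt (\<omega> * of_real w1) (inv_sign c * of_real w2)"
  "cratio (1, False) (2, True) = proj_pt (inv_sign c * of_real w2) (\<omega> * of_real w1)"
proof -
  have n: "chain_num c pnum (1, True) / chain_num c pnum (2, False) = of_real w1 / (inv_sign c * \<omega> * of_real w2)" if "W = 0"
    unfolding chain_num_simps div_inv_sign pnum_products(4)[OF that] omega_cnj(4) by (cases c) simp_all
  have n': "chain_num c pnum (2, True) / chain_num c pnum (1, False) = (\<omega> * of_real w1) / (inv_sign c * of_real w2)" if "W = 0"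
    unfolding chain_num_simps div_inv_sign pnum_products(5)[OF that] by (cases c) simp_all
  show "cratio (1, True) (2, False) = proj_pt (of_real w1) (inv_sign c * \<omega> * of_real w2)"
    "cratio (2, False) (1, True) = proj_pt (inv_sign c * \<omega> * of_real w2) (of_real w1)"
    by (rule ratio_pair; use nz(4) omega_cnj(3) sign_zero(4) level_pos(1,4) level_less(10-12) n in \<open>force\<close>)+
  show "cratio (2, True) (1, False) = proj_pt (\<omega> * of_real w1) (inv_sign c * of_real w2)"
    "cratio (1, False) (2, True) = proj_pt (inv_sign c * of_real w2) (\<omega> * of_real w1)"
    by (rule ratio_pair; use nz(4) omega_cnj(3) sign_zero(4) level_pos(2,3) level_less(10-12) n' in \<open>force\<close>)+
qed

lemma ratio_self: "fst l \<noteq> 0 \<Longrightarrow> cratio l l = proj_pt 1 1"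
  using pnum_nonzero[of "fst l"]
  by (cases l; cases "snd l") (simp_all add: chain_ratio_def proj_pt_def chain_num_def)

lemma ratio_0: "cratio (0, True) m = proj_pt 0 1" "cratio (0, False) m = proj_pt 1 0"
  by (simp_all add: chain_ratio_def chain_val_def proj_pt_def)

end

text \<open>The ratio z_i+ / z_i- is |z_i|^2 up to the sign of the involution, hence the squares; u
  and w govern the ratios between the two pairs. These coordinates are polynomial in the weights and
  \<omega>, so they stay continuous where the levels jump.\<close>

definition ratio_hom :: "invol \<Rightarrow> real \<times> real \<Rightarrow> real \<times> real \<Rightarrow> real \<times> real \<Rightarrow> real \<times> real \<Rightarrow> complex \<Rightarrow>
    label \<Rightarrow> label \<Rightarrow> complex \<times> complex" where
  "ratio_hom c p q u w \<omega> l m =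
    (if l = m then (1, 1) else if l = (0, True) then (0, 1) else if l = (0, False) then (1, 0)
     else if l = (1, True) \<and> m = (1, False) then (of_real ((fst p)\<^sup>2), inv_sign c * of_real ((snd p)\<^sup>2))
     else if l = (1, False) \<and> m = (1, True) then (inv_sign c * of_real ((snd p)\<^sup>2), of_real ((fst p)\<^sup>2))
     else if l = (2, True) \<and> m = (2, False) then (of_real ((fst q)\<^sup>2), inv_sign c * of_real ((snd q)\<^sup>2))
     else if l = (2, False) \<and> m = (2, True) then (inv_sign c * of_real ((snd q)\<^sup>2), of_real ((fst q)\<^sup>2))
     else if l = (2, True) \<and> m = (1, True) then (\<omega> * of_real (fst u), of_real (snd u))
     else if l = (1, True) \<and> m = (2, True) then (of_real (snd u), \<omega> * of_real (fst u))
     else if l = (1, False) \<and> m = (2, False) then (of_real (fst u), \<omega> * of_real (snd u))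
     else if l = (2, False) \<and> m = (1, False) then (\<omega> * of_real (snd u), of_real (fst u))
     else if l = (1, True) \<and> m = (2, False) then (of_real (fst w), inv_sign c * \<omega> * of_real (snd w))
     else if l = (2, False) \<and> m = (1, True) then (inv_sign c * \<omega> * of_real (snd w), of_real (fst w))
     else if l = (2, True) \<and> m = (1, False) then (\<omega> * of_real (fst w), inv_sign c * of_real (snd w))
     else (inv_sign c * of_real (snd w), \<omega> * of_real (fst w)))"

lemma labels_2: "l \<in> labels 2 \<longleftrightarrow> l \<in> {(0, True), (0, False), (1, True), (1, False), (2, True), (2, False)}"
proof -
  have "i \<le> 2 \<longleftrightarrow> i \<in> {0, 1, 2}" for i :: nat by auto
  then show ?thesis by (cases l; cases "snd l") (simp_all add: labels_def)
qed

lemma (in pair_weights) ratio_hom: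
  assumes "l \<in> labels 2" "fst m \<in> {1..2}"
  shows "fst (ratio_hom c (p1, p2) (q1, q2) (u1, u2) (w1, w2) \<omega> l m) \<noteq> 0 \<or>
      snd (ratio_hom c (p1, p2) (q1, q2) (u1, u2) (w1, w2) \<omega> l m) \<noteq> 0"
    "cratio l m = proj_pt (fst (ratio_hom c (p1, p2) (q1, q2) (u1, u2) (w1, w2) \<omega> l m))
      (snd (ratio_hom c (p1, p2) (q1, q2) (u1, u2) (w1, w2) \<omega> l m))"
proof -
  have "m \<in> labels 2" "fst m \<noteq> 0" using assms(2) by (auto simp: labels_def mem_Times_iff)
  then have m: "m \<in> {(1, True), (1, False), (2, True), (2, False)}" by (auto simp: labels_2)
  have l: "l \<in> {(0, True), (0, False), (1, True), (1, False), (2, True), (2, False)}"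
    using assms(1) by (simp only: labels_2)
  from l m show "fst (ratio_hom c (p1, p2) (q1, q2) (u1, u2) (w1, w2) \<omega> l m) \<noteq> 0 \<or>
      snd (ratio_hom c (p1, p2) (q1, q2) (u1, u2) (w1, w2) \<omega> l m) \<noteq> 0"
    by (elim insertE emptyE; insert nz omega_cnj(3); simp add: ratio_hom_def disj_commute)
  from l m show "cratio l m = proj_pt (fst (ratio_hom c (p1, p2) (q1, q2) (u1, u2) (w1, w2) \<omega> l m))
      (snd (ratio_hom c (p1, p2) (q1, q2) (u1, u2) (w1, w2) \<omega> l m))"
    by (elim insertE emptyE; hypsubst;
      simp add: ratio_hom_def ratio_self ratio_0 ratio_1 ratio_2 ratio_u ratio_w del: One_nat_def)
qed

section \<open>The octagon\<close>

text \<open>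
  The first four functions vanish on the sides \<open>x = -2\<close>, \<open>x = 2\<close>, \<open>y = -2\<close> and \<open>y = 2\<close> of the octagon and the
  last four on its oblique sides. In the toric style, the coordinate \<open>p\<close> is a monomial in them, and
  so are \<open>q\<close>, \<open>q / p\<close> and \<open>p q\<close>. The caps and square roots make \<open>q\<^sup>2 = \<tau> / (1 - \<tau>)\<close> at \<open>y = 2 \<tau> - 1\<close> on
  the sides \<open>x = -2\<close> and \<open>x = 2\<close>.
\<close>
definition side :: "nat \<Rightarrow> (nat \<Rightarrow> real) \<Rightarrow> real" where
  "side n v = (if n = 1 then min 1 (2 + v 0) else if n = 2 then min 1 (2 - v 0)
     else if n = 3 then min 1 (2 + v 1) else if n = 4 then min 1 (2 - v 1)
     else if n = 5 then sqrt (min 2 (3 + v 0 + v 1)) else if n = 6 then sqrt (min 2 (3 - v 0 - v 1))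
     else if n = 7 then sqrt (min 2 (3 + v 0 - v 1)) else sqrt (min 2 (3 - v 0 + v 1)))"

text \<open>Points are functions on \<nat> because \<open>oriented_simplex\<close> takes its values
  there; only coordinates 0 and 1 are constrained.\<close>

definition octagon :: "(nat \<Rightarrow> real) set" where
  "octagon = {v. \<bar>v 0\<bar> \<le> 2 \<and> \<bar>v 1\<bar> \<le> 2 \<and> \<bar>v 0 + v 1\<bar> \<le> 3 \<and> \<bar>v 0 - v 1\<bar> \<le> 3}"

definition oct_p :: "(nat \<Rightarrow> real) \<Rightarrow> real \<times> real" where
  "oct_p v = (side 1 v * side 5 v * side 7 v, side 2 v * side 6 v * side 8 v)"

definition oct_q :: "(nat \<Rightarrow> real) \<Rightarrow> real \<times> real" where
  "oct_q v = (side 3 v * side 5 v * side 8 v, side 4 v * side 6 v * side 7 v)"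

definition oct_u :: "(nat \<Rightarrow> real) \<Rightarrow> real \<times> real" where
  "oct_u v = (side 3 v * side 2 v * (side 8 v)\<^sup>2, side 1 v * side 4 v * (side 7 v)\<^sup>2)"

definition oct_w :: "(nat \<Rightarrow> real) \<Rightarrow> real \<times> real" where
  "oct_w v = (side 1 v * side 3 v * (side 5 v)\<^sup>2, side 2 v * side 4 v * (side 6 v)\<^sup>2)"

text \<open>
  The points \<open>z\<^sub>2\<^sup>+ / z\<^sub>1\<^sup>+\<close> and \<open>z\<^sub>2\<^sup>- / z\<^sub>1\<^sup>+\<close> must be negative on the oblique sides where they are of finite size,
  for both involutions. For \<open>\<eta>\<close> this forces \<open>\<omega>\<close> to take both values \<open>1\<close> and \<open>-1\<close>.
\<close>
fun oct_omega :: "invol \<Rightarrow> (nat \<Rightarrow> real) \<Rightarrow> complex" where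
  "oct_omega Tau v = - 1"
| "oct_omega Eta v = Complex (side 5 v * side 6 v) (side 7 v * side 8 v) / Complex (side 5 v * side 6 v) (- side 7 v * side 8 v)"

text \<open>The letters stand for the vanishing of the eight side functions: A vertical, B
  horizontal, C oblique. In the cyclic order A1, C1, B1, C4, A2, C2, B2, C3 only neighbours can
  vanish together, which leaves one interior, eight sides and eight vertices, one for each sign
  vector of \<open>sgn_sum_aux\<close>.\<close>

lemma sign_pattern:
  "(A1 \<longrightarrow> \<not> B1 \<and> \<not> C4 \<and> \<not> A2 \<and> \<not> C2 \<and> \<not> B2) \<longrightarrow> (C1 \<longrightarrow> \<not> C4 \<and> \<not> A2 \<and> \<not> C2 \<and> \<not> B2 \<and> \<not> C3) \<longrightarrow>
   (B1 \<longrightarrow> \<not> A2 \<and> \<not> C2 \<and> \<not> B2 \<and> \<not> C3) \<longrightarrow> (C4 \<longrightarrow> \<not> C2 \<and> \<not> B2 \<and> \<not> C3) \<longrightarrow> (A2 \<longrightarrow> \<not> B2 \<and> \<not> C3) \<longrightarrow> (C2 \<longrightarrow> \<not> C3) \<longrightarrow>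
   P = (if A2 \<or> C2 \<or> C4 then 1 else 0) - (if A1 \<or> C1 \<or> C3 then 1 else (0::int)) \<longrightarrow>
   Q = (if B2 \<or> C2 \<or> C3 then 1 else 0) - (if B1 \<or> C1 \<or> C4 then 1 else (0::int)) \<longrightarrow>
   U = (if A1 \<or> B2 \<or> C3 then 1 else 0) - (if B1 \<or> A2 \<or> C4 then 1 else (0::int)) \<longrightarrow>
   W = (if A2 \<or> B2 \<or> C2 then 1 else 0) - (if A1 \<or> B1 \<or> C1 then 1 else (0::int)) \<longrightarrow>
   (P = Q \<longrightarrow> W = P) \<and> (P = - Q \<longrightarrow> U = Q) \<and> (P = 0 \<longrightarrow> U = Q \<and> W = Q) \<and>
    (Q = 0 \<longrightarrow> U = - P \<and> W = P) \<and> (U = 0 \<longrightarrow> P = Q) \<and> (W = 0 \<longrightarrow> P = - Q)"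
  by (cases A1; cases C1; cases B1; cases C4; cases A2; cases C2; cases B2; cases C3; simp)

text \<open>The weights are nonnegative, so z2+ = z1+ would force \<omega> = 1 and z1+ = z2- would
  force \<open>inv_sign c * \<omega> = 1\<close>. Neither holds for \<open>Tau\<close>. For
  \<open>Eta\<close> the phase is 1 only if c3 c4 = 0 and -1 only if c1 c2 = 0, and then u,
  respectively w, is 0 or infinite.\<close>

lemma pair_weights_of_sides:
  fixes a1 a2 b1 b2 c1 c2 c3 c4 :: real
  assumes "a1 \<ge> 0" "a2 \<ge> 0" "b1 \<ge> 0" "b2 \<ge> 0" "c1 \<ge> 0" "c2 \<ge> 0" "c3 \<ge> 0" "c4 \<ge> 0"
    and z: "a1 = 0 \<longrightarrow> b1 \<noteq> 0 \<and> c4 \<noteq> 0 \<and> a2 \<noteq> 0 \<and> c2 \<noteq> 0 \<and> b2 \<noteq> 0"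
      "c1 = 0 \<longrightarrow> c4 \<noteq> 0 \<and> a2 \<noteq> 0 \<and> c2 \<noteq> 0 \<and> b2 \<noteq> 0 \<and> c3 \<noteq> 0"
      "b1 = 0 \<longrightarrow> a2 \<noteq> 0 \<and> c2 \<noteq> 0 \<and> b2 \<noteq> 0 \<and> c3 \<noteq> 0"
      "c4 = 0 \<longrightarrow> c2 \<noteq> 0 \<and> b2 \<noteq> 0 \<and> c3 \<noteq> 0"
      "a2 = 0 \<longrightarrow> b2 \<noteq> 0 \<and> c3 \<noteq> 0"
      "c2 = 0 \<longrightarrow> c3 \<noteq> 0"
    and \<omega>: "c = Tau \<and> \<omega> = - 1 \<or> c = Eta \<and> \<omega> = Complex (c1 * c2) (c3 * c4) / Complex (c1 * c2) (- c3 * c4)"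
  shows "pair_weights c (a1 * c1 * c3) (a2 * c2 * c4) (b1 * c1 * c4) (b2 * c2 * c3)
    (b1 * a2 * c4\<^sup>2) (a1 * b2 * c3\<^sup>2) (a1 * b1 * c1\<^sup>2) (a2 * b2 * c2\<^sup>2) \<omega>"
proof -
  let ?P = "dir_sign (a1 * c1 * c3) (a2 * c2 * c4)" and ?Q = "dir_sign (b1 * c1 * c4) (b2 * c2 * c3)"
  let ?U = "dir_sign (b1 * a2 * c4\<^sup>2) (a1 * b2 * c3\<^sup>2)" and ?W = "dir_sign (a1 * b1 * c1\<^sup>2) (a2 * b2 * c2\<^sup>2)"
  have nz: "a1 * c1 * c3 \<noteq> 0 \<or> a2 * c2 * c4 \<noteq> 0" "b1 * c1 * c4 \<noteq> 0 \<or> b2 * c2 * c3 \<noteq> 0"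
    "b1 * a2 * c4\<^sup>2 \<noteq> 0 \<or> a1 * b2 * c3\<^sup>2 \<noteq> 0" "a1 * b1 * c1\<^sup>2 \<noteq> 0 \<or> a2 * b2 * c2\<^sup>2 \<noteq> 0" "c1 * c2 \<noteq> 0 \<or> c3 * c4 \<noteq> 0"
    using z by (simp_all, blast+)
  have e: "?P = (if a2 = 0 \<or> c2 = 0 \<or> c4 = 0 then 1 else 0) - (if a1 = 0 \<or> c1 = 0 \<or> c3 = 0 then 1 else 0)"
    "?Q = (if b2 = 0 \<or> c2 = 0 \<or> c3 = 0 then 1 else 0) - (if b1 = 0 \<or> c1 = 0 \<or> c4 = 0 then 1 else 0)"
    "?U = (if a1 = 0 \<or> b2 = 0 \<or> c3 = 0 then 1 else 0) - (if b1 = 0 \<or> a2 = 0 \<or> c4 = 0 then 1 else 0)"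
    "?W = (if a2 = 0 \<or> b2 = 0 \<or> c2 = 0 then 1 else 0) - (if a1 = 0 \<or> b1 = 0 \<or> c1 = 0 then 1 else 0)"
    unfolding dir_sign_def by simp_all
  have s: "(?P = ?Q \<longrightarrow> ?W = ?P) \<and> (?P = - ?Q \<longrightarrow> ?U = ?Q) \<and> (?P = 0 \<longrightarrow> ?U = ?Q \<and> ?W = ?Q) \<and>
    (?Q = 0 \<longrightarrow> ?U = - ?P \<and> ?W = ?P) \<and> (?U = 0 \<longrightarrow> ?P = ?Q) \<and> (?W = 0 \<longrightarrow> ?P = - ?Q)"
    by (rule sign_pattern[THEN mp, THEN mp, THEN mp, THEN mp, THEN mp, THEN mp, THEN mp, THEN mp, THEN mp, THEN mp, OF z e])
  have pos: "b1 * a2 * c4\<^sup>2 \<ge> 0" "a1 * b2 * c3\<^sup>2 \<ge> 0" "a1 * b1 * c1\<^sup>2 \<ge> 0" "a2 * b2 * c2\<^sup>2 \<ge> 0"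
    using assms(1-8) by simp_all
  have eta: "norm \<omega> = 1" "\<omega> = 1 \<Longrightarrow> c3 * c4 = 0" "\<omega> = - 1 \<Longrightarrow> c1 * c2 = 0" if "c = Eta"
  proof -
    have d: "Complex (c1 * c2) (- c3 * c4) \<noteq> 0" using nz(5) by (auto simp: complex_eq_iff)
    have w: "\<omega> = Complex (c1 * c2) (c3 * c4) / Complex (c1 * c2) (- c3 * c4)" using \<omega> that by simp
    have "norm (Complex (c1 * c2) (c3 * c4)) = norm (Complex (c1 * c2) (- c3 * c4))" by (simp add: cmod_def)
    then show "norm \<omega> = 1" using d unfolding w norm_divide by simp
    show "c3 * c4 = 0" if "\<omega> = 1"
    proof -
      have "Complex (c1 * c2) (c3 * c4) = Complex (c1 * c2) (- c3 * c4)" using that d w by simp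
      then show ?thesis by simp
    qed
    show "c1 * c2 = 0" if "\<omega> = - 1"
    proof -
      have "Complex (c1 * c2) (c3 * c4) = - Complex (c1 * c2) (- c3 * c4)" using that d w by (simp add: field_simps)
      then show ?thesis by (simp add: complex_eq_iff)
    qed
  qed
  \<comment> \<open>Comparing moduli gives x = y; as this common value is not 0, it can be
    cancelled.\<close>
  have eq_or: "x = y \<and> w = 1" if "w * complex_of_real x = complex_of_real y" "norm w = 1" "x \<ge> 0" "y \<ge> 0" "x \<noteq> 0 \<or> y \<noteq> 0" for w x y
  proof -
    have "norm (w * complex_of_real x) = norm (complex_of_real y)" using that(1) by simp
    then have "x = y" using that(2-4) by (simp add: norm_mult)
    then show ?thesis using that(1,5) by simp
  qed
  have n1: "norm \<omega> = 1" using \<omega> eta(1) by auto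
  have u: "\<omega> * complex_of_real (b1 * a2 * c4\<^sup>2) \<noteq> complex_of_real (a1 * b2 * c3\<^sup>2)"
  proof
    assume e: "\<omega> * complex_of_real (b1 * a2 * c4\<^sup>2) = complex_of_real (a1 * b2 * c3\<^sup>2)"
    from eq_or[OF e n1 pos(1,2) nz(3)] have *: "b1 * a2 * c4\<^sup>2 = a1 * b2 * c3\<^sup>2" "\<omega> = 1" by auto
    then have "c = Eta" using \<omega> by auto
    then have "c3 * c4 = 0" using eta(2) *(2) by simp
    then have "b1 * a2 * c4\<^sup>2 = 0 \<or> a1 * b2 * c3\<^sup>2 = 0" by auto
    with *(1) nz(3) show False by linarith
  qed
  have w: "complex_of_real (a1 * b1 * c1\<^sup>2) \<noteq> inv_sign c * \<omega> * complex_of_real (a2 * b2 * c2\<^sup>2)"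
  proof
    assume e: "complex_of_real (a1 * b1 * c1\<^sup>2) = inv_sign c * \<omega> * complex_of_real (a2 * b2 * c2\<^sup>2)"
    have "norm (inv_sign c * \<omega>) = 1" using n1 by (simp add: norm_mult)
    from eq_or[OF e[symmetric] this pos(4,3)] nz(4)
    have *: "a2 * b2 * c2\<^sup>2 = a1 * b1 * c1\<^sup>2" "inv_sign c * \<omega> = 1" by blast+
    have "c = Eta" using *(2) \<omega> by (cases c) simp_all
    moreover from this have "\<omega> = - 1" using *(2) by (simp add: minus_equation_iff[of \<omega>])
    ultimately have "c = Eta" "\<omega> = - 1" by blast+
    then have "c1 * c2 = 0" using eta(3) by simp
    then have "a2 * b2 * c2\<^sup>2 = 0 \<or> a1 * b1 * c1\<^sup>2 = 0" by auto
    with *(1) nz(4) show False by linarith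
  qed
  show ?thesis
    by (rule pair_weights.intro[OF nz(1-4) s[THEN conjunct1, THEN mp] s[THEN conjunct2, THEN conjunct1, THEN mp]
          s[THEN conjunct2, THEN conjunct2, THEN conjunct1, THEN mp]
          s[THEN conjunct2, THEN conjunct2, THEN conjunct2, THEN conjunct1, THEN mp]
          s[THEN conjunct2, THEN conjunct2, THEN conjunct2, THEN conjunct2, THEN conjunct1, THEN mp]
          s[THEN conjunct2, THEN conjunct2, THEN conjunct2, THEN conjunct2, THEN conjunct2, THEN mp] _ _ n1 u w])
      (simp_all only: power2_eq_square ac_simps)
qed

lemma oct_weights:
  assumes "v \<in> octagon"
  shows "pair_weights c (fst (oct_p v)) (snd (oct_p v)) (fst (oct_q v)) (snd (oct_q v)) (fst (oct_u v)) (snd (oct_u v))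
    (fst (oct_w v)) (snd (oct_w v)) (oct_omega c v)"
  unfolding oct_p_def oct_q_def oct_u_def oct_w_def fst_conv snd_conv
proof (rule pair_weights_of_sides)
  have v: "\<bar>v 0\<bar> \<le> 2" "\<bar>v 1\<bar> \<le> 2" "\<bar>v 0 + v 1\<bar> \<le> 3" "\<bar>v 0 - v 1\<bar> \<le> 3" using assms by (auto simp: octagon_def)
  show "side 1 v \<ge> 0" "side 2 v \<ge> 0" "side 3 v \<ge> 0" "side 4 v \<ge> 0" "side 5 v \<ge> 0" "side 6 v \<ge> 0" "side 7 v \<ge> 0" "side 8 v \<ge> 0"
    using v unfolding side_def by (simp_all del: One_nat_def add: min_def) linarith+
  have s: "side 1 v = 0 \<longleftrightarrow> v 0 = - 2" "side 2 v = 0 \<longleftrightarrow> v 0 = 2" "side 3 v = 0 \<longleftrightarrow> v 1 = - 2" "side 4 v = 0 \<longleftrightarrow> v 1 = 2"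
    "side 5 v = 0 \<longleftrightarrow> v 0 + v 1 = - 3" "side 6 v = 0 \<longleftrightarrow> v 0 + v 1 = 3" "side 7 v = 0 \<longleftrightarrow> v 0 - v 1 = - 3" "side 8 v = 0 \<longleftrightarrow> v 0 - v 1 = 3"
    unfolding side_def by (simp_all del: One_nat_def add: min_def) linarith+
  show "side 1 v = 0 \<longrightarrow> side 3 v \<noteq> 0 \<and> side 8 v \<noteq> 0 \<and> side 2 v \<noteq> 0 \<and> side 6 v \<noteq> 0 \<and> side 4 v \<noteq> 0"
    "side 5 v = 0 \<longrightarrow> side 8 v \<noteq> 0 \<and> side 2 v \<noteq> 0 \<and> side 6 v \<noteq> 0 \<and> side 4 v \<noteq> 0 \<and> side 7 v \<noteq> 0"
    "side 3 v = 0 \<longrightarrow> side 2 v \<noteq> 0 \<and> side 6 v \<noteq> 0 \<and> side 4 v \<noteq> 0 \<and> side 7 v \<noteq> 0"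
    "side 8 v = 0 \<longrightarrow> side 6 v \<noteq> 0 \<and> side 4 v \<noteq> 0 \<and> side 7 v \<noteq> 0"
    "side 2 v = 0 \<longrightarrow> side 4 v \<noteq> 0 \<and> side 7 v \<noteq> 0" "side 6 v = 0 \<longrightarrow> side 7 v \<noteq> 0"
    using v unfolding s by linarith+
  show "c = Tau \<and> oct_omega c v = - 1 \<or>
    c = Eta \<and> oct_omega c v = Complex (side 5 v * side 6 v) (side 7 v * side 8 v) / Complex (side 5 v * side 6 v) (- side 7 v * side 8 v)"
    by (cases c) simp_all
qed

definition oct_levels :: "(nat \<Rightarrow> real) \<Rightarrow> nat \<Rightarrow> nat" where
  "oct_levels v = pair_levels (dir_sign (fst (oct_p v)) (snd (oct_p v))) (dir_sign (fst (oct_q v)) (snd (oct_q v)))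
    (dir_sign (fst (oct_u v)) (snd (oct_u v))) (dir_sign (fst (oct_w v)) (snd (oct_w v)))"

definition oct_num :: "invol \<Rightarrow> (nat \<Rightarrow> real) \<Rightarrow> nat \<Rightarrow> complex" where
  "oct_num c v = pair_weights.pnum (fst (oct_p v)) (snd (oct_p v)) (fst (oct_q v)) (snd (oct_q v)) (fst (oct_u v)) (snd (oct_u v))
    (fst (oct_w v)) (snd (oct_w v)) (oct_omega c v)"

abbreviation oct_curve :: "invol \<Rightarrow> (nat \<Rightarrow> real) \<Rightarrow> rcurve" where
  "oct_curve c v \<equiv> chain_curve c 6 (oct_levels v) (oct_num c v) 2"

abbreviation oct_ratio :: "invol \<Rightarrow> (nat \<Rightarrow> real) \<Rightarrow> label \<Rightarrow> label \<Rightarrow> csphere" where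
  "oct_ratio c v \<equiv> chain_ratio c 6 (oct_levels v) (oct_num c v) 2"

definition oct_class :: "invol \<Rightarrow> (nat \<Rightarrow> real) \<Rightarrow> rcurve set" where
  "oct_class c v = iso_class 2 (oct_curve c v)"

definition oct_hom :: "invol \<Rightarrow> (nat \<Rightarrow> real) \<Rightarrow> label \<Rightarrow> label \<Rightarrow> complex \<times> complex" where
  "oct_hom c v = ratio_hom c (oct_p v) (oct_q v) (oct_u v) (oct_w v) (oct_omega c v)"

lemma oct_chain: "v \<in> octagon \<Longrightarrow> chain c 6 (oct_levels v) (oct_num c v) 2"
  unfolding oct_levels_def oct_num_def by (rule pair_weights.chain[OF oct_weights])

lemma oct_ratio_hom:
  assumes "v \<in> octagon" "l \<in> labels 2" "fst m \<in> {1..2}"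
  shows "fst (oct_hom c v l m) \<noteq> 0 \<or> snd (oct_hom c v l m) \<noteq> 0"
    "oct_ratio c v l m = proj_pt (fst (oct_hom c v l m)) (snd (oct_hom c v l m))"
  using pair_weights.ratio_hom[OF oct_weights[OF assms(1)] assms(2,3), of c]
  unfolding oct_hom_def oct_levels_def oct_num_def by simp_all

lemma continuous_on_side: "continuous_on S (side n)"
proof -
  have "continuous_on S (\<lambda>v :: nat \<Rightarrow> real. v i)" for i
    by (rule continuous_on_product_coordinates[THEN continuous_on_subset]) simp
  note c = this
  have "continuous_on S (\<lambda>v :: nat \<Rightarrow> real. min 1 (2 + v 0))" "continuous_on S (\<lambda>v :: nat \<Rightarrow> real. min 1 (2 - v 0))"
    "continuous_on S (\<lambda>v :: nat \<Rightarrow> real. min 1 (2 + v 1))" "continuous_on S (\<lambda>v :: nat \<Rightarrow> real. min 1 (2 - v 1))"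
    "continuous_on S (\<lambda>v :: nat \<Rightarrow> real. sqrt (min 2 (3 + v 0 + v 1)))" "continuous_on S (\<lambda>v :: nat \<Rightarrow> real. sqrt (min 2 (3 - v 0 - v 1)))"
    "continuous_on S (\<lambda>v :: nat \<Rightarrow> real. sqrt (min 2 (3 + v 0 - v 1)))" "continuous_on S (\<lambda>v :: nat \<Rightarrow> real. sqrt (min 2 (3 - v 0 + v 1)))"
    by (intro continuous_on_min continuous_on_real_sqrt continuous_on_add continuous_on_diff continuous_on_const c)+
  note sides = this
  have ifc: "continuous_on S (\<lambda>x. if b then f x else g x)"
    if "continuous_on S f" "continuous_on S g" for b and f g :: "(nat \<Rightarrow> real) \<Rightarrow> real"
    using that by (cases b) simp_all
  show ?thesis unfolding side_def[abs_def] by (intro ifc sides)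
qed

lemma oct_omega_denom:
  assumes "v \<in> octagon"
  shows "Complex (side 5 v * side 6 v) (- side 7 v * side 8 v) \<noteq> 0"
  using pair_weights.omega_cnj(3)[OF oct_weights[OF assms, of Eta]] by auto

lemma continuous_on_oct_omega: "continuous_on octagon (oct_omega c)"
proof (cases c)
  case Eta
  have "oct_omega Eta = (\<lambda>v. Complex (side 5 v * side 6 v) (side 7 v * side 8 v) / Complex (side 5 v * side 6 v) (- side 7 v * side 8 v))"
    by (rule ext) simp
  moreover have "continuous_on octagon (\<lambda>v. Complex (side 5 v * side 6 v) (side 7 v * side 8 v) / Complex (side 5 v * side 6 v) (- side 7 v * side 8 v))"
    unfolding Complex_eq
    by (intro continuous_intros continuous_on_side) (use oct_omega_denom in \<open>simp add: Complex_eq\<close>)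
  ultimately show ?thesis using Eta by simp
next
  case Tau
  have "oct_omega Tau = (\<lambda>_. - 1)" by (rule ext) simp
  then show ?thesis using Tau by simp
qed

lemma continuous_on_oct_hom:
  assumes "l \<in> labels 2" "fst m \<in> {1..2}"
  shows "continuous_on octagon (\<lambda>v. fst (oct_hom c v l m))" "continuous_on octagon (\<lambda>v. snd (oct_hom c v l m))"
proof -
  have "m \<in> labels 2" "fst m \<noteq> 0" using assms(2) by (auto simp: labels_def mem_Times_iff)
  then have m: "m \<in> {(1, True), (1, False), (2, True), (2, False)}" by (auto simp: labels_2)
  have l: "l \<in> {(0, True), (0, False), (1, True), (1, False), (2, True), (2, False)}"
    using assms(1) by (simp only: labels_2)
  note w = continuous_on_oct_omega[of c]
  define P1 P2 Q1 Q2 U1 U2 W1 W2 where f: "P1 = (\<lambda>v. fst (oct_p v))" "P2 = (\<lambda>v. snd (oct_p v))"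
    "Q1 = (\<lambda>v. fst (oct_q v))" "Q2 = (\<lambda>v. snd (oct_q v))" "U1 = (\<lambda>v. fst (oct_u v))" "U2 = (\<lambda>v. snd (oct_u v))"
    "W1 = (\<lambda>v. fst (oct_w v))" "W2 = (\<lambda>v. snd (oct_w v))"
  have c: "continuous_on octagon P1" "continuous_on octagon P2" "continuous_on octagon Q1" "continuous_on octagon Q2"
    "continuous_on octagon U1" "continuous_on octagon U2" "continuous_on octagon W1" "continuous_on octagon W2"
    unfolding f oct_p_def oct_q_def oct_u_def oct_w_def fst_conv snd_conv
    by (intro continuous_on_mult continuous_on_power continuous_on_side)+
  have r: "fst (oct_p v) = P1 v" "snd (oct_p v) = P2 v" "fst (oct_q v) = Q1 v" "snd (oct_q v) = Q2 v"
    "fst (oct_u v) = U1 v" "snd (oct_u v) = U2 v" "fst (oct_w v) = W1 v" "snd (oct_w v) = W2 v" for v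
    by (simp_all add: f)
  note i = continuous_on_mult continuous_on_power continuous_on_of_real continuous_on_const w c
  have lm: "(l, m) \<in> {(0, True), (0, False), (1, True), (1, False), (2, True), (2, False)} \<times> {(1, True), (1, False), (2, True), (2, False)}"
    using l m by blast
  from lm show "continuous_on octagon (\<lambda>v. fst (oct_hom c v l m))"
    unfolding oct_hom_def ratio_hom_def r
    by (elim SigmaE insertE emptyE Pair_inject; hypsubst; simp del: One_nat_def of_real_power of_real_mult; intro i)
  from lm show "continuous_on octagon (\<lambda>v. snd (oct_hom c v l m))"
    unfolding oct_hom_def ratio_hom_def r
    by (elim SigmaE insertE emptyE Pair_inject; hypsubst; simp del: One_nat_def of_real_power of_real_mult; intro i)
qed

lemma oct_class_in_RM: "v \<in> octagon \<Longrightarrow> c \<in> invols R \<Longrightarrow> oct_class c v \<in> RM_set R 2"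
proof -
  assume v: "v \<in> octagon" and c: "c \<in> invols R"
  have "oct_class c v \<in> c_moduli_set c 2"
    unfolding c_moduli_set_iff oct_class_def
    using chain.real[OF oct_chain[OF v]] chain.c_real[OF oct_chain[OF v]] by (intro exI[of _ "oct_curve c v"] conjI refl)
  with c show ?thesis unfolding RM_set_eq by (rule UN_I)
qed

theorem continuous_oct_class:
  assumes "c \<in> invols R"
  shows "continuous_map (top_of_set octagon) (RM R 2) (oct_class c)"
proof (rule continuous_map_RM)
  show "oct_class c v \<in> RM_set R 2" if "v \<in> topspace (top_of_set octagon)" for v
    using oct_class_in_RM that assms by simp
  fix l1 l2 l3 l4 assume q: "(l1, l2, l3, l4) \<in> quadruples 2"
  have "continuous_map (top_of_set octagon) csphere_top (\<lambda>v. cr (oct_curve c v) l1 l2 l3 l4)"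
    by (rule continuous_chain_family[OF oct_chain _ _ q, where n = "\<lambda>l m v. fst (oct_hom c v l m)" and d = "\<lambda>l m v. snd (oct_hom c v l m)"])
      (use continuous_on_oct_hom oct_ratio_hom in auto)
  then show "continuous_map (top_of_set octagon) csphere_top (\<lambda>v. curve_cross_ratio (oct_class c v) l1 l2 l3 l4)"
    by (rule continuous_map_eq)
      (simp add: oct_class_def curve_cross_ratio_iso_class[OF chain.real[OF oct_chain] q])
qed

lemma oct_class_eqI:
  assumes "v \<in> octagon" "v' \<in> octagon"
    and "\<And>l m. l \<in> labels 2 \<Longrightarrow> fst m \<in> {1..2} \<Longrightarrow> oct_ratio c v l m = oct_ratio c' v' l m"
  shows "oct_class c v = oct_class c' v'"
  unfolding oct_class_def by (rule chain_cr_eqI[OF oct_chain oct_chain]) (use assms in auto)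

section \<open>The sides of the octagon\<close>

text \<open>The free coordinate 2 \<tau> - 1 runs through [-1, 1], the extent of the axis-parallel
  sides. The flag s selects the side at -2, where z_i+ joins z0+, or the side at 2, where z_i-
  does.\<close>

definition edge_pt :: "nat \<Rightarrow> bool \<Rightarrow> real \<Rightarrow> nat \<Rightarrow> real" where
  "edge_pt i s \<tau> = (\<lambda>n. if n = 0 then (if i = 1 then (if s then - 2 else 2) else 2 * \<tau> - 1)
     else if n = 1 then (if i = 1 then 2 * \<tau> - 1 else if s then - 2 else 2) else 0)"

text \<open>The order along the chain is z0+ with (i, s), then the pair 3 - i, then the conjugates
  of the first two. The phase has disappeared: it enters only ratios between pairs 1 and 2, and
  these are 0 or infinite here.\<close>

definition edge_ratio :: "invol \<Rightarrow> nat \<Rightarrow> bool \<Rightarrow> real \<Rightarrow> label \<Rightarrow> label \<Rightarrow> csphere" where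
  "edge_ratio c i s \<tau> l m =
    (if l = m then Some 1
     else if fst m = i then
       (if snd m = s then (if l = (0, True) then Some 0 else None) else (if l = (0, False) then None else Some 0))
     else if l = (0, True) \<or> l = (i, s) then Some 0 else if l = (0, False) \<or> l = (i, \<not> s) then None
     else if snd m then proj_pt (inv_sign c * of_real (1 - \<tau>)) (of_real \<tau>)
     else proj_pt (of_real \<tau>) (inv_sign c * of_real (1 - \<tau>)))"

lemma edge_pt_in_octagon: "\<tau> \<in> {0..1} \<Longrightarrow> edge_pt i s \<tau> \<in> octagon"
  unfolding octagon_def edge_pt_def by auto

lemma side_edge:
  assumes "\<tau> \<in> {0..1}"
  shows "map (\<lambda>n. side n (edge_pt 1 True \<tau>)) [1,2,3,4,5,6,7,8] =
      [0, 1, 1, 1, sqrt (2 * \<tau>), sqrt 2, sqrt (2 * (1 - \<tau>)), sqrt 2]"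
    "map (\<lambda>n. side n (edge_pt 1 False \<tau>)) [1,2,3,4,5,6,7,8] =
      [1, 0, 1, 1, sqrt 2, sqrt (2 * (1 - \<tau>)), sqrt 2, sqrt (2 * \<tau>)]"
    "map (\<lambda>n. side n (edge_pt 2 True \<tau>)) [1,2,3,4,5,6,7,8] =
      [1, 1, 0, 1, sqrt (2 * \<tau>), sqrt 2, sqrt 2, sqrt (2 * (1 - \<tau>))]"
    "map (\<lambda>n. side n (edge_pt 2 False \<tau>)) [1,2,3,4,5,6,7,8] =
      [1, 1, 1, 0, sqrt 2, sqrt (2 * (1 - \<tau>)), sqrt (2 * \<tau>), sqrt 2]"
  using assms by (simp_all add: side_def edge_pt_def min_def)

lemma edge_coords:
  assumes "\<tau> \<in> {0..1}"
  shows "oct_p (edge_pt 1 True \<tau>) = (0, 2)" "oct_u (edge_pt 1 True \<tau>) = (2, 0)" "oct_w (edge_pt 1 True \<tau>) = (0, 2)"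
    "oct_p (edge_pt 1 False \<tau>) = (2, 0)" "oct_u (edge_pt 1 False \<tau>) = (0, 2)" "oct_w (edge_pt 1 False \<tau>) = (2, 0)"
    "oct_q (edge_pt 2 True \<tau>) = (0, 2)" "oct_u (edge_pt 2 True \<tau>) = (0, 2)" "oct_w (edge_pt 2 True \<tau>) = (0, 2)"
    "oct_q (edge_pt 2 False \<tau>) = (2, 0)" "oct_u (edge_pt 2 False \<tau>) = (2, 0)" "oct_w (edge_pt 2 False \<tau>) = (2, 0)"
    "oct_q (edge_pt 1 s \<tau>) = (2 * sqrt \<tau>, 2 * sqrt (1 - \<tau>))"
    "oct_p (edge_pt 2 s \<tau>) = (2 * sqrt \<tau>, 2 * sqrt (1 - \<tau>))"
proof -
  note e = side_edge[OF assms, unfolded list.map list.inject]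
  show "oct_p (edge_pt 1 True \<tau>) = (0, 2)" "oct_u (edge_pt 1 True \<tau>) = (2, 0)" "oct_w (edge_pt 1 True \<tau>) = (0, 2)"
    using e(1) by (simp_all add: oct_p_def oct_u_def oct_w_def del: One_nat_def)
  show "oct_p (edge_pt 1 False \<tau>) = (2, 0)" "oct_u (edge_pt 1 False \<tau>) = (0, 2)" "oct_w (edge_pt 1 False \<tau>) = (2, 0)"
    using e(2) by (simp_all add: oct_p_def oct_u_def oct_w_def del: One_nat_def)
  show "oct_q (edge_pt 2 True \<tau>) = (0, 2)" "oct_u (edge_pt 2 True \<tau>) = (0, 2)" "oct_w (edge_pt 2 True \<tau>) = (0, 2)"
    using e(3) by (simp_all add: oct_q_def oct_u_def oct_w_def del: One_nat_def)
  show "oct_q (edge_pt 2 False \<tau>) = (2, 0)" "oct_u (edge_pt 2 False \<tau>) = (2, 0)" "oct_w (edge_pt 2 False \<tau>) = (2, 0)"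
    using e(4) by (simp_all add: oct_q_def oct_u_def oct_w_def del: One_nat_def)
  have m: "sqrt (2 * x) * sqrt 2 = 2 * sqrt x" "sqrt 2 * sqrt (2 * x) = 2 * sqrt x" for x
    by (simp_all add: real_sqrt_mult)
  show "oct_q (edge_pt 1 s \<tau>) = (2 * sqrt \<tau>, 2 * sqrt (1 - \<tau>))"
    using e(1,2) m[of \<tau>] m[of "1 - \<tau>"] by (cases s) (simp_all only: oct_q_def mult_1 mult_1_right)
  show "oct_p (edge_pt 2 s \<tau>) = (2 * sqrt \<tau>, 2 * sqrt (1 - \<tau>))"
    using e(3,4) m[of \<tau>] m[of "1 - \<tau>"] by (cases s) (simp_all only: oct_p_def mult_1 mult_1_right)
qed

lemma ratio_hom_edge:
  fixes A B \<tau> :: real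
  assumes l: "l \<in> {(0, True), (0, False), (1, True), (1, False), (2, True), (2, False)}"
    and m: "m \<in> {(1, True), (1, False), (2, True), (2, False)}" and om: "\<omega> \<noteq> 0"
    and AB: "A\<^sup>2 = 4 * \<tau>" "B\<^sup>2 = 4 * (1 - \<tau>)"
  shows "(\<lambda>(n, d). proj_pt n d) (ratio_hom c (0, 2) (A, B) (2, 0) (0, 2) \<omega> l m) = edge_ratio c 1 True \<tau> l m"
    "(\<lambda>(n, d). proj_pt n d) (ratio_hom c (2, 0) (A, B) (0, 2) (2, 0) \<omega> l m) = edge_ratio c 1 False \<tau> l m"
    "(\<lambda>(n, d). proj_pt n d) (ratio_hom c (A, B) (0, 2) (0, 2) (0, 2) \<omega> l m) = edge_ratio c 2 True \<tau> l m"
    "(\<lambda>(n, d). proj_pt n d) (ratio_hom c (A, B) (2, 0) (2, 0) (2, 0) \<omega> l m) = edge_ratio c 2 False \<tau> l m"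
proof -
  \<comment> \<open>The squares of the side coordinates carry a common factor 4, which homogeneous
    coordinates ignore.\<close>
  have p4: "proj_pt (complex_of_real (A\<^sup>2)) (inv_sign c * complex_of_real (B\<^sup>2)) =
      proj_pt (complex_of_real \<tau>) (inv_sign c * complex_of_real (1 - \<tau>))"
    "proj_pt (inv_sign c * complex_of_real (B\<^sup>2)) (complex_of_real (A\<^sup>2)) =
      proj_pt (inv_sign c * complex_of_real (1 - \<tau>)) (complex_of_real \<tau>)"
    using proj_pt_scale[of 4 "complex_of_real \<tau>" "inv_sign c * complex_of_real (1 - \<tau>)"]
      proj_pt_scale[of 4 "inv_sign c * complex_of_real (1 - \<tau>)" "complex_of_real \<tau>"]
    unfolding AB of_real_mult of_real_numeral mult.left_commute[of "inv_sign c" 4] by simp_all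
  have p0: "a \<noteq> 0 \<Longrightarrow> proj_pt 0 a = Some 0" "proj_pt a 0 = None" "proj_pt 1 1 = Some 1" for a by (simp_all add: proj_pt_def)
  show "(\<lambda>(n, d). proj_pt n d) (ratio_hom c (0, 2) (A, B) (2, 0) (0, 2) \<omega> l m) = edge_ratio c 1 True \<tau> l m"
    using l m by (elim insertE emptyE; hypsubst; simp add: om ratio_hom_def edge_ratio_def p4 p0 del: One_nat_def of_real_power of_real_diff)
  show "(\<lambda>(n, d). proj_pt n d) (ratio_hom c (2, 0) (A, B) (0, 2) (2, 0) \<omega> l m) = edge_ratio c 1 False \<tau> l m"
    using l m by (elim insertE emptyE; hypsubst; simp add: om ratio_hom_def edge_ratio_def p4 p0 del: One_nat_def of_real_power of_real_diff)
  show "(\<lambda>(n, d). proj_pt n d) (ratio_hom c (A, B) (0, 2) (0, 2) (0, 2) \<omega> l m) = edge_ratio c 2 True \<tau> l m"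
    using l m by (elim insertE emptyE; hypsubst; simp add: om ratio_hom_def edge_ratio_def p4 p0 del: One_nat_def of_real_power of_real_diff)
  show "(\<lambda>(n, d). proj_pt n d) (ratio_hom c (A, B) (2, 0) (2, 0) (2, 0) \<omega> l m) = edge_ratio c 2 False \<tau> l m"
    using l m by (elim insertE emptyE; hypsubst; simp add: om ratio_hom_def edge_ratio_def p4 p0 del: One_nat_def of_real_power of_real_diff)
qed

lemma oct_ratio_edge:
  assumes t: "\<tau> \<in> {0..1}" and i: "i \<in> {1, 2}" and l: "l \<in> labels 2" and m: "fst m \<in> {1..2}"
  shows "oct_ratio c (edge_pt i s \<tau>) l m = edge_ratio c i s \<tau> l m"
proof -
  have "m \<in> labels 2" "fst m \<noteq> 0" using m by (auto simp: labels_def mem_Times_iff)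
  then have m': "m \<in> {(1, True), (1, False), (2, True), (2, False)}" by (auto simp: labels_2)
  have l': "l \<in> {(0, True), (0, False), (1, True), (1, False), (2, True), (2, False)}"
    using l by (simp only: labels_2)
  note v = edge_pt_in_octagon[OF t, of i s]
  have w: "oct_omega c (edge_pt i s \<tau>) \<noteq> 0" using pair_weights.omega_cnj(3)[OF oct_weights[OF v]] .
  have sq: "(2 * sqrt \<tau>)\<^sup>2 = 4 * \<tau>" "(2 * sqrt (1 - \<tau>))\<^sup>2 = 4 * (1 - \<tau>)"
    using t by (simp_all add: power_mult_distrib)
  note r = ratio_hom_edge[OF l' m' w sq, of c]
  have "oct_ratio c (edge_pt i s \<tau>) l m = (\<lambda>(n, d). proj_pt n d) (oct_hom c (edge_pt i s \<tau>) l m)"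
    using oct_ratio_hom(2)[OF v l m] by (simp only: case_prod_beta)
  also have "\<dots> = edge_ratio c i s \<tau> l m"
  proof -
    consider "i = 1" "s" | "i = 1" "\<not> s" | "i = 2" "s" | "i = 2" "\<not> s" using i by blast
    then show ?thesis
    proof cases
      case 1
      then have "s = True" by simp
      show ?thesis using r(1) unfolding oct_hom_def 1(1) \<open>s = True\<close> edge_coords[OF t] .
    next
      case 2
      then have "s = False" by simp
      show ?thesis using r(2) unfolding oct_hom_def 2(1) \<open>s = False\<close> edge_coords[OF t] .
    next
      case 3
      then have "s = True" by simp
      show ?thesis using r(3) unfolding oct_hom_def 3(1) \<open>s = True\<close> edge_coords[OF t] .
    next
      case 4
      then have "s = False" by simp
      show ?thesis using r(4) unfolding oct_hom_def 4(1) \<open>s = False\<close> edge_coords[OF t] .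
    qed
  qed
  finally show ?thesis .
qed

lemma real_isoE:
  assumes "(C, D) \<in> real_iso k"
  obtains f \<phi> where "bij_betw f (comps C) (comps D)" "\<And>\<alpha>. \<alpha> \<in> comps C \<Longrightarrow> mobius (\<phi> \<alpha>)"
    "\<And>l. l \<in> labels k \<Longrightarrow> f (mcomp C l) = mcomp D l"
    "\<And>\<alpha> l. \<alpha> \<in> comps C \<Longrightarrow> l \<in> labels k \<Longrightarrow> dir_pt D (f \<alpha>) l = \<phi> \<alpha> (dir_pt C \<alpha> l)"
proof -
  obtain f \<phi> where R: "real_curve k C" "real_curve k D"
    and f: "bij_betw f (comps C) (comps D)" "\<forall>\<alpha>\<in>comps C. mobius (\<phi> \<alpha>)"
      "\<forall>\<alpha>\<in>comps C. \<forall>\<beta>\<in>comps C. (\<alpha>, \<beta>) \<in> adj C \<longleftrightarrow> (f \<alpha>, f \<beta>) \<in> adj D"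
      "\<forall>(\<alpha>, \<beta>)\<in>adj C. \<phi> \<alpha> (node C \<alpha> \<beta>) = node D (f \<alpha>) (f \<beta>)"
      "\<forall>l\<in>labels k. f (mcomp C l) = mcomp D l \<and> \<phi> (mcomp C l) (mpt C l) = mpt D l"
    using assms unfolding real_iso_def by auto
  note S = real_curve_stable[OF R(1)] real_curve_stable[OF R(2)]
  have "dir_pt D (f \<alpha>) l = \<phi> \<alpha> (dir_pt C \<alpha> l)" if "\<alpha> \<in> comps C" "l \<in> labels k" for \<alpha> l
    by (rule real_iso_dir_pt[OF S f(1)]) (use f that in auto)
  then show ?thesis using f by (intro that[of f \<phi>]) simp_all
qed

text \<open>Matching the components of C with views of the chain is enough: every cross-ratio can be
  computed on some component of C and carried over, and cross-ratios determine the class.\<close>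

lemma iso_class_eqI_views:
  assumes D: "chain c N \<kappa> z k" and C: "real_curve k C"
    and v: "\<And>\<alpha>. \<alpha> \<in> comps C \<Longrightarrow>
      \<exists>m g. fst m \<in> {1..k} \<and> mobius g \<and> (\<forall>l\<in>labels k. dir_pt C \<alpha> l = g (chain_ratio c N \<kappa> z k l m))"
  shows "iso_class k C = iso_class k (chain_curve c N \<kappa> z k)"
proof -
  let ?D = "chain_curve c N \<kappa> z k"
  have "\<exists>\<beta>\<in>comps ?D. \<exists>g. mobius g \<and> (\<forall>l\<in>labels k. dir_pt ?D \<beta> l = g (dir_pt C \<alpha> l))" if "\<alpha> \<in> comps C" for \<alpha>
  proof -
    obtain m g where m: "fst m \<in> {1..k}" "mobius g" "\<And>l. l \<in> labels k \<Longrightarrow> dir_pt C \<alpha> l = g (chain_ratio c N \<kappa> z k l m)"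
      using v[OF \<open>\<alpha> \<in> comps C\<close>] by blast
    obtain h where h: "mobius h" "h \<circ> g = id" using mobius_inverse[OF m(2)] by metis
    let ?n = "mobius_map (chain_num c z m) 0 0 1"
    have "m \<in> labels k" using m(1) by (cases m) (simp add: labels_def)
    then have "chain_pos N \<kappa> k m \<in> comps ?D" using chain.pos_in_K[OF D] by (simp add: chain_curve_def)
    moreover have "dir_pt ?D (chain_pos N \<kappa> k m) l = (?n \<circ> h) (dir_pt C \<alpha> l)" if "l \<in> labels k" for l
      using chain.dir_pt_ratio[OF D that m(1)] m(3)[OF that] h(2) by (simp add: fun_eq_iff)
    moreover have "mobius (?n \<circ> h)" by (rule mobius_comp[OF chain.mobius_num[OF D m(1)] h(1)])
    ultimately show ?thesis by blast
  qed
  from cr_eq_of_views[OF real_curve_stable[OF C] chain.stable[OF D] this] show ?thesis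
    using iso_class_eq_iff[OF C chain.real[OF D]] by blast
qed

lemma edge_class_eqI:
  assumes t: "\<tau> \<in> {0..1}" and i: "i \<in> {1, 2}" and C: "real_curve 2 C"
    and v: "\<And>\<alpha>. \<alpha> \<in> comps C \<Longrightarrow>
      \<exists>m g. fst m \<in> {1..2} \<and> mobius g \<and> (\<forall>l\<in>labels 2. dir_pt C \<alpha> l = g (edge_ratio c i s \<tau> l m))"
  shows "iso_class 2 C = oct_class c (edge_pt i s \<tau>)"
proof -
  note o = edge_pt_in_octagon[OF t, of i s]
  show ?thesis
    unfolding oct_class_def
  proof (rule iso_class_eqI_views[OF oct_chain[OF o] C])
    fix \<alpha> assume "\<alpha> \<in> comps C"
    then obtain m g where "fst m \<in> {1..2}" "mobius g" "\<forall>l\<in>labels 2. dir_pt C \<alpha> l = g (edge_ratio c i s \<tau> l m)"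
      using v by blast
    then show "\<exists>m g. fst m \<in> {1..2} \<and> mobius g \<and> (\<forall>l\<in>labels 2. dir_pt C \<alpha> l = g (oct_ratio c (edge_pt i s \<tau>) l m))"
      using oct_ratio_edge[OF t i] by (intro exI[of _ m] exI[of _ g]) simp
  qed
qed

lemma labels_2_split:
  assumes "l \<in> labels 2" "i \<in> {1, 2}"
  obtains "l = (0, True)" | "l = (0, False)" | "l = (i, s)" | "l = (i, \<not> s)" | "l = (3 - i, True)" | "l = (3 - i, False)"
  using assms by (cases s) (auto simp: labels_2)

text \<open>
  The involution is \<open>r / cnj z\<close> with real \<open>r\<close> in the coordinate in which the nodes are \<open>0\<close> and \<open>\<infinity>\<close> and the
  remaining pair is \<open>(1, r)\<close>. Its type is read off from the existence of fixed points.
\<close>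
lemma conj_pair_real:
  assumes f: "antimobius f" "\<And>p. f (f p) = p" and g: "mobius g" "g \<circ> f = std_inv c \<circ> g"
    and x: "x \<noteq> f x" "y \<noteq> f y" "x \<noteq> y" "f x \<noteq> y"
  obtains \<tau> h where "\<tau> \<in> {0..1}" "mobius h" "h (Some 0) = x" "h None = f x" "h (Some 1) = y"
    "h (proj_pt (inv_sign c * of_real (1 - \<tau>)) (of_real \<tau>)) = f y"
proof -
  obtain h where h: "mobius h" "h (Some 0) = x" "h None = f x" "h (Some 1) = y"
  proof (rule mobius_transport[of "Some 0" None "Some 1" x "f x" y])
    fix g assume "mobius g" "g (Some 0) = x" "g None = f x" "g (Some 1) = y"
    with that show thesis by blast
  qed (use x in simp_all)
  obtain h' where h': "mobius h'" "h' \<circ> h = id" "h \<circ> h' = id" using mobius_inverse[OF h(1)] by metis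
  have hh: "h' (h p) = p" "h (h' p) = p" for p using h'(2,3) by (simp_all add: fun_eq_iff)
  let ?\<sigma> = "h' \<circ> (f \<circ> h)"
  have s: "?\<sigma> (Some 0) = None" "?\<sigma> None = Some 0" using h(2,3) hh(1)[of None] hh(1)[of "Some 0"] f(2)[of x] by simp_all
  have fxy: "f y \<noteq> x" "f y \<noteq> f x" using x(3,4) f(2) by metis+
  have "h' (f y) \<noteq> None" "h' (f y) \<noteq> Some 0" using hh(2)[of "f y"] h(2,3) fxy by metis+
  then obtain w where w: "h' (f y) = Some w" "w \<noteq> 0" by (cases "h' (f y)") auto
  let ?\<rho> = "mobius_map 0 w 1 0 \<circ> map_option cnj"
  have \<rho>: "antimobius ?\<rho>" unfolding antimobius_def mobius_def using w(2)
    by (intro exI[of _ "mobius_map 0 w 1 0"] conjI exI[of _ 0] exI[of _ w] exI[of _ 1] refl) auto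
  have "?\<sigma> = ?\<rho>"
    by (rule antimobius_eqI[OF antimobius_comp(1)[OF antimobius_comp(2)[OF f(1) h(1)] h'(1)] \<rho>, of "Some 0" None "Some 1"])
      (use s w h(4) in \<open>simp_all add: mobius_map_def proj_pt_def\<close>)
  then have \<sigma>: "h' (f (h p)) = mobius_map 0 w 1 0 (map_option cnj p)" for p by (simp add: fun_eq_iff)
  \<comment> \<open>Applying the involution twice to the point 1 shows that w equals its
    conjugate.\<close>
  have "h (Some w) = f y" using w(1) hh(2) by metis
  then have "mobius_map 0 w 1 0 (Some (cnj w)) = Some 1"
    using \<sigma>[of "Some w"] f(2)[of y] hh(1)[of "Some 1"] h(4) by simp
  then have "w = cnj w" using w(2) by (simp add: mobius_map_def proj_pt_def)
  then obtain r where r: "w = of_real r" "r \<noteq> 0" using w(2) by (metis complex_is_Real_iff Reals_cases Reals_cnj_iff of_real_0)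
  have fix_iff: "(\<exists>p. f p = p) \<longleftrightarrow> (\<exists>q. std_inv c q = q)"
  proof
    assume "\<exists>p. f p = p"
    then show "\<exists>q. std_inv c q = q" using g(2) by (metis comp_apply)
  next
    assume "\<exists>q. std_inv c q = q"
    then obtain q where q: "std_inv c q = q" by blast
    obtain p where "g p = q" using mobius_bij[OF g(1)] by (metis bij_pointE)
    then have "g (f p) = g p" using g(2) q by (metis comp_apply)
    then show "\<exists>p. f p = p" using mobius_eq_iff[OF g(1)] by blast
  qed
  have "r > 0 \<longleftrightarrow> (\<exists>p. f p = p)"
  proof
    \<comment> \<open>The fixed points of r / cnj z form the circle |z|^2 = r, so they exist exactly
      for r > 0.\<close>
    assume "r > 0"
    then have "of_real r / complex_of_real (sqrt r) = complex_of_real (sqrt r)"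
      by (metis of_real_divide real_div_sqrt less_imp_le)
    then have "mobius_map 0 w 1 0 (map_option cnj (Some (of_real (sqrt r)))) = Some (of_real (sqrt r))"
      using \<open>r > 0\<close> r by (simp add: mobius_map_def proj_pt_def)
    then have "f (h (Some (of_real (sqrt r)))) = h (Some (of_real (sqrt r)))" using \<sigma> hh(2) by metis
    then show "\<exists>p. f p = p" by blast
  next
    assume "\<exists>p. f p = p"
    then obtain p where p: "f p = p" by blast
    have "mobius_map 0 w 1 0 (map_option cnj (h' p)) = h' p" using \<sigma>[of "h' p"] hh(2)[of p] p by simp
    then obtain q where q: "q \<noteq> 0" "w / cnj q = q"
      by (cases "h' p") (auto simp: mobius_map_def proj_pt_def split: if_splits)
    then have "w = q * cnj q" by (simp add: field_simps)
    then have "complex_of_real r = of_real ((cmod q)\<^sup>2)" using r(1) complex_norm_square[of q] by simp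
    then have "r = (cmod q)\<^sup>2" by (simp only: of_real_eq_iff)
    then show "r > 0" using q(1) by simp
  qed
  also have "\<dots> \<longleftrightarrow> c = Tau"
  proof (cases c)
    case Tau
    have "std_inv Tau (Some 1) = Some 1" by simp
    then show ?thesis unfolding fix_iff Tau by blast
  next
    case Eta
    have "std_inv Eta q \<noteq> q" for q
    proof (cases q)
      case (Some u)
      show ?thesis
      proof (cases "u = 0")
        case False
        have "- 1 / cnj u \<noteq> u"
        proof
          assume "- 1 / cnj u = u"
          then have "u * cnj u = - 1" using False by (simp add: field_simps)
          then have "Re (u * cnj u) = - 1" by simp
          moreover have "Re (u * cnj u) = (Re u)\<^sup>2 + (Im u)\<^sup>2" by (simp add: power2_eq_square)
          ultimately show False using sum_power2_ge_zero[of "Re u" "Im u"] by linarith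
        qed
        then show ?thesis using Some False by simp
      qed (simp add: Some)
    qed simp
    then show ?thesis unfolding fix_iff Eta by simp
  qed
  finally have sgn: "r > 0 \<longleftrightarrow> c = Tau" .
  \<comment> \<open>Chosen so that (1 - \<tau>) / \<tau> = |r|; the sign of r is already accounted
    for by \<open>inv_sign c\<close>.\<close>
  define \<tau> where "\<tau> = 1 / (1 + \<bar>r\<bar>)"
  have \<tau>: "\<tau> \<in> {0..1}" "\<tau> \<noteq> 0" "(1 - \<tau>) / \<tau> = \<bar>r\<bar>" using r(2) by (simp_all add: \<tau>_def field_simps)
  have "inv_sign c * of_real \<bar>r\<bar> = complex_of_real r" using sgn r(2) by (cases c) auto
  then have "proj_pt (inv_sign c * of_real (1 - \<tau>)) (of_real \<tau>) = Some (of_real r)"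
    using \<tau>(2) unfolding \<tau>(3)[symmetric] by (simp add: proj_pt_def)
  then have "h (proj_pt (inv_sign c * of_real (1 - \<tau>)) (of_real \<tau>)) = f y" using \<open>h (Some w) = f y\<close> r(1) by simp
  with that[OF \<tau>(1) h] show ?thesis by blast
qed

section \<open>The submanifolds as sides of the octagon\<close>

lemma edge_ratio_values:
  assumes "i \<in> {1, 2}"
  shows "edge_ratio c i s \<tau> (0, True) (i, s) = Some 0" "edge_ratio c i s \<tau> (i, s) (i, s) = Some 1"
    "edge_ratio c i s \<tau> (0, False) (i, s) = None" "edge_ratio c i s \<tau> (i, \<not> s) (i, s) = None"
    "edge_ratio c i s \<tau> (3 - i, t) (i, s) = None"
    "edge_ratio c i s \<tau> (0, False) (i, \<not> s) = None" "edge_ratio c i s \<tau> (i, \<not> s) (i, \<not> s) = Some 1"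
    "edge_ratio c i s \<tau> (0, True) (i, \<not> s) = Some 0" "edge_ratio c i s \<tau> (i, s) (i, \<not> s) = Some 0"
    "edge_ratio c i s \<tau> (3 - i, t) (i, \<not> s) = Some 0"
    "edge_ratio c i s \<tau> (0, True) (3 - i, True) = Some 0" "edge_ratio c i s \<tau> (i, s) (3 - i, True) = Some 0"
    "edge_ratio c i s \<tau> (0, False) (3 - i, True) = None" "edge_ratio c i s \<tau> (i, \<not> s) (3 - i, True) = None"
    "edge_ratio c i s \<tau> (3 - i, True) (3 - i, True) = Some 1"
    "edge_ratio c i s \<tau> (3 - i, False) (3 - i, True) = proj_pt (inv_sign c * of_real (1 - \<tau>)) (of_real \<tau>)"
proof -
  have "i \<noteq> 0" "3 - i \<noteq> 0" "3 - i \<noteq> i" "i \<noteq> 3 - i" using assms by auto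
  then show "edge_ratio c i s \<tau> (0, True) (i, s) = Some 0" "edge_ratio c i s \<tau> (i, s) (i, s) = Some 1"
    "edge_ratio c i s \<tau> (0, False) (i, s) = None" "edge_ratio c i s \<tau> (i, \<not> s) (i, s) = None"
    "edge_ratio c i s \<tau> (3 - i, t) (i, s) = None"
    "edge_ratio c i s \<tau> (0, False) (i, \<not> s) = None" "edge_ratio c i s \<tau> (i, \<not> s) (i, \<not> s) = Some 1"
    "edge_ratio c i s \<tau> (0, True) (i, \<not> s) = Some 0" "edge_ratio c i s \<tau> (i, s) (i, \<not> s) = Some 0"
    "edge_ratio c i s \<tau> (3 - i, t) (i, \<not> s) = Some 0"
    "edge_ratio c i s \<tau> (0, True) (3 - i, True) = Some 0" "edge_ratio c i s \<tau> (i, s) (3 - i, True) = Some 0"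
    "edge_ratio c i s \<tau> (0, False) (3 - i, True) = None" "edge_ratio c i s \<tau> (i, \<not> s) (3 - i, True) = None"
    "edge_ratio c i s \<tau> (3 - i, True) (3 - i, True) = Some 1"
    "edge_ratio c i s \<tau> (3 - i, False) (3 - i, True) = proj_pt (inv_sign c * of_real (1 - \<tau>)) (of_real \<tau>)"
    unfolding edge_ratio_def by simp_all
qed

lemma labels_2_members: "i \<in> {1, 2} \<Longrightarrow> (0, t) \<in> labels 2 \<and> (i, t) \<in> labels 2 \<and> (3 - i, t) \<in> labels 2"
  by (auto simp: labels_def)

lemma dir_pt_other: "mcomp C l \<noteq> \<alpha> \<Longrightarrow> dir_pt C \<alpha> l = node C \<alpha> (first_step C \<alpha> (mcomp C l))"
  by (simp add: dir_pt_eq)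

text \<open>The shape of the tree is not given and has to be derived: z0+ and z0- lie on two
  conjugate leaves, and the third component is real, carries the pair 3 - i and lies between the
  leaves. The involution on it then supplies the parameter.\<close>

lemma three_comp_class:
  assumes C: "real_curve 2 C" and card: "card (comps C) = 3" and i: "i \<in> {1, 2}"
    and im: "mcomp C (i, s) = mcomp C (0, True)" and c: "c_real c C"
  shows "\<exists>\<tau>\<in>{0..1}. iso_class 2 C = oct_class c (edge_pt i s \<tau>)"
proof -
  note S = real_curve_stable[OF C]
  note T = stable_curve_tree[OF S]
  let ?j = "3 - i"
  have lab: "(0, t) \<in> labels 2" "(i, t) \<in> labels 2" "(?j, t) \<in> labels 2" for t
    using labels_2_members[OF i] by auto
  have ij: "i \<noteq> 0" "?j \<noteq> 0" "?j \<noteq> i" using i by auto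
  have lcases: "P l" if "l \<in> labels 2" "P (0, True)" "P (0, False)" "P (i, s)" "P (i, \<not> s)" "P (?j, True)" "P (?j, False)" for l P
    by (rule labels_2_split[OF that(1) i, where s = s]) (simp_all only: that(2-))
  define \<gamma> \<gamma>' where "\<gamma> = mcomp C (0, True)" and "\<gamma>' = icomp C \<gamma>"
  have g: "\<gamma> \<in> comps C" "mcomp C (0, True) = \<gamma>" "mcomp C (i, s) = \<gamma>"
    using stable_curve_mcomp[OF S lab(1)] im by (auto simp: \<gamma>_def)
  have g': "\<gamma>' \<in> comps C" "mcomp C (0, False) = \<gamma>'" "mcomp C (i, \<not> s) = \<gamma>'" "icomp C \<gamma>' = \<gamma>"
    using real_curve_icomp[OF C g(1)] real_curve_mark(1)[OF C lab(1), of True] real_curve_mark(1)[OF C lab(2), of s] g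
    by (simp_all add: \<gamma>'_def)
  have ne: "\<gamma>' \<noteq> \<gamma>"
  proof
    assume eq: "\<gamma>' = \<gamma>"
    \<comment> \<open>If \<gamma> were its own conjugate, it would carry pairs 0 and i. Every other
      component would see just the directions of \<gamma> and of the pair 3 - i, so the two others
      would be medians of the same triple.\<close>
    have sep: "dir_pt C \<delta> (0, True) \<noteq> dir_pt C \<delta> (?j, True) \<and> dir_pt C \<delta> (0, True) \<noteq> dir_pt C \<delta> (?j, False) \<and>
        dir_pt C \<delta> (?j, True) \<noteq> dir_pt C \<delta> (?j, False)" if d: "\<delta> \<in> comps C" "\<delta> \<noteq> \<gamma>" for \<delta>
    proof -
      have "dir_pt C \<delta> l \<in> {dir_pt C \<delta> (0, True), dir_pt C \<delta> (?j, True), dir_pt C \<delta> (?j, False)}" if "l \<in> labels 2" for l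
        by (rule lcases[OF that]) (use g g' eq d(2) in \<open>simp_all add: dir_pt_other\<close>)
      note in3 = this
      obtain l m n where lmn: "l \<in> labels 2" "m \<in> labels 2" "n \<in> labels 2"
        "dir_pt C \<delta> l \<noteq> dir_pt C \<delta> m" "dir_pt C \<delta> l \<noteq> dir_pt C \<delta> n" "dir_pt C \<delta> m \<noteq> dir_pt C \<delta> n"
        by (rule three_directions[OF S d(1)]) blast
      show ?thesis using in3[OF lmn(1)] in3[OF lmn(2)] in3[OF lmn(3)] lmn(4-6) unfolding insert_iff empty_iff by (elim disjE) simp_all
    qed
    have "\<not> comps C \<subseteq> {\<gamma>}" using card_mono[of "{\<gamma>}" "comps C"] card by auto
    then obtain \<delta> where d: "\<delta> \<in> comps C" "\<delta> \<noteq> \<gamma>" by blast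
    have "card {\<gamma>, \<delta>} \<le> 2" by (simp add: card_insert_if)
    then have "\<not> comps C \<subseteq> {\<gamma>, \<delta>}" using card_mono[of "{\<gamma>, \<delta>}" "comps C"] card by auto
    then obtain \<delta>' where d': "\<delta>' \<in> comps C" "\<delta>' \<noteq> \<gamma>" "\<delta>' \<noteq> \<delta>" by blast
    have "\<delta> = \<delta>'"
      using median_unique[OF S d(1) d'(1) lab(1,3,3), of True True False] sep[OF d] sep[OF d'(1,2)] by blast
    with d'(3) show False by simp
  qed
  obtain b where b: "comps C = {\<gamma>, \<gamma>', b}" "b \<noteq> \<gamma>" "b \<noteq> \<gamma>'"
  proof -
    have fin: "finite (comps C)" using card by (metis card.infinite zero_neq_numeral)
    have "card (comps C - {\<gamma>, \<gamma>'}) = 1" using card g(1) g'(1) ne fin by (simp add: card_Diff_subset)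
    then obtain b where "comps C - {\<gamma>, \<gamma>'} = {b}" by (auto simp: card_1_singleton_iff)
    then show ?thesis using that[of b] g(1) g'(1) by blast
  qed
  have bc: "b \<in> comps C" using b(1) by blast
  note ib = real_curve_icomp[OF C bc]
  have ibb: "icomp C b = b"
  proof -
    have "icomp C b \<noteq> \<gamma>" using ib(2) b(3) \<gamma>'_def by metis
    moreover have "icomp C b \<noteq> \<gamma>'" using ib(2) b(2) g'(4) by metis
    ultimately show ?thesis using ib(1) b(1) by blast
  qed
  \<comment> \<open>Otherwise all marked points lie on \<gamma> and \<gamma>', and b sees only two
    directions.\<close>
  have jT: "mcomp C (?j, True) = b"
  proof (rule ccontr)
    assume n: "mcomp C (?j, True) \<noteq> b"
    have m: "mcomp C (?j, True) \<in> {\<gamma>, \<gamma>'}" using stable_curve_mcomp[OF S lab(3), of True] b(1) n by blast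
    have "mcomp C (?j, False) = icomp C (mcomp C (?j, True))" using real_curve_mark(1)[OF C lab(3), of True] by simp
    then have m': "mcomp C (?j, False) \<in> {\<gamma>, \<gamma>'}" using m g'(4) \<gamma>'_def by auto
    have "dir_pt C b l \<in> {node C b (first_step C b \<gamma>), node C b (first_step C b \<gamma>')}" if "l \<in> labels 2" for l
    proof -
      have "mcomp C l \<in> {\<gamma>, \<gamma>'}" by (rule lcases[OF that]) (use g g' m m' in simp_all)
      then show ?thesis using dir_pt_other[of C l b] b(2,3) by auto
    qed
    note in2 = this
    obtain l m n where lmn: "l \<in> labels 2" "m \<in> labels 2" "n \<in> labels 2"
      "dir_pt C b l \<noteq> dir_pt C b m" "dir_pt C b l \<noteq> dir_pt C b n" "dir_pt C b m \<noteq> dir_pt C b n"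
      by (rule three_directions[OF S bc]) blast
    show False using in2[OF lmn(1)] in2[OF lmn(2)] in2[OF lmn(3)] lmn(4-6) unfolding insert_iff empty_iff by (elim disjE) simp_all
  qed
  have jF: "mcomp C (?j, False) = b" using real_curve_mark(1)[OF C lab(3), of True] jT ibb by simp
  have conj: "dir_pt C (icomp C \<alpha>) (n, \<not> t) = imap C \<alpha> (dir_pt C \<alpha> (n, t))" if "\<alpha> \<in> comps C" "(n, t) \<in> labels 2" for \<alpha> n t
    by (rule real_curve_dir_pt_conj[OF C that])
  note [simp] = dir_pt_other
  \<comment> \<open>By \<open>dir_pt_toward\<close>, the point with label (3 - i, False) is seen
    from \<gamma> toward \<gamma>' or from \<gamma>' toward \<gamma>. Conjugation turns the second
    case into the first.\<close>
  have e: "node C \<gamma> (first_step C \<gamma> b) = node C \<gamma> (first_step C \<gamma> \<gamma>')"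
  proof -
    have f1: "dir_pt C \<gamma>' (?j, False) = imap C \<gamma> (dir_pt C \<gamma> (?j, True))" using conj[OF g(1) lab(3), of True] \<gamma>'_def by simp
    have f2: "dir_pt C \<gamma>' (0, True) = imap C \<gamma> (dir_pt C \<gamma> (0, False))" using conj[OF g(1) lab(1), of False] \<gamma>'_def by simp
    have "dir_pt C \<gamma> (?j, False) = node C \<gamma> (first_step C \<gamma> \<gamma>') \<or> dir_pt C \<gamma>' (?j, False) = node C \<gamma>' (first_step C \<gamma>' \<gamma>)"
      by (rule dir_pt_toward[OF S g(1) g'(1) ne[symmetric] lab(3)])
    then show ?thesis
    proof
      assume "dir_pt C \<gamma> (?j, False) = node C \<gamma> (first_step C \<gamma> \<gamma>')"
      then show ?thesis using jF b(2) by simp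
    next
      assume "dir_pt C \<gamma>' (?j, False) = node C \<gamma>' (first_step C \<gamma>' \<gamma>)"
      then have "imap C \<gamma> (dir_pt C \<gamma> (?j, True)) = imap C \<gamma> (dir_pt C \<gamma> (0, False))"
        using f1 f2 g(2) ne by simp
      then show ?thesis
        using antimobius_eq_iff[OF real_curve_icomp(3)[OF C g(1)]] jT g'(2) b(2) ne by simp
    qed
  qed
  have e': "node C \<gamma>' (first_step C \<gamma>' b) = node C \<gamma>' (first_step C \<gamma>' \<gamma>)"
  proof -
    have "dir_pt C \<gamma>' (?j, False) = imap C \<gamma> (dir_pt C \<gamma> (?j, True))" "dir_pt C \<gamma>' (0, True) = imap C \<gamma> (dir_pt C \<gamma> (0, False))"
      using conj[OF g(1) lab(3), of True] conj[OF g(1) lab(1), of False] \<gamma>'_def by simp_all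
    then show ?thesis using e jT jF g(2) g'(2) ne b by (simp add: ne[symmetric])
  qed
  note mark = mcomp_iff[OF S _ , THEN iffD1, rule_format]
  define x y where "x = dir_pt C b (0, True)" and "y = dir_pt C b (?j, True)"
  have x: "dir_pt C b (i, s) = x" "dir_pt C b (0, False) = imap C b x" "dir_pt C b (i, \<not> s) = imap C b x"
    and y: "dir_pt C b (?j, False) = imap C b y"
    using conj[OF bc lab(1), of True] conj[OF bc lab(3), of True] ibb g g' b by (simp_all add: x_def y_def)
  have xy: "x \<noteq> y" "imap C b x \<noteq> y" "y \<noteq> imap C b y"
    using mark[OF bc lab(3) jT lab(1), of True] mark[OF bc lab(3) jT lab(1), of False]
      mark[OF bc lab(3) jT lab(3), of False] ij x y by (simp_all add: x_def y_def)
  \<comment> \<open>Equality would put \<gamma> and \<gamma>' in the same direction from b. One of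
    them would then lie between b and the other and see these two through different nodes, against
    \<open>e\<close> or \<open>e'\<close>.\<close>
  have xx: "x \<noteq> imap C b x"
  proof
    assume eq: "x = imap C b x"
    note p = path_to_first_step(1)[OF T bc g(1) b(2)] path_to_first_step(1)[OF T bc g'(1) b(3)]
    have "node C b (first_step C b \<gamma>) = node C b (first_step C b \<gamma>')"
      using eq x(2) g(2) g'(2) b(2,3) by (simp add: x_def)
    then have fs: "first_step C b \<gamma> = first_step C b \<gamma>'" using stable_curve_node_inj[OF S p] by blast
    have "first_step C b \<gamma> \<in> comps C" "first_step C b \<gamma> \<noteq> b" using adj_in_comps[OF T p(1)] by auto
    then consider "first_step C b \<gamma> = \<gamma>" | "first_step C b \<gamma> = \<gamma>'" using b(1) by blast
    then show False
    proof cases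
      case 1
      have adj: "(b, \<gamma>) \<in> adj C" using p(1) 1 by simp
      have "first_step C \<gamma> \<gamma>' \<noteq> b"
        using first_step_adj_iff[OF T adj g'(1)] fs 1 b(3) ne by auto
      moreover have "first_step C \<gamma> b = first_step C \<gamma> \<gamma>'"
        using stable_curve_node_inj[OF S path_to_first_step(1)[OF T g(1) bc b(2)[symmetric]]
            path_to_first_step(1)[OF T g(1) g'(1) ne[symmetric]]] e by blast
      ultimately show False using first_step_adj[OF T adj_sym[OF T adj]] by simp
    next
      case 2
      have adj: "(b, \<gamma>') \<in> adj C" using p(1) 2 by simp
      have "first_step C \<gamma>' \<gamma> \<noteq> b"
        using first_step_adj_iff[OF T adj g(1)] 2 b(2) ne by auto
      moreover have "first_step C \<gamma>' b = first_step C \<gamma>' \<gamma>"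
        using stable_curve_node_inj[OF S path_to_first_step(1)[OF T g'(1) bc b(3)[symmetric]]
            path_to_first_step(1)[OF T g'(1) g(1) ne]] e' by blast
      ultimately show False using first_step_adj[OF T adj_sym[OF T adj]] by simp
    qed
  qed
  obtain k where k: "mobius k" "k \<circ> imap C b = std_inv c \<circ> k" using c bc ibb unfolding c_real_def by blast
  have invb: "imap C b (imap C b p) = p" for p using real_curve_icomp(4)[OF C bc, of p] ibb by simp
  show ?thesis
  proof (rule conj_pair_real[OF ib(3) invb k xx xy(3,1,2)])
    fix \<tau> h
    assume t: "\<tau> \<in> {0..1}" and h: "mobius h" "h (Some 0) = x" "h None = imap C b x" "h (Some 1) = y"
      "h (proj_pt (inv_sign c * of_real (1 - \<tau>)) (of_real \<tau>)) = imap C b y"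
    have "\<exists>m g. fst m \<in> {1..2} \<and> mobius g \<and> (\<forall>l\<in>labels 2. dir_pt C \<alpha> l = g (edge_ratio c i s \<tau> l m))" if "\<alpha> \<in> comps C" for \<alpha>
    proof -
      note ev = edge_ratio_values[OF i, of c s \<tau>]
      have "\<alpha> = \<gamma> \<or> \<alpha> = \<gamma>' \<or> \<alpha> = b" using that unfolding b(1) by simp
      then consider (1) "\<alpha> = \<gamma>" | (2) "\<alpha> = \<gamma>'" | (3) "\<alpha> = b" by blast
      then show ?thesis
      proof cases
        case 1
        have d: "dir_pt C \<gamma> (0, True) \<noteq> dir_pt C \<gamma> (i, s)" "dir_pt C \<gamma> (0, True) \<noteq> dir_pt C \<gamma> (0, False)"
          "dir_pt C \<gamma> (i, s) \<noteq> dir_pt C \<gamma> (0, False)"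
          using mark[OF g(1) lab(1) g(2) lab(2), of s] mark[OF g(1) lab(1) g(2) lab(1), of False]
            mark[OF g(1) lab(2) g(3) lab(1), of False] ij by (auto simp del: dir_pt_other)
        obtain u where u: "mobius u" "u (Some 0) = dir_pt C \<gamma> (0, True)" "u (Some 1) = dir_pt C \<gamma> (i, s)" "u None = dir_pt C \<gamma> (0, False)"
        proof (rule mobius_transport[of "Some 0" "Some 1" None "dir_pt C \<gamma> (0, True)" "dir_pt C \<gamma> (i, s)" "dir_pt C \<gamma> (0, False)"])
          fix u assume "mobius u" "u (Some 0) = dir_pt C \<gamma> (0, True)" "u (Some 1) = dir_pt C \<gamma> (i, s)" "u None = dir_pt C \<gamma> (0, False)"
          with that show thesis by blast
        qed (use d in \<open>simp_all only: not_False_eq_True option.distinct option.inject zero_neq_one\<close>)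
        have "dir_pt C \<gamma> l = u (edge_ratio c i s \<tau> l (i, s))" if "l \<in> labels 2" for l
          by (rule lcases[OF that]) (use u ev(1-5) e jT jF g g' b(2,3) ne in simp_all)
        then show ?thesis unfolding 1 using i u(1) by (intro exI[of _ "(i, s)"] exI[of _ u]) auto
      next
        case 2
        have d: "dir_pt C \<gamma>' (0, False) \<noteq> dir_pt C \<gamma>' (i, \<not> s)" "dir_pt C \<gamma>' (0, False) \<noteq> dir_pt C \<gamma>' (0, True)"
          "dir_pt C \<gamma>' (i, \<not> s) \<noteq> dir_pt C \<gamma>' (0, True)"
          using mark[OF g'(1) lab(1) g'(2) lab(2), of "\<not> s"] mark[OF g'(1) lab(1) g'(2) lab(1), of True]
            mark[OF g'(1) lab(2) g'(3) lab(1), of True] ij by (auto simp del: dir_pt_other)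
        obtain u where u: "mobius u" "u None = dir_pt C \<gamma>' (0, False)" "u (Some 1) = dir_pt C \<gamma>' (i, \<not> s)" "u (Some 0) = dir_pt C \<gamma>' (0, True)"
        proof (rule mobius_transport[of None "Some 1" "Some 0" "dir_pt C \<gamma>' (0, False)" "dir_pt C \<gamma>' (i, \<not> s)" "dir_pt C \<gamma>' (0, True)"])
          fix u assume "mobius u" "u None = dir_pt C \<gamma>' (0, False)" "u (Some 1) = dir_pt C \<gamma>' (i, \<not> s)" "u (Some 0) = dir_pt C \<gamma>' (0, True)"
          with that show thesis by blast
        qed (use d in \<open>simp_all only: not_False_eq_True option.distinct option.inject one_neq_zero\<close>)
        have "dir_pt C \<gamma>' l = u (edge_ratio c i s \<tau> l (i, \<not> s))" if "l \<in> labels 2" for l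
          by (rule lcases[OF that]) (use u ev(6-10) e' jT jF g g' b(2,3) ne in simp_all)
        then show ?thesis unfolding 2 using i u(1) by (intro exI[of _ "(i, \<not> s)"] exI[of _ u]) auto
      next
        case 3
        have "dir_pt C b l = h (edge_ratio c i s \<tau> l (?j, True))" if "l \<in> labels 2" for l
          by (rule lcases[OF that]) (simp_all only: ev h x y x_def[symmetric] y_def[symmetric])
        then show ?thesis unfolding 3 using i h(1) by (intro exI[of _ "(?j, True)"] exI[of _ h]) auto
      qed
    qed
    from edge_class_eqI[OF t i C this] t show ?thesis by blast
  qed
qed

lemma edge_levels:
  assumes t: "\<tau> \<in> {0<..<1}"
  shows "oct_levels (edge_pt 1 True \<tau>) n = (if n = 1 then 0 else 3)" "oct_levels (edge_pt 1 False \<tau>) n = (if n = 1 then 6 else 3)"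
    "oct_levels (edge_pt 2 True \<tau>) n = (if n = 1 then 3 else 0)" "oct_levels (edge_pt 2 False \<tau>) n = (if n = 1 then 3 else 6)"
proof -
  have t': "\<tau> \<in> {0..1}" "\<tau> > 0" "\<tau> < 1" using t by auto
  show "oct_levels (edge_pt 1 True \<tau>) n = (if n = 1 then 0 else 3)" "oct_levels (edge_pt 1 False \<tau>) n = (if n = 1 then 6 else 3)"
    "oct_levels (edge_pt 2 True \<tau>) n = (if n = 1 then 3 else 0)" "oct_levels (edge_pt 2 False \<tau>) n = (if n = 1 then 3 else 6)"
    unfolding oct_levels_def edge_coords[OF t'(1)] pair_levels_def dir_sign_def using t'(2,3) by simp_all
qed

text \<open>At \<tau> = 1/2 the pair 3 - i collides for \<open>Tau\<close> and a real bubble becomes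
  a fourth component; at the ends the central sphere breaks up. The closure in \<open>Gam\<close>
  restores all these points.\<close>

lemma edge_generic:
  assumes t: "\<tau> \<in> {0<..<1}" "\<tau> \<noteq> 1 / 2" and i: "i \<in> {1, 2}"
  shows "card (comps (oct_curve c (edge_pt i s \<tau>))) = 3"
    "mcomp (oct_curve c (edge_pt i s \<tau>)) (i, s) = mcomp (oct_curve c (edge_pt i s \<tau>)) (0, True)"
proof -
  let ?v = "edge_pt i s \<tau>"
  have t': "\<tau> \<in> {0..1}" "\<tau> > 0" "\<tau> < 1" using t by auto
  note v = edge_pt_in_octagon[OF t'(1), of i s]
  interpret chain c 6 "oct_levels ?v" "oct_num c ?v" 2 by (rule oct_chain[OF v])
  have lev: "oct_levels ?v i = (if s then 0 else 6)" "oct_levels ?v (3 - i) = 3"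
    using i edge_levels[OF t(1)] by (cases s; auto)+
  have i12: "{1..2} = {i, 3 - i}" using i by auto
  have K: "K = {0, 3, 6}" unfolding chain_levels_def i12 using lev by (cases s) auto
  have nb: "\<not> bub n" for n
  proof
    assume n: "bub n"
    note nd = bubD[OF n]
    have "n \<in> {i, 3 - i}" using nd i12 by blast
    moreover have "n \<noteq> i" using nd lev(1) by (cases s) auto
    ultimately have nj: "n = 3 - i" by blast
    \<comment> \<open>A bubble means that the two points of the pair coincide, that is,
      \<open>inv_sign c * (1 - \<tau>) = \<tau>\<close>. For \<open>Tau\<close> this gives \<tau> =
      1/2, and for \<open>Eta\<close> it is impossible.\<close>
    have "edge_ratio c i s \<tau> (n, False) (n, True) = Some 1"
    proof -
      have "fst (n, True) \<in> {1..2}" "(n, False) \<in> labels 2" using nd by (auto simp: labels_def)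
      moreover have "pos (n, False) = pos (n, True)" "num (n, False) = num (n, True)" "num (n, True) \<noteq> 0"
        using nd num_nonzero[of "(n, True)"] by (simp_all add: chain_pos_def chain_num_def)
      then have "ratio (n, False) (n, True) = Some 1" using nd by (simp add: chain_ratio_def)
      ultimately show ?thesis using oct_ratio_edge[OF t'(1) i] by metis
    qed
    then have "proj_pt (inv_sign c * of_real (1 - \<tau>)) (of_real \<tau>) = Some 1"
      using edge_ratio_values(16)[OF i, of c s \<tau>] nj by simp
    then have "inv_sign c * complex_of_real (1 - \<tau>) = of_real \<tau>" using t'(2) by (simp add: proj_pt_def field_simps)
    then have "complex_of_real ((if c = Tau then 1 else - 1) * (1 - \<tau>)) = of_real \<tau>" by (cases c) simp_all
    then have "(if c = Tau then 1 else - 1) * (1 - \<tau>) = \<tau>" by (simp only: of_real_eq_iff)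
    then show False using t t' by (simp split: if_splits)
  qed
  then have cb: "Collect bub = {}" by blast
  have "comps C = {0, 3, 6}" using K by (simp add: cb del: Collect_empty_eq)
  then show "card (comps (oct_curve c ?v)) = 3" by simp
  have "pos (i, s) = 0" "pos (0, True) = 0" using lev K i by (auto simp: chain_pos_def)
  then show "mcomp (oct_curve c ?v) (i, s) = mcomp (oct_curve c ?v) (0, True)" using nb by simp
qed

lemma continuous_edge_pt: "continuous_on S (edge_pt i s)"
proof (rule continuous_on_coordinatewise_then_product)
  fix n
  show "continuous_on S (\<lambda>\<tau>. edge_pt i s \<tau> n)"
    unfolding edge_pt_def by (cases "n = 0"; cases "n = 1"; cases "i = 1") (simp_all add: continuous_intros)
qed

definition edge_class :: "invol \<Rightarrow> nat \<Rightarrow> bool \<Rightarrow> real \<Rightarrow> rcurve set" where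
  "edge_class c i s \<tau> = oct_class c (edge_pt i s \<tau>)"

lemma continuous_edge_class:
  assumes "c \<in> invols R"
  shows "continuous_map (top_of_set {0..1}) (RM R 2) (edge_class c i s)"
proof -
  have "continuous_map (top_of_set {0..1}) (top_of_set octagon) (edge_pt i s)"
    using continuous_edge_pt edge_pt_in_octagon by (auto simp: continuous_map_in_subtopology)
  from continuous_map_compose[OF this continuous_oct_class[OF assms]] show ?thesis
    by (simp add: edge_class_def[abs_def] comp_def)
qed

lemma cr_map_eq_imp:
  assumes "X \<in> RM_set R k" "Y \<in> RM_set R k" "cr_map k X = cr_map k Y"
  shows "X = Y"
proof -
  obtain C D where C: "real_curve k C" "X = iso_class k C" and D: "real_curve k D" "Y = iso_class k D"
    using assms(1,2) unfolding RM_set_eq by (auto simp: c_moduli_set_iff)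
  have "cr C l1 l2 l3 l4 = cr D l1 l2 l3 l4" if q: "(l1, l2, l3, l4) \<in> quadruples k" for l1 l2 l3 l4
    using fun_cong[OF assms(3), of "(l1, l2, l3, l4)"] q
      curve_cross_ratio_iso_class[OF C(1) q] curve_cross_ratio_iso_class[OF D(1) q] C(2) D(2)
    by (simp add: cr_map_def)
  then show ?thesis unfolding C(2) D(2) using iso_class_eq_iff[OF C(1) D(1)] by blast
qed

text \<open>The right-hand side is compact, and its image under the injective continuous
  \<open>cr_map\<close> is closed in the Hausdorff product of spheres, so it contains the closure.
  Conversely, the generic parameters are dense in the interval and yield curves with three
  components.\<close>

theorem Gam_eq:
  assumes i: "i \<in> {1, 2}"
  shows "Gam R i s = (\<Union>c\<in>invols R. edge_class c i s ` {0..1})"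
proof -
  define Z where "Z = {X \<in> RM_set R 2. \<exists>C\<in>X. card (comps C) = 3 \<and> mcomp C (i, s) = mcomp C (0, True)}"
  define E where "E = (\<Union>c\<in>invols R. edge_class c i s ` {0..1})"
  have fin: "finite (invols R)"
  proof (rule finite_subset)
    show "invols R \<subseteq> {Tau, Eta}" using invol.exhaust by blast
  qed simp
  have ER: "E \<subseteq> RM_set R 2"
    using oct_class_in_RM[OF edge_pt_in_octagon] by (auto simp: E_def edge_class_def)
  have ZE: "Z \<subseteq> E"
  proof
    fix X assume "X \<in> Z"
    then have X: "X \<in> RM_set R 2" and "\<exists>C\<in>X. card (comps C) = 3 \<and> mcomp C (i, s) = mcomp C (0, True)"
      by (simp_all add: Z_def)
    then obtain C where C: "C \<in> X" "card (comps C) = 3" "mcomp C (i, s) = mcomp C (0, True)" by blast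
    obtain c where c: "c \<in> invols R" "X \<in> c_moduli_set c 2" using X unfolding RM_set_eq by blast
    obtain C0 where C0: "real_curve 2 C0" "c_real c C0" "X = iso_class 2 C0" using c(2) unfolding c_moduli_set_iff by blast
    have "(C0, C) \<in> real_iso 2" using C(1) C0(3) by (simp add: iso_class_def)
    then obtain f \<phi> where f: "bij_betw f (comps C0) (comps C)" "\<And>l. l \<in> labels 2 \<Longrightarrow> f (mcomp C0 l) = mcomp C l"
      by (rule real_isoE) blast
    have l: "(i, s) \<in> labels 2" "(0, True) \<in> labels 2" using labels_2_members[OF i] by auto
    have "f (mcomp C0 (i, s)) = f (mcomp C0 (0, True))" using f(2) l C(3) by simp
    then have "mcomp C0 (i, s) = mcomp C0 (0, True)"
      using f(1) stable_curve_mcomp[OF real_curve_stable[OF C0(1)]] l by (meson bij_betw_imp_inj_on inj_onD)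
    moreover have "card (comps C0) = 3" using bij_betw_same_card[OF f(1)] C(2) by simp
    ultimately have "\<exists>\<tau>\<in>{0..1}. X = oct_class c (edge_pt i s \<tau>)"
      using three_comp_class[OF C0(1) _ i _ C0(2)] C0(3) by simp
    with c(1) show "X \<in> E" by (auto simp: E_def edge_class_def)
  qed
  have cl: "RM R 2 closure_of Z \<subseteq> E"
  proof
    fix X assume X: "X \<in> RM R 2 closure_of Z"
    let ?P = "product_topology (\<lambda>_. csphere_top) (quadruples 2)"
    have "compactin (RM R 2) (edge_class c i s ` {0..1})" if "c \<in> invols R" for c
      by (rule image_compactin[OF _ continuous_edge_class[OF that]]) (simp add: compactin_subtopology)
    then have "compactin (RM R 2) E" unfolding E_def using fin by (intro compactin_Union) auto
    then have "compactin ?P (cr_map 2 ` E)" by (rule image_compactin[OF _ continuous_map_cr_map])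
    then have closed: "closedin ?P (cr_map 2 ` E)"
      by (rule compactin_imp_closedin[rotated]) (simp add: Hausdorff_space_product_topology Hausdorff_csphere)
    have "cr_map 2 X \<in> ?P closure_of (cr_map 2 ` Z)"
      using continuous_map_image_closure_subset[OF continuous_map_cr_map, of 2 R Z] X by blast
    also have "\<dots> \<subseteq> cr_map 2 ` E"
      by (rule closure_of_minimal[OF image_mono[OF ZE] closed])
    finally obtain Y where Y: "Y \<in> E" "cr_map 2 X = cr_map 2 Y" by blast
    have "X \<in> RM_set R 2" using X closure_of_subset_topspace[of "RM R 2" Z] by auto
    with Y ER cr_map_eq_imp show "X \<in> E" by blast
  qed
  have "E \<subseteq> RM R 2 closure_of Z"
  proof
    fix X assume "X \<in> E"
    then obtain c \<tau> where c: "c \<in> invols R" and t: "\<tau> \<in> {0..1}" and X: "X = edge_class c i s \<tau>" by (auto simp: E_def)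
    let ?G = "{0<..<1/2} \<union> {1/2<..<1::real}"
    have G: "edge_class c i s t' \<in> Z" if "t' \<in> ?G" for t'
    proof -
      have t': "t' \<in> {0<..<1}" "t' \<noteq> 1/2" "t' \<in> {0..1}" using that by auto
      have "oct_curve c (edge_pt i s t') \<in> edge_class c i s t'"
        unfolding edge_class_def oct_class_def by (rule self_in_iso_class[OF chain.real[OF oct_chain[OF edge_pt_in_octagon[OF t'(3)]]]])
      moreover have "edge_class c i s t' \<in> RM_set R 2"
        unfolding edge_class_def by (rule oct_class_in_RM[OF edge_pt_in_octagon[OF t'(3)] c])
      ultimately show ?thesis using edge_generic[OF t'(1,2) i] unfolding Z_def by blast
    qed
    have "closure ?G = {0..1/2} \<union> {1/2..1}" by (simp add: closure_Un)
    then have "\<tau> \<in> closure ?G" using t by auto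
    moreover have G1: "{0..1} \<inter> ?G = ?G" by auto
    ultimately have "\<tau> \<in> top_of_set {0..1} closure_of ?G" using t
      unfolding closure_of_subtopology G1 by (auto simp del: closure_Un)
    then have "X \<in> RM R 2 closure_of (edge_class c i s ` ?G)"
      unfolding X using continuous_map_image_closure_subset[OF continuous_edge_class[OF c], of i s ?G] by blast
    moreover have "edge_class c i s ` ?G \<subseteq> Z" using G by blast
    ultimately show "X \<in> RM R 2 closure_of Z" using closure_of_mono by blast
  qed
  with cl show ?thesis unfolding Gam_def E_def Z_def by blast
qed

section \<open>Curves with two conjugate pairs\<close>

lemma quadruple_1: "(l1, l2, l3, l4) \<in> quadruples 1 \<longleftrightarrow>
    {l1, l2, l3, l4} \<subseteq> {(1, True), (0, True), (1, False), (0, False)} \<and> distinct [l1, l2, l3, l4]"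
proof -
  have "labels 1 = {(1, True), (0, True), (1, False), (0, False)}"
    by (auto simp: labels_def le_Suc_eq)
  then show ?thesis by (simp add: quadruples_iff)
qed

text \<open>
  The three products of pairs of differences satisfy a linear relation, so their ratios are determined by one of them.
\<close>
lemma cross_ratio_permute:
  fixes p q :: "'l \<Rightarrow> csphere"
  assumes p: "nondeg4 (p a) (p b) (p e) (p f)" and q: "nondeg4 (q a) (q b) (q e) (q f)"
    and eq: "cross_ratio (p a) (p b) (p e) (p f) = cross_ratio (q a) (q b) (q e) (q f)"
    and l: "{l1, l2, l3, l4} \<subseteq> {a, b, e, f}" "distinct [l1, l2, l3, l4]"
  shows "cross_ratio (p l1) (p l2) (p l3) (p l4) = cross_ratio (q l1) (q l2) (q l3) (q l4)"
proof -
  define h h' where "h = (\<lambda>l m. hdiff (p l) (p m))" and "h' = (\<lambda>l m. hdiff (q l) (q m))"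
  have nz: "h a b * h e f \<noteq> 0 \<or> h e b * h a f \<noteq> 0" "h' a b * h' e f \<noteq> 0 \<or> h' e b * h' a f \<noteq> 0"
    using p q unfolding nondeg4_iff h_def h'_def by blast+
  have cross: "h a b * h e f * (h' e b * h' a f) = h' a b * h' e f * (h e b * h a f)"
    using eq proj_pt_eq_iff[OF nz] unfolding cross_ratio_def h_def h'_def by blast
  obtain k where k: "k \<noteq> 0" "h a b * h e f = k * (h' a b * h' e f)" "h e b * h a f = k * (h' e b * h' a f)"
  proof -
    define x y x' y' where "x = h a b * h e f" and "y = h e b * h a f" and "x' = h' a b * h' e f" and "y' = h' e b * h' a f"
    have n: "x \<noteq> 0 \<or> y \<noteq> 0" "x' \<noteq> 0 \<or> y' \<noteq> 0" and xy: "x * y' = x' * y"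
      using nz cross unfolding x_def y_def x'_def y'_def by blast+
    have "\<exists>k. k \<noteq> 0 \<and> x = k * x' \<and> y = k * y'"
    proof (cases "x' = 0")
      case True
      then have "y' \<noteq> 0" "x = 0" "y \<noteq> 0" using n xy by auto
      with True show ?thesis by (intro exI[of _ "y / y'"]) simp
    next
      case False
      have "x \<noteq> 0" using n xy False by auto
      with False show ?thesis using xy by (intro exI[of _ "x / x'"]) (simp add: field_simps)
    qed
    then show ?thesis using that unfolding x_def y_def x'_def y'_def by blast
  qed
  have third: "h a e * h b f = k * (h' a e * h' b f)"
  proof -
    have "h a e * h b f = h a b * h e f - h e b * h a f" "h' a e * h' b f = h' a b * h' e f - h' e b * h' a f"
      unfolding h_def h'_def by (rule hdiff_pluecker)+
    then show ?thesis unfolding k(2,3) by (simp add: right_diff_distrib)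
  qed
  have sw: "h b a = - h a b" "h f e = - h e f" "h b e = - h e b" "h f a = - h a f" "h e a = - h a e" "h f b = - h b f"
    "h' b a = - h' a b" "h' f e = - h' e f" "h' b e = - h' e b" "h' f a = - h' a f" "h' e a = - h' a e" "h' f b = - h' b f"
    unfolding h_def h'_def by (rule hdiff_swap)+
  note r = k(2,3) third
  have r': "h e f * h a b = k * (h' e f * h' a b)" "h a f * h e b = k * (h' a f * h' e b)" "h b f * h a e = k * (h' b f * h' a e)"
    using r by (simp_all only: mult.commute)
  \<comment> \<open>Up to order and sign there are only three products, one for each splitting of
    the four labels into two pairs.\<close>
  have P: "h m1 m2 * h m3 m4 = k * (h' m1 m2 * h' m3 m4)"
    if "m1 \<in> {a, b, e, f}" "m2 \<in> {a, b, e, f}" "m3 \<in> {a, b, e, f}" "m4 \<in> {a, b, e, f}" "distinct [m1, m2, m3, m4]" for m1 m2 m3 m4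
    using that unfolding insert_iff empty_iff
    by (elim disjE FalseE; hypsubst?; simp only: distinct.simps list.set insert_iff simp_thms;
        simp only: sw r r' minus_mult_minus mult_minus_left mult_minus_right)
  have l': "l3 \<noteq> l2" "l3 \<noteq> l1" "l2 \<noteq> l1" using l(2) by auto
  have "h l1 l2 * h l3 l4 = k * (h' l1 l2 * h' l3 l4)" "h l3 l2 * h l1 l4 = k * (h' l3 l2 * h' l1 l4)"
    by (rule P; use l l' in simp)+
  then show ?thesis
    unfolding cross_ratio_def h_def h'_def using proj_pt_scale[OF k(1)] by simp
qed

text \<open>There are only four labels, so a single cross-ratio determines all the others, and hence
  the class.\<close>

lemma cr_1_class:
  assumes C: "real_curve 1 C" and D: "real_curve 1 D"
    and eq: "cr C (1, True) (0, True) (1, False) (0, False) = cr D (1, True) (0, True) (1, False) (0, False)"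
  shows "iso_class 1 C = iso_class 1 D"
  unfolding iso_class_eq_iff[OF C D]
proof (intro allI impI)
  fix l1 l2 l3 l4 assume q: "(l1, l2, l3, l4) \<in> quadruples 1"
  note l = q[unfolded quadruple_1]
  have q0: "((1, True), (0, True), (1, False), (0, False)) \<in> quadruples 1" unfolding quadruple_1 by simp
  note S = real_curve_stable[OF C] real_curve_stable[OF D]
  obtain \<alpha> where a: "\<alpha> \<in> comps C" "3 \<le> card (dir_pt C \<alpha> ` {(1, True), (0, True), (1, False), (0, False)})"
    "nondeg4 (dir_pt C \<alpha> (1, True)) (dir_pt C \<alpha> (0, True)) (dir_pt C \<alpha> (1, False)) (dir_pt C \<alpha> (0, False))"
    by (rule quadruple_comp[OF S(1) q0])
  obtain \<beta> where b: "\<beta> \<in> comps D" "3 \<le> card (dir_pt D \<beta> ` {(1, True), (0, True), (1, False), (0, False)})"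
    "nondeg4 (dir_pt D \<beta> (1, True)) (dir_pt D \<beta> (0, True)) (dir_pt D \<beta> (1, False)) (dir_pt D \<beta> (0, False))"
    by (rule quadruple_comp[OF S(2) q0])
  have four: "{l1, l2, l3, l4} = {(1, True), (0, True), (1, False), (0, False)}"
  proof (rule card_subset_eq)
    show "card {l1, l2, l3, l4} = card {(1::nat, True), (0, True), (1, False), (0, False)}" using l by simp
  qed (use l in simp_all)
  have n: "nondeg4 (dir_pt C \<alpha> l1) (dir_pt C \<alpha> l2) (dir_pt C \<alpha> l3) (dir_pt C \<alpha> l4)"
    "nondeg4 (dir_pt D \<beta> l1) (dir_pt D \<beta> l2) (dir_pt D \<beta> l3) (dir_pt D \<beta> l4)"
    using a(2) b(2) unfolding four[symmetric] by (auto intro!: card_ge_3_imp_nondeg4)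
  have "cross_ratio (dir_pt C \<alpha> (1, True)) (dir_pt C \<alpha> (0, True)) (dir_pt C \<alpha> (1, False)) (dir_pt C \<alpha> (0, False)) =
    cross_ratio (dir_pt D \<beta> (1, True)) (dir_pt D \<beta> (0, True)) (dir_pt D \<beta> (1, False)) (dir_pt D \<beta> (0, False))"
    using eq unfolding cr_eqI[OF S(1) q0 a(1,3)] cr_eqI[OF S(2) q0 b(1,3)] .
  from cross_ratio_permute[where p = "dir_pt C \<alpha>" and q = "dir_pt D \<beta>", OF a(3) b(3) this l[THEN conjunct1] l[THEN conjunct2]]
  have "cross_ratio (dir_pt C \<alpha> l1) (dir_pt C \<alpha> l2) (dir_pt C \<alpha> l3) (dir_pt C \<alpha> l4) =
    cross_ratio (dir_pt D \<beta> l1) (dir_pt D \<beta> l2) (dir_pt D \<beta> l3) (dir_pt D \<beta> l4)" .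
  then show "cr C l1 l2 l3 l4 = cr D l1 l2 l3 l4"
    unfolding cr_eqI[OF S(1) q a(1) n(1)] cr_eqI[OF S(2) q b(1) n(2)] .
qed

section \<open>The interval of curves with two conjugate pairs\<close>

definition seg_level :: "real \<Rightarrow> nat \<Rightarrow> nat" where
  "seg_level \<tau> n = (if \<tau> = 0 then 0 else if \<tau> = 1 then 2 else 1)"

text \<open>On such a curve \<open>chart2\<close> is |z1+|^2, which is \<tau> / (1 - \<tau>) for
  this number. At the ends the sphere can be rescaled, and 1 is a normalization.\<close>

definition seg_num :: "real \<Rightarrow> nat \<Rightarrow> complex" where
  "seg_num \<tau> n = (if \<tau> = 0 \<or> \<tau> = 1 then 1 else complex_of_real (sqrt (\<tau> / (1 - \<tau>))))"

abbreviation seg_curve :: "invol \<Rightarrow> real \<Rightarrow> rcurve" where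
  "seg_curve c \<tau> \<equiv> chain_curve c 2 (seg_level \<tau>) (seg_num \<tau>) 1"

text \<open>The inverse of the coordinate \<^const>\<open>chart2\<close>, with \<open>[0, \<infinity>]\<close> parametrized by \<open>\<tau> : 1 - \<tau>\<close>.\<close>
definition seg_class :: "invol \<Rightarrow> real \<Rightarrow> rcurve set" where
  "seg_class c \<tau> = iso_class 1 (seg_curve c \<tau>)"

lemma seg_chain: "\<tau> \<in> {0..1} \<Longrightarrow> chain c 2 (seg_level \<tau>) (seg_num \<tau>) 1"
  by unfold_locales (auto simp: seg_level_def seg_num_def)

lemma seg_cr:
  assumes t: "\<tau> \<in> {0..1}"
  shows "cr (seg_curve c \<tau>) (1, True) (0, True) (1, False) (0, False) = proj_pt (of_real \<tau>) (inv_sign c * of_real (1 - \<tau>))"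
proof -
  interpret chain c 2 "seg_level \<tau>" "seg_num \<tau>" 1 by (rule seg_chain[OF t])
  have q: "((1, True), (0, True), (1, False), (0, False)) \<in> quadruples 1" unfolding quadruple_1 by simp
  have m: "fst (1::nat, True) \<in> {1..1}" by simp
  have nz: "inv_sign c * complex_of_real (1 - \<tau>) \<noteq> 0 \<or> complex_of_real \<tau> \<noteq> 0"
    using t by auto
  have r: "ratio (1, True) (1, True) = proj_pt 1 1" "ratio (0, True) (1, True) = proj_pt 0 1" "ratio (0, False) (1, True) = proj_pt 1 0"
    "ratio (1, False) (1, True) = proj_pt (inv_sign c * of_real (1 - \<tau>)) (of_real \<tau>)"
  proof -
    show "ratio (1, True) (1, True) = proj_pt 1 1" "ratio (0, True) (1, True) = proj_pt 0 1" "ratio (0, False) (1, True) = proj_pt 1 0"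
      using num_nonzero[OF m] by (simp_all add: chain_ratio_def chain_val_def proj_pt_def)
    consider "\<tau> = 0" | "\<tau> = 1" | "0 < \<tau>" "\<tau> < 1" using t by fastforce
    then show "ratio (1, False) (1, True) = proj_pt (inv_sign c * of_real (1 - \<tau>)) (of_real \<tau>)"
    proof cases
      case 3
      have "complex_of_real (sqrt (\<tau> / (1 - \<tau>))) * complex_of_real (sqrt (\<tau> / (1 - \<tau>))) = complex_of_real (\<tau> / (1 - \<tau>))"
        using 3 unfolding of_real_mult[symmetric] by (subst real_sqrt_mult_self) simp
      with 3 have "inv_sign c / (cnj (seg_num \<tau> 1) * seg_num \<tau> 1) = inv_sign c * of_real (1 - \<tau>) / of_real \<tau>"
        by (simp add: seg_num_def)
      with 3 show ?thesis
        by (simp add: chain_ratio_def chain_pos_def seg_level_def chain_num_def proj_pt_def)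
    qed (simp_all add: chain_ratio_def chain_pos_def seg_level_def chain_num_def proj_pt_def)
  qed
  have n: "nondeg4 (ratio (1, True) (1, True)) (ratio (0, True) (1, True)) (ratio (1, False) (1, True)) (ratio (0, False) (1, True))"
    unfolding r by (subst nondeg4_proj_pt) (use nz in auto)
  show ?thesis
    unfolding cr_ratio[OF q m n] unfolding r by (subst cross_ratio_proj_pt) (use nz proj_pt_scale[of "-1"] in auto)
qed

lemma seg_chart2:
  assumes "\<tau> \<in> {0..1}"
  shows "chart2 c (seg_class c \<tau>) = proj_pt (of_real \<tau>) (of_real (1 - \<tau>))"
proof -
  have q: "((1, True), (0, True), (1, False), (0, False)) \<in> quadruples 1" unfolding quadruple_1 by simp
  have "(\<lambda>z. inv_sign c * z) (x / (inv_sign c * y)) = x / y" for x y by (cases c) simp_all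
  then show ?thesis
    unfolding chart2_def seg_class_def curve_cross_ratio_iso_class[OF chain.real[OF seg_chain[OF assms]] q] seg_cr[OF assms]
    by (simp add: proj_pt_def del: of_real_diff)
qed

lemma seg_class_in: "\<tau> \<in> {0..1} \<Longrightarrow> seg_class c \<tau> \<in> c_moduli_set c 1"
  unfolding c_moduli_set_iff seg_class_def
  using chain.real[OF seg_chain] chain.c_real[OF seg_chain] by blast

text \<open>The barycentric coordinate x 1 is the parameter \<tau>, since x 1 : x 0 = \<tau> : 1 -
  \<tau>.\<close>

lemma fund_simplex_eq:
  assumes "x \<in> standard_simplex 1"
  shows "fund_simplex c x = seg_class c (x 1)"
proof -
  have x: "x 1 \<in> {0..1}" "x 0 = 1 - x 1"
    using assms unfolding standard_simplex_def by auto
  have "inv_into (c_moduli_set c 1) (chart2 c) (chart2 c (seg_class c (x 1))) = seg_class c (x 1)"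
  proof (rule inv_into_f_f[OF _ seg_class_in[OF x(1)]])
    have q: "((1, True), (0, True), (1, False), (0, False)) \<in> quadruples 1" unfolding quadruple_1 by simp
    have inj: "map_option ((*) (inv_sign c)) u = map_option ((*) (inv_sign c)) v \<Longrightarrow> u = v" for u v
      by (cases u; cases v) auto
    show "inj_on (chart2 c) (c_moduli_set c 1)"
    proof (rule inj_onI)
      fix X Y assume "X \<in> c_moduli_set c 1" "Y \<in> c_moduli_set c 1" and eq: "chart2 c X = chart2 c Y"
      then obtain C D where C: "real_curve 1 C" "X = iso_class 1 C" and D: "real_curve 1 D" "Y = iso_class 1 D"
        unfolding c_moduli_set_iff by blast
      show "X = Y"
        unfolding C(2) D(2)
        by (rule cr_1_class[OF C(1) D(1)])
          (use inj[OF eq[unfolded chart2_def]] curve_cross_ratio_iso_class[OF C(1) q] curve_cross_ratio_iso_class[OF D(1) q] C(2) D(2) in simp)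
    qed
  qed
  then show ?thesis
    unfolding fund_simplex_def seg_chart2[OF x(1)] using assms x(2) by simp
qed

section \<open>Removing a conjugate pair of leaves\<close>

text \<open>The path to a leaf is the path to its only neighbour, prolonged by one step.\<close>

lemma first_step_past_leaf:
  assumes T: "is_tree C" and ab: "(\<gamma>, \<beta>) \<in> adj C" and u: "\<And>x. (\<gamma>, x) \<in> adj C \<Longrightarrow> x = \<beta>"
    and a: "\<alpha> \<in> comps C" "\<alpha> \<noteq> \<gamma>" "\<alpha> \<noteq> \<beta>"
  shows "first_step C \<alpha> \<gamma> = first_step C \<alpha> \<beta>"
proof -
  have gb: "\<gamma> \<in> comps C" "\<beta> \<in> comps C" "\<gamma> \<noteq> \<beta>" using adj_in_comps[OF T ab] by auto
  have p: "tree_path C \<alpha> (path_to C \<alpha> \<beta>) \<beta>" by (rule tree_path_path_to[OF T a(1) gb(2)])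
  have u': "x = \<beta>" if "(x, \<gamma>) \<in> adj C" for x by (rule u[OF adj_sym[OF T that]])
  have "\<gamma> \<notin> set (path_to C \<alpha> \<beta>)"
    by (rule tree_path_avoids_leaf[OF p a(2)[symmetric] gb(3) u u'])
  moreover have "tree_path C \<beta> [\<beta>, \<gamma>] \<gamma>"
    using gb adj_sym[OF T ab] by (simp add: tree_path_def)
  ultimately have "tree_path C \<alpha> (path_to C \<alpha> \<beta> @ [\<gamma>]) \<gamma>" using tree_path_append[OF p] by simp
  then have "path_to C \<alpha> \<gamma> = path_to C \<alpha> \<beta> @ [\<gamma>]" by (rule path_to_eqI[OF T])
  moreover obtain ys where "path_to C \<alpha> \<beta> = \<alpha> # ys" "ys \<noteq> []"
    using p a(3) by (cases "path_to C \<alpha> \<beta>"; cases "tl (path_to C \<alpha> \<beta>)") (auto simp: tree_path_def)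
  ultimately show ?thesis unfolding first_step_def by (simp add: nth_append)
qed

text \<open>A leaf with z0+ and one further marked point, described by directions: everything else
  is seen in a single direction p3. This form survives isomorphisms and covers the degenerate curves
  of the submanifolds too.\<close>

locale cuttable =
  fixes C :: rcurve and i :: nat and s :: bool and \<gamma> :: nat and p1 p2 p3 :: csphere
  assumes C: "real_curve 2 C" and i: "i \<in> {1, 2}" and g: "\<gamma> \<in> comps C"
    and d1: "dir_pt C \<gamma> (0, True) = p1" and d2: "dir_pt C \<gamma> (i, s) = p2"
    and d3: "\<And>l. l \<in> labels 2 \<Longrightarrow> l \<noteq> (0, True) \<Longrightarrow> l \<noteq> (i, s) \<Longrightarrow> dir_pt C \<gamma> l = p3"
    and ne: "p1 \<noteq> p2" "p1 \<noteq> p3" "p2 \<noteq> p3"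
begin

lemmas S = real_curve_stable[OF C]
lemmas T = stable_curve_tree[OF S]

abbreviation "j \<equiv> 3 - i"

lemma lab: "(0, t) \<in> labels 2" "(i, t) \<in> labels 2" "(j, t) \<in> labels 2"
  using labels_2_members[OF i] by auto

lemma ij: "i \<noteq> 0" "j \<noteq> 0" "j \<noteq> i" "i \<noteq> j"
  using i by auto

definition "\<gamma>' = icomp C \<gamma>"

lemma on_leaf: "mcomp C (0, True) = \<gamma>" "mcomp C (i, s) = \<gamma>"
proof -
  show "mcomp C (0, True) = \<gamma>"
    unfolding mcomp_iff[OF S g lab(1)]
  proof (intro ballI impI)
    fix m assume "m \<in> labels 2" "m \<noteq> (0, True)"
    then show "dir_pt C \<gamma> m \<noteq> dir_pt C \<gamma> (0, True)" using d1 d2 d3 ne by (cases "m = (i, s)") auto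
  qed
  show "mcomp C (i, s) = \<gamma>"
    unfolding mcomp_iff[OF S g lab(2)]
  proof (intro ballI impI)
    fix m assume "m \<in> labels 2" "m \<noteq> (i, s)"
    then show "dir_pt C \<gamma> m \<noteq> dir_pt C \<gamma> (i, s)" using d1 d2 d3 ne by (cases "m = (0, True)") auto
  qed
qed

lemma not_on_leaf:
  assumes "l \<in> labels 2" "l \<noteq> (0, True)" "l \<noteq> (i, s)"
  shows "mcomp C l \<noteq> \<gamma>"
proof
  assume m: "mcomp C l = \<gamma>"
  obtain m' where "m' \<in> labels 2" "m' \<noteq> l" "m' \<noteq> (0, True)" "m' \<noteq> (i, s)"
    using that[of "(j, True)"] that[of "(j, False)"] lab ij by (cases "l = (j, True)") auto
  then show False using mcomp_iff[OF S g assms(1)] m d3 assms by metis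
qed

text \<open>A label beyond any node of \<gamma> is not on \<gamma>, so the node is the point p3;
  distinct nodes would be distinct points.\<close>

lemma neighbour: "\<exists>!\<beta>. (\<gamma>, \<beta>) \<in> adj C"
proof -
  have n: "mcomp C (j, True) \<noteq> \<gamma>" by (rule not_on_leaf[OF lab(3)]) (use ij in auto)
  have ex: "(\<gamma>, first_step C \<gamma> (mcomp C (j, True))) \<in> adj C"
    by (rule beyond_adj[OF S g lab(3) n])
  have "node C \<gamma> x = p3" if x: "(\<gamma>, x) \<in> adj C" for x
  proof -
    obtain l m where l: "l \<in> labels 2" "m \<in> labels 2" "l \<noteq> m" "beyond C \<gamma> x l" "beyond C \<gamma> x m"
      by (rule two_labels_beyond[OF S x]) blast
    have "mcomp C l \<noteq> \<gamma>" using l(4) by (simp add: beyond_def)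
    then have "l \<noteq> (0, True)" "l \<noteq> (i, s)" using on_leaf by auto
    then have "dir_pt C \<gamma> l = p3" using d3 l(1) by blast
    then show ?thesis using dir_pt_eq_node_iff[OF S x l(1)] l(4) by simp
  qed
  then show ?thesis using ex stable_curve_node_inj[OF S] by metis
qed

definition "\<beta> = (THE \<beta>. (\<gamma>, \<beta>) \<in> adj C)"
definition "\<beta>' = icomp C \<beta>"

lemma beta: "(\<gamma>, \<beta>) \<in> adj C" "\<And>x. (\<gamma>, x) \<in> adj C \<Longrightarrow> x = \<beta>"
  unfolding \<beta>_def using theI'[OF neighbour] neighbour by blast+

lemma in_comps: "\<beta> \<in> comps C" "\<beta> \<noteq> \<gamma>" "\<gamma>' \<in> comps C" "\<beta>' \<in> comps C"
  "icomp C \<gamma>' = \<gamma>" "icomp C \<beta>' = \<beta>"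
  using adj_in_comps[OF T beta(1)] real_curve_icomp(1,2)[OF C] g by (auto simp: \<gamma>'_def \<beta>'_def)

lemma leaf': "mcomp C (0, False) = \<gamma>'" "mcomp C (i, \<not> s) = \<gamma>'" "\<gamma>' \<noteq> \<gamma>"
proof -
  show *: "mcomp C (0, False) = \<gamma>'" "mcomp C (i, \<not> s) = \<gamma>'"
    using real_curve_mark(1)[OF C lab(1), of True] real_curve_mark(1)[OF C lab(2), of s] on_leaf by (simp_all add: \<gamma>'_def)
  have "mcomp C (0, False) \<noteq> \<gamma>" by (rule not_on_leaf[OF lab(1)]) (use ij in auto)
  with * show "\<gamma>' \<noteq> \<gamma>" by simp
qed

lemma beta': "(\<gamma>', \<beta>') \<in> adj C" "\<And>x. (\<gamma>', x) \<in> adj C \<Longrightarrow> x = \<beta>'"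
proof -
  show "(\<gamma>', \<beta>') \<in> adj C" using real_curve_adj(1)[OF C beta(1)] by (simp add: \<gamma>'_def \<beta>'_def)
  fix x assume x: "(\<gamma>', x) \<in> adj C"
  have "(\<gamma>, icomp C x) \<in> adj C" using real_curve_adj(1)[OF C x] in_comps(5) by simp
  then have "icomp C x = \<beta>" by (rule beta(2))
  moreover have "icomp C (icomp C x) = x" using real_curve_icomp(2)[OF C] adj_in_comps[OF T x] by blast
  ultimately show "x = \<beta>'" by (simp add: \<beta>'_def)
qed

text \<open>If the two leaves were adjacent, \<gamma> would see the whole pair \<open>j\<close>
  through \<gamma>'. By conjugation \<gamma>' would see it through \<gamma> as well, against
  \<open>beyond_swap\<close>.\<close>

lemma beta_ne: "\<beta> \<noteq> \<gamma>'" "\<beta>' \<noteq> \<gamma>" "\<beta>' \<noteq> \<gamma>'"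
proof -
  have n: "mcomp C (j, t) \<noteq> \<gamma>" for t by (rule not_on_leaf[OF lab(3)]) (use ij in auto)
  have b: "beyond C \<gamma> \<beta> (j, t)" for t
    unfolding beyond_def using n beta(2)[OF beyond_adj[OF S g lab(3) n]] by blast
  show "\<beta> \<noteq> \<gamma>'"
  proof
    assume eq: "\<beta> = \<gamma>'"
    have adj': "(\<gamma>', \<gamma>) \<in> adj C" using adj_sym[OF T beta(1)] eq by simp
    have "dir_pt C \<gamma>' (j, False) = imap C \<gamma> (dir_pt C \<gamma> (j, True))"
      using real_curve_dir_pt_conj[OF C g lab(3), of True] by (simp add: \<gamma>'_def)
    also have "dir_pt C \<gamma> (j, True) = node C \<gamma> \<gamma>'"
      using dir_pt_eq_node_iff[OF S beta(1) lab(3)] b eq by simp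
    also have "imap C \<gamma> (node C \<gamma> \<gamma>') = node C \<gamma>' \<gamma>"
      using real_curve_adj(2)[OF C, of \<gamma> \<gamma>'] beta(1) eq in_comps(5) by (simp add: \<gamma>'_def)
    finally have "beyond C \<gamma>' \<gamma> (j, False)" using dir_pt_eq_node_iff[OF S adj' lab(3)] by blast
    then show False using beyond_swap[OF S beta(1) lab(3), of False] b[of False] unfolding eq by blast
  qed
  then show "\<beta>' \<noteq> \<gamma>" using in_comps(6) by (auto simp: \<gamma>'_def)
  show "\<beta>' \<noteq> \<gamma>'" using in_comps(2,5,6) by metis
qed

abbreviation "D \<equiv> cut_curve i C"
definition "V = comps C - {\<gamma>, \<gamma>'}"

lemma D_eq: "D = C\<lparr>comps := V, adj := adj C \<inter> V \<times> V,
    mcomp := (\<lambda>(n, t). if n = 0 then (if t then \<beta> else \<beta>') else mcomp C (j, t)),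
    mpt := (\<lambda>(n, t). if n = 0 then (if t then node C \<beta> \<gamma> else node C \<beta>' \<gamma>') else mpt C (j, t))\<rparr>"
  unfolding cut_curve_def on_leaf Let_def V_def \<gamma>'_def \<beta>_def[symmetric] \<beta>'_def ..

lemma D_simps [simp]: "comps D = V" "adj D = adj C \<inter> V \<times> V" "node D = node C" "icomp D = icomp C" "imap D = imap C"
  "mcomp D (0, True) = \<beta>" "mcomp D (0, False) = \<beta>'" "n \<noteq> 0 \<Longrightarrow> mcomp D (n, t) = mcomp C (j, t)"
  "mpt D (0, True) = node C \<beta> \<gamma>" "mpt D (0, False) = node C \<beta>' \<gamma>'" "n \<noteq> 0 \<Longrightarrow> mpt D (n, t) = mpt C (j, t)"
  by (simp_all add: D_eq)

lemma V: "\<beta> \<in> V" "\<beta>' \<in> V" "mcomp C (j, t) \<in> V" "\<alpha> \<in> V \<Longrightarrow> \<alpha> \<in> comps C \<and> \<alpha> \<noteq> \<gamma> \<and> \<alpha> \<noteq> \<gamma>'" "\<alpha> \<in> V \<Longrightarrow> icomp C \<alpha> \<in> V"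
proof -
  show "\<beta> \<in> V" "\<beta>' \<in> V" "\<alpha> \<in> V \<Longrightarrow> \<alpha> \<in> comps C \<and> \<alpha> \<noteq> \<gamma> \<and> \<alpha> \<noteq> \<gamma>'"
    using in_comps beta_ne by (simp_all add: V_def)
  have n: "mcomp C (j, t) \<noteq> \<gamma>" for t by (rule not_on_leaf[OF lab(3)]) (use ij in auto)
  have "mcomp C (j, t) \<noteq> \<gamma>'"
  proof
    assume "mcomp C (j, t) = \<gamma>'"
    then have "mcomp C (j, \<not> t) = \<gamma>" using real_curve_mark(1)[OF C lab(3), of t] in_comps(5) by simp
    with n show False by simp
  qed
  then show "mcomp C (j, t) \<in> V" using n stable_curve_mcomp[OF S lab(3)] by (simp add: V_def)
  assume a: "\<alpha> \<in> V"
  then have ac: "\<alpha> \<in> comps C" "\<alpha> \<noteq> \<gamma>" "\<alpha> \<noteq> \<gamma>'" by (auto simp: V_def)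
  have "icomp C \<alpha> \<noteq> \<gamma>" using real_curve_icomp(2)[OF C ac(1)] ac(3) by (auto simp: \<gamma>'_def)
  moreover have "icomp C \<alpha> \<noteq> \<gamma>'" using real_curve_icomp(2)[OF C ac(1)] ac(2) in_comps(5) by auto
  ultimately show "icomp C \<alpha> \<in> V" using real_curve_icomp(1)[OF C ac(1)] by (simp add: V_def)
qed

lemma tree_path_D:
  assumes "\<alpha> \<in> V" "\<delta> \<in> V"
  shows "tree_path D \<alpha> xs \<delta> \<longleftrightarrow> tree_path C \<alpha> xs \<delta>"
proof -
  have sub: "tree_path D \<alpha> xs \<delta> \<longleftrightarrow> tree_path C \<alpha> xs \<delta> \<and> set xs \<subseteq> comps D"
    by (rule tree_path_subtree) (simp_all add: V_def)
  have "set xs \<subseteq> V" if p: "tree_path C \<alpha> xs \<delta>"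
  proof -
    note a = V(4)[OF assms(1)] V(4)[OF assms(2)]
    have "\<gamma> \<notin> set xs"
      by (rule tree_path_avoids_leaf[OF p _ _ beta(2)]) (use a beta(2) adj_sym[OF T] in blast)+
    moreover have "\<gamma>' \<notin> set xs"
      by (rule tree_path_avoids_leaf[OF p _ _ beta'(2)]) (use a beta'(2) adj_sym[OF T] in blast)+
    moreover have "set xs \<subseteq> comps C" using p by (simp add: tree_path_def)
    ultimately show ?thesis by (auto simp: V_def)
  qed
  with sub show ?thesis by auto
qed

lemma tree_D: "is_tree D"
proof -
  have "\<exists>!xs. tree_path D \<alpha> xs \<delta>" if "\<alpha> \<in> V" "\<delta> \<in> V" for \<alpha> \<delta>
    unfolding tree_path_D[OF that] using tree_path_ex1[OF T] V(4)[OF that(1)] V(4)[OF that(2)] by blast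
  moreover have "finite V" "V \<noteq> {}" "sym (adj C \<inter> V \<times> V)" "irrefl (adj C \<inter> V \<times> V)"
    using T V(1) unfolding is_tree_def sym_def irrefl_def V_def by auto
  ultimately show ?thesis unfolding is_tree_def D_simps by blast
qed

lemma first_step_D: "\<alpha> \<in> V \<Longrightarrow> \<delta> \<in> V \<Longrightarrow> first_step D \<alpha> \<delta> = first_step C \<alpha> \<delta>"
  unfolding first_step_def path_to_def by (simp add: tree_path_D)

text \<open>The new pair 0 sits exactly where z0+ and z0- used to be seen, so cutting changes no
  direction on the components that remain.\<close>

lemma dir_pt_D:
  assumes a: "\<alpha> \<in> V"
  shows "dir_pt D \<alpha> (0, t) = dir_pt C \<alpha> (0, t)" "n \<noteq> 0 \<Longrightarrow> dir_pt D \<alpha> (n, t) = dir_pt C \<alpha> (j, t)"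
proof -
  note ac = V(4)[OF a]
  have T0: "dir_pt D \<alpha> (0, True) = dir_pt C \<alpha> (0, True)"
  proof (cases "\<alpha> = \<beta>")
    case True
    then show ?thesis using first_step_adj[OF T adj_sym[OF T beta(1)]] on_leaf in_comps(2) by (simp add: dir_pt_eq)
  next
    case False
    then show ?thesis
      using first_step_past_leaf[OF T beta, of \<alpha>] first_step_D[OF a V(1)] on_leaf ac by (simp add: dir_pt_eq)
  qed
  have F0: "dir_pt D \<alpha> (0, False) = dir_pt C \<alpha> (0, False)"
  proof (cases "\<alpha> = \<beta>'")
    case True
    then show ?thesis using first_step_adj[OF T adj_sym[OF T beta'(1)]] leaf' beta_ne by (simp add: dir_pt_eq)
  next
    case False
    then show ?thesis
      using first_step_past_leaf[OF T beta', of \<alpha>] first_step_D[OF a V(2)] leaf' ac by (simp add: dir_pt_eq)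
  qed
  show "dir_pt D \<alpha> (0, t) = dir_pt C \<alpha> (0, t)" using T0 F0 by (cases t) simp_all
  show "n \<noteq> 0 \<Longrightarrow> dir_pt D \<alpha> (n, t) = dir_pt C \<alpha> (j, t)" using first_step_D[OF a V(3)] by (simp add: dir_pt_eq)
qed

lemma marks_D:
  assumes "l \<in> labels 1" "mcomp D l = \<alpha>"
  obtains "l = (0, True)" "(\<alpha>, \<gamma>) \<in> adj C" "mpt D l = node C \<alpha> \<gamma>" "\<alpha> = \<beta>"
    | "l = (0, False)" "(\<alpha>, \<gamma>') \<in> adj C" "mpt D l = node C \<alpha> \<gamma>'" "\<alpha> = \<beta>'"
    | t where "l = (1, t)" "mcomp C (j, t) = \<alpha>" "mpt D l = mpt C (j, t)"
proof -
  have "l = (0, True) \<or> l = (0, False) \<or> l = (1, True) \<or> l = (1, False)"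
    using assms(1) by (cases l; cases "snd l") (auto simp: labels_def le_Suc_eq)
  then consider "l = (0, True)" | "l = (0, False)" | t where "l = (1, t)" by blast
  then show ?thesis
  proof cases
    case 1
    then show ?thesis using that(1) assms(2) adj_sym[OF T beta(1)] by simp
  next
    case 2
    then show ?thesis using that(2) assms(2) adj_sym[OF T beta'(1)] by simp
  next
    case (3 t)
    then show ?thesis using that(3)[of t] assms(2) by simp
  qed
qed

text \<open>Stability is inherited because no special point is lost: the nodes at which the leaves
  were attached turn into marked points.\<close>

lemma special_D:
  assumes a: "\<alpha> \<in> V"
  shows "node C \<alpha> ` (adj C `` {\<alpha>}) \<union> mpt C ` marks_on 2 C \<alpha> \<subseteq> node D \<alpha> ` (adj D `` {\<alpha>}) \<union> mpt D ` marks_on 1 D \<alpha>"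
proof
  note ac = V(4)[OF a]
  have lab1: "(n, t) \<in> labels 1" if "n = 0 \<or> n = 1" for n t using that by (auto simp: labels_def)
  fix p assume "p \<in> node C \<alpha> ` (adj C `` {\<alpha>}) \<union> mpt C ` marks_on 2 C \<alpha>"
  then consider x where "(\<alpha>, x) \<in> adj C" "p = node C \<alpha> x" | l where "l \<in> labels 2" "mcomp C l = \<alpha>" "p = mpt C l"
    by (auto simp: marks_on_def)
  then show "p \<in> node D \<alpha> ` (adj D `` {\<alpha>}) \<union> mpt D ` marks_on 1 D \<alpha>"
  proof cases
    case 1
    have xc: "x \<in> comps C" using adj_in_comps[OF T 1(1)] by blast
    consider "x = \<gamma>" | "x = \<gamma>'" | "x \<in> V" using xc unfolding V_def by blast
    then show ?thesis
    proof cases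
      case x: 1
      have ab: "\<alpha> = \<beta>" using beta(2) adj_sym[OF T 1(1)] x by blast
      have "(0, True) \<in> marks_on 1 D \<alpha>" using lab1 by (simp add: marks_on_def ab)
      moreover have "p = mpt D (0, True)" using 1 x ab by simp
      ultimately show ?thesis by blast
    next
      case x: 2
      have ab: "\<alpha> = \<beta>'" using beta'(2) adj_sym[OF T 1(1)] x by blast
      have "(0, False) \<in> marks_on 1 D \<alpha>" using lab1 by (simp add: marks_on_def ab)
      moreover have "p = mpt D (0, False)" using 1 x ab by simp
      ultimately show ?thesis by blast
    next
      case x: 3
      then have "x \<in> adj D `` {\<alpha>}" using 1 a by simp
      moreover have "p = node D \<alpha> x" using 1 by simp
      ultimately show ?thesis by blast
    qed
  next
    case 2
    have "l \<noteq> (0, True)" "l \<noteq> (0, False)" "l \<noteq> (i, s)" "l \<noteq> (i, \<not> s)" using 2 on_leaf leaf' ac by auto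
    then obtain t where l: "l = (j, t)" using labels_2_split[OF 2(1) i, where s = s] by metis
    have "(1, t) \<in> marks_on 1 D \<alpha>" using lab1 2 l by (simp add: marks_on_def)
    moreover have "p = mpt D (1, t)" using 2 l by simp
    ultimately show ?thesis by blast
  qed
qed

lemma stable_D: "stable_curve 1 D"
proof -
  have mc: "mcomp D l \<in> V" if "l \<in> labels 1" for l
    by (rule marks_D[OF that refl]) (use V in auto)
  have inj_node: "inj_on (node D \<alpha>) (adj D `` {\<alpha>})" for \<alpha>
    by (rule inj_onI) (use stable_curve_node_inj[OF S] in auto)
  have inj_mpt: "inj_on (mpt D) (marks_on 1 D \<alpha>)" for \<alpha>
  proof (rule inj_onI)
    fix l m assume "l \<in> marks_on 1 D \<alpha>" "m \<in> marks_on 1 D \<alpha>" and eq: "mpt D l = mpt D m"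
    then have l: "l \<in> labels 1" "mcomp D l = \<alpha>" and m: "m \<in> labels 1" "mcomp D m = \<alpha>" by (auto simp: marks_on_def)
    have nm: "mpt C (j, t) \<noteq> node C \<alpha> x" if "mcomp C (j, t) = \<alpha>" "(\<alpha>, x) \<in> adj C" for t x
      using stable_curve_mpt_node[OF S lab(3), of t x] that by simp
    have nn: "node C \<alpha> \<gamma> \<noteq> node C \<alpha> \<gamma>'" if "(\<alpha>, \<gamma>) \<in> adj C" "(\<alpha>, \<gamma>') \<in> adj C"
      using stable_curve_node_inj[OF S that] leaf'(3) by auto
    have mm: "t = u" if "mcomp C (j, t) = \<alpha>" "mcomp C (j, u) = \<alpha>" "mpt C (j, t) = mpt C (j, u)" for t u
      using stable_curve_mpt_inj[OF S lab(3) lab(3), of t u] that by simp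
    from l show "l = m"
    proof (cases rule: marks_D)
      case 1
      from m show ?thesis by (cases rule: marks_D) (use 1 eq nm nn in simp_all, metis+)
    next
      case 2
      from m show ?thesis by (cases rule: marks_D) (use 2 eq nm nn in simp_all, metis+)
    next
      case (3 t)
      from m show ?thesis by (cases rule: marks_D) (use 3 eq nm mm in simp_all)
    qed
  qed
  have disj: "node D \<alpha> ` (adj D `` {\<alpha>}) \<inter> mpt D ` marks_on 1 D \<alpha> = {}" for \<alpha>
  proof -
    have "mpt D l \<noteq> node C \<alpha> x" if l: "l \<in> labels 1" "mcomp D l = \<alpha>" and x: "(\<alpha>, x) \<in> adj C" "x \<in> V" for l x
    proof -
      note xv = V(4)[OF x(2)]
      from l show ?thesis
      proof (cases rule: marks_D)
        case 1
        then show ?thesis using stable_curve_node_inj[OF S 1(2) x(1)] xv by auto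
      next
        case 2
        then show ?thesis using stable_curve_node_inj[OF S 2(2) x(1)] xv by auto
      next
        case (3 t)
        then show ?thesis using stable_curve_mpt_node[OF S lab(3), of t x] x(1) by simp
      qed
    qed
    then show ?thesis by (fastforce simp: marks_on_def)
  qed
  have card3: "3 \<le> card (node D \<alpha> ` (adj D `` {\<alpha>}) \<union> mpt D ` marks_on 1 D \<alpha>)" if a: "\<alpha> \<in> V" for \<alpha>
  proof -
    have "adj D `` {\<alpha>} \<subseteq> V" by auto
    then have "finite (adj D `` {\<alpha>})" using tree_D finite_subset unfolding is_tree_def by (metis D_simps(1))
    moreover have "finite (marks_on 1 D \<alpha>)" by (rule finite_subset[OF _ finite_labels[of 1]]) (auto simp: marks_on_def)
    ultimately have "finite (node D \<alpha> ` (adj D `` {\<alpha>}) \<union> mpt D ` marks_on 1 D \<alpha>)" by blast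
    from card_mono[OF this special_D[OF a]] show ?thesis
      using stable_curve_card[OF S] V(4)[OF a] by (meson order_trans)
  qed
  show ?thesis
    unfolding stable_curve_def
    using tree_D mc inj_node inj_mpt disj card3 by (intro conjI ballI image_subsetI) (simp_all only: D_simps(1))
qed

lemma real_D: "real_curve 1 D"
proof -
  have "(icomp C (mcomp D l) = mcomp D (fst l, \<not> snd l)) \<and> imap C (mcomp D l) (mpt D l) = mpt D (fst l, \<not> snd l)"
    if "l \<in> labels 1" for l
    using that refl
  proof (cases rule: marks_D)
    case 1
    then show ?thesis using real_curve_adj(2)[OF C 1(2)] by (simp add: \<beta>'_def \<gamma>'_def)
  next
    case 2
    then show ?thesis using real_curve_adj(2)[OF C 2(2)] in_comps(5,6) by simp
  next
    case (3 t)
    then show ?thesis using real_curve_mark[OF C lab(3), of t] by simp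
  qed
  then have m: "icomp C (mcomp D (n, t)) = mcomp D (n, \<not> t) \<and> imap C (mcomp D (n, t)) (mpt D (n, t)) = mpt D (n, \<not> t)"
    if "(n, t) \<in> labels 1" for n t using that by force
  have "real_involution 1 D"
    unfolding real_involution_def
  proof (intro conjI ballI)
    fix \<alpha> assume "\<alpha> \<in> comps D"
    then have a: "\<alpha> \<in> V" "\<alpha> \<in> comps C" using V(4) by auto
    show "icomp D \<alpha> \<in> comps D" "icomp D (icomp D \<alpha>) = \<alpha>" "antimobius (imap D \<alpha>)" "\<forall>z. imap D (icomp D \<alpha>) (imap D \<alpha> z) = z"
      using V(5)[OF a(1)] real_curve_icomp[OF C a(2)] by simp_all
  next
    fix e assume "e \<in> adj D"
    then obtain x y where e: "e = (x, y)" "(x, y) \<in> adj C" "x \<in> V" "y \<in> V" by (cases e) auto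
    show "case e of (x, y) \<Rightarrow> (icomp D x, icomp D y) \<in> adj D \<and> imap D x (node D x y) = node D (icomp D x) (icomp D y)"
      using real_curve_adj[OF C e(2)] V(5)[OF e(3)] V(5)[OF e(4)] e(1) by simp
  next
    fix l assume "l \<in> labels 1"
    then show "case l of (i, s) \<Rightarrow> icomp D (mcomp D (i, s)) = mcomp D (i, \<not> s) \<and>
        imap D (mcomp D (i, s)) (mpt D (i, s)) = mpt D (i, \<not> s)"
      using m by (cases l) simp
  qed
  then show ?thesis using stable_D by (simp add: real_curve_def)
qed

lemma cr_D: "cr D (1, True) (0, True) (1, False) (0, False) = cr C (j, True) (0, True) (j, False) (0, False)"
proof -
  have q: "((1, True), (0, True), (1, False), (0, False)) \<in> quadruples 1" unfolding quadruple_1 by simp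
  have q2: "((j, True), (0, True), (j, False), (0, False)) \<in> quadruples 2" using lab ij by (simp add: quadruples_iff)
  obtain \<alpha> where a: "\<alpha> \<in> comps D" "3 \<le> card (dir_pt D \<alpha> ` {(1, True), (0, True), (1, False), (0, False)})"
    "nondeg4 (dir_pt D \<alpha> (1, True)) (dir_pt D \<alpha> (0, True)) (dir_pt D \<alpha> (1, False)) (dir_pt D \<alpha> (0, False))"
    by (rule quadruple_comp[OF stable_D q])
  have av: "\<alpha> \<in> V" using a(1) by simp
  have dd: "dir_pt D \<alpha> (1, t) = dir_pt C \<alpha> (j, t)" for t by (rule dir_pt_D(2)[OF av]) simp
  have "nondeg4 (dir_pt C \<alpha> (j, True)) (dir_pt C \<alpha> (0, True)) (dir_pt C \<alpha> (j, False)) (dir_pt C \<alpha> (0, False))"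
    using a(3) unfolding dd dir_pt_D(1)[OF av] .
  from cr_eqI[OF S q2 _ this] V(4)[OF av] show ?thesis
    unfolding cr_eqI[OF stable_D q a(1,3)] dd dir_pt_D(1)[OF av] by simp
qed

end

text \<open>Every representative C has to be treated, since \<open>record_real\<close> takes a union
  over the whole class. The leaf is therefore located through its directions, which are transported
  from \<open>oct_curve\<close>.\<close>

lemma cut_edge_class:
  assumes i: "i \<in> {1, 2}" and t: "\<tau> \<in> {0..1}" and X: "C \<in> edge_class c i s \<tau>"
  shows "real_iso 1 `` {cut_curve i C} = seg_class c \<tau>"
proof -
  let ?v = "edge_pt i s \<tau>"
  note v = edge_pt_in_octagon[OF t, of i s]
  interpret chain c 6 "oct_levels ?v" "oct_num c ?v" 2 by (rule oct_chain[OF v])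
  let ?E = "oct_curve c ?v"
  have lab: "(0, t) \<in> labels 2" "(i, t) \<in> labels 2" "(3 - i, t) \<in> labels 2" for t using labels_2_members[OF i] by auto
  have ij: "i \<noteq> 0" "3 - i \<noteq> 0" "3 - i \<noteq> i" using i by auto
  have iso: "(?E, C) \<in> real_iso 2" using X by (simp add: edge_class_def oct_class_def iso_class_def)
  then have C: "real_curve 2 C" by (simp add: real_iso_iff)
  from iso obtain f \<phi> where f: "bij_betw f (comps ?E) (comps C)" "\<And>\<alpha>. \<alpha> \<in> comps ?E \<Longrightarrow> mobius (\<phi> \<alpha>)"
    "\<And>\<alpha> l. \<alpha> \<in> comps ?E \<Longrightarrow> l \<in> labels 2 \<Longrightarrow> dir_pt C (f \<alpha>) l = \<phi> \<alpha> (dir_pt ?E \<alpha> l)"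
    by (rule real_isoE) blast
  have view: "\<exists>\<gamma>\<in>comps C. \<exists>h. mobius h \<and> (\<forall>l\<in>labels 2. dir_pt C \<gamma> l = h (edge_ratio c i s \<tau> l m))" if m: "fst m \<in> {1..2}" for m
  proof -
    have "m \<in> labels 2" using m by (cases m) (simp add: labels_def)
    then have p: "pos m \<in> comps ?E" using pos_in_K by simp
    have "mobius (\<phi> (pos m) \<circ> mobius_map (num m) 0 0 1)" by (rule mobius_comp[OF f(2)[OF p] mobius_num[OF m]])
    moreover have "dir_pt C (f (pos m)) l = (\<phi> (pos m) \<circ> mobius_map (num m) 0 0 1) (edge_ratio c i s \<tau> l m)" if "l \<in> labels 2" for l
      unfolding f(3)[OF p that] dir_pt_ratio[OF that m] oct_ratio_edge[OF t i that m] by simp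
    moreover have "f (pos m) \<in> comps C" using f(1) p by (rule bij_betwE[THEN bspec])
    ultimately show ?thesis by blast
  qed
  have "fst (i, s) \<in> {1..2}" using i by auto
  from view[OF this] obtain \<gamma> h where g: "\<gamma> \<in> comps C" and h: "mobius h"
    and dir: "\<And>l. l \<in> labels 2 \<Longrightarrow> dir_pt C \<gamma> l = h (edge_ratio c i s \<tau> l (i, s))" by blast
  note ev = edge_ratio_values[OF i, of c s \<tau>]
  interpret cut: cuttable C i s \<gamma> "h (Some 0)" "h (Some 1)" "h None"
  proof
    show "dir_pt C \<gamma> l = h None" if "l \<in> labels 2" "l \<noteq> (0, True)" "l \<noteq> (i, s)" for l
      using dir[OF that(1)] that(2,3) ij by (simp add: edge_ratio_def)
  qed (use C i g dir[OF lab(1)] dir[OF lab(2)] ev mobius_eq_iff[OF h] in auto)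
  have "fst (3 - i, True) \<in> {1..2}" using i by auto
  from view[OF this] obtain \<delta> k where d: "\<delta> \<in> comps C" and k: "mobius k"
    and dir': "\<And>l. l \<in> labels 2 \<Longrightarrow> dir_pt C \<delta> l = k (edge_ratio c i s \<tau> l (3 - i, True))" by blast
  have q2: "((3 - i, True), (0, True), (3 - i, False), (0, False)) \<in> quadruples 2" using lab ij by (simp add: quadruples_iff)
  have pts: "Some 1 = proj_pt 1 1" "Some 0 = proj_pt 0 1" "None = proj_pt 1 0" by (simp_all add: proj_pt_def)
  have nz: "inv_sign c * complex_of_real (1 - \<tau>) \<noteq> 0 \<or> complex_of_real \<tau> \<noteq> 0" by auto
  have n: "nondeg4 (Some 1) (Some 0) (proj_pt (inv_sign c * of_real (1 - \<tau>)) (of_real \<tau>)) None"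
    unfolding pts by (subst nondeg4_proj_pt) (use nz in auto)
  have e: "cross_ratio (Some 1) (Some 0) (proj_pt (inv_sign c * of_real (1 - \<tau>)) (of_real \<tau>)) None =
      proj_pt (of_real \<tau>) (inv_sign c * of_real (1 - \<tau>))"
    unfolding pts by (subst cross_ratio_proj_pt) (use nz proj_pt_scale[of "-1"] in auto)
  note dv = dir'[OF lab(1)] dir'[OF lab(3)]
  have "cr C (3 - i, True) (0, True) (3 - i, False) (0, False) = proj_pt (of_real \<tau>) (inv_sign c * of_real (1 - \<tau>))"
    using cr_eqI[OF real_curve_stable[OF C] q2 d]
    unfolding dv ev nondeg4_mobius[OF k] cross_ratio_mobius[OF k] using n e by simp
  then have "cr (cut_curve i C) (1, True) (0, True) (1, False) (0, False) = cr (seg_curve c \<tau>) (1, True) (0, True) (1, False) (0, False)"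
    unfolding cut.cr_D seg_cr[OF t] .
  from cr_1_class[OF cut.real_D chain.real[OF seg_chain[OF t]] this] show ?thesis
    by (simp add: seg_class_def iso_class_def)
qed

lemma record_real_edge_class:
  assumes "i \<in> {1, 2}" "\<tau> \<in> {0..1}"
  shows "record_real i (edge_class c i s \<tau>) = seg_class c \<tau>"
proof -
  have "edge_class c i s \<tau> \<noteq> {}"
    unfolding edge_class_def oct_class_def
    using self_in_iso_class[OF chain.real[OF oct_chain[OF edge_pt_in_octagon[OF assms(2)]]]] by blast
  moreover have "real_iso 1 `` {cut_curve i C} = seg_class c \<tau>" if "C \<in> edge_class c i s \<tau>" for C
    by (rule cut_edge_class[OF assms that])
  ultimately show ?thesis unfolding record_real_def by blast
qed

text \<open>For \<tau> = 0 or 1 the ratio 1 - \<tau> : \<tau> is infinite or 0, which erases the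
  sign of the involution.\<close>

lemma edge_class_ends:
  assumes "i \<in> {1, 2}" "\<tau> \<in> {0, 1}"
  shows "edge_class c i s \<tau> = edge_class c' i s \<tau>"
proof -
  have t: "\<tau> \<in> {0..1}" using assms(2) by auto
  note v = edge_pt_in_octagon[OF t, of i s]
  have "edge_ratio c i s \<tau> l m = edge_ratio c' i s \<tau> l m" for l m
    using assms(2) by (auto simp: edge_ratio_def proj_pt_def)
  then show ?thesis
    unfolding edge_class_def by (intro oct_class_eqI[OF v v]) (simp add: oct_ratio_edge[OF t assms(1)])
qed

lemma inv_record_real:
  assumes i: "i \<in> {1, 2}" and t: "\<tau> \<in> {0..1}" and c: "c \<in> invols R"
  shows "inv_into (Gam R i s) (record_real i) (seg_class c \<tau>) = edge_class c i s \<tau>"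
proof -
  have q: "((1, True), (0, True), (1, False), (0, False)) \<in> quadruples 1" unfolding quadruple_1 by simp
  \<comment> \<open>The types may differ here. Inside the interval the coordinate is positive for
    \<open>Tau\<close> and negative for \<open>Eta\<close>, so a coincidence between them occurs
    only at 0 or infinity, where \<open>edge_class_ends\<close> applies.\<close>
  have inj: "edge_class c i s \<tau> = edge_class c' i s \<tau>'"
    if t: "\<tau> \<in> {0..1}" "\<tau>' \<in> {0..1}" and eq: "seg_class c \<tau> = seg_class c' \<tau>'" for c c' \<tau> \<tau>'
  proof -
    have "curve_cross_ratio (seg_class c \<tau>) (1, True) (0, True) (1, False) (0, False) = proj_pt (of_real \<tau>) (inv_sign c * of_real (1 - \<tau>))"
      if "\<tau> \<in> {0..1}" for c \<tau>
      unfolding seg_class_def curve_cross_ratio_iso_class[OF chain.real[OF seg_chain[OF that]] q] by (rule seg_cr[OF that])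
    from this[OF t(1), of c] this[OF t(2), of c'] eq
    have "proj_pt (of_real \<tau>) (inv_sign c * of_real (1 - \<tau>)) = proj_pt (of_real \<tau>') (inv_sign c' * of_real (1 - \<tau>'))" by simp
    moreover have "complex_of_real \<tau> \<noteq> 0 \<or> inv_sign c * of_real (1 - \<tau>) \<noteq> 0" "complex_of_real \<tau>' \<noteq> 0 \<or> inv_sign c' * of_real (1 - \<tau>') \<noteq> 0"
      by auto
    ultimately have e: "complex_of_real \<tau> * (inv_sign c' * of_real (1 - \<tau>')) = complex_of_real \<tau>' * (inv_sign c * of_real (1 - \<tau>))"
      using proj_pt_eq_iff by blast
    define r where "r = (\<lambda>c. if c = Tau then 1 else - 1 :: real)"
    have sr: "inv_sign c = of_real (r c)" for c by (cases c) (simp_all add: r_def)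
    from e have "complex_of_real (\<tau> * (r c' * (1 - \<tau>'))) = complex_of_real (\<tau>' * (r c * (1 - \<tau>)))" unfolding sr by simp
    then have e: "\<tau> * (r c' * (1 - \<tau>')) = \<tau>' * (r c * (1 - \<tau>))" unfolding of_real_eq_iff .
    show ?thesis
    proof (cases "c = c'")
      case True
      then have "\<tau> * (1 - \<tau>') = \<tau>' * (1 - \<tau>)" using e by (simp add: r_def split: if_splits)
      then have "\<tau> = \<tau>'" by (simp add: algebra_simps)
      with True show ?thesis by simp
    next
      case False
      then have "r c' = - r c" by (cases c; cases c') (simp_all add: r_def)
      then have z: "\<tau> * (1 - \<tau>') + \<tau>' * (1 - \<tau>) = 0" using e by (simp add: r_def algebra_simps split: if_splits)
      have "\<tau> * (1 - \<tau>') \<ge> 0" "\<tau>' * (1 - \<tau>) \<ge> 0" using t by simp_all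
      then have "\<tau> * (1 - \<tau>') = 0" "\<tau>' * (1 - \<tau>) = 0" using z by linarith+
      then have "\<tau> = \<tau>'" "\<tau> \<in> {0, 1}" by auto
      then show ?thesis using edge_class_ends[OF i] by blast
    qed
  qed
  have mem: "edge_class c i s \<tau> \<in> Gam R i s" unfolding Gam_eq[OF i] using c t by blast
  have "inj_on (record_real i) (Gam R i s)"
  proof (rule inj_onI)
    fix X Y assume "X \<in> Gam R i s" "Y \<in> Gam R i s" and eq: "record_real i X = record_real i Y"
    then obtain c1 t1 c2 t2 where "t1 \<in> {0..1}" "t2 \<in> {0..1}" "X = edge_class c1 i s t1" "Y = edge_class c2 i s t2"
      unfolding Gam_eq[OF i] by blast
    then show "X = Y" using eq record_real_edge_class[OF i] inj by metis
  qed
  from inv_into_f_f[OF this mem] show ?thesis unfolding record_real_edge_class[OF i t] .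
qed

section \<open>Rational chains\<close>

lemma qboundary_superset:
  assumes "finite A" "Poly_Mapping.keys c \<subseteq> A"
  shows "qboundary p c = (if p = 0 then 0 else
    (\<Sum>f\<in>A. \<Sum>k\<le>p. Poly_Mapping.single (singular_face p k f) ((- 1) ^ k * Poly_Mapping.lookup c f)))"
proof -
  have "(\<Sum>f\<in>Poly_Mapping.keys c. \<Sum>k\<le>p. Poly_Mapping.single (singular_face p k f) ((- 1) ^ k * Poly_Mapping.lookup c f)) =
      (\<Sum>f\<in>A. \<Sum>k\<le>p. Poly_Mapping.single (singular_face p k f) ((- 1) ^ k * Poly_Mapping.lookup c f))"
    by (rule sum.mono_neutral_left[OF assms]) (simp add: in_keys_iff)
  then show ?thesis by (simp add: qboundary_def)
qed

lemma qboundary_diff: "qboundary p (a - b) = qboundary p a - qboundary p b"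
proof -
  let ?A = "Poly_Mapping.keys a \<union> Poly_Mapping.keys b"
  have "Poly_Mapping.keys (a - b) \<subseteq> ?A" by (rule keys_diff)
  then show ?thesis
    using qboundary_superset[of ?A "a - b" p] qboundary_superset[of ?A a p] qboundary_superset[of ?A b p]
    by (simp add: lookup_minus right_diff_distrib single_diff sum_subtractf)
qed

lemma qboundary_0 [simp]: "qboundary p 0 = 0"
  by (simp add: qboundary_def)

lemma qboundary_uminus: "qboundary p (- a) = - qboundary p a"
  using qboundary_diff[of p 0 a] by simp

lemma qboundary_single:
  "qboundary p (Poly_Mapping.single f 1) =
    (if p = 0 then 0 else (\<Sum>k\<le>p. Poly_Mapping.single (singular_face p k f) ((- 1) ^ k)))"
  by (simp add: qboundary_def)

lemma qchain_map_superset: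
  assumes "finite A" "Poly_Mapping.keys c \<subseteq> A"
  shows "qchain_map p g c = (\<Sum>f\<in>A. Poly_Mapping.single (simplex_map p g f) (Poly_Mapping.lookup c f))"
  unfolding qchain_map_def by (rule sum.mono_neutral_left[OF assms]) (simp add: in_keys_iff)

lemma qchain_map_diff: "qchain_map p g (a - b) = qchain_map p g a - qchain_map p g b"
proof -
  let ?A = "Poly_Mapping.keys a \<union> Poly_Mapping.keys b"
  have "Poly_Mapping.keys (a - b) \<subseteq> ?A" by (rule keys_diff)
  then show ?thesis
    using qchain_map_superset[of ?A "a - b" p g] qchain_map_superset[of ?A a p g] qchain_map_superset[of ?A b p g]
    by (simp add: lookup_minus single_diff sum_subtractf)
qed

lemma qchain_map_single: "qchain_map p g (Poly_Mapping.single f 1) = Poly_Mapping.single (simplex_map p g f) 1"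
  by (simp add: qchain_map_def)

lemma qchain_0 [simp]: "qchain p X 0"
  by (simp add: qchain_def)

lemma qchain_single [simp]: "qchain p X (Poly_Mapping.single f 1) \<longleftrightarrow> singular_simplex p X f"
  by (simp add: qchain_def)

lemma qchain_diff: "qchain p X a \<Longrightarrow> qchain p X b \<Longrightarrow> qchain p X (a - b)"
  unfolding qchain_def using keys_diff[of a b] by blast

lemma qchain_uminus: "qchain p X a \<Longrightarrow> qchain p X (- a)"
  using qchain_diff[of p X 0 a] by simp

lemma qrelcycle_uminus: "qrelcycle p X S a \<Longrightarrow> qrelcycle p X S (- a)"
  by (simp add: qrelcycle_def qboundary_uminus qchain_uminus)

section \<open>Relative boundaries and homology classes\<close>

lemma qrelboundary_diff:
  assumes "qrelboundary p X S a" "qrelboundary p X S b"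
  shows "qrelboundary p X S (a - b)"
proof -
  obtain d e where d: "qchain (Suc p) X d" "qchain p (subtopology X S) (qboundary (Suc p) d - a)"
    and e: "qchain (Suc p) X e" "qchain p (subtopology X S) (qboundary (Suc p) e - b)"
    using assms unfolding qrelboundary_def by blast
  have eq: "qboundary (Suc p) (d - e) - (a - b) = (qboundary (Suc p) d - a) - (qboundary (Suc p) e - b)"
    by (simp add: qboundary_diff)
  show ?thesis
    unfolding qrelboundary_def
    using qchain_diff[OF d(1) e(1)] qchain_diff[OF d(2) e(2), folded eq] by blast
qed

lemma qrelboundary_0: "qrelboundary p X S 0"
  unfolding qrelboundary_def by (intro exI[of _ 0]) simp

lemma qrelboundary_uminus: "qrelboundary p X S a \<Longrightarrow> qrelboundary p X S (- a)"
  using qrelboundary_diff[OF qrelboundary_0, of p X S a] by simp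

lemma qrelboundary_add: "qrelboundary p X S a \<Longrightarrow> qrelboundary p X S b \<Longrightarrow> qrelboundary p X S (a + b)"
  using qrelboundary_diff[of p X S a "- b"] qrelboundary_uminus[of p X S b] by simp

lemma qrelboundary_boundary: "qchain (Suc p) X d \<Longrightarrow> qrelboundary p X S (qboundary (Suc p) d)"
  unfolding qrelboundary_def by (intro exI[of _ d]) simp

lemma qrelboundary_subspace: "qchain p (subtopology X S) a \<Longrightarrow> qrelboundary p X S a"
  unfolding qrelboundary_def by (intro exI[of _ 0]) (simp add: qchain_uminus)

lemma qhomology_class_eq: "qhomology_class p X S a = {h + a | h. qrelboundary p X S h}"
  by (auto simp: qhomology_class_def r_coset_def qrelcycle_group_def)

lemma qhomology_class_eqI:
  assumes "qrelboundary p X S (a - b)"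
  shows "qhomology_class p X S a = qhomology_class p X S b"
proof -
  have "qhomology_class p X S a \<subseteq> qhomology_class p X S b" if ab: "qrelboundary p X S (a - b)" for a b
  proof
    fix x assume "x \<in> qhomology_class p X S a"
    then obtain h where h: "qrelboundary p X S h" "x = h + a" unfolding qhomology_class_eq by blast
    have "x = (h + (a - b)) + b" using h(2) by simp
    with qrelboundary_add[OF h(1) ab] show "x \<in> qhomology_class p X S b" unfolding qhomology_class_eq by blast
  qed
  from this[OF assms] this[of b a] qrelboundary_uminus[OF assms] show ?thesis by simp
qed

lemma qhomology_class_add:
  "qhomology_class p X S a \<otimes>\<^bsub>qhomology_group p X S\<^esub> qhomology_class p X S b = qhomology_class p X S (a + b)"
proof -
  have "qhomology_class p X S a \<otimes>\<^bsub>qhomology_group p X S\<^esub> qhomology_class p X S b =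
      {x + y | x y. x \<in> qhomology_class p X S a \<and> y \<in> qhomology_class p X S b}"
    by (auto simp: qhomology_group_def FactGroup_def set_mult_def qrelcycle_group_def)
  also have "\<dots> = qhomology_class p X S (a + b)"
  proof (intro equalityI subsetI)
    fix z assume "z \<in> {x + y | x y. x \<in> qhomology_class p X S a \<and> y \<in> qhomology_class p X S b}"
    then obtain h k where h: "qrelboundary p X S h" "qrelboundary p X S k" and z: "z = (h + a) + (k + b)"
      unfolding qhomology_class_eq by blast
    have "z = (h + k) + (a + b)" unfolding z by (simp add: algebra_simps)
    with qrelboundary_add[OF h] show "z \<in> qhomology_class p X S (a + b)" unfolding qhomology_class_eq by blast
  next
    fix z assume "z \<in> qhomology_class p X S (a + b)"
    then obtain h where h: "qrelboundary p X S h" and z: "z = h + (a + b)" unfolding qhomology_class_eq by blast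
    have "z = (h + a) + (0 + b)" unfolding z by (simp add: algebra_simps)
    with h qrelboundary_0 show "z \<in> {x + y | x y. x \<in> qhomology_class p X S a \<and> y \<in> qhomology_class p X S b}"
      unfolding qhomology_class_eq by blast
  qed
  finally show ?thesis .
qed

section \<open>Affine simplices in the octagon\<close>

definition affine_simplex :: "nat \<Rightarrow> ((nat \<Rightarrow> real) \<Rightarrow> 'a) \<Rightarrow> (nat \<Rightarrow> nat \<Rightarrow> real) \<Rightarrow> 'a qchain" where
  "affine_simplex p F l = Poly_Mapping.single (simplex_map p F (oriented_simplex p l)) 1"

definition edge_chain :: "((nat \<Rightarrow> real) \<Rightarrow> 'a) \<Rightarrow> (nat \<Rightarrow> real) \<Rightarrow> (nat \<Rightarrow> real) \<Rightarrow> 'a qchain" where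
  "edge_chain F u v = affine_simplex 1 F (\<lambda>j. if j = 0 then u else v)"

definition tri_chain :: "((nat \<Rightarrow> real) \<Rightarrow> 'a) \<Rightarrow> (nat \<Rightarrow> real) \<Rightarrow> (nat \<Rightarrow> real) \<Rightarrow> (nat \<Rightarrow> real) \<Rightarrow> 'a qchain" where
  "tri_chain F u v w = affine_simplex 2 F (\<lambda>j. if j = 0 then u else if j = 1 then v else w)"

definition point_chain :: "'a \<Rightarrow> 'a qchain" where
  "point_chain x = Poly_Mapping.single (\<lambda>_\<in>standard_simplex 0. x) 1"

lemma affine_simplex_cong:
  "(\<And>j. j \<le> p \<Longrightarrow> l j = l' j) \<Longrightarrow> affine_simplex p F l = affine_simplex p F l'"
  unfolding affine_simplex_def using oriented_simplex_eq[of p l l'] by simp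

lemma affine_simplex_0: "affine_simplex 0 F l = point_chain (F (l 0))"
proof -
  have "simplex_map 0 F (oriented_simplex 0 l) = (\<lambda>_\<in>standard_simplex 0. F (l 0))"
    unfolding simplex_map_def
  proof (rule restrict_ext)
    fix x :: "nat \<Rightarrow> real" assume x: "x \<in> standard_simplex 0"
    then have "x 0 = 1" by (simp add: standard_simplex_def)
    with x show "(F \<circ> oriented_simplex 0 l) x = F (l 0)" by (simp add: oriented_simplex_def)
  qed
  then show ?thesis by (simp add: affine_simplex_def point_chain_def)
qed

lemma qboundary_affine_simplex:
  assumes "1 \<le> p"
  shows "qboundary p (affine_simplex p F l) =
    (\<Sum>k\<le>p. Poly_Mapping.single (simplex_map (p - 1) F (oriented_simplex (p - 1) (\<lambda>j. if j < k then l j else l (Suc j)))) ((- 1) ^ k))"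
proof -
  have "singular_face p k (simplex_map p F (oriented_simplex p l)) =
      simplex_map (p - 1) F (oriented_simplex (p - 1) (\<lambda>j. if j < k then l j else l (Suc j)))" if "k \<le> p" for k
  proof -
    have "singular_face p k (simplex_map p F (oriented_simplex p l)) = simplex_map (p - 1) F (singular_face p k (oriented_simplex p l))"
      using singular_face_simplex_map[OF assms that, of F "oriented_simplex p l"]
      by (auto simp: simplex_map_def singular_face_def)
    then show ?thesis unfolding singular_face_oriented_simplex[OF assms that] .
  qed
  then show ?thesis
    unfolding affine_simplex_def qboundary_single using assms by simp
qed

lemma qboundary_edge_chain: "qboundary 1 (edge_chain F u v) = point_chain (F v) - point_chain (F u)"
proof -
  define l where "l = (\<lambda>j::nat. if j = 0 then u else v)"
  define m where "m = (\<lambda>k j::nat. if j < k then l j else l (Suc j))"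
  have "affine_simplex 0 F (m 0) = point_chain (F v)" "affine_simplex 0 F (m 1) = point_chain (F u)"
    by (simp_all add: affine_simplex_0 m_def l_def)
  moreover have "(\<Sum>k\<le>1::nat. Poly_Mapping.single (simplex_map 0 F (oriented_simplex 0 (m k))) ((- 1) ^ k)) =
      affine_simplex 0 F (m 0) - affine_simplex 0 F (m 1)"
    by (simp add: affine_simplex_def single_uminus)
  moreover have "qboundary 1 (edge_chain F u v) =
      (\<Sum>k\<le>1::nat. Poly_Mapping.single (simplex_map 0 F (oriented_simplex 0 (m k))) ((- 1) ^ k))"
    unfolding edge_chain_def m_def l_def using qboundary_affine_simplex[of 1 F] by simp
  ultimately show ?thesis by simp
qed

lemma qboundary_tri_chain:
  "qboundary 2 (tri_chain F u v w) = edge_chain F v w - edge_chain F u w + edge_chain F u v"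
proof -
  define l where "l = (\<lambda>j::nat. if j = 0 then u else if j = 1 then v else w)"
  define m where "m = (\<lambda>k j::nat. if j < k then l j else l (Suc j))"
  have "affine_simplex 1 F (m 0) = edge_chain F v w" "affine_simplex 1 F (m 1) = edge_chain F u w"
    "affine_simplex 1 F (m 2) = edge_chain F u v"
    unfolding edge_chain_def by (rule affine_simplex_cong; simp add: m_def l_def)+
  moreover have "(\<Sum>k\<le>2::nat. Poly_Mapping.single (simplex_map 1 F (oriented_simplex 1 (m k))) ((- 1) ^ k)) =
      affine_simplex 1 F (m 0) - affine_simplex 1 F (m 1) + affine_simplex 1 F (m 2)"
    by (simp add: affine_simplex_def numeral_2_eq_2 single_uminus)
  moreover have "qboundary 2 (tri_chain F u v w) =
      (\<Sum>k\<le>2::nat. Poly_Mapping.single (simplex_map 1 F (oriented_simplex 1 (m k))) ((- 1) ^ k))"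
    unfolding tri_chain_def m_def l_def using qboundary_affine_simplex[of 2 F] by simp
  ultimately show ?thesis by simp
qed

lemma simplex_sum_bound:
  assumes x: "x \<in> standard_simplex p" and a: "\<And>j. j \<le> p \<Longrightarrow> \<bar>a j\<bar> \<le> B"
  shows "\<bar>\<Sum>j\<le>p. a j * x j\<bar> \<le> B"
proof -
  have x': "\<And>j. 0 \<le> x j" "(\<Sum>j\<le>p. x j) = 1" using x by (auto simp: standard_simplex_def)
  have "\<bar>\<Sum>j\<le>p. a j * x j\<bar> \<le> (\<Sum>j\<le>p. \<bar>a j * x j\<bar>)" by (rule sum_abs)
  also have "\<dots> \<le> (\<Sum>j\<le>p. B * x j)"
    by (rule sum_mono) (simp add: abs_mult x' mult_right_mono a)
  also have "\<dots> = B" by (simp add: sum_distrib_left[symmetric] x')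
  finally show ?thesis .
qed

text \<open>The octagon is cut out by bounds on absolute values of linear forms, which convex
  combinations preserve.\<close>

lemma octagon_convex:
  assumes x: "x \<in> standard_simplex p" and l: "\<And>j. j \<le> p \<Longrightarrow> l j \<in> octagon"
  shows "(\<lambda>i. \<Sum>j\<le>p. l j i * x j) \<in> octagon"
proof -
  have "\<bar>\<Sum>j\<le>p. l j 0 * x j\<bar> \<le> 2" "\<bar>\<Sum>j\<le>p. l j 1 * x j\<bar> \<le> 2"
    "\<bar>\<Sum>j\<le>p. (l j 0 + l j 1) * x j\<bar> \<le> 3" "\<bar>\<Sum>j\<le>p. (l j 0 - l j 1) * x j\<bar> \<le> 3"
    by (rule simplex_sum_bound[OF x]; use l in \<open>auto simp: octagon_def\<close>)+
  then show ?thesis unfolding octagon_def by (simp add: distrib_right left_diff_distrib sum.distrib sum_subtractf)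
qed

lemma singular_affine_simplex:
  assumes F: "continuous_map (top_of_set S) X F" and l: "\<And>x. x \<in> standard_simplex p \<Longrightarrow> (\<lambda>i. \<Sum>j\<le>p. l j i * x j) \<in> S"
  shows "qchain p X (affine_simplex p F l)"
proof -
  have "simplicial_simplex p S (oriented_simplex p l)"
    unfolding simplicial_simplex_oriented_simplex using l by blast
  then have "singular_simplex p (top_of_set S) (oriented_simplex p l)"
    using simplicial_imp_singular_simplex euclidean_product_topology by metis
  from singular_simplex_simplex_map[OF this F] show ?thesis by (simp add: affine_simplex_def)
qed

section \<open>The oblique sides\<close>

definition oblique :: "(nat \<Rightarrow> real) set" where
  "oblique = {v \<in> octagon. \<bar>v 0 + v 1\<bar> = 3 \<or> \<bar>v 0 - v 1\<bar> = 3}"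

text \<open>The phase for \<open>Eta\<close> is a complex number divided by its conjugate: it is -1
  where the real part \<open>side 5 v * side 6 v\<close> vanishes, and 1 where the imaginary part
  \<open>side 7 v * side 8 v\<close> does.\<close>

lemma oblique_zero:
  assumes v: "v \<in> oblique"
  shows "fst (oct_p v) = 0 \<or> snd (oct_p v) = 0" "fst (oct_q v) = 0 \<or> snd (oct_q v) = 0"
    "oct_omega Eta v = - 1 \<and> (fst (oct_w v) = 0 \<or> snd (oct_w v) = 0) \<or>
     oct_omega Eta v = 1 \<and> (fst (oct_u v) = 0 \<or> snd (oct_u v) = 0)"
proof -
  have o: "v \<in> octagon" and c: "\<bar>v 0 + v 1\<bar> = 3 \<or> \<bar>v 0 - v 1\<bar> = 3" using v by (auto simp: oblique_def)
  have "side 5 v = 0 \<or> side 6 v = 0 \<or> side 7 v = 0 \<or> side 8 v = 0"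
    using c by (auto simp: side_def abs_if split: if_splits)
  then have "side 5 v * side 6 v = 0 \<or> side 7 v * side 8 v = 0" by auto
  note s = this
  from s show "fst (oct_p v) = 0 \<or> snd (oct_p v) = 0" "fst (oct_q v) = 0 \<or> snd (oct_q v) = 0"
    by (auto simp: oct_p_def oct_q_def)
  note d = oct_omega_denom[OF o]
  from s show "oct_omega Eta v = - 1 \<and> (fst (oct_w v) = 0 \<or> snd (oct_w v) = 0) \<or>
     oct_omega Eta v = 1 \<and> (fst (oct_u v) = 0 \<or> snd (oct_u v) = 0)"
  proof
    assume z: "side 5 v * side 6 v = 0"
    have "Complex 0 (side 7 v * side 8 v) = - Complex 0 (- side 7 v * side 8 v)" by (simp add: complex_eq_iff)
    then have "oct_omega Eta v = - Complex 0 (- side 7 v * side 8 v) / Complex 0 (- side 7 v * side 8 v)"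
      by (simp only: oct_omega.simps z)
    then have "oct_omega Eta v = - 1" using d[unfolded z] by (simp only: minus_divide_left[symmetric] divide_self simp_thms)
    moreover have "fst (oct_w v) = 0 \<or> snd (oct_w v) = 0" using z by (auto simp: oct_w_def)
    ultimately show ?thesis by blast
  next
    assume z: "side 7 v * side 8 v = 0"
    then have z': "- side 7 v * side 8 v = 0" by simp
    have "oct_omega Eta v = Complex (side 5 v * side 6 v) 0 / Complex (side 5 v * side 6 v) 0"
      by (simp only: oct_omega.simps z z')
    then have "oct_omega Eta v = 1" using d[unfolded z'] by (simp only: divide_self simp_thms)
    moreover have "fst (oct_u v) = 0 \<or> snd (oct_u v) = 0" using z by (auto simp: oct_u_def)
    ultimately show ?thesis by blast
  qed
qed

text \<open>All ratios within a pair are 0 or infinite. If u can be finite, the phase is -1 for both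
  types. If w can be finite, z1+ / z2- is w divided by \<open>inv_sign c * \<omega>\<close>, which
  is -1 for both types.\<close>

lemma oblique_class_eq:
  assumes v: "v \<in> oblique"
  shows "oct_class Tau v = oct_class Eta v"
proof (rule oct_class_eqI)
  show o: "v \<in> octagon" "v \<in> octagon" using v by (simp_all add: oblique_def)
  fix l m :: label assume l: "l \<in> labels 2" and m: "fst m \<in> {1..2}"
  have "m \<in> labels 2" "fst m \<noteq> 0" using m by (auto simp: labels_def mem_Times_iff)
  then have m': "m \<in> {(1, True), (1, False), (2, True), (2, False)}" by (auto simp: labels_2)
  have l': "l \<in> {(0, True), (0, False), (1, True), (1, False), (2, True), (2, False)}"
    using l by (simp only: labels_2)
  note labs = prod.inject simp_thms if_True if_False fst_conv snd_conv num.distinct numeral_eq_iff zero_neq_one zero_neq_numeral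
    numeral_neq_zero numeral_eq_one_iff one_eq_numeral_iff inv_sign.simps
  have eq: "proj_pt (fst (ratio_hom Tau p q u w (- 1) l m)) (snd (ratio_hom Tau p q u w (- 1) l m)) =
      proj_pt (fst (ratio_hom Eta p q u w \<omega> l m)) (snd (ratio_hom Eta p q u w \<omega> l m))"
    if "fst p = 0 \<or> snd p = 0" "fst q = 0 \<or> snd q = 0"
      "\<omega> = - 1 \<and> (fst w = 0 \<or> snd w = 0) \<or> \<omega> = 1 \<and> (fst u = 0 \<or> snd u = 0)" for p q u w \<omega>
    using that(3)
  proof (elim disjE[of "\<omega> = - 1 \<and> _"] conjE)
    assume "\<omega> = - 1" and w: "fst w = 0 \<or> snd w = 0"
    show ?thesis
      using l' m' unfolding \<open>\<omega> = - 1\<close>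
      by (elim insertE emptyE; hypsubst; (simp only: ratio_hom_def labs)?; (use that(1,2) w in \<open>auto simp: proj_pt_def\<close>)?)
  next
    assume "\<omega> = 1" and u: "fst u = 0 \<or> snd u = 0"
    show ?thesis
      using l' m' unfolding \<open>\<omega> = 1\<close>
      by (elim insertE emptyE; hypsubst; (simp only: ratio_hom_def labs)?; (use that(1,2) u in \<open>auto simp: proj_pt_def\<close>)?)
  qed
  show "oct_ratio Tau v l m = oct_ratio Eta v l m"
    unfolding oct_ratio_hom(2)[OF o(1) l m] oct_hom_def oct_omega.simps(1)
    by (rule eq[OF oblique_zero[OF v]])
qed

text \<open>Nonzero P and Q keep pairs 1 and 2 off the central level 3, the only one the involution
  preserves.\<close>

lemma oblique_class_boundary:
  assumes v: "v \<in> oblique"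
  shows "oct_class c v \<in> RM_boundary (Of c) 2"
proof -
  have o: "v \<in> octagon" using v by (simp add: oblique_def)
  note w = oct_weights[OF o, of c]
  interpret chain c 6 "oct_levels v" "oct_num c v" 2 by (rule oct_chain[OF o])
  have "no_fixed_comp (oct_curve c v)"
  proof (rule no_fixed_comp)
    fix i :: nat assume i: "i \<in> {1..2}"
    define P Q U W where "P = dir_sign (fst (oct_p v)) (snd (oct_p v))" and "Q = dir_sign (fst (oct_q v)) (snd (oct_q v))"
      and "U = dir_sign (fst (oct_u v)) (snd (oct_u v))" and "W = dir_sign (fst (oct_w v)) (snd (oct_w v))"
    have "P \<noteq> 0" "Q \<noteq> 0" using pair_weights.sign_zero(1,2)[OF w] oblique_zero(1,2)[OF v] unfolding P_def Q_def by blast+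
    moreover have "sgn (P + W - U) = P" "sgn (Q + W + U) = Q"
      using pair_weights.level_signs(1,2)[OF w] unfolding P_def Q_def U_def W_def by blast+
    ultimately have n: "P + W - U \<noteq> 0" "Q + W + U \<noteq> 0" by auto
    have "int (oct_levels v i) = 3 + (if i = 1 then P + W - U else Q + W + U)"
      using pair_weights.levels_le(2)[OF w, of i] unfolding oct_levels_def P_def Q_def U_def W_def .
    then show "2 * oct_levels v i \<noteq> 6" using n by (auto split: if_splits)
  qed
  then show ?thesis
    unfolding RM_boundary.simps oct_class_def iso_class_def using real by (intro quotientI) simp
qed

section \<open>The cycles\<close>

text \<open>The minus sign is that of \<open>fund_chain\<close>: in the glued space the
  \<open>Eta\<close> part carries the opposite orientation.\<close>

definition signed_chain :: "rmoduli \<Rightarrow> (invol \<Rightarrow> 'a qchain) \<Rightarrow> 'a qchain" where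
  "signed_chain R K = (case R of Of c \<Rightarrow> K c | Glued \<Rightarrow> K Tau - K Eta)"

lemma signed_chain_qchain: "(\<And>c. c \<in> invols R \<Longrightarrow> qchain p X (K c)) \<Longrightarrow> qchain p X (signed_chain R K)"
  by (cases R) (auto simp: signed_chain_def invols_def intro: qchain_diff)

lemma signed_chain_boundary: "qboundary p (signed_chain R K) = signed_chain R (\<lambda>c. qboundary p (K c))"
  by (cases R) (simp_all add: signed_chain_def qboundary_diff)

definition oct_edge :: "rmoduli \<Rightarrow> (nat \<Rightarrow> real) \<Rightarrow> (nat \<Rightarrow> real) \<Rightarrow> rcurve set qchain" where
  "oct_edge R u v = signed_chain R (\<lambda>c. edge_chain (oct_class c) u v)"

abbreviation null :: "rmoduli \<Rightarrow> rcurve set qchain \<Rightarrow> bool" where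
  "null R \<equiv> qrelboundary 1 (RM R 2) (RM_boundary R 2)"

lemma oct_edge_qchain: "u \<in> octagon \<Longrightarrow> v \<in> octagon \<Longrightarrow> qchain 1 (RM R 2) (oct_edge R u v)"
  unfolding oct_edge_def edge_chain_def
  by (rule signed_chain_qchain, rule singular_affine_simplex[OF continuous_oct_class octagon_convex]) auto

lemma null_triangle:
  assumes "u \<in> octagon" "v \<in> octagon" "w \<in> octagon"
  shows "null R (oct_edge R v w - oct_edge R u w + oct_edge R u v)"
proof -
  let ?d = "signed_chain R (\<lambda>c. tri_chain (oct_class c) u v w)"
  have "qchain 2 (RM R 2) ?d"
    unfolding tri_chain_def
    by (rule signed_chain_qchain, rule singular_affine_simplex[OF continuous_oct_class octagon_convex]) (use assms in auto)
  then have "null R (qboundary 2 ?d)" using qrelboundary_boundary[of 1 "RM R 2" ?d "RM_boundary R 2"] by (simp add: numeral_2_eq_2)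
  moreover have "qboundary 2 ?d = oct_edge R v w - oct_edge R u w + oct_edge R u v"
    unfolding signed_chain_boundary qboundary_tri_chain oct_edge_def by (cases R) (simp_all add: signed_chain_def)
  ultimately show ?thesis by simp
qed

text \<open>There are two different reasons: for a single type the simplex lies in the boundary, and
  in the glued space, whose boundary is empty, the \<open>Tau\<close> and \<open>Eta\<close>
  simplices coincide and cancel.\<close>

lemma null_oblique:
  assumes seg: "\<And>x. x \<in> standard_simplex 1 \<Longrightarrow> (\<lambda>i. \<Sum>j\<le>1. (if j = (0::nat) then u else v) i * x j) \<in> oblique"
  shows "null R (oct_edge R u v)"
proof (cases R)
  case (Of c)
  have "continuous_map (top_of_set oblique) (RM R 2) (oct_class c)"
    using continuous_map_from_subtopology_mono[OF continuous_oct_class[of c R]] Of by (auto simp: invols_def oblique_def)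
  moreover have "oct_class c ` oblique \<subseteq> RM_boundary R 2" using oblique_class_boundary Of by blast
  ultimately have "continuous_map (top_of_set oblique) (subtopology (RM R 2) (RM_boundary R 2)) (oct_class c)"
    by (auto simp: continuous_map_in_subtopology)
  from singular_affine_simplex[OF this seg] show ?thesis
    using Of by (intro qrelboundary_subspace) (simp add: oct_edge_def signed_chain_def edge_chain_def)
next
  case Glued
  have "simplex_map 1 (oct_class Tau) (oriented_simplex 1 (\<lambda>j. if j = 0 then u else v)) =
      simplex_map 1 (oct_class Eta) (oriented_simplex 1 (\<lambda>j. if j = 0 then u else v))"
    unfolding simplex_map_def oriented_simplex_def using oblique_class_eq[OF seg] by (intro restrict_ext) simp
  then show ?thesis using Glued qrelboundary_0 by (simp add: oct_edge_def signed_chain_def edge_chain_def affine_simplex_def)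
qed

lemma oct_edge_relcycle:
  assumes "u \<in> oblique" "v \<in> oblique"
  shows "qrelcycle 1 (RM R 2) (RM_boundary R 2) (oct_edge R u v)"
proof -
  have o: "u \<in> octagon" "v \<in> octagon" using assms by (simp_all add: oblique_def)
  have "qchain 0 (subtopology (RM R 2) (RM_boundary R 2)) (qboundary 1 (oct_edge R u v))"
  proof (cases R)
    case (Of c)
    have "qchain 0 (subtopology (RM R 2) (RM_boundary R 2)) (point_chain (oct_class c v))" if v: "v \<in> oblique" for v
    proof -
      have "oct_class c v \<in> RM_set R 2" using v Of by (intro oct_class_in_RM) (simp_all add: oblique_def invols_def)
      moreover have "oct_class c v \<in> RM_boundary R 2" using oblique_class_boundary[OF v] Of by simp
      ultimately show ?thesis
        by (auto simp: point_chain_def singular_simplex_subtopology singular_simplex_def)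
    qed
    then show ?thesis using assms Of
      by (simp add: oct_edge_def signed_chain_def qboundary_edge_chain[unfolded One_nat_def] qchain_diff)
  next
    case Glued
    then show ?thesis
      using oblique_class_eq[OF assms(1)] oblique_class_eq[OF assms(2)]
      by (simp add: oct_edge_def signed_chain_def qboundary_diff qboundary_edge_chain[unfolded One_nat_def])
  qed
  then show ?thesis using oct_edge_qchain[OF o] by (simp add: qrelcycle_def)
qed

text \<open>The two chains are equal, not merely homologous, because the side functions were chosen
  so that the affine parameter of a side is the parameter of the fundamental simplex.\<close>

lemma Gam_cycle_eq:
  assumes i: "i \<in> {1, 2}"
  shows "Gam_cycle R i s = (if s then oct_edge R (edge_pt i s 0) (edge_pt i s 1) else - oct_edge R (edge_pt i s 0) (edge_pt i s 1))"
proof -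
  have sm: "simplex_map 1 (inv_into (Gam R i s) (record_real i)) (fund_simplex c) =
      simplex_map 1 (oct_class c) (oriented_simplex 1 (\<lambda>j. if j = 0 then edge_pt i s 0 else edge_pt i s 1))" if c: "c \<in> invols R" for c
    unfolding simplex_map_def
  proof (rule restrict_ext)
    fix x :: "nat \<Rightarrow> real" assume x: "x \<in> standard_simplex 1"
    then have t: "x 1 \<in> {0..1}" "x 0 = 1 - x 1" unfolding standard_simplex_def by auto
    have "oriented_simplex 1 (\<lambda>j. if j = 0 then edge_pt i s 0 else edge_pt i s 1) x = edge_pt i s (x 1)"
      using x t(2) by (auto simp: oriented_simplex_def edge_pt_def fun_eq_iff algebra_simps)
    then show "(inv_into (Gam R i s) (record_real i) \<circ> fund_simplex c) x =
        (oct_class c \<circ> oriented_simplex 1 (\<lambda>j. if j = 0 then edge_pt i s 0 else edge_pt i s 1)) x"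
      using inv_record_real[OF i t(1) c, of s] fund_simplex_eq[OF x] by (simp add: edge_class_def)
  qed
  have "qchain_map 1 (inv_into (Gam R i s) (record_real i)) (fund_chain R) = oct_edge R (edge_pt i s 0) (edge_pt i s 1)"
  proof (cases R)
    case (Of c)
    then show ?thesis using sm[of c]
      by (simp add: qchain_map_single oct_edge_def signed_chain_def edge_chain_def affine_simplex_def invols_def)
  next
    case Glued
    then show ?thesis using sm[of Tau] sm[of Eta]
      by (simp add: qchain_map_diff qchain_map_single oct_edge_def signed_chain_def edge_chain_def affine_simplex_def invols_def)
  qed
  then show ?thesis by (simp add: Gam_cycle_def Let_def)
qed

lemma edge_ends_oblique: "i \<in> {1, 2} \<Longrightarrow> t \<in> {0, 1} \<Longrightarrow> edge_pt i s t \<in> oblique"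
  unfolding oblique_def octagon_def edge_pt_def by auto

lemma oblique_segments:
  assumes x: "x \<in> standard_simplex 1"
    and uv: "(u, v) \<in> {(edge_pt 2 True 1, edge_pt 1 False 0), (edge_pt 1 False 1, edge_pt 2 False 1),
      (edge_pt 2 False 0, edge_pt 1 True 1), (edge_pt 1 True 0, edge_pt 2 True 0)}"
  shows "(\<lambda>i. \<Sum>j\<le>1. (if j = (0::nat) then u else v) i * x j) \<in> oblique"
proof -
  have "u \<in> octagon" "v \<in> octagon" using uv edge_pt_in_octagon by auto
  then have "(\<lambda>i. \<Sum>j\<le>1. (if j = (0::nat) then u else v) i * x j) \<in> octagon" by (intro octagon_convex[OF x]) auto
  moreover have "x 0 = 1 - x 1" using x unfolding standard_simplex_def by auto
  then have "\<bar>(\<Sum>j\<le>1. (if j = (0::nat) then u else v) 0 * x j) + (\<Sum>j\<le>1. (if j = (0::nat) then u else v) 1 * x j)\<bar> = 3 \<or>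
      \<bar>(\<Sum>j\<le>1. (if j = (0::nat) then u else v) 0 * x j) - (\<Sum>j\<le>1. (if j = (0::nat) then u else v) 1 * x j)\<bar> = 3"
    using uv by (auto simp: edge_pt_def algebra_simps)
  ultimately show ?thesis unfolding oblique_def by blast
qed

lemma octagon_relation:
  "null R ((oct_edge R (edge_pt 1 True 0) (edge_pt 1 True 1) - oct_edge R (edge_pt 1 False 0) (edge_pt 1 False 1)) -
    (oct_edge R (edge_pt 2 True 0) (edge_pt 2 True 1) - oct_edge R (edge_pt 2 False 0) (edge_pt 2 False 1)))"
proof -
  \<comment> \<open>The vertices in counterclockwise order. The boundary traverses the lower and the
    right side with increasing \<tau>, but the upper and the left side with decreasing \<tau>; up to
    a global sign this is the reversal built into the barred cycles.\<close>
  define a1 a2 a3 a4 a5 a6 a7 a8 where "a1 = edge_pt 2 True 0" and "a2 = edge_pt 2 True 1" and "a3 = edge_pt 1 False 0"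
    and "a4 = edge_pt 1 False 1" and "a5 = edge_pt 2 False 1" and "a6 = edge_pt 2 False 0" and "a7 = edge_pt 1 True 1"
    and "a8 = edge_pt 1 True 0"
  note a = a1_def a2_def a3_def a4_def a5_def a6_def a7_def a8_def
  let ?E = "oct_edge R"
  have o: "a1 \<in> octagon" "a2 \<in> octagon" "a3 \<in> octagon" "a4 \<in> octagon" "a5 \<in> octagon" "a6 \<in> octagon" "a7 \<in> octagon" "a8 \<in> octagon"
    unfolding a by (rule edge_pt_in_octagon; simp)+
  have ob: "null R (?E a2 a3)" "null R (?E a4 a5)" "null R (?E a6 a7)" "null R (?E a8 a1)"
    by (rule null_oblique, rule oblique_segments, assumption, simp add: a)+
  have self: "null R (?E u u)" if "u \<in> octagon" for u using null_triangle[OF that that that, of R] by simp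
  \<comment> \<open>The degenerate triangle u, v, u; its middle edge is constant and null by
    \<open>self\<close>.\<close>
  have rev: "null R (?E u v + ?E v u)" if "u \<in> octagon" "v \<in> octagon" for u v
    using qrelboundary_add[OF null_triangle[OF that that(1), of R] self[OF that(1)]] by (simp add: add.commute)
  note tri = null_triangle[OF o(1), of _ _ R]
  \<comment> \<open>The six triangles of the fan from a1, with the diagonals cancelling. The
    correction terms close the fan at a8, reverse the upper and the left side, and remove the
    oblique sides.\<close>
  have fan: "null R ((((((((((?E a2 a3 - ?E a1 a3 + ?E a1 a2) + (?E a3 a4 - ?E a1 a4 + ?E a1 a3)) + (?E a4 a5 - ?E a1 a5 + ?E a1 a4)) +
      (?E a5 a6 - ?E a1 a6 + ?E a1 a5)) + (?E a6 a7 - ?E a1 a7 + ?E a1 a6)) + (?E a7 a8 - ?E a1 a8 + ?E a1 a7)) +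
      (?E a8 a1 + ?E a1 a8)) - (?E a5 a6 + ?E a6 a5)) - (?E a7 a8 + ?E a8 a7)) - (((?E a2 a3 + ?E a4 a5) + ?E a6 a7) + ?E a8 a1))"
    by (intro qrelboundary_diff qrelboundary_add tri rev ob o)
  have "null R (?E a1 a2 + ?E a3 a4 - ?E a6 a5 - ?E a8 a7)"
    using fan by (simp add: algebra_simps)
  from qrelboundary_uminus[OF this] show ?thesis unfolding a by (simp add: algebra_simps)
qed

theorem proposition3p3:
  fixes R :: rmoduli
  shows "(\<forall>i\<in>{1, 2}. \<forall>s. qrelcycle 1 (RM R 2) (RM_boundary R 2) (Gam_cycle R i s)) \<and>
    Gam_class R 1 True \<otimes>\<^bsub>qhomology_group 1 (RM R 2) (RM_boundary R 2)\<^esub> Gam_class R 1 False =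
    Gam_class R 2 True \<otimes>\<^bsub>qhomology_group 1 (RM R 2) (RM_boundary R 2)\<^esub> Gam_class R 2 False"
proof (intro conjI ballI allI)
  fix i :: nat and s :: bool assume i: "i \<in> {1, 2}"
  have "qrelcycle 1 (RM R 2) (RM_boundary R 2) (oct_edge R (edge_pt i s 0) (edge_pt i s 1))"
    by (rule oct_edge_relcycle; rule edge_ends_oblique[OF i]) simp_all
  then show "qrelcycle 1 (RM R 2) (RM_boundary R 2) (Gam_cycle R i s)"
    unfolding Gam_cycle_eq[OF i] by (cases s) (simp_all add: qrelcycle_uminus del: One_nat_def)
next
  have "null R (Gam_cycle R 1 True + Gam_cycle R 1 False - (Gam_cycle R 2 True + Gam_cycle R 2 False))"
    using octagon_relation[of R] by (simp add: Gam_cycle_eq del: One_nat_def)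
  from qhomology_class_eqI[OF this]
  show "Gam_class R 1 True \<otimes>\<^bsub>qhomology_group 1 (RM R 2) (RM_boundary R 2)\<^esub> Gam_class R 1 False =
    Gam_class R 2 True \<otimes>\<^bsub>qhomology_group 1 (RM R 2) (RM_boundary R 2)\<^esub> Gam_class R 2 False"
    unfolding Gam_class_def qhomology_class_add .
qed

end
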